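(* Let $Q$ be a quiver, $\underline f\in\mathbb{Z}_{\ge0}^{Q_0}$, and $\underline d^{(0)},\ldots,\underline d^{(\ell)}\in\mathbb{Z}_{\ge0}^{Q_0}$ a sequence of dimension vectors with $\underline d^{(0)}=\underline d$ and $\underline d^{(0)}-\underline d^{(\ell)}=\underline k$. Then the space $\mathcal{M}_Q(\underline d^{(0)},\ldots,\underline d^{(\ell)};\underline f)$ is either empty or it is a smooth variety of dimension $$\dim\mathcal{M}_Q(\underline d;\underline f)-\underline f^T\underline k+\underline d^T\mathbf{C}\underline k-\sum_{v\in Q_0}\ \sum_{1\le m_1\le m_2\le\ell}\left(d_v^{(m_1)}-d_v^{(m_1-1)}\right)\left(d_v^{(m_2)}-d_v^{(m_2-1)}\right).$$
   Context: Everything is over $\mathbb{C}$. $Q=(Q_0,Q_1,\mathrm{out},\mathrm{in})$ is a quiver (loops and multiple arrows allowed); an arrow $e\in Q_1$ goes from $\mathrm{out}(e)$ to $\mathrm{in}(e)$; $Q_1(v,w)$ is the set of arrows from $v$ to $w$. The Cartan matrix $\mathbf{C}=(\mathbf{C}_{v,w})_{v,w\in Q_0}$ is $\mathbf{C}_{v,w}=2\delta_{vw}-|Q_1(v,w)|-|Q_1(w,v)|$. Vectors are column vectors. Given $\underline{d},\underline{f}\in\mathbb{Z}_{\ge0}^{Q_0}$, fix vector spaces $D_v,F_v$ with $\dim D_v=d_v$, $\dim F_v=f_v$. A representation of the double framed quiver with dimension vector $\underline d$ and framing vector $\underline f$ is a tuple $(A_e,B_e,i_v,j_v)$ with $A_e:D_{\mathrm{out}(e)}\to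 D_{\mathrm{in}(e)}$, $B_e:D_{\mathrm{in}(e)}\to D_{\mathrm{out}(e)}$, $i_v:F_v\to D_v$, $j_v:D_v\to F_v$ linear. Moment map equations: for all $v$, $\sum_{\mathrm{in}(e)=v}A_eB_e-\sum_{\mathrm{out}(e)=v}B_eA_e+i_vj_v=0$. Stability: the only collection of subspaces $D'_v\subseteq D_v$ with $i_v(F_v)\subseteq D'_v$ for all $v$ and preserved by all $A_e,B_e$ is $D'_v=D_v$. The group $G_{\underline d}=\prod_v\mathrm{GL}(D_v)$ acts by $g\cdot(A,B,i,j)=(g_{\mathrm{in}(e)}A_eg_{\mathrm{out}(e)}^{-1},g_{\mathrm{out}(e)}B_eg_{\mathrm{in}(e)}^{-1},g_vi_v,j_vg_v^{-1})$. The Nakajima quiver variety $\mathcal{M}_Q(\underline d;\underline f)$ is the quotient by $G_{\underline d}$ of the set of stable tuples satisfying the moment map equations; if nonempty it is smooth of dimension $2\underline f^T\underline d-\underline d^T\mathbf{C}\underline d$. Split parabolic quiver variety: let $\mathcal{P}_Q(\underline{d}^{(0)},\ldots,\underline{d}^{(\ell)};\underline f)$ be the variety of tuples $(A^{(m)},B^{(m)},i^{(m)},j^{(m)})_{0\le m\le\ell}$, $(\pi^{(m)}_v)_{0\le m\le \ell-1,\,v\in Q_0}$ such that: (1) for each $m$, $(A^{(m)},B^{(m)},i^{(m)},j^{(m)})$ is a stable representation on spaces $D^{(m)}_v$ of dimension $d^{(m)}_v$, with the same framing spaces $F_v$ for all $m$, satisfying the moment map equations; (2) $\pi_v^{(m)}:D_v^{(m)}\to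 D_v^{(m+1)}$ are linear maps with $\pi^{(m)}A^{(m)}_e=A^{(m+1)}_e\pi^{(m)}$, $\pi^{(m)}B^{(m)}_e=B^{(m+1)}_e\pi^{(m)}$ (at the relevant vertices), $\pi^{(m)}_vi^{(m)}_v=i^{(m+1)}_v$, $j_v^{(m+1)}\pi_v^{(m)}=j_v^{(m)}$; (3) for $K_v:=\ker(\pi_v^{(\ell-1)}\circ\cdots\circ\pi_v^{(0)})$, all $A^{(0)}_e$ (with $\mathrm{out}(e)=v$), $B_e^{(0)}$ (with $\mathrm{in}(e)=v$) and $j^{(0)}_v$ vanish on $K_v$, for every $v$. (Stability forces all $\pi^{(m)}_v$ to be surjective.) The group $G=\prod_{m=0}^{\ell}G_{\underline d^{(m)}}$ acts freely, with $\pi_v^{(m)}\mapsto g_{m+1,v}\pi^{(m)}_vg_{m,v}^{-1}$, and $\mathcal{M}_Q(\underline{d}^{(0)},\ldots,\underline{d}^{(\ell)};\underline f):=\mathcal{P}_Q/G$. *)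

theory Defs
  imports
    "HOL-Analysis.Derivative"
    "HOL-Analysis.Function_Topology"
    "HOL-Algebra.Group_Action"
    "HOL-Algebra.Product_Groups"
    "Graph_Theory.Digraph"
    "Jordan_Normal_Form.DL_Rank"
    "Jordan_Normal_Form.Matrix_Kernel"
begin

section \<open>Complex varieties as spaces with functions\<close>

text \<open>
  Varieties over the complex numbers are treated classically: a topological space together with,
  for each open set, the set of regular complex-valued functions on it. Functions are total in HOL;
  only their values on the open set in question matter.
\<close>

record 'a fun_space =
  fs_top :: "'a topology"
  fs_reg :: "'a set \<Rightarrow> ('a \<Rightarrow> complex) set"

definition fs_restrict :: "'a fun_space \<Rightarrow> 'a set \<Rightarrow> 'a fun_space" where
  "fs_restrict X U = \<lparr> fs_top = subtopology (fs_top X) U, fs_reg = fs_reg X \<rparr>"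

definition fs_morphism :: "'a fun_space \<Rightarrow> 'b fun_space \<Rightarrow> ('a \<Rightarrow> 'b) \<Rightarrow> bool" where
  "fs_morphism X Y \<phi> \<longleftrightarrow>
     continuous_map (fs_top X) (fs_top Y) \<phi> \<and>
     (\<forall>U h. openin (fs_top Y) U \<and> h \<in> fs_reg Y U \<longrightarrow>
        h \<circ> \<phi> \<in> fs_reg X {x \<in> topspace (fs_top X). \<phi> x \<in> U})"

definition fs_isomorphic :: "'a fun_space \<Rightarrow> 'b fun_space \<Rightarrow> bool" where
  "fs_isomorphic X Y \<longleftrightarrow>
     (\<exists>\<phi> \<psi>. fs_morphism X Y \<phi> \<and> fs_morphism Y X \<psi> \<and>
        (\<forall>x \<in> topspace (fs_top X). \<psi> (\<phi> x) = x) \<and>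
        (\<forall>y \<in> topspace (fs_top Y). \<phi> (\<psi> y) = y))"

inductive_set poly_funs :: "('a \<Rightarrow> complex) set \<Rightarrow> ('a \<Rightarrow> complex) set"
  for \<Phi> :: "('a \<Rightarrow> complex) set" where
  const: "(\<lambda>_. c) \<in> poly_funs \<Phi>"
| coord: "\<phi> \<in> \<Phi> \<Longrightarrow> \<phi> \<in> poly_funs \<Phi>"
| add: "p \<in> poly_funs \<Phi> \<Longrightarrow> q \<in> poly_funs \<Phi> \<Longrightarrow> (\<lambda>x. p x + q x) \<in> poly_funs \<Phi>"
| mult: "p \<in> poly_funs \<Phi> \<Longrightarrow> q \<in> poly_funs \<Phi> \<Longrightarrow> (\<lambda>x. p x * q x) \<in> poly_funs \<Phi>"

text \<open>
  If \<open>\<Phi>\<close> is a finite set of functions separating the points of \<open>X\<close>, it embeds \<open>X\<close> into an affine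
  space. When the image is locally closed, the following is the reduced quasi-affine variety \<open>X\<close>:
  the induced Zariski topology, and as regular functions those which are locally quotients of
  polynomials in the coordinates \<open>\<Phi>\<close>.
\<close>

definition zariski_topology :: "'a set \<Rightarrow> ('a \<Rightarrow> complex) set \<Rightarrow> 'a topology" where
  "zariski_topology X \<Phi> = topology_generated_by {{x \<in> X. p x \<noteq> 0} | p. p \<in> poly_funs \<Phi>}"

definition zariski_space :: "'a set \<Rightarrow> ('a \<Rightarrow> complex) set \<Rightarrow> 'a fun_space" where
  "zariski_space X \<Phi> =
     \<lparr> fs_top = zariski_topology X \<Phi>,
       fs_reg = (\<lambda>U. {h. \<forall>x \<in> U. \<exists>V p q. openin (zariski_topology X \<Phi>) V \<and> x \<in> V \<and> V \<subseteq> U \<and>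
          p \<in> poly_funs \<Phi> \<and> q \<in> poly_funs \<Phi> \<and> (\<forall>y \<in> V. q y \<noteq> 0 \<and> h y = p y / q y)}) \<rparr>"

definition vec_coords :: "nat \<Rightarrow> (complex vec \<Rightarrow> complex) set" where
  "vec_coords N = (\<lambda>i x. vec_index x i) ` {..<N}"

definition zero_locus :: "nat \<Rightarrow> (complex vec \<Rightarrow> complex) set \<Rightarrow> complex vec set" where
  "zero_locus N P = {x \<in> carrier_vec N. \<forall>p \<in> P. p x = 0}"

definition affine_closed_space :: "nat \<Rightarrow> (complex vec \<Rightarrow> complex) set \<Rightarrow> complex vec fun_space" where
  "affine_closed_space N P = zariski_space (zero_locus N P) (vec_coords N)"

definition affine_variety :: "'a fun_space \<Rightarrow> bool" where
  "affine_variety X \<longleftrightarrow>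
     (\<exists>N P. P \<subseteq> poly_funs (vec_coords N) \<and> fs_isomorphic X (affine_closed_space N P))"

text \<open>Separatedness: two morphisms from an affine variety agree on a closed set.\<close>

definition separated :: "'a fun_space \<Rightarrow> bool" where
  "separated X \<longleftrightarrow>
     (\<forall>N P \<phi> \<psi>. P \<subseteq> poly_funs (vec_coords N) \<and>
        fs_morphism (affine_closed_space N P) X \<phi> \<and> fs_morphism (affine_closed_space N P) X \<psi> \<longrightarrow>
        closedin (fs_top (affine_closed_space N P)) {z \<in> zero_locus N P. \<phi> z = \<psi> z})"

text \<open>Varieties are not required to be irreducible or connected.\<close>

definition variety :: "'a fun_space \<Rightarrow> bool" where
  "variety X \<longleftrightarrow>
     (\<exists>\<U>. finite \<U> \<and> \<Union>\<U> = topspace (fs_top X) \<and>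
        (\<forall>U \<in> \<U>. openin (fs_top X) U \<and> affine_variety (fs_restrict X U))) \<and>
     separated X"

definition jacobian :: "nat \<Rightarrow> (complex vec \<Rightarrow> complex) list \<Rightarrow> complex vec \<Rightarrow> complex mat" where
  "jacobian N ps x =
     mat (length ps) N (\<lambda>(r, i). deriv (\<lambda>t. (ps ! r) (x + t \<cdot>\<^sub>v unit_vec N i)) 0)"

text \<open>
  Smoothness of (pure) dimension \<open>n\<close> is smoothness of relative dimension \<open>n\<close> over the base field:
  every point has an open neighbourhood isomorphic to an open subset \<open>W\<close> of the zero locus of \<open>c\<close>
  polynomials in \<open>n + c\<close> variables whose Jacobian matrix has rank \<open>c\<close> everywhere on \<open>W\<close>.
\<close>

definition smooth_of_dim :: "nat \<Rightarrow> 'a fun_space \<Rightarrow> bool" where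
  "smooth_of_dim n X \<longleftrightarrow>
     (\<forall>x \<in> topspace (fs_top X). \<exists>U ps W.
        openin (fs_top X) U \<and> x \<in> U \<and>
        set ps \<subseteq> poly_funs (vec_coords (n + length ps)) \<and>
        openin (fs_top (affine_closed_space (n + length ps) (set ps))) W \<and>
        (\<forall>w \<in> W. vec_space.rank (length ps) (jacobian (n + length ps) ps w) = length ps) \<and>
        fs_isomorphic (fs_restrict X U)
          (fs_restrict (affine_closed_space (n + length ps) (set ps)) W))"

definition smooth_variety_of_dim :: "nat \<Rightarrow> 'a fun_space \<Rightarrow> bool" where
  "smooth_variety_of_dim n X \<longleftrightarrow> variety X \<and> smooth_of_dim n X"

text \<open>Only meaningful for nonempty smooth varieties of pure dimension.\<close>

definition smooth_variety_dim :: "'a fun_space \<Rightarrow> nat" where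
  "smooth_variety_dim X = (THE n. smooth_variety_of_dim n X)"

text \<open>
  The geometric quotient by a group action preserving the point set of \<open>X\<close>: the set of orbits with
  the quotient topology, where a function is regular iff its pullback to \<open>X\<close> is.
\<close>

definition quotient_preimage ::
  "('g, 'm) monoid_scheme \<Rightarrow> ('g \<Rightarrow> 'a \<Rightarrow> 'a) \<Rightarrow> 'a fun_space \<Rightarrow> 'a set set \<Rightarrow> 'a set" where
  "quotient_preimage G act X U = {x \<in> topspace (fs_top X). orbit G act x \<in> U}"

definition quotient_topology ::
  "('g, 'm) monoid_scheme \<Rightarrow> ('g \<Rightarrow> 'a \<Rightarrow> 'a) \<Rightarrow> 'a fun_space \<Rightarrow> 'a set topology" where
  "quotient_topology G act X =
     topology (\<lambda>U. U \<subseteq> orbits G (topspace (fs_top X)) act \<and>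
                   openin (fs_top X) (quotient_preimage G act X U))"

definition quotient_space ::
  "('g, 'm) monoid_scheme \<Rightarrow> ('g \<Rightarrow> 'a \<Rightarrow> 'a) \<Rightarrow> 'a fun_space \<Rightarrow> 'a set fun_space" where
  "quotient_space G act X =
     \<lparr> fs_top = quotient_topology G act X,
       fs_reg = (\<lambda>U. {h. (\<lambda>x. h (orbit G act x)) \<in> fs_reg X (quotient_preimage G act X U)}) \<rparr>"

lemma openin_quotient_topology:
  "openin (quotient_topology G act X) U \<longleftrightarrow>
     U \<subseteq> orbits G (topspace (fs_top X)) act \<and> openin (fs_top X) (quotient_preimage G act X U)"
proof -
  have int: "quotient_preimage G act X (S \<inter> T) =
      quotient_preimage G act X S \<inter> quotient_preimage G act X T" for S T
    unfolding quotient_preimage_def by blast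
  have un: "quotient_preimage G act X (\<Union>\<K>) = (\<Union>K \<in> \<K>. quotient_preimage G act X K)" for \<K>
    unfolding quotient_preimage_def by blast
  have "istopology (\<lambda>U. U \<subseteq> orbits G (topspace (fs_top X)) act \<and>
      openin (fs_top X) (quotient_preimage G act X U))"
    unfolding istopology_def int un by blast
  then show ?thesis
    by (simp add: quotient_topology_def topology_inverse')
qed

lemma topspace_quotient_topology:
  "topspace (quotient_topology G act X) = orbits G (topspace (fs_top X)) act"
proof (rule subset_antisym)
  have "quotient_preimage G act X (orbits G (topspace (fs_top X)) act) = topspace (fs_top X)"
    unfolding quotient_preimage_def orbits_def by blast
  then have "openin (quotient_topology G act X) (orbits G (topspace (fs_top X)) act)"
    unfolding openin_quotient_topology by simp
  then show "orbits G (topspace (fs_top X)) act \<subseteq> topspace (quotient_topology G act X)"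
    by (rule openin_subset)
  show "topspace (quotient_topology G act X) \<subseteq> orbits G (topspace (fs_top X)) act"
    using openin_topspace[of "quotient_topology G act X"]
    unfolding openin_quotient_topology by (rule conjunct1)
qed

lemma topspace_zariski_space: "topspace (fs_top (zariski_space X \<Phi>)) = X"
proof -
  have "X \<in> {{x \<in> X. p x \<noteq> 0} | p. p \<in> poly_funs \<Phi>}"
    by (rule CollectI, rule exI[of _ "\<lambda>_. 1"]) (simp add: poly_funs.const)
  then have "\<Union>{{x \<in> X. p x \<noteq> 0} | p. p \<in> poly_funs \<Phi>} = X"
    by (intro subset_antisym Union_upper Union_least) auto
  then show ?thesis
    by (simp add: zariski_space_def zariski_topology_def)
qed


section \<open>Quivers and representations of the double framed quiver\<close>

text \<open>
  A quiver is a \<open>pre_digraph\<close>: \<open>tail\<close> and \<open>head\<close> are the maps out and in; loops and parallel arcs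
  are allowed. The spaces \<open>D\<^sub>v\<close> and \<open>F\<^sub>v\<close> are the coordinate spaces of column vectors.
\<close>

definition cartan :: "('v, 'e) pre_digraph \<Rightarrow> 'v \<Rightarrow> 'v \<Rightarrow> int" where
  "cartan Q v w = (if v = w then 2 else 0)
     - int (card {e \<in> arcs Q. tail Q e = v \<and> head Q e = w})
     - int (card {e \<in> arcs Q. tail Q e = w \<and> head Q e = v})"

record ('v, 'e) qrep =
  Amap :: "'e \<Rightarrow> complex mat"
  Bmap :: "'e \<Rightarrow> complex mat"
  imap :: "'v \<Rightarrow> complex mat"
  jmap :: "'v \<Rightarrow> complex mat"

definition qreps ::
  "('v, 'e) pre_digraph \<Rightarrow> ('v \<Rightarrow> nat) \<Rightarrow> ('v \<Rightarrow> nat) \<Rightarrow> ('v, 'e) qrep set" where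
  "qreps Q d f = {x.
     Amap x \<in> (\<Pi>\<^sub>E e \<in> arcs Q. carrier_mat (d (head Q e)) (d (tail Q e))) \<and>
     Bmap x \<in> (\<Pi>\<^sub>E e \<in> arcs Q. carrier_mat (d (tail Q e)) (d (head Q e))) \<and>
     imap x \<in> (\<Pi>\<^sub>E v \<in> verts Q. carrier_mat (d v) (f v)) \<and>
     jmap x \<in> (\<Pi>\<^sub>E v \<in> verts Q. carrier_mat (f v) (d v))}"

definition moment_map_eqs :: "('v, 'e) pre_digraph \<Rightarrow> ('v \<Rightarrow> nat) \<Rightarrow> ('v, 'e) qrep \<Rightarrow> bool" where
  "moment_map_eqs Q d x \<longleftrightarrow> (\<forall>v \<in> verts Q. \<forall>r < d v. \<forall>c < d v.
     (\<Sum>e | e \<in> arcs Q \<and> head Q e = v. (Amap x e * Bmap x e) $$ (r, c))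
     - (\<Sum>e | e \<in> arcs Q \<and> tail Q e = v. (Bmap x e * Amap x e) $$ (r, c))
     + (imap x v * jmap x v) $$ (r, c) = 0)"

definition stable ::
  "('v, 'e) pre_digraph \<Rightarrow> ('v \<Rightarrow> nat) \<Rightarrow> ('v \<Rightarrow> nat) \<Rightarrow> ('v, 'e) qrep \<Rightarrow> bool" where
  "stable Q d f x \<longleftrightarrow> (\<forall>S.
     (\<forall>v \<in> verts Q. VectorSpace.subspace class_ring (S v) (module_vec TYPE(complex) (d v)) \<and>
        (\<forall>u \<in> carrier_vec (f v). imap x v *\<^sub>v u \<in> S v)) \<and>
     (\<forall>e \<in> arcs Q. (\<forall>u \<in> S (tail Q e). Amap x e *\<^sub>v u \<in> S (head Q e)) \<and>
        (\<forall>u \<in> S (head Q e). Bmap x e *\<^sub>v u \<in> S (tail Q e)))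
     \<longrightarrow> (\<forall>v \<in> verts Q. S v = carrier_vec (d v)))"

definition stable_qreps ::
  "('v, 'e) pre_digraph \<Rightarrow> ('v \<Rightarrow> nat) \<Rightarrow> ('v \<Rightarrow> nat) \<Rightarrow> ('v, 'e) qrep set" where
  "stable_qreps Q d f = {x \<in> qreps Q d f. stable Q d f x \<and> moment_map_eqs Q d x}"

definition qrep_coords ::
  "('v, 'e) pre_digraph \<Rightarrow> ('v \<Rightarrow> nat) \<Rightarrow> ('v \<Rightarrow> nat) \<Rightarrow> (('v, 'e) qrep \<Rightarrow> complex) set" where
  "qrep_coords Q d f =
     {\<lambda>x. Amap x e $$ (r, c) | e r c. e \<in> arcs Q \<and> r < d (head Q e) \<and> c < d (tail Q e)} \<union>
     {\<lambda>x. Bmap x e $$ (r, c) | e r c. e \<in> arcs Q \<and> r < d (tail Q e) \<and> c < d (head Q e)} \<union>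
     {\<lambda>x. imap x v $$ (r, c) | v r c. v \<in> verts Q \<and> r < d v \<and> c < f v} \<union>
     {\<lambda>x. jmap x v $$ (r, c) | v r c. v \<in> verts Q \<and> r < f v \<and> c < d v}"

definition GL :: "nat \<Rightarrow> complex mat monoid" where
  "GL n = units_of (ring_mat TYPE(complex) n ())"

definition gauge_group :: "('v, 'e) pre_digraph \<Rightarrow> ('v \<Rightarrow> nat) \<Rightarrow> ('v \<Rightarrow> complex mat) monoid" where
  "gauge_group Q d = product_group (verts Q) (\<lambda>v. GL (d v))"

definition gauge_act ::
  "('v, 'e) pre_digraph \<Rightarrow> ('v \<Rightarrow> nat) \<Rightarrow> ('v \<Rightarrow> complex mat) \<Rightarrow> ('v, 'e) qrep \<Rightarrow> ('v, 'e) qrep" where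
  "gauge_act Q d g x =
     \<lparr> Amap = (\<lambda>e \<in> arcs Q. g (head Q e) * Amap x e * inv\<^bsub>GL (d (tail Q e))\<^esub> g (tail Q e)),
       Bmap = (\<lambda>e \<in> arcs Q. g (tail Q e) * Bmap x e * inv\<^bsub>GL (d (head Q e))\<^esub> g (head Q e)),
       imap = (\<lambda>v \<in> verts Q. g v * imap x v),
       jmap = (\<lambda>v \<in> verts Q. jmap x v * inv\<^bsub>GL (d v)\<^esub> g v) \<rparr>"

definition nakajima_variety ::
  "('v, 'e) pre_digraph \<Rightarrow> ('v \<Rightarrow> nat) \<Rightarrow> ('v \<Rightarrow> nat) \<Rightarrow> ('v, 'e) qrep set fun_space" where
  "nakajima_variety Q d f =
     quotient_space (gauge_group Q d) (gauge_act Q d)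
       (zariski_space (stable_qreps Q d f) (qrep_coords Q d f))"


section \<open>Split parabolic quiver varieties\<close>

text \<open>
  A point of the prequotient consists of representations \<open>X m\<close> for \<open>m \<le> l\<close> and maps \<open>\<pi> m v\<close>
  for \<open>m < l\<close>.
\<close>

type_synonym ('v, 'e) parabolic_rep = "(nat \<Rightarrow> ('v, 'e) qrep) \<times> (nat \<Rightarrow> 'v \<Rightarrow> complex mat)"

fun pi_comp :: "nat \<Rightarrow> (nat \<Rightarrow> 'v \<Rightarrow> complex mat) \<Rightarrow> 'v \<Rightarrow> nat \<Rightarrow> complex mat" where
  "pi_comp n \<pi> v 0 = 1\<^sub>m n"
| "pi_comp n \<pi> v (Suc m) = \<pi> m v * pi_comp n \<pi> v m"

definition parabolic_intertwining ::
  "('v, 'e) pre_digraph \<Rightarrow> nat \<Rightarrow> ('v, 'e) parabolic_rep \<Rightarrow> bool" where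
  "parabolic_intertwining Q l = (\<lambda>(X, \<pi>). \<forall>m < l.
     (\<forall>e \<in> arcs Q.
        \<pi> m (head Q e) * Amap (X m) e = Amap (X (Suc m)) e * \<pi> m (tail Q e) \<and>
        \<pi> m (tail Q e) * Bmap (X m) e = Bmap (X (Suc m)) e * \<pi> m (head Q e)) \<and>
     (\<forall>v \<in> verts Q.
        \<pi> m v * imap (X m) v = imap (X (Suc m)) v \<and>
        jmap (X (Suc m)) v * \<pi> m v = jmap (X m) v))"

definition parabolic_split ::
  "('v, 'e) pre_digraph \<Rightarrow> nat \<Rightarrow> (nat \<Rightarrow> 'v \<Rightarrow> nat) \<Rightarrow> ('v \<Rightarrow> nat) \<Rightarrow>
   ('v, 'e) parabolic_rep \<Rightarrow> bool" where
  "parabolic_split Q l ds f = (\<lambda>(X, \<pi>). \<forall>v \<in> verts Q.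
     \<forall>u \<in> mat_kernel (pi_comp (ds 0 v) \<pi> v l).
       (\<forall>e \<in> arcs Q. tail Q e = v \<longrightarrow> Amap (X 0) e *\<^sub>v u = 0\<^sub>v (ds 0 (head Q e))) \<and>
       (\<forall>e \<in> arcs Q. head Q e = v \<longrightarrow> Bmap (X 0) e *\<^sub>v u = 0\<^sub>v (ds 0 (tail Q e))) \<and>
       jmap (X 0) v *\<^sub>v u = 0\<^sub>v (f v))"

definition split_parabolic_reps ::
  "('v, 'e) pre_digraph \<Rightarrow> nat \<Rightarrow> (nat \<Rightarrow> 'v \<Rightarrow> nat) \<Rightarrow> ('v \<Rightarrow> nat) \<Rightarrow>
   ('v, 'e) parabolic_rep set" where
  "split_parabolic_reps Q l ds f =
     {x \<in> (\<Pi>\<^sub>E m \<in> {..l}. stable_qreps Q (ds m) f) \<times>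
          (\<Pi>\<^sub>E m \<in> {..<l}. \<Pi>\<^sub>E v \<in> verts Q. carrier_mat (ds (Suc m) v) (ds m v)).
        parabolic_intertwining Q l x \<and> parabolic_split Q l ds f x}"

definition parabolic_coords ::
  "('v, 'e) pre_digraph \<Rightarrow> nat \<Rightarrow> (nat \<Rightarrow> 'v \<Rightarrow> nat) \<Rightarrow> ('v \<Rightarrow> nat) \<Rightarrow>
   (('v, 'e) parabolic_rep \<Rightarrow> complex) set" where
  "parabolic_coords Q l ds f =
     {\<lambda>x. \<phi> (fst x m) | m \<phi>. m \<le> l \<and> \<phi> \<in> qrep_coords Q (ds m) f} \<union>
     {\<lambda>x. snd x m v $$ (r, c) | m v r c. m < l \<and> v \<in> verts Q \<and> r < ds (Suc m) v \<and> c < ds m v}"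

definition parabolic_group ::
  "('v, 'e) pre_digraph \<Rightarrow> nat \<Rightarrow> (nat \<Rightarrow> 'v \<Rightarrow> nat) \<Rightarrow> (nat \<Rightarrow> 'v \<Rightarrow> complex mat) monoid" where
  "parabolic_group Q l ds = product_group {..l} (\<lambda>m. gauge_group Q (ds m))"

definition parabolic_act ::
  "('v, 'e) pre_digraph \<Rightarrow> nat \<Rightarrow> (nat \<Rightarrow> 'v \<Rightarrow> nat) \<Rightarrow> (nat \<Rightarrow> 'v \<Rightarrow> complex mat) \<Rightarrow>
   ('v, 'e) parabolic_rep \<Rightarrow> ('v, 'e) parabolic_rep" where
  "parabolic_act Q l ds g = (\<lambda>(X, \<pi>).
     (\<lambda>m \<in> {..l}. gauge_act Q (ds m) (g m) (X m),
      \<lambda>m \<in> {..<l}. \<lambda>v \<in> verts Q. g (Suc m) v * \<pi> m v * inv\<^bsub>GL (ds m v)\<^esub> g m v))"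

definition split_parabolic_variety ::
  "('v, 'e) pre_digraph \<Rightarrow> nat \<Rightarrow> (nat \<Rightarrow> 'v \<Rightarrow> nat) \<Rightarrow> ('v \<Rightarrow> nat) \<Rightarrow>
   ('v, 'e) parabolic_rep set fun_space" where
  "split_parabolic_variety Q l ds f =
     quotient_space (parabolic_group Q l ds) (parabolic_act Q l ds)
       (zariski_space (split_parabolic_reps Q l ds f) (parabolic_coords Q l ds f))"

end

theory Submission
  imports Defs
begin

text \<open>
  The quotient is covered by finitely many affine slices, each cut out of an affine space by
  polynomial equations with independent differentials; the dimension is the number of coordinates
  minus the number of equations.

  Write \<open>D m v\<close> for the space of dimension \<open>ds m v\<close>. A word is a path of
  the double quiver that starts at a framing vector, and it has a value in each of the
  representations of a chain. Stability says that the values of words span. Hence each point of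
  the prequotient admits at every vertex a list \<open>L\<close> of words such that, for every
  \<open>m\<close>, the values of its first \<open>ds m v\<close> members form a basis of \<open>D
  m v\<close> (\<open>chart_exists\<close>): a basis for the last step lifts along the
  homomorphisms \<open>\<pi>\<close> to independent words of the previous step, and these extend
  to a basis. Word sizes are bounded, so finitely many lists suffice. The points at which
  \<open>L\<close> gives bases form an open invariant set, and the orbits in it have unique
  representatives at which these bases are the standard ones. The representatives form the slice
  of \<open>L\<close>.

  On the slice all \<open>\<pi>\<close> have the form \<open>(1 | *)\<close>, and the condition on
  the kernel of the composite \<open>D 0 \<rightarrow> D l\<close> says that \<open>A\<close>,
  \<open>B\<close> and \<open>j\<close> of the first representation factor through this composite.
  The later representations are quotients of the first. So the slice has as coordinates the
  induced maps on \<open>D l\<close>, the map \<open>i\<close>, and the free columns of the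
  \<open>\<pi>\<close>. Its equations are the moment map equation, read as an equation between
  maps \<open>D l \<rightarrow> D 0\<close>, and the normalisation of the values of the words of
  \<open>L\<close> in \<open>D 0\<close>. This is \<open>atlas\<close>; the locale
  \<open>quotient_atlas\<close> derives from such data that the quotient is a variety
  (\<open>variety_M\<close>). It is separated because the only possible isomorphism from a point
  of a slice to another point \<open>y\<close> is given by the word values of \<open>y\<close>,
  which makes the orbit relation polynomial.

  The differentials of the equations are independent (\<open>eqns_independent\<close>). A linear
  relation between them consists of maps \<open>X v : D 0 v \<rightarrow> D l v\<close> and
  \<open>Y v : D 0 v \<rightarrow> D 0 v\<close>, paired by the trace with the two kinds of
  equations. An infinitesimal gauge transformation \<open>b\<close> leaves the moment map zero and
  moves the frame of words by \<open>b\<close>, so \<open>Y = 0\<close>. Changing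
  \<open>A\<close>, \<open>B\<close> and \<open>j\<close> while keeping the \<open>\<pi>\<close>
  shows that \<open>X\<close> intertwines the representation with its last quotient and kills the
  framing; so it kills the values of all words, and \<open>X = 0\<close>.

  The Nakajima quiver variety is the case \<open>l = 0\<close>, and \<open>nakajima_dim\<close>
  counts its dimension in the same way. That a nonempty smooth space has only one dimension
  (\<open>smooth_dim_unique\<close>) is proved with tangent vectors: these are the kernels of the
  Jacobian matrices, since each vector of such a kernel is the limit direction of a sequence on
  the zero locus (\<open>newton_curve\<close>), and regular functions have directional derivatives
  along such sequences. The comparison of the two counts is \<open>dimension_formula\<close>.
\<close>

unbundle no vec_syntax

section \<open>Algebras of functions\<close>

text \<open>
  Polynomial functions, functions that are polynomial on a subset, and regular functions on an
  open set are treated at once. Functions are total, so membership may only depend on the values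
  on \<open>U\<close>.
\<close>

locale fun_alg =
  fixes U :: "'a set" and R :: "('a \<Rightarrow> complex) set"
  assumes const: "(\<lambda>_. c) \<in> R"
    and add: "f \<in> R \<Longrightarrow> g \<in> R \<Longrightarrow> (\<lambda>x. f x + g x) \<in> R"
    and mult: "f \<in> R \<Longrightarrow> g \<in> R \<Longrightarrow> (\<lambda>x. f x * g x) \<in> R"
    and cong: "f \<in> R \<Longrightarrow> (\<And>x. x \<in> U \<Longrightarrow> f x = g x) \<Longrightarrow> g \<in> R"
begin

lemma uminus: "f \<in> R \<Longrightarrow> (\<lambda>x. - f x) \<in> R"
  using mult[OF const[of "-1"]] by simp

lemma diff: "f \<in> R \<Longrightarrow> g \<in> R \<Longrightarrow> (\<lambda>x. f x - g x) \<in> R"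
  using add[OF _ uminus] by simp

lemma sum: "(\<And>i. i \<in> I \<Longrightarrow> f i \<in> R) \<Longrightarrow> (\<lambda>x. \<Sum>i\<in>I. f i x) \<in> R"
proof (induction I rule: infinite_finite_induct)
  case (insert i I)
  then show ?case using add[of "f i" "\<lambda>x. \<Sum>i\<in>I. f i x"] by simp
qed (simp_all add: const)

lemma prod: "(\<And>i. i \<in> I \<Longrightarrow> f i \<in> R) \<Longrightarrow> (\<lambda>x. \<Prod>i\<in>I. f i x) \<in> R"
proof (induction I rule: infinite_finite_induct)
  case (insert i I)
  then show ?case using mult[of "f i" "\<lambda>x. \<Prod>i\<in>I. f i x"] by simp
qed (simp_all add: const)

lemma poly_comp:
  assumes "p \<in> poly_funs \<Psi>" and "\<And>\<psi>. \<psi> \<in> \<Psi> \<Longrightarrow> (\<lambda>x. \<psi> (\<rho> x)) \<in> R"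
  shows "(\<lambda>x. p (\<rho> x)) \<in> R"
  using assms(1) by induction (auto intro: const add mult assms(2))

definition mfun :: "nat \<Rightarrow> nat \<Rightarrow> ('a \<Rightarrow> complex mat) \<Rightarrow> bool" where
  "mfun n m F \<longleftrightarrow> (\<forall>x\<in>U. F x \<in> carrier_mat n m) \<and> (\<forall>r<n. \<forall>c<m. (\<lambda>x. F x $$ (r, c)) \<in> R)"

lemma mfunI:
  "(\<And>x. x \<in> U \<Longrightarrow> F x \<in> carrier_mat n m) \<Longrightarrow>
   (\<And>r c. r < n \<Longrightarrow> c < m \<Longrightarrow> (\<lambda>x. F x $$ (r, c)) \<in> R) \<Longrightarrow> mfun n m F"
  by (auto simp: mfun_def)

lemma mfun_entry: "mfun n m F \<Longrightarrow> r < n \<Longrightarrow> c < m \<Longrightarrow> (\<lambda>x. F x $$ (r, c)) \<in> R"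
  by (auto simp: mfun_def)

lemma mfun_carrier: "mfun n m F \<Longrightarrow> x \<in> U \<Longrightarrow> F x \<in> carrier_mat n m"
  by (auto simp: mfun_def)

lemma mfun_const: "A \<in> carrier_mat n m \<Longrightarrow> mfun n m (\<lambda>_. A)"
  by (rule mfunI) (auto intro: const)

lemma mfun_mat: "(\<And>r c. r < n \<Longrightarrow> c < m \<Longrightarrow> (\<lambda>x. f x (r, c)) \<in> R) \<Longrightarrow> mfun n m (\<lambda>x. mat n m (f x))"
  by (rule mfunI) auto

lemma mfun_mult:
  assumes "mfun n k F" "mfun k m G" shows "mfun n m (\<lambda>x. F x * G x)"
proof (rule mfunI)
  show "F x * G x \<in> carrier_mat n m" if "x \<in> U" for x
    using mfun_carrier[OF assms(1) that] mfun_carrier[OF assms(2) that] by simp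
  show "(\<lambda>x. (F x * G x) $$ (r, c)) \<in> R" if "r < n" "c < m" for r c
  proof (rule cong)
    show "(\<lambda>x. \<Sum>i\<in>{0..<k}. F x $$ (r, i) * G x $$ (i, c)) \<in> R"
      using assms that by (intro sum mult mfun_entry[of n k] mfun_entry[of k m]) auto
    show "(\<Sum>i\<in>{0..<k}. F x $$ (r, i) * G x $$ (i, c)) = (F x * G x) $$ (r, c)" if "x \<in> U" for x
      using mfun_carrier[OF assms(1) that] mfun_carrier[OF assms(2) that] \<open>r < n\<close> \<open>c < m\<close>
      by (auto simp: scalar_prod_def intro!: sum.cong)
  qed
qed

lemma mfun_diff:
  assumes "mfun n m F" "mfun n m G" shows "mfun n m (\<lambda>x. F x - G x)"
proof (rule mfunI)
  show "F x - G x \<in> carrier_mat n m" if "x \<in> U" for x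
    using mfun_carrier[OF assms(2) that] by auto
  show "(\<lambda>x. (F x - G x) $$ (r, c)) \<in> R" if "r < n" "c < m" for r c
  proof (rule cong)
    show "(\<lambda>x. F x $$ (r, c) - G x $$ (r, c)) \<in> R"
      using assms that by (intro diff mfun_entry[of n m])
    show "F x $$ (r, c) - G x $$ (r, c) = (F x - G x) $$ (r, c)" if "x \<in> U" for x
      using mfun_carrier[OF assms(2) that] \<open>r < n\<close> \<open>c < m\<close> by auto
  qed
qed

lemma mfun_minor: "mfun (Suc n) (Suc m) F \<Longrightarrow> i < Suc n \<Longrightarrow> j < Suc m \<Longrightarrow>
   mfun n m (\<lambda>x. mat_delete (F x) i j)"
proof (rule mfunI)
  assume F: "mfun (Suc n) (Suc m) F" and ij: "i < Suc n" "j < Suc m"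
  show "mat_delete (F x) i j \<in> carrier_mat n m" if "x \<in> U" for x
    using mfun_carrier[OF F that] by (simp add: mat_delete_def)
  show "(\<lambda>x. mat_delete (F x) i j $$ (r, c)) \<in> R" if "r < n" "c < m" for r c
  proof (rule cong)
    show "(\<lambda>x. F x $$ (if r < i then r else Suc r, if c < j then c else Suc c)) \<in> R"
      using that by (intro mfun_entry[OF F]) auto
    show "F x $$ (if r < i then r else Suc r, if c < j then c else Suc c) =
        mat_delete (F x) i j $$ (r, c)" if "x \<in> U" for x
      using mfun_carrier[OF F that] \<open>r < n\<close> \<open>c < m\<close> by (simp add: mat_delete_def)
  qed
qed

lemma mfun_det:
  assumes "mfun n n F" shows "(\<lambda>x. det (F x)) \<in> R"
proof (rule cong)
  show "(\<lambda>x. \<Sum>p\<in>{p. p permutes {0..<n}}. signof p * (\<Prod>i = 0..<n. F x $$ (i, p i))) \<in> R"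
    by (intro sum mult const prod mfun_entry[OF assms])
      (auto dest: permutes_in_image[of _ _ "_::nat"])
  show "(\<Sum>p\<in>{p. p permutes {0..<n}}. signof p * (\<Prod>i = 0..<n. F x $$ (i, p i))) = det (F x)"
    if "x \<in> U" for x
    using mfun_carrier[OF assms that] by (simp add: det_def'[of _ n])
qed

lemma mfun_adj:
  assumes "mfun n n F" shows "mfun n n (\<lambda>x. adj_mat (F x))"
proof (rule mfunI)
  show "adj_mat (F x) \<in> carrier_mat n n" if "x \<in> U" for x
    using mfun_carrier[OF assms that] by (rule adj_mat(1))
  show "(\<lambda>x. adj_mat (F x) $$ (r, c)) \<in> R" if rc: "r < n" "c < n" for r c
  proof (rule cong)
    obtain n' where n: "n = Suc n'" using rc by (cases n) auto
    show "(\<lambda>x. (-1) ^ (c + r) * det (mat_delete (F x) c r)) \<in> R"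
      using mfun_minor[OF assms[unfolded n], of c r] rc unfolding n
      by (intro mult const mfun_det) auto
    show "(-1) ^ (c + r) * det (mat_delete (F x) c r) = adj_mat (F x) $$ (r, c)" if "x \<in> U" for x
      using mfun_carrier[OF assms that] rc by (auto simp: adj_mat_def cofactor_def)
  qed
qed

end

text \<open>The inverse given by Cramer's rule, whose entries are visibly rational.\<close>

definition minv :: "complex mat \<Rightarrow> complex mat" where
  "minv A = (1 / det A) \<cdot>\<^sub>m adj_mat A"

lemma minv:
  assumes A: "A \<in> carrier_mat n n" and d: "det A \<noteq> 0"
  shows "minv A \<in> carrier_mat n n" "A * minv A = 1\<^sub>m n" "minv A * A = 1\<^sub>m n"
proof -
  note a = adj_mat[OF A]
  have e: "(1 / det A) \<cdot>\<^sub>m (det A \<cdot>\<^sub>m 1\<^sub>m n) = 1\<^sub>m n"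
    using d by (intro eq_matI) auto
  show "minv A \<in> carrier_mat n n" using a(1) by (simp add: minv_def)
  show "A * minv A = 1\<^sub>m n"
    unfolding minv_def using mult_smult_distrib[OF A a(1)] a(2) e by simp
  show "minv A * A = 1\<^sub>m n"
    unfolding minv_def using mult_smult_assoc_mat[OF a(1) A] a(3) e by simp
qed

lemma (in fun_alg) mfun_minv:
  assumes F: "mfun n n F" and i: "(\<lambda>x. 1 / det (F x)) \<in> R"
  shows "mfun n n (\<lambda>x. minv (F x))"
proof (rule mfunI)
  have adj: "mfun n n (\<lambda>x. adj_mat (F x))" by (rule mfun_adj[OF F])
  show "minv (F x) \<in> carrier_mat n n" if "x \<in> U" for x
    using mfun_carrier[OF adj that] by (simp add: minv_def)
  show "(\<lambda>x. minv (F x) $$ (r, c)) \<in> R" if "r < n" "c < n" for r c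
  proof (rule cong)
    show "(\<lambda>x. 1 / det (F x) * adj_mat (F x) $$ (r, c)) \<in> R"
      by (intro mult i mfun_entry[OF adj] that)
    show "1 / det (F x) * adj_mat (F x) $$ (r, c) = minv (F x) $$ (r, c)" if "x \<in> U" for x
      using mfun_carrier[OF adj that] \<open>r < n\<close> \<open>c < n\<close> by (auto simp: minv_def)
  qed
qed

lemma fun_alg_poly: "fun_alg UNIV (poly_funs \<Phi>)"
proof
  fix f g :: "'a \<Rightarrow> complex"
  assume "f \<in> poly_funs \<Phi>" "\<And>x. x \<in> UNIV \<Longrightarrow> f x = g x"
  moreover from this(2) have "f = g" by auto
  ultimately show "g \<in> poly_funs \<Phi>" by simp
qed (auto intro: poly_funs.intros)

definition poly_on :: "'a set \<Rightarrow> ('a \<Rightarrow> complex) set \<Rightarrow> ('a \<Rightarrow> complex) set" where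
  "poly_on X \<Phi> = {h. \<exists>p\<in>poly_funs \<Phi>. \<forall>x\<in>X. h x = p x}"

lemma fun_alg_poly_on: "fun_alg X (poly_on X \<Phi>)"
proof
  fix f g :: "'a \<Rightarrow> complex"
  show "(\<lambda>_. c) \<in> poly_on X \<Phi>" for c
    unfolding poly_on_def by (auto intro!: bexI[OF _ poly_funs.const])
  assume "f \<in> poly_on X \<Phi>"
  then obtain p where p: "p \<in> poly_funs \<Phi>" "\<forall>x\<in>X. f x = p x" by (auto simp: poly_on_def)
  show "g \<in> poly_on X \<Phi>" if "\<And>x. x \<in> X \<Longrightarrow> f x = g x"
    using p that unfolding poly_on_def by (auto intro!: bexI[OF _ p(1)])
  assume "g \<in> poly_on X \<Phi>"
  then obtain q where q: "q \<in> poly_funs \<Phi>" "\<forall>x\<in>X. g x = q x" by (auto simp: poly_on_def)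
  show "(\<lambda>x. f x + g x) \<in> poly_on X \<Phi>"
    using p q unfolding poly_on_def by (auto intro!: bexI[OF _ poly_funs.add[OF p(1) q(1)]])
  show "(\<lambda>x. f x * g x) \<in> poly_on X \<Phi>"
    using p q unfolding poly_on_def by (auto intro!: bexI[OF _ poly_funs.mult[OF p(1) q(1)]])
qed

lemma poly_on_coord: "\<phi> \<in> \<Phi> \<Longrightarrow> \<phi> \<in> poly_on X \<Phi>"
  unfolding poly_on_def by (auto intro!: bexI[OF _ poly_funs.coord])


section \<open>Regular functions on Zariski spaces\<close>

lemma openin_zariski:
  "openin (zariski_topology X \<Phi>) V \<longleftrightarrow>
     V \<subseteq> X \<and> (\<forall>x\<in>V. \<exists>p\<in>poly_funs \<Phi>. p x \<noteq> 0 \<and> {y\<in>X. p y \<noteq> 0} \<subseteq> V)"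
  (is "?L V \<longleftrightarrow> ?R V")
proof
  let ?B = "{{x \<in> X. p x \<noteq> 0} | p. p \<in> poly_funs \<Phi>}"
  assume "?L V"
  then have "generate_topology_on ?B V"
    by (simp add: zariski_topology_def openin_topology_generated_by_iff)
  then show "?R V"
  proof induction
    case (Int a b)
    show ?case
    proof (intro conjI ballI)
      fix x assume "x \<in> a \<inter> b"
      then obtain p q where "p \<in> poly_funs \<Phi>" "p x \<noteq> 0" "{y\<in>X. p y \<noteq> 0} \<subseteq> a"
        "q \<in> poly_funs \<Phi>" "q x \<noteq> 0" "{y\<in>X. q y \<noteq> 0} \<subseteq> b" using Int by blast
      then show "\<exists>p\<in>poly_funs \<Phi>. p x \<noteq> 0 \<and> {y \<in> X. p y \<noteq> 0} \<subseteq> a \<inter> b"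
        by (intro bexI[OF _ poly_funs.mult[of p _ q]]) auto
    qed (use Int in blast)
  next
    case (UN K)
    then show ?case by (meson Union_iff Sup_le_iff subset_trans Sup_upper)
  qed auto
next
  assume R: "?R V"
  show "?L V"
  proof (subst openin_subopen, intro ballI)
    fix x assume x: "x \<in> V"
    then obtain p where p: "p \<in> poly_funs \<Phi>" "p x \<noteq> 0" "{y\<in>X. p y \<noteq> 0} \<subseteq> V" using R by blast
    have "openin (zariski_topology X \<Phi>) {y\<in>X. p y \<noteq> 0}"
      unfolding zariski_topology_def using p(1) by (intro topology_generated_by_Basis) blast
    then show "\<exists>T. openin (zariski_topology X \<Phi>) T \<and> x \<in> T \<and> T \<subseteq> V"
      using p x R by (intro exI[of _ "{y\<in>X. p y \<noteq> 0}"]) auto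
  qed
qed

lemma topspace_zariski: "topspace (zariski_topology X \<Phi>) = X"
  using topspace_zariski_space[of X \<Phi>] by (simp add: zariski_space_def)

definition reg :: "'a set \<Rightarrow> ('a \<Rightarrow> complex) set \<Rightarrow> 'a set \<Rightarrow> ('a \<Rightarrow> complex) set" where
  "reg X \<Phi> U = {h. \<forall>x\<in>U. \<exists>V p q. openin (zariski_topology X \<Phi>) V \<and> x \<in> V \<and> V \<subseteq> U \<and>
     p \<in> poly_funs \<Phi> \<and> q \<in> poly_funs \<Phi> \<and> (\<forall>y\<in>V. q y \<noteq> 0 \<and> h y = p y / q y)}"

lemma fs_reg_zariski_space: "fs_reg (zariski_space X \<Phi>) U = reg X \<Phi> U"
  by (simp add: zariski_space_def reg_def)

lemma fs_top_zariski_space: "fs_top (zariski_space X \<Phi>) = zariski_topology X \<Phi>"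
  by (simp add: zariski_space_def)

lemma regE:
  assumes "h \<in> reg X \<Phi> U" "x \<in> U"
  obtains V p q where "openin (zariski_topology X \<Phi>) V" "x \<in> V" "V \<subseteq> U"
    "p \<in> poly_funs \<Phi>" "q \<in> poly_funs \<Phi>" "\<And>y. y \<in> V \<Longrightarrow> q y \<noteq> 0" "\<And>y. y \<in> V \<Longrightarrow> h y = p y / q y"
  using assms unfolding reg_def by blast

lemma regI:
  assumes "\<And>x. x \<in> U \<Longrightarrow> \<exists>V p q. openin (zariski_topology X \<Phi>) V \<and> x \<in> V \<and> V \<subseteq> U \<and>
     p \<in> poly_funs \<Phi> \<and> q \<in> poly_funs \<Phi> \<and> (\<forall>y\<in>V. q y \<noteq> 0 \<and> h y = p y / q y)"
  shows "h \<in> reg X \<Phi> U"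
  using assms unfolding reg_def by blast

lemma poly_reg:
  assumes "openin (zariski_topology X \<Phi>) U" "p \<in> poly_funs \<Phi>" shows "p \<in> reg X \<Phi> U"
  by (rule regI, rule exI[of _ U], rule exI[of _ p], rule exI[of _ "\<lambda>_. 1"])
    (use assms in \<open>auto intro: poly_funs.const\<close>)

lemma reg_restrict:
  assumes "h \<in> reg X \<Phi> U" "openin (zariski_topology X \<Phi>) V" "V \<subseteq> U" shows "h \<in> reg X \<Phi> V"
proof (rule regI)
  fix x assume x: "x \<in> V"
  then obtain W p q where "openin (zariski_topology X \<Phi>) W" "x \<in> W" "W \<subseteq> U"
    "p \<in> poly_funs \<Phi>" "q \<in> poly_funs \<Phi>" "\<And>y. y \<in> W \<Longrightarrow> q y \<noteq> 0" "\<And>y. y \<in> W \<Longrightarrow> h y = p y / q y"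
    using regE[OF assms(1)] assms(3) by blast
  then show "\<exists>V' p q. openin (zariski_topology X \<Phi>) V' \<and> x \<in> V' \<and> V' \<subseteq> V \<and>
     p \<in> poly_funs \<Phi> \<and> q \<in> poly_funs \<Phi> \<and> (\<forall>y\<in>V'. q y \<noteq> 0 \<and> h y = p y / q y)"
    using assms(2) x by (intro exI[of _ "W \<inter> V"] exI[of _ p] exI[of _ q]) (auto intro: openin_Int)
qed

lemma reg_local:
  assumes "\<And>x. x \<in> U \<Longrightarrow> \<exists>V. x \<in> V \<and> V \<subseteq> U \<and> h \<in> reg X \<Phi> V" shows "h \<in> reg X \<Phi> U"
proof (rule regI)
  fix x assume x: "x \<in> U"
  then obtain V where V: "x \<in> V" "V \<subseteq> U" "h \<in> reg X \<Phi> V" using assms by blast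
  obtain W p q where "openin (zariski_topology X \<Phi>) W" "x \<in> W" "W \<subseteq> V"
    "p \<in> poly_funs \<Phi>" "q \<in> poly_funs \<Phi>" "\<And>y. y \<in> W \<Longrightarrow> q y \<noteq> 0" "\<And>y. y \<in> W \<Longrightarrow> h y = p y / q y"
    using regE[OF V(3,1)] by blast
  then show "\<exists>V p q. openin (zariski_topology X \<Phi>) V \<and> x \<in> V \<and> V \<subseteq> U \<and>
     p \<in> poly_funs \<Phi> \<and> q \<in> poly_funs \<Phi> \<and> (\<forall>y\<in>V. q y \<noteq> 0 \<and> h y = p y / q y)"
    using V(2) by blast
qed

text \<open>
  Brings two local fractions to a common neighbourhood; sums, products and inverses differ only in
  the algebra of the resulting fraction.
\<close>

lemma reg_combine:
  assumes fg: "f \<in> reg X \<Phi> U" "g \<in> reg X \<Phi> U"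
    and comb: "\<And>p q p' q'. p \<in> poly_funs \<Phi> \<Longrightarrow> q \<in> poly_funs \<Phi> \<Longrightarrow> p' \<in> poly_funs \<Phi> \<Longrightarrow>
      q' \<in> poly_funs \<Phi> \<Longrightarrow> \<exists>P\<in>poly_funs \<Phi>. \<exists>S\<in>poly_funs \<Phi>.
        \<forall>y\<in>U. q y \<noteq> 0 \<longrightarrow> q' y \<noteq> 0 \<longrightarrow> f y = p y / q y \<longrightarrow> g y = p' y / q' y \<longrightarrow>
          S y \<noteq> 0 \<and> h y = P y / S y"
  shows "h \<in> reg X \<Phi> U"
proof (rule regI)
  fix x assume x: "x \<in> U"
  obtain V p q where 1: "openin (zariski_topology X \<Phi>) V" "x \<in> V" "V \<subseteq> U"
    "p \<in> poly_funs \<Phi>" "q \<in> poly_funs \<Phi>" "\<And>y. y \<in> V \<Longrightarrow> q y \<noteq> 0" "\<And>y. y \<in> V \<Longrightarrow> f y = p y / q y"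
    using regE[OF fg(1) x] by blast
  obtain V' p' q' where 2: "openin (zariski_topology X \<Phi>) V'" "x \<in> V'" "V' \<subseteq> U"
    "p' \<in> poly_funs \<Phi>" "q' \<in> poly_funs \<Phi>" "\<And>y. y \<in> V' \<Longrightarrow> q' y \<noteq> 0" "\<And>y. y \<in> V' \<Longrightarrow> g y = p' y / q' y"
    using regE[OF fg(2) x] by blast
  obtain P S where "P \<in> poly_funs \<Phi>" "S \<in> poly_funs \<Phi>"
    "\<forall>y\<in>U. q y \<noteq> 0 \<longrightarrow> q' y \<noteq> 0 \<longrightarrow> f y = p y / q y \<longrightarrow> g y = p' y / q' y \<longrightarrow>
          S y \<noteq> 0 \<and> h y = P y / S y"
    using comb[OF 1(4,5) 2(4,5)] by blast
  then show "\<exists>V p q. openin (zariski_topology X \<Phi>) V \<and> x \<in> V \<and> V \<subseteq> U \<and>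
     p \<in> poly_funs \<Phi> \<and> q \<in> poly_funs \<Phi> \<and> (\<forall>y\<in>V. q y \<noteq> 0 \<and> h y = p y / q y)"
    using 1 2 by (intro exI[of _ "V \<inter> V'"] exI[of _ P] exI[of _ S]) (auto intro: openin_Int)
qed

lemma fun_alg_reg:
  assumes "openin (zariski_topology X \<Phi>) U" shows "fun_alg U (reg X \<Phi> U)"
proof
  fix f g :: "'a \<Rightarrow> complex"
  show "(\<lambda>_. c) \<in> reg X \<Phi> U" for c
    by (rule poly_reg[OF assms poly_funs.const])
  assume f: "f \<in> reg X \<Phi> U"
  show "g \<in> reg X \<Phi> U" if "\<And>x. x \<in> U \<Longrightarrow> f x = g x"

  proof (rule reg_combine[OF f f], goal_cases)
    case (1 p q p' q')
    then show ?case
      by (intro bexI[of _ p] bexI[of _ q] ballI) (simp_all flip: that)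
  qed
  assume g: "g \<in> reg X \<Phi> U"
  show "(\<lambda>x. f x + g x) \<in> reg X \<Phi> U"
  proof (rule reg_combine[OF f g], goal_cases)
    case (1 p q p' q')
    then show ?case
      by (intro bexI[of _ "\<lambda>x. p x * q' x + p' x * q x"] bexI[of _ "\<lambda>x. q x * q' x"] ballI)
        (auto simp: add_frac_eq intro: poly_funs.add poly_funs.mult)
  qed
  show "(\<lambda>x. f x * g x) \<in> reg X \<Phi> U"
  proof (rule reg_combine[OF f g], goal_cases)
    case (1 p q p' q')
    then show ?case
      by (intro bexI[of _ "\<lambda>x. p x * p' x"] bexI[of _ "\<lambda>x. q x * q' x"] ballI)
        (auto intro: poly_funs.mult)
  qed
qed

lemma reg_inverse:
  assumes f: "f \<in> reg X \<Phi> U" and nz: "\<And>x. x \<in> U \<Longrightarrow> f x \<noteq> 0"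
  shows "(\<lambda>x. 1 / f x) \<in> reg X \<Phi> U"
proof (rule reg_combine[OF f f], goal_cases)
  case (1 p q p' q')
  then show ?case
  proof (rule_tac bexI[of _ q], rule_tac bexI[of _ p], intro ballI impI)
    fix y assume y: "y \<in> U" and q: "q y \<noteq> 0" and fy: "f y = p y / q y"
    show "p y \<noteq> 0 \<and> 1 / f y = q y / p y"
      using nz[OF y] q fy by auto
  qed
qed

lemma openin_reg_nonzero:
  assumes U: "openin (zariski_topology X \<Phi>) U" and h: "h \<in> reg X \<Phi> U"
  shows "openin (zariski_topology X \<Phi>) {x\<in>U. h x \<noteq> 0}"
proof (subst openin_subopen, intro ballI)
  fix x assume x: "x \<in> {x\<in>U. h x \<noteq> 0}"
  then obtain V p q where 1: "openin (zariski_topology X \<Phi>) V" "x \<in> V" "V \<subseteq> U"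
    "p \<in> poly_funs \<Phi>" "q \<in> poly_funs \<Phi>" "\<And>y. y \<in> V \<Longrightarrow> q y \<noteq> 0" "\<And>y. y \<in> V \<Longrightarrow> h y = p y / q y"
    using regE[OF h] by blast
  have VX: "V \<subseteq> X" using openin_subset[OF 1(1)] by (simp add: topspace_zariski)
  have "openin (zariski_topology X \<Phi>) {y\<in>X. p y \<noteq> 0}"
    unfolding openin_zariski using 1(4) by auto
  with 1 have "openin (zariski_topology X \<Phi>) (V \<inter> {y\<in>X. p y \<noteq> 0})" by blast
  moreover have "x \<in> V \<inter> {y\<in>X. p y \<noteq> 0}" using x 1 VX by auto
  moreover have "V \<inter> {y\<in>X. p y \<noteq> 0} \<subseteq> {x\<in>U. h x \<noteq> 0}" using 1 by auto
  ultimately show "\<exists>T. openin (zariski_topology X \<Phi>) T \<and> x \<in> T \<and> T \<subseteq> {x\<in>U. h x \<noteq> 0}" by blast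
qed

text \<open>Maps with regular coordinates are morphisms.\<close>

lemma reg_map_open:
  assumes U: "openin (zariski_topology X \<Phi>) U"
    and f: "\<And>\<psi>. \<psi> \<in> \<Psi> \<Longrightarrow> (\<lambda>x. \<psi> (f x)) \<in> reg X \<Phi> U" and fZ: "\<And>x. x \<in> U \<Longrightarrow> f x \<in> Z"
    and V: "openin (zariski_topology Z \<Psi>) V"
  shows "openin (zariski_topology X \<Phi>) {x\<in>U. f x \<in> V}"
proof (subst openin_subopen, intro ballI)
  interpret fun_alg U "reg X \<Phi> U" by (rule fun_alg_reg[OF U])
  fix x assume x: "x \<in> {x\<in>U. f x \<in> V}"
  then obtain p where p: "p \<in> poly_funs \<Psi>" "p (f x) \<noteq> 0" "{y\<in>Z. p y \<noteq> 0} \<subseteq> V"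
    using V unfolding openin_zariski by blast
  have "openin (zariski_topology X \<Phi>) {x\<in>U. p (f x) \<noteq> 0}"
    by (intro openin_reg_nonzero U poly_comp[OF p(1)] f)
  then show "\<exists>T. openin (zariski_topology X \<Phi>) T \<and> x \<in> T \<and> T \<subseteq> {x\<in>U. f x \<in> V}"
    using p x fZ by (intro exI[of _ "{x\<in>U. p (f x) \<noteq> 0}"]) auto
qed

lemma reg_map_pullback:
  assumes U: "openin (zariski_topology X \<Phi>) U"
    and f: "\<And>\<psi>. \<psi> \<in> \<Psi> \<Longrightarrow> (\<lambda>x. \<psi> (f x)) \<in> reg X \<Phi> U" and fZ: "\<And>x. x \<in> U \<Longrightarrow> f x \<in> Z"
    and h: "h \<in> reg Z \<Psi> V"
  shows "(\<lambda>x. h (f x)) \<in> reg X \<Phi> {x\<in>U. f x \<in> V}"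
proof (rule reg_local)
  fix x assume x: "x \<in> {x\<in>U. f x \<in> V}"
  then obtain W p q where 1: "openin (zariski_topology Z \<Psi>) W" "f x \<in> W" "W \<subseteq> V"
    "p \<in> poly_funs \<Psi>" "q \<in> poly_funs \<Psi>" "\<And>y. y \<in> W \<Longrightarrow> q y \<noteq> 0" "\<And>y. y \<in> W \<Longrightarrow> h y = p y / q y"
    using regE[OF h] by blast
  let ?W = "{x\<in>U. f x \<in> W}"
  have W: "openin (zariski_topology X \<Phi>) ?W" by (rule reg_map_open[where f = f, OF U _ _ 1(1)]) (use f fZ in auto)
  interpret fun_alg ?W "reg X \<Phi> ?W" by (rule fun_alg_reg[OF W])
  have f': "(\<lambda>x. \<psi> (f x)) \<in> reg X \<Phi> ?W" if "\<psi> \<in> \<Psi>" for \<psi>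
    using reg_restrict[OF f[OF that] W] by auto
  have "(\<lambda>x. p (f x) * (1 / q (f x))) \<in> reg X \<Phi> ?W"
    by (intro mult reg_inverse poly_comp[OF 1(4)] poly_comp[OF 1(5)] f') (use 1(6) in auto)
  then have "(\<lambda>x. h (f x)) \<in> reg X \<Phi> ?W"
    by (rule cong) (use 1(7) in auto)
  then show "\<exists>V'. x \<in> V' \<and> V' \<subseteq> {x\<in>U. f x \<in> V} \<and> (\<lambda>x. h (f x)) \<in> reg X \<Phi> V'"
    using x 1 by (intro exI[of _ ?W]) auto
qed


section \<open>Quotients with affine slices\<close>

definition pair_coords :: "('a \<Rightarrow> complex) set \<Rightarrow> ('a \<times> 'a \<Rightarrow> complex) set" where
  "pair_coords \<Phi> = {\<lambda>p. \<phi> (fst p) | \<phi>. \<phi> \<in> \<Phi>} \<union> {\<lambda>p. \<phi> (snd p) | \<phi>. \<phi> \<in> \<Phi>}"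

text \<open>
  Each member of a finite cover of \<open>X\<close> by invariant open sets has a slice, which
  \<open>\<sigma> L\<close> parametrises by a zero locus, and \<open>\<rho> L\<close> sends a
  point to the parameter of the slice point in its orbit. The functions in \<open>E L\<close> cut
  out the orbit relation between points of the slice and arbitrary points, which is what makes the
  quotient separated.
\<close>

locale quotient_atlas =
  fixes X :: "'a set" and \<Phi> :: "('a \<Rightarrow> complex) set"
    and G :: "('g, 'm) monoid_scheme" and act :: "'g \<Rightarrow> 'a \<Rightarrow> 'a"
    and I :: "'i set" and U :: "'i \<Rightarrow> 'a set"
    and N :: nat and P :: "'i \<Rightarrow> (complex vec \<Rightarrow> complex) set"
    and \<sigma> :: "'i \<Rightarrow> complex vec \<Rightarrow> 'a" and \<rho> :: "'i \<Rightarrow> 'a \<Rightarrow> complex vec"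
    and E :: "'i \<Rightarrow> ('a \<times> 'a \<Rightarrow> complex) set"
  assumes fin: "finite I"
    and cover: "X = (\<Union>L\<in>I. U L)"
    and U_open: "L \<in> I \<Longrightarrow> openin (zariski_topology X \<Phi>) (U L)"
    and orbit_refl: "x \<in> X \<Longrightarrow> x \<in> orbit G act x"
    and orbit_closed: "x \<in> X \<Longrightarrow> y \<in> orbit G act x \<Longrightarrow> y \<in> X"
    and orbit_eq: "x \<in> X \<Longrightarrow> y \<in> orbit G act x \<Longrightarrow> orbit G act y = orbit G act x"
    and U_inv: "L \<in> I \<Longrightarrow> x \<in> U L \<Longrightarrow> y \<in> orbit G act x \<Longrightarrow> y \<in> U L"
    and P_poly: "L \<in> I \<Longrightarrow> P L \<subseteq> poly_funs (vec_coords N)"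
    and \<sigma>_in: "L \<in> I \<Longrightarrow> z \<in> zero_locus N (P L) \<Longrightarrow> \<sigma> L z \<in> U L"
    and \<sigma>_poly: "L \<in> I \<Longrightarrow> \<phi> \<in> \<Phi> \<Longrightarrow> (\<lambda>z. \<phi> (\<sigma> L z)) \<in> poly_on (zero_locus N (P L)) (vec_coords N)"
    and \<rho>_in: "L \<in> I \<Longrightarrow> x \<in> U L \<Longrightarrow> \<rho> L x \<in> zero_locus N (P L)"
    and \<rho>_reg: "L \<in> I \<Longrightarrow> i < N \<Longrightarrow> (\<lambda>x. \<rho> L x $ i) \<in> reg X \<Phi> (U L)"
    and \<rho>_inv: "L \<in> I \<Longrightarrow> x \<in> U L \<Longrightarrow> y \<in> orbit G act x \<Longrightarrow> \<rho> L y = \<rho> L x"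
    and \<rho>_\<sigma>: "L \<in> I \<Longrightarrow> z \<in> zero_locus N (P L) \<Longrightarrow> \<rho> L (\<sigma> L z) = z"
    and \<sigma>_\<rho>: "L \<in> I \<Longrightarrow> x \<in> U L \<Longrightarrow> \<sigma> L (\<rho> L x) \<in> orbit G act x"
    and E_poly: "L \<in> I \<Longrightarrow> e \<in> E L \<Longrightarrow> e \<in> poly_on (X \<times> X) (pair_coords \<Phi>)"
    and E_orbit: "L \<in> I \<Longrightarrow> z \<in> zero_locus N (P L) \<Longrightarrow> y \<in> X \<Longrightarrow>
      y \<in> orbit G act (\<sigma> L z) \<longleftrightarrow> (\<forall>e\<in>E L. e (\<sigma> L z, y) = 0)"
begin

abbreviation "orb \<equiv> orbit G act"
abbreviation "M \<equiv> quotient_space G act (zariski_space X \<Phi>)"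
abbreviation "Z L \<equiv> zero_locus N (P L)"

lemma U_sub: "L \<in> I \<Longrightarrow> U L \<subseteq> X"
  by (subst cover) blast

lemma orbit_iff: "x \<in> X \<Longrightarrow> y \<in> X \<Longrightarrow> y \<in> orb x \<longleftrightarrow> orb y = orb x"
  using orbit_eq orbit_refl by blast

lemma topspace_M: "topspace (fs_top M) = orb ` X"
  by (auto simp: quotient_space_def topspace_quotient_topology topspace_zariski_space orbits_def)

lemma cover_orb: "orb ` X = (\<Union>L\<in>I. orb ` U L)"
  by (simp only: cover image_UN)

lemma openin_M: "openin (fs_top M) V \<longleftrightarrow> V \<subseteq> orb ` X \<and> openin (zariski_topology X \<Phi>) {x\<in>X. orb x \<in> V}"
proof -
  have "orbits G X act = orb ` X" by (auto simp: orbits_def)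
  then show ?thesis
    by (simp add: quotient_space_def openin_quotient_topology topspace_zariski
      quotient_preimage_def fs_top_zariski_space)
qed

lemma reg_M: "h \<in> fs_reg M V \<longleftrightarrow> (\<lambda>x. h (orb x)) \<in> reg X \<Phi> {x\<in>X. orb x \<in> V}"
  by (simp add: quotient_space_def quotient_preimage_def topspace_zariski_space fs_reg_zariski_space)

lemma orb_in_image_U: "L \<in> I \<Longrightarrow> x \<in> X \<Longrightarrow> orb x \<in> orb ` U L \<longleftrightarrow> x \<in> U L"
  using U_inv orbit_refl U_sub by (metis (no_types, lifting) image_iff subsetD)

lemma preimage_image_U: "L \<in> I \<Longrightarrow> {x\<in>X. orb x \<in> orb ` U L} = U L"
  using orb_in_image_U U_sub by blast

lemma open_image_U: "L \<in> I \<Longrightarrow> openin (fs_top M) (orb ` U L)"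
  unfolding openin_M preimage_image_U using U_open U_sub by blast

text \<open>The map that \<open>\<rho> L\<close> induces on orbits.\<close>

definition chart :: "'i \<Rightarrow> 'a set \<Rightarrow> complex vec" where
  "chart L c = \<rho> L (SOME x. x \<in> c)"

lemma chart_orb: "L \<in> I \<Longrightarrow> x \<in> U L \<Longrightarrow> chart L (orb x) = \<rho> L x"
proof -
  assume L: "L \<in> I" and x: "x \<in> U L"
  then have "x \<in> orb x" using U_sub orbit_refl by blast
  then have "(SOME y. y \<in> orb x) \<in> orb x" by (rule someI)
  then show ?thesis unfolding chart_def by (rule \<rho>_inv[OF L x])
qed

lemma chart_in: "L \<in> I \<Longrightarrow> c \<in> orb ` U L \<Longrightarrow> chart L c \<in> Z L"
  using chart_orb \<rho>_in by auto

lemma chart_reg: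
  assumes L: "L \<in> I" and i: "i < N" shows "(\<lambda>c. chart L c $ i) \<in> fs_reg M (orb ` U L)"
proof -
  interpret fun_alg "U L" "reg X \<Phi> (U L)" by (rule fun_alg_reg[OF U_open[OF L]])
  show ?thesis
    unfolding reg_M preimage_image_U[OF L]
    by (rule cong[OF \<rho>_reg[OF L i]]) (simp add: chart_orb[OF L])
qed

lemma \<rho>_coord: "L \<in> I \<Longrightarrow> \<psi> \<in> vec_coords N \<Longrightarrow> (\<lambda>x. \<psi> (\<rho> L x)) \<in> reg X \<Phi> (U L)"
  using \<rho>_reg by (auto simp: vec_coords_def)

lemma orb_\<sigma>_chart: "L \<in> I \<Longrightarrow> c \<in> orb ` U L \<Longrightarrow> orb (\<sigma> L (chart L c)) = c"
proof -
  assume L: "L \<in> I" and "c \<in> orb ` U L"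
  then obtain x where x: "x \<in> U L" "c = orb x" by blast
  then have "x \<in> X" using U_sub[OF L] by blast
  from orbit_eq[OF this \<sigma>_\<rho>[OF L x(1)]] show ?thesis
    unfolding x(2) chart_orb[OF L x(1)] .
qed

lemma \<sigma>_reg:
  assumes L: "L \<in> I" and \<phi>: "\<phi> \<in> \<Phi>"
  shows "(\<lambda>z. \<phi> (\<sigma> L z)) \<in> reg (Z L) (vec_coords N) (Z L)"
proof -
  have o: "openin (zariski_topology (Z L) (vec_coords N)) (Z L)"
    using openin_topspace[of "zariski_topology (Z L) (vec_coords N)"] by (simp add: topspace_zariski)
  interpret fun_alg "Z L" "reg (Z L) (vec_coords N) (Z L)" by (rule fun_alg_reg[OF o])
  obtain p where "p \<in> poly_funs (vec_coords N)" "\<forall>z\<in>Z L. \<phi> (\<sigma> L z) = p z"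
    using \<sigma>_poly[OF L \<phi>] by (auto simp: poly_on_def)
  then show ?thesis using cong[OF poly_reg[OF o]] by metis
qed

text \<open>
  The slice meets every orbit in \<open>U L\<close> exactly once, so \<open>\<rho> L\<close>
  descends to the quotient, and \<open>\<sigma> L\<close> followed by the projection is the
  inverse.
\<close>

lemma chart_iso:
  assumes L: "L \<in> I"
  shows "fs_isomorphic (fs_restrict M (orb ` U L)) (affine_closed_space N (P L))"
  unfolding fs_isomorphic_def
proof (intro exI conjI)
  let ?A = "affine_closed_space N (P L)" and ?R = "fs_restrict M (orb ` U L)"
  have topA: "fs_top ?A = zariski_topology (Z L) (vec_coords N)"
    and regA: "fs_reg ?A V = reg (Z L) (vec_coords N) V" for V
    by (simp_all add: affine_closed_space_def fs_top_zariski_space fs_reg_zariski_space)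
  have topR: "topspace (fs_top ?R) = orb ` U L"
    using U_sub[OF L] by (auto simp: fs_restrict_def topspace_M)
  have openR: "openin (fs_top ?R) V \<longleftrightarrow> V \<subseteq> orb ` U L \<and> openin (zariski_topology X \<Phi>) {x\<in>U L. orb x \<in> V}" for V
  proof -
    have *: "openin (fs_top ?R) V \<longleftrightarrow> openin (fs_top M) V \<and> V \<subseteq> orb ` U L"
      by (simp add: fs_restrict_def openin_open_subtopology[OF open_image_U[OF L]])
    show ?thesis
    proof (cases "V \<subseteq> orb ` U L")
      case True
      then have "{x\<in>X. orb x \<in> V} = {x\<in>U L. orb x \<in> V}" and "V \<subseteq> orb ` X"
        using U_sub[OF L] orb_in_image_U[OF L] by (blast, blast)
      then show ?thesis using * True by (simp add: openin_M)
    qed (use * in simp)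
  qed
  have o: "openin (zariski_topology (Z L) (vec_coords N)) (Z L)"
    using openin_topspace[of "zariski_topology (Z L) (vec_coords N)"] by (simp add: topspace_zariski)
  show "fs_morphism ?R ?A (chart L)"
    unfolding fs_morphism_def
  proof (intro conjI allI impI)
    show "continuous_map (fs_top ?R) (fs_top ?A) (chart L)"
      unfolding continuous_map_def
    proof (intro conjI allI impI)
      show "chart L \<in> topspace (fs_top ?R) \<rightarrow> topspace (fs_top ?A)"
        using chart_in[OF L] by (auto simp: topR topA topspace_zariski)
      fix V assume V: "openin (fs_top ?A) V"
      have "openin (zariski_topology X \<Phi>) {x\<in>U L. \<rho> L x \<in> V}"
        by (rule reg_map_open[where f = "\<rho> L" and \<Psi> = "vec_coords N" and Z = "Z L"])
          (use V U_open[OF L] \<rho>_coord[OF L] \<rho>_in[OF L] in \<open>auto simp: topA\<close>)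
      moreover have "{x\<in>U L. orb x \<in> {c \<in> topspace (fs_top ?R). chart L c \<in> V}} = {x\<in>U L. \<rho> L x \<in> V}"
        using chart_orb[OF L] by (auto simp: topR)
      ultimately show "openin (fs_top ?R) {c \<in> topspace (fs_top ?R). chart L c \<in> V}"
        unfolding openR by (auto simp: topR)
    qed
    fix V h assume Vh: "openin (fs_top ?A) V \<and> h \<in> fs_reg ?A V"
    let ?V = "{c \<in> topspace (fs_top ?R). chart L c \<in> V}"
    have pre: "{x\<in>X. orb x \<in> ?V} = {x\<in>U L. \<rho> L x \<in> V}"
    proof -
      have "{x\<in>X. orb x \<in> ?V} = {x\<in>X. x \<in> U L \<and> chart L (orb x) \<in> V}"
        using orb_in_image_U[OF L] by (auto simp only: topR mem_Collect_eq)
      then show ?thesis using chart_orb[OF L] U_sub[OF L] by auto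
    qed
    have opn: "openin (zariski_topology X \<Phi>) {x\<in>U L. \<rho> L x \<in> V}"
      by (rule reg_map_open[where f = "\<rho> L" and \<Psi> = "vec_coords N" and Z = "Z L"])
        (use Vh U_open[OF L] \<rho>_coord[OF L] \<rho>_in[OF L] in \<open>auto simp: topA\<close>)
    have "(\<lambda>x. h (\<rho> L x)) \<in> reg X \<Phi> {x\<in>U L. \<rho> L x \<in> V}"
      by (rule reg_map_pullback[where f = "\<rho> L" and \<Psi> = "vec_coords N" and Z = "Z L"])
        (use Vh U_open[OF L] \<rho>_coord[OF L] \<rho>_in[OF L] in \<open>auto simp: regA\<close>)
    then have "(\<lambda>x. h (chart L (orb x))) \<in> reg X \<Phi> {x\<in>U L. \<rho> L x \<in> V}"
      by (rule fun_alg.cong[OF fun_alg_reg[OF opn]]) (simp add: chart_orb[OF L])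
    then have "(\<lambda>c. h (chart L c)) \<in> fs_reg M ?V"
      unfolding reg_M pre .
    then show "h \<circ> chart L \<in> fs_reg ?R ?V"
      by (simp add: fs_restrict_def comp_def)
  qed
  show "fs_morphism ?A ?R (\<lambda>z. orb (\<sigma> L z))"
    unfolding fs_morphism_def
  proof (intro conjI allI impI)
    have in_orb: "orb (\<sigma> L z) \<in> orb ` U L" if "z \<in> Z L" for z using \<sigma>_in[OF L that] by auto
    show "continuous_map (fs_top ?A) (fs_top ?R) (\<lambda>z. orb (\<sigma> L z))"
      unfolding continuous_map_def
    proof (intro conjI allI impI)
      show "(\<lambda>z. orb (\<sigma> L z)) \<in> topspace (fs_top ?A) \<rightarrow> topspace (fs_top ?R)"
        using in_orb by (auto simp: topR topA topspace_zariski)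
      fix V assume "openin (fs_top ?R) V"
      then have V: "openin (zariski_topology X \<Phi>) {x\<in>U L. orb x \<in> V}" by (simp add: openR)
      have "openin (zariski_topology (Z L) (vec_coords N)) {z\<in>Z L. \<sigma> L z \<in> {x\<in>U L. orb x \<in> V}}"
        by (rule reg_map_open[where \<Psi> = \<Phi> and Z = X, OF o _ _ V])
          (use \<sigma>_reg[OF L] \<sigma>_in[OF L] U_sub[OF L] in auto)
      then show "openin (fs_top ?A) {z \<in> topspace (fs_top ?A). orb (\<sigma> L z) \<in> V}"
        using \<sigma>_in[OF L] by (simp add: topA topspace_zariski conj_commute cong: conj_cong)
    qed
    fix V h assume Vh: "openin (fs_top ?R) V \<and> h \<in> fs_reg ?R V"
    then have h: "(\<lambda>x. h (orb x)) \<in> reg X \<Phi> {x\<in>X. orb x \<in> V}"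
      by (simp add: fs_restrict_def reg_M)
    have "(\<lambda>z. h (orb (\<sigma> L z))) \<in> reg (Z L) (vec_coords N) {z\<in>Z L. \<sigma> L z \<in> {x\<in>X. orb x \<in> V}}"
      by (rule reg_map_pullback[where \<Psi> = \<Phi> and Z = X and f = "\<sigma> L", OF o _ _ h])
        (use \<sigma>_reg[OF L] \<sigma>_in[OF L] U_sub[OF L] in auto)
    moreover have "{z\<in>Z L. \<sigma> L z \<in> {x\<in>X. orb x \<in> V}} = {z\<in>Z L. orb (\<sigma> L z) \<in> V}"
      using \<sigma>_in[OF L] U_sub[OF L] by blast
    ultimately show "h \<circ> (\<lambda>z. orb (\<sigma> L z)) \<in> fs_reg ?A {z \<in> topspace (fs_top ?A). orb (\<sigma> L z) \<in> V}"
      by (simp add: regA topA topspace_zariski comp_def)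
  qed
  show "\<forall>c\<in>topspace (fs_top ?R). orb (\<sigma> L (chart L c)) = c"
    unfolding topR using orb_\<sigma>_chart[OF L] by blast
  show "\<forall>z\<in>topspace (fs_top ?A). chart L (orb (\<sigma> L z)) = z"
    using chart_orb[OF L \<sigma>_in[OF L]] \<rho>_\<sigma>[OF L] by (simp add: topA topspace_zariski)
qed

text \<open>
  Two morphisms into the quotient lift locally through the slices. The orbit equations evaluated
  at the lifts are regular functions, and the morphisms differ exactly where one of these is
  nonzero.
\<close>

lemma separated_M: "separated M"
  unfolding separated_def
proof (intro allI impI)
  fix K Q \<phi> \<psi>
  let ?A = "affine_closed_space K Q" and ?T = "zariski_topology (zero_locus K Q) (vec_coords K)"
  let ?Z = "zero_locus K Q"
  assume "Q \<subseteq> poly_funs (vec_coords K) \<and> fs_morphism ?A M \<phi> \<and> fs_morphism ?A M \<psi>"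
  then have mor: "fs_morphism ?A M \<phi>" "fs_morphism ?A M \<psi>" by auto
  have topA: "fs_top ?A = ?T" and regA: "fs_reg ?A V = reg ?Z (vec_coords K) V" for V
    by (simp_all add: affine_closed_space_def fs_top_zariski_space fs_reg_zariski_space)
  have im: "\<phi> z \<in> orb ` X" "\<psi> z \<in> orb ` X" if "z \<in> ?Z" for z
    using mor that
    by (auto simp: fs_morphism_def continuous_map_def topA topspace_zariski topspace_M)
  have pull: "openin ?T {z\<in>?Z. f z \<in> orb ` U L}"
    "j < N \<Longrightarrow> (\<lambda>z. chart L (f z) $ j) \<in> reg ?Z (vec_coords K) {z\<in>?Z. f z \<in> orb ` U L}"
    if f: "fs_morphism ?A M f" and L: "L \<in> I" for f L j
  proof -
    show "openin ?T {z\<in>?Z. f z \<in> orb ` U L}"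
      using f open_image_U[OF L]
      by (auto simp: fs_morphism_def continuous_map_def topA topspace_zariski)
    show "(\<lambda>z. chart L (f z) $ j) \<in> reg ?Z (vec_coords K) {z\<in>?Z. f z \<in> orb ` U L}" if "j < N"
      using f open_image_U[OF L] chart_reg[OF L that]
      unfolding fs_morphism_def topA topspace_zariski regA comp_def by auto
  qed
  have "openin ?T {z\<in>?Z. \<phi> z \<noteq> \<psi> z}"
  proof (subst openin_subopen, intro ballI)
    fix z0 assume "z0 \<in> {z\<in>?Z. \<phi> z \<noteq> \<psi> z}"
    then have z0: "z0 \<in> ?Z" "\<phi> z0 \<noteq> \<psi> z0" by auto
    obtain L L' where L: "L \<in> I" "\<phi> z0 \<in> orb ` U L" and L': "L' \<in> I" "\<psi> z0 \<in> orb ` U L'"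
      using im[OF z0(1)] unfolding cover_orb by blast
    define V where "V = {z\<in>?Z. \<phi> z \<in> orb ` U L} \<inter> {z\<in>?Z. \<psi> z \<in> orb ` U L'}"
    have V: "openin ?T V"
      unfolding V_def using pull(1)[OF mor(1) L(1)] pull(1)[OF mor(2) L'(1)] by blast
    interpret fun_alg V "reg ?Z (vec_coords K) V" by (rule fun_alg_reg[OF V])
    \<comment> \<open>Local lifts of the two morphisms to points of \<open>X\<close>.\<close>
    define a where "a z = \<sigma> L (chart L (\<phi> z))" for z
    define b where "b z = \<sigma> L' (chart L' (\<psi> z))" for z
    have lift: "(\<lambda>z. \<eta> (\<sigma> L (chart L (f z)))) \<in> reg ?Z (vec_coords K) V"
      if h: "\<eta> \<in> \<Phi>" "fs_morphism ?A M f" "L \<in> I" "V \<subseteq> {z\<in>?Z. f z \<in> orb ` U L}" for \<eta> f L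
    proof -
      obtain p where p: "p \<in> poly_funs (vec_coords N)" "\<forall>z\<in>Z L. \<eta> (\<sigma> L z) = p z"
        using \<sigma>_poly[OF h(3,1)] by (auto simp: poly_on_def)
      have "(\<lambda>z. p (chart L (f z))) \<in> reg ?Z (vec_coords K) V"
      proof (rule poly_comp[OF p(1)])
        fix \<psi> assume "\<psi> \<in> vec_coords N"
        then obtain j where j: "j < N" "\<psi> = (\<lambda>x. x $ j)" by (auto simp: vec_coords_def)
        show "(\<lambda>z. \<psi> (chart L (f z))) \<in> reg ?Z (vec_coords K) V"
          unfolding j(2) by (rule reg_restrict[OF pull(2)[OF h(2,3) j(1)] V h(4)])
      qed
      then show ?thesis
        by (rule cong) (use p(2) chart_in[OF h(3)] h(4) in auto)
    qed
    have ab: "a z \<in> X" "orb (a z) = \<phi> z" "b z \<in> X" "orb (b z) = \<psi> z" if "z \<in> V" for z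
      using that chart_in[OF L(1), of "\<phi> z"] chart_in[OF L'(1), of "\<psi> z"] \<sigma>_in[OF L(1)] \<sigma>_in[OF L'(1)]
        U_sub[OF L(1)] U_sub[OF L'(1)] orb_\<sigma>_chart[OF L(1)] orb_\<sigma>_chart[OF L'(1)]
      unfolding a_def b_def V_def by auto
    have e_reg: "(\<lambda>z. e (a z, b z)) \<in> reg ?Z (vec_coords K) V" if e: "e \<in> E L" for e
    proof -
      obtain p where p: "p \<in> poly_funs (pair_coords \<Phi>)" "\<forall>q\<in>X \<times> X. e q = p q"
        using E_poly[OF L(1) e] by (auto simp: poly_on_def)
      have "(\<lambda>z. p (a z, b z)) \<in> reg ?Z (vec_coords K) V"
      proof (rule poly_comp[OF p(1)])
        fix \<eta> assume "\<eta> \<in> pair_coords \<Phi>"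
        then obtain \<eta>' where "\<eta>' \<in> \<Phi>" "\<eta> = (\<lambda>p. \<eta>' (fst p)) \<or> \<eta> = (\<lambda>p. \<eta>' (snd p))"
          by (auto simp: pair_coords_def)
        then show "(\<lambda>z. \<eta> (a z, b z)) \<in> reg ?Z (vec_coords K) V"
          using lift[of \<eta>' \<phi> L] lift[of \<eta>' \<psi> L'] mor L(1) L'(1)
          unfolding a_def b_def V_def by auto
      qed
      then show ?thesis by (rule cong) (use p(2) ab in auto)
    qed
    have z0V: "z0 \<in> V" using z0 L L' by (auto simp: V_def)
    have key: "\<phi> z = \<psi> z \<longleftrightarrow> (\<forall>e\<in>E L. e (a z, b z) = 0)" if z: "z \<in> V" for z
    proof -
      have "b z \<in> orb (a z) \<longleftrightarrow> (\<forall>e\<in>E L. e (a z, b z) = 0)"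
        unfolding a_def using z chart_in[OF L(1), of "\<phi> z"] ab(3)[OF z]
        by (intro E_orbit L(1)) (auto simp: V_def)
      then show ?thesis using orbit_iff[of "a z" "b z"] ab[OF z] by auto
    qed
    then obtain e where e: "e \<in> E L" "e (a z0, b z0) \<noteq> 0" using z0 z0V by blast
    have "openin ?T {z\<in>V. e (a z, b z) \<noteq> 0}"
      by (rule openin_reg_nonzero[OF V e_reg[OF e(1)]])
    moreover have "{z\<in>V. e (a z, b z) \<noteq> 0} \<subseteq> {z\<in>?Z. \<phi> z \<noteq> \<psi> z}"
      using key e(1) by (auto simp: V_def)
    ultimately show "\<exists>T. openin ?T T \<and> z0 \<in> T \<and> T \<subseteq> {z\<in>?Z. \<phi> z \<noteq> \<psi> z}"
      using z0V e(2) by blast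
  qed
  moreover have "topspace ?T - {z\<in>?Z. \<phi> z = \<psi> z} = {z\<in>?Z. \<phi> z \<noteq> \<psi> z}"
    by (auto simp: topspace_zariski)
  ultimately show "closedin (fs_top ?A) {z\<in>?Z. \<phi> z = \<psi> z}"
    unfolding closedin_def topA by (auto simp: topspace_zariski)
qed

theorem variety_M: "variety M"
  unfolding variety_def
proof (intro conjI separated_M exI ballI)
  show "finite ((\<lambda>L. orb ` U L) ` I)" using fin by simp
  show "\<Union>((\<lambda>L. orb ` U L) ` I) = topspace (fs_top M)" unfolding topspace_M cover_orb by blast
  fix V assume "V \<in> (\<lambda>L. orb ` U L) ` I"
  then obtain L where L: "L \<in> I" "V = orb ` U L" by auto
  show "openin (fs_top M) V" using L open_image_U by simp
  show "affine_variety (fs_restrict M V)"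
    unfolding affine_variety_def L(2)
    by (intro exI[of _ N] exI[of _ "P L"] conjI P_poly chart_iso L(1))
qed

theorem smooth_M:
  assumes N: "\<And>L. L \<in> I \<Longrightarrow> N = n + length (ps L)" and ps: "\<And>L. L \<in> I \<Longrightarrow> P L = set (ps L)"
    and rank: "\<And>L z. L \<in> I \<Longrightarrow> z \<in> Z L \<Longrightarrow>
      vec_space.rank (length (ps L)) (jacobian N (ps L) z) = length (ps L)"
  shows "smooth_of_dim n M"
  unfolding smooth_of_dim_def
proof (intro ballI)
  fix c assume "c \<in> topspace (fs_top M)"
  then obtain L where L: "L \<in> I" "c \<in> orb ` U L" unfolding topspace_M cover_orb by blast
  let ?A = "affine_closed_space N (P L)"
  have res: "fs_restrict ?A (Z L) = ?A"
    by (simp add: fs_restrict_def affine_closed_space_def fs_top_zariski_space zariski_space_def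
        subtopology_topspace[of "zariski_topology (Z L) (vec_coords N)", unfolded topspace_zariski])
  have "openin (fs_top ?A) (Z L)"
    using openin_topspace[of "fs_top ?A"]
    by (simp add: affine_closed_space_def fs_top_zariski_space topspace_zariski)
  then have oZ: "openin (fs_top ?A) (Z L)" .
  show "\<exists>U ps W. openin (fs_top M) U \<and> c \<in> U \<and>
        set ps \<subseteq> poly_funs (vec_coords (n + length ps)) \<and>
        openin (fs_top (affine_closed_space (n + length ps) (set ps))) W \<and>
        (\<forall>w \<in> W. vec_space.rank (length ps) (jacobian (n + length ps) ps w) = length ps) \<and>
        fs_isomorphic (fs_restrict M U)
          (fs_restrict (affine_closed_space (n + length ps) (set ps)) W)"
    unfolding ps[OF L(1)] N[OF L(1)]
  proof (rule_tac exI[of _ "orb ` U L"], rule_tac exI[of _ "ps L"], rule_tac exI[of _ "Z L"], intro conjI)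
    show "openin (fs_top M) (orb ` U L)" "c \<in> orb ` U L" by (rule open_image_U[OF L(1)], rule L(2))
    show "set (ps L) \<subseteq> poly_funs (vec_coords (n + length (ps L)))"
      using P_poly[OF L(1)] unfolding ps[OF L(1)] N[OF L(1)] .
    show "openin (fs_top (affine_closed_space (n + length (ps L)) (set (ps L)))) (Z L)"
      using oZ unfolding ps[OF L(1)] N[OF L(1)] .
    show "\<forall>w\<in>Z L. vec_space.rank (length (ps L)) (jacobian (n + length (ps L)) (ps L) w) = length (ps L)"
      using rank[OF L(1)] unfolding N[OF L(1)] by blast
    show "fs_isomorphic (fs_restrict M (orb ` U L))
       (fs_restrict (affine_closed_space (n + length (ps L)) (set (ps L))) (Z L))"
      using chart_iso[OF L(1)] res unfolding ps[OF L(1)] N[OF L(1)] by simp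
  qed
qed

end


section \<open>Linear algebra of coordinate spaces\<close>

lemma mult_mat_vec_index:
  "A \<in> carrier_mat n m \<Longrightarrow> v \<in> carrier_vec m \<Longrightarrow> i < n \<Longrightarrow> (A *\<^sub>v v) $ i = (\<Sum>j<m. A $$ (i, j) * v $ j)"
  by (auto simp: mult_mat_vec_def scalar_prod_def lessThan_atLeast0 intro!: sum.cong)

lemma mult_mat_index:
  "A \<in> carrier_mat n k \<Longrightarrow> B \<in> carrier_mat k m \<Longrightarrow> i < n \<Longrightarrow> j < m \<Longrightarrow>
    (A * B) $$ (i, j) = (\<Sum>l<k. A $$ (i, l) * B $$ (l, j))"
  by (auto simp: scalar_prod_def lessThan_atLeast0 intro!: sum.cong)

text \<open>Padding with zero rows gives a square matrix with determinant zero.\<close>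

lemma wide_matrix_kernel:
  fixes A :: "complex mat"
  assumes A: "A \<in> carrier_mat r c" and rc: "r < c"
  shows "\<exists>a\<in>carrier_vec c. a \<noteq> 0\<^sub>v c \<and> A *\<^sub>v a = 0\<^sub>v r"
proof -
  define B where "B = mat c c (\<lambda>(i, j). if i < r then A $$ (i, j) else 0)"
  have B: "B \<in> carrier_mat c c" by (simp add: B_def)
  have "det B = (\<Sum>p\<in>{p. p permutes {0..<c}}. signof p * (\<Prod>i = 0..<c. B $$ (i, p i)))"
    by (rule det_def'[OF B])
  also have "\<dots> = 0"
  proof (intro sum.neutral ballI)
    fix p assume "p \<in> {p. p permutes {0..<c}}"
    then have "p r < c" using permutes_in_image[of p "{0..<c}" r] rc by auto
    then have "B $$ (r, p r) = 0" using rc by (simp add: B_def)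
    then have "(\<Prod>i = 0..<c. B $$ (i, p i)) = 0" using rc by (intro prod_zero) auto
    then show "signof p * (\<Prod>i = 0..<c. B $$ (i, p i)) = 0" by simp
  qed
  finally have "det B = 0" .
  then obtain a where a: "a \<in> carrier_vec c" "a \<noteq> 0\<^sub>v c" "B *\<^sub>v a = 0\<^sub>v c"
    using det_0_iff_vec_prod_zero[OF B] by auto
  have "A *\<^sub>v a = 0\<^sub>v r"
  proof (rule eq_vecI)
    fix i assume "i < dim_vec (0\<^sub>v r :: complex vec)"
    then have i: "i < r" "i < c" using rc by auto
    have "(A *\<^sub>v a) $ i = (B *\<^sub>v a) $ i"
      unfolding mult_mat_vec_index[OF A a(1) i(1)] mult_mat_vec_index[OF B a(1) i(2)]
      using i by (intro sum.cong) (auto simp: B_def)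
    then show "(A *\<^sub>v a) $ i = 0\<^sub>v r $ i" using a(3) i by simp
  qed (use A in auto)
  then show ?thesis using a by blast
qed

lemma left_kernel_trivial_right_inverse:
  fixes A :: "complex mat"
  assumes A: "A \<in> carrier_mat c N"
    and ker: "\<And>y. (\<And>i. i < N \<Longrightarrow> (\<Sum>r<c. y r * A $$ (r, i)) = 0) \<Longrightarrow> (\<And>r. r < c \<Longrightarrow> y r = 0)"
  shows "\<exists>R\<in>carrier_mat N c. A * R = 1\<^sub>m c"
proof -
  \<comment> \<open>The Gram matrix \<open>A * H\<close> of the rows is invertible.\<close>
  define H where "H = mat N c (\<lambda>(i, j). cnj (A $$ (j, i)))"
  have H: "H \<in> carrier_mat N c" by (simp add: H_def)
  have AH: "A * H \<in> carrier_mat c c" using A H by simp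
  have "det (A * H) \<noteq> 0"
  proof
    assume "det (A * H) = 0"
    then obtain y where y: "y \<in> carrier_vec c" "y \<noteq> 0\<^sub>v c" "(A * H) *\<^sub>v y = 0\<^sub>v c"
      using det_0_iff_vec_prod_zero[OF AH] by auto
    define b where "b = H *\<^sub>v y"
    have b: "b \<in> carrier_vec N" using H y by (simp add: b_def)
    have Ab: "A *\<^sub>v b = 0\<^sub>v c" using y(3) A H y(1) by (simp add: b_def)
    have bi: "b $ i = (\<Sum>r<c. cnj (A $$ (r, i)) * y $ r)" if "i < N" for i
      using that by (simp add: b_def mult_mat_vec_index[OF H y(1)]) (simp add: H_def)
    have "(\<Sum>i<N. b $ i * cnj (b $ i)) = (\<Sum>i<N. \<Sum>r<c. cnj (y $ r) * (A $$ (r, i) * b $ i))"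
      by (intro sum.cong refl) (simp add: bi sum_distrib_left mult_ac)
    also have "\<dots> = (\<Sum>r<c. cnj (y $ r) * (\<Sum>i<N. A $$ (r, i) * b $ i))"
      by (subst sum.swap) (simp add: sum_distrib_left)
    also have "\<dots> = (\<Sum>r<c. cnj (y $ r) * (A *\<^sub>v b) $ r)"
      by (intro sum.cong refl) (simp add: mult_mat_vec_index[OF A b])
    also have "\<dots> = 0" unfolding Ab by simp
    finally have "complex_of_real (\<Sum>i<N. (cmod (b $ i))\<^sup>2) = 0"
      by (simp add: complex_norm_square[symmetric])
    then have "(\<Sum>i<N. (cmod (b $ i))\<^sup>2) = 0" by (simp only: of_real_eq_0_iff)
    then have b0: "b $ i = 0" if "i < N" for i
      using that by (simp add: sum_nonneg_eq_0_iff)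
    have "cnj (y $ r) = 0" if "r < c" for r
    proof (rule ker[OF _ that])
      fix i assume i: "i < N"
      have "(\<Sum>r<c. cnj (y $ r) * A $$ (r, i)) = cnj (b $ i)" by (simp add: bi[OF i] mult_ac)
      then show "(\<Sum>r<c. cnj (y $ r) * A $$ (r, i)) = 0" using b0[OF i] by simp
    qed
    then have "y = 0\<^sub>v c" using y(1) by (intro eq_vecI) auto
    then show False using y(2) by simp
  qed
  from minv[OF AH this] have "minv (A * H) \<in> carrier_mat c c" "A * (H * minv (A * H)) = 1\<^sub>m c"
    using A H by (auto simp: assoc_mult_mat[of A c N H c])
  then show ?thesis using H by (intro bexI[of _ "H * minv (A * H)"]) auto
qed

text \<open>
  Full row rank means that every unit vector is in the column space; preimages of the unit vectors
  are the columns of a right inverse.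
\<close>

lemma (in vec_space) rank_eq_iff_right_inverse:
  assumes A: "A \<in> carrier_mat n nc"
  shows "rank A = n \<longleftrightarrow> (\<exists>R\<in>carrier_mat nc n. A * R = 1\<^sub>m n)"
proof
  have sub: "set (cols A) \<subseteq> carrier_vec n" using A cols_dim by blast
  have cs: "span (set (cols A)) = {y\<in>carrier_vec n. \<exists>x\<in>carrier_vec nc. A *\<^sub>v x = y}"
    using col_space_eq[OF A] A by (simp add: col_space_def)
  {
    assume r: "rank A = n"
    obtain S where S: "maximal S (\<lambda>T. T \<subseteq> set (cols A) \<and> lin_indpt T)" "finite S"
      using maximal_exists_superset[of "set (cols A)" "\<lambda>T. T \<subseteq> set (cols A) \<and> lin_indpt T" "{}"]
        finite_lin_indpt2[of "{}"] by auto
    then have S': "S \<subseteq> set (cols A)" "lin_indpt S" by (simp_all add: maximal_def)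
    have "card S = n" using rank_card_indpt[OF A S(1)] r by simp
    then have "basis S"
      using dim_li_is_basis[OF fin_dim S(2) _ S'(2)] S'(1) sub by (auto simp: dim_is_n)
    then have "span S = carrier_vec n" by (simp add: basis_def)
    then have full: "carrier_vec n \<subseteq> span (set (cols A))" using span_is_monotone[OF S'(1)] by simp
    have "\<exists>x. x \<in> carrier_vec nc \<and> A *\<^sub>v x = unit_vec n j" for j
    proof -
      have "unit_vec n j \<in> span (set (cols A))" using full by auto
      then show ?thesis unfolding cs by auto
    qed
    then obtain x where x: "\<And>j. j < n \<Longrightarrow> x j \<in> carrier_vec nc" "\<And>j. j < n \<Longrightarrow> A *\<^sub>v x j = unit_vec n j"
      by metis
    define R where "R = mat_of_cols nc (map x [0..<n])"
    have R: "R \<in> carrier_mat nc n" using mat_of_cols_carrier(1)[of nc "map x [0..<n]"] by (simp add: R_def)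
    have "A * R = 1\<^sub>m n"
    proof (rule mat_col_eqI)
      fix j assume "j < dim_col (1\<^sub>m n :: 'a mat)"
      then have j: "j < n" by simp
      have "col R j = x j" using x(1)[OF j] j unfolding R_def by (subst col_mat_of_cols) auto
      then show "col (A * R) j = col (1\<^sub>m n) j"
        using col_mult2[OF A R j] x(2)[OF j] j by simp
    qed (use A R in auto)
    then show "\<exists>R\<in>carrier_mat nc n. A * R = 1\<^sub>m n" using R by blast
  }
  assume "\<exists>R\<in>carrier_mat nc n. A * R = 1\<^sub>m n"
  then obtain R where R: "R \<in> carrier_mat nc n" "A * R = 1\<^sub>m n" by blast
  have "span (set (cols A)) = carrier_vec n"
  proof -
    have "y \<in> span (set (cols A))" if y: "y \<in> carrier_vec n" for y
    proof -
      have "A *\<^sub>v (R *\<^sub>v y) = y" using R A y by (simp flip: assoc_mult_mat_vec)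
      then show ?thesis unfolding cs using y R(1) by auto
    qed
    then show ?thesis using cs by auto
  qed
  then have "span_vs (set (cols A)) = V" by simp
  then show "rank A = n" unfolding rank_def using dim_is_n by simp
qed

text \<open>
  The kernel of \<open>J1\<close> has dimension at least \<open>N1 - c1\<close>, that of
  \<open>J2\<close> dimension exactly \<open>N2 - c2\<close>, and \<open>D\<close> embeds the one
  into the other.
\<close>

lemma kernel_embedding_dim_le:
  fixes J1 J2 D :: "complex mat"
  assumes J1: "J1 \<in> carrier_mat c1 N1" and J2: "J2 \<in> carrier_mat c2 N2" and R2: "R2 \<in> carrier_mat N2 c2"
    and JR2: "J2 * R2 = 1\<^sub>m c2" and D: "D \<in> carrier_mat N2 N1"
    and into: "\<And>v. v \<in> carrier_vec N1 \<Longrightarrow> J1 *\<^sub>v v = 0\<^sub>v c1 \<Longrightarrow> J2 *\<^sub>v (D *\<^sub>v v) = 0\<^sub>v c2"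
    and inj: "\<And>v. v \<in> carrier_vec N1 \<Longrightarrow> J1 *\<^sub>v v = 0\<^sub>v c1 \<Longrightarrow> D *\<^sub>v v = 0\<^sub>v N2 \<Longrightarrow> v = 0\<^sub>v N1"
  shows "N1 + c2 \<le> c1 + N2"
proof (rule ccontr)
  assume "\<not> ?thesis"
  then have lt: "c1 + N2 < N1 + c2" by simp
  let ?B = "four_block_mat J1 (0\<^sub>m c1 c2) D R2"
  have "?B \<in> carrier_mat (c1 + N2) (N1 + c2)" using J1 D R2 by simp
  from wide_matrix_kernel[OF this lt] obtain a where
    a: "a \<in> carrier_vec (N1 + c2)" "a \<noteq> 0\<^sub>v (N1 + c2)" "?B *\<^sub>v a = 0\<^sub>v (c1 + N2)" by blast
  define v u where "v = vec_first a N1" and "u = vec_last a c2"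
  have v: "v \<in> carrier_vec N1" and u: "u \<in> carrier_vec c2" by (simp_all add: v_def u_def)
  have avu: "a = v @\<^sub>v u" using a(1) by (simp add: v_def u_def)
  have z: "0\<^sub>v (m + n) = (0\<^sub>v m @\<^sub>v 0\<^sub>v n :: complex vec)" for m n
    by (intro eq_vecI) auto
  have "(J1 *\<^sub>v v + 0\<^sub>m c1 c2 *\<^sub>v u) @\<^sub>v (D *\<^sub>v v + R2 *\<^sub>v u) = 0\<^sub>v c1 @\<^sub>v 0\<^sub>v N2"
    using a(3) four_block_mat_mult_vec[OF J1 zero_carrier_mat D R2 v u] unfolding avu z by simp
  then have "J1 *\<^sub>v v + 0\<^sub>m c1 c2 *\<^sub>v u = 0\<^sub>v c1 \<and> D *\<^sub>v v + R2 *\<^sub>v u = 0\<^sub>v N2"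
    by (rule iffD1[OF append_vec_eq[OF add_carrier_vec[OF mult_mat_vec_carrier[OF J1 v]
      mult_mat_vec_carrier[OF zero_carrier_mat u]] zero_carrier_vec]])
  then have "J1 *\<^sub>v v + 0\<^sub>m c1 c2 *\<^sub>v u = 0\<^sub>v c1" and DR: "D *\<^sub>v v + R2 *\<^sub>v u = 0\<^sub>v N2"
    by (rule conjunct1, rule conjunct2)
  moreover have "0\<^sub>m c1 c2 *\<^sub>v u = 0\<^sub>v c1" using u by (intro eq_vecI) (auto simp: scalar_prod_def)
  ultimately have Jv: "J1 *\<^sub>v v = 0\<^sub>v c1" using J1 v by simp
  have "J2 *\<^sub>v (D *\<^sub>v v + R2 *\<^sub>v u) = J2 *\<^sub>v (D *\<^sub>v v) + J2 *\<^sub>v (R2 *\<^sub>v u)"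
    using J2 D R2 v u by (intro mult_add_distrib_mat_vec) auto
  also have "\<dots> = u"
    using into[OF v Jv] J2 R2 JR2 u by (simp flip: assoc_mult_mat_vec)
  finally have "J2 *\<^sub>v 0\<^sub>v N2 = u" unfolding DR .
  then have u0: "u = 0\<^sub>v c2" using J2 by (auto simp: scalar_prod_def intro!: eq_vecI)
  moreover have "R2 *\<^sub>v 0\<^sub>v c2 = 0\<^sub>v N2" using R2 by (intro eq_vecI) (auto simp: scalar_prod_def)
  ultimately have "D *\<^sub>v v = 0\<^sub>v N2" using DR D v by simp
  then have "v = 0\<^sub>v N1" by (rule inj[OF v Jv])
  then show False using a(2) unfolding avu u0 z by simp
qed


section \<open>Uniqueness of the dimension of a smooth space\<close>

text \<open>
  Convergence by coordinates, because the type of all vectors carries no topology.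
\<close>

definition conv :: "nat \<Rightarrow> complex vec \<Rightarrow> (nat \<Rightarrow> complex vec) \<Rightarrow> bool" where
  "conv N w x \<longleftrightarrow> (\<forall>n. x n \<in> carrier_vec N) \<and> (\<forall>i<N. (\<lambda>n. x n $ i) \<longlonglongrightarrow> w $ i)"

text \<open>
  Difference quotients in several variables in the style of Hadamard. They are continuous along
  the diagonal, where they form the gradient, so they encode strict differentiability.
\<close>

definition slope :: "nat \<Rightarrow> (complex vec \<Rightarrow> complex) \<Rightarrow> (nat \<Rightarrow> complex vec \<Rightarrow> complex vec \<Rightarrow> complex) \<Rightarrow> bool" where
  "slope N p Q \<longleftrightarrow>
     (\<forall>x\<in>carrier_vec N. \<forall>y\<in>carrier_vec N. p x - p y = (\<Sum>i<N. Q i x y * (x $ i - y $ i))) \<and>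
     (\<forall>w\<in>carrier_vec N. \<forall>x y. conv N w x \<longrightarrow> conv N w y \<longrightarrow>
        (\<forall>i<N. (\<lambda>n. Q i (x n) (y n)) \<longlonglongrightarrow> Q i w w)) \<and>
     (\<forall>w\<in>carrier_vec N. \<forall>v\<in>carrier_vec N.
        ((\<lambda>t. p (w + t \<cdot>\<^sub>v v)) has_field_derivative (\<Sum>i<N. Q i w w * v $ i)) (at 0))"

lemma slope_id: "slope N p Q \<Longrightarrow> x \<in> carrier_vec N \<Longrightarrow> y \<in> carrier_vec N \<Longrightarrow>
    p x - p y = (\<Sum>i<N. Q i x y * (x $ i - y $ i))"
  by (simp add: slope_def)

lemma slope_lim: "slope N p Q \<Longrightarrow> w \<in> carrier_vec N \<Longrightarrow> conv N w x \<Longrightarrow> conv N w y \<Longrightarrow> i < N \<Longrightarrow>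
    (\<lambda>n. Q i (x n) (y n)) \<longlonglongrightarrow> Q i w w"
  by (simp add: slope_def)

lemma slope_deriv: "slope N p Q \<Longrightarrow> w \<in> carrier_vec N \<Longrightarrow> v \<in> carrier_vec N \<Longrightarrow>
    ((\<lambda>t. p (w + t \<cdot>\<^sub>v v)) has_field_derivative (\<Sum>i<N. Q i w w * v $ i)) (at 0)"
  by (simp add: slope_def)

lemma conv_const: "w \<in> carrier_vec N \<Longrightarrow> conv N w (\<lambda>_. w)"
  by (simp add: conv_def)

lemma slope_cont:
  assumes s: "slope N p Q" and w: "w \<in> carrier_vec N" and x: "conv N w x"
  shows "(\<lambda>n. p (x n)) \<longlonglongrightarrow> p w"
proof -
  have "(\<lambda>n. \<Sum>i<N. Q i (x n) w * (x n $ i - w $ i)) \<longlonglongrightarrow> (\<Sum>i<N. Q i w w * (w $ i - w $ i))"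
    by (intro tendsto_intros slope_lim[OF s w x conv_const[OF w]]) (use x in \<open>auto simp: conv_def\<close>)
  moreover have "p (x n) - p w = (\<Sum>i<N. Q i (x n) w * (x n $ i - w $ i))" for n
    using x by (intro slope_id[OF s _ w]) (simp add: conv_def)
  ultimately have "(\<lambda>n. p (x n) - p w) \<longlonglongrightarrow> 0" by simp
  then show ?thesis by (simp add: LIM_zero_iff)
qed

text \<open>
  By induction on the polynomial; a product is handled by the Leibniz rule for differences.
\<close>

lemma poly_slope:
  assumes "p \<in> poly_funs (vec_coords N)" shows "\<exists>Q. slope N p Q"
  using assms
proof induction
  case (const c)
  show ?case by (rule exI[of _ "\<lambda>_ _ _. 0"]) (simp add: slope_def)
next
  case (coord \<phi>)
  then obtain j where j: "j < N" "\<phi> = (\<lambda>x. x $ j)" by (auto simp: vec_coords_def)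
  have d: "((\<lambda>t. (w + t \<cdot>\<^sub>v v) $ j) has_field_derivative v $ j) (at 0)"
    if "w \<in> carrier_vec N" "v \<in> carrier_vec N" for w v :: "complex vec"
  proof -
    have "(\<lambda>t. (w + t \<cdot>\<^sub>v v) $ j) = (\<lambda>t. w $ j + t * v $ j)" using that j by auto
    then show ?thesis by (auto intro!: derivative_eq_intros)
  qed
  have s: "(\<Sum>i<N. (if i = j then 1 else 0) * f i) = f j" for f :: "nat \<Rightarrow> complex"
    using j(1) by (subst sum.cong[OF refl, of _ _ "\<lambda>i. if i = j then f i else 0"]) auto
  show ?case
    by (rule exI[of _ "\<lambda>i _ _. if i = j then 1 else 0"]) (auto simp: slope_def j(2) d s)
next
  case (add p q)
  then obtain Q Q' where Q: "slope N p Q" "slope N q Q'" by blast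
  show ?case
  proof (rule exI[of _ "\<lambda>i x y. Q i x y + Q' i x y"], unfold slope_def, intro conjI ballI allI impI)
    fix x y :: "complex vec" assume xy: "x \<in> carrier_vec N" "y \<in> carrier_vec N"
    have "p x + q x - (p y + q y) = (p x - p y) + (q x - q y)" by simp
    also have "\<dots> = (\<Sum>i<N. (Q i x y + Q' i x y) * (x $ i - y $ i))"
      unfolding slope_id[OF Q(1) xy] slope_id[OF Q(2) xy] by (simp only: sum.distrib[symmetric] distrib_right)
    finally show "p x + q x - (p y + q y) = (\<Sum>i<N. (Q i x y + Q' i x y) * (x $ i - y $ i))" .
  next
    fix w x y i assume "w \<in> carrier_vec N" "conv N w x" "conv N w y" "i < N"
    then show "(\<lambda>n. Q i (x n) (y n) + Q' i (x n) (y n)) \<longlonglongrightarrow> Q i w w + Q' i w w"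
      by (intro tendsto_intros slope_lim[OF Q(1)] slope_lim[OF Q(2)])
  next
    fix w v :: "complex vec" assume wv: "w \<in> carrier_vec N" "v \<in> carrier_vec N"
    show "((\<lambda>t. p (w + t \<cdot>\<^sub>v v) + q (w + t \<cdot>\<^sub>v v)) has_field_derivative
      (\<Sum>i<N. (Q i w w + Q' i w w) * v $ i)) (at 0)"
      using DERIV_add[OF slope_deriv[OF Q(1) wv] slope_deriv[OF Q(2) wv]]
      by (simp add: sum.distrib algebra_simps)
  qed
next
  case (mult p q)
  then obtain Q Q' where Q: "slope N p Q" "slope N q Q'" by blast
  show ?case
  proof (rule exI[of _ "\<lambda>i x y. p x * Q' i x y + q y * Q i x y"], unfold slope_def, intro conjI ballI allI impI)
    fix x y :: "complex vec" assume xy: "x \<in> carrier_vec N" "y \<in> carrier_vec N"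
    have "p x * q x - (p y * q y) = p x * (q x - q y) + q y * (p x - p y)" by (simp add: algebra_simps)
    also have "\<dots> = (\<Sum>i<N. (p x * Q' i x y + q y * Q i x y) * (x $ i - y $ i))"
      unfolding slope_id[OF Q(1) xy] slope_id[OF Q(2) xy]
      unfolding sum_distrib_left sum.distrib[symmetric] by (intro sum.cong refl) (simp add: algebra_simps)
    finally show "p x * q x - (p y * q y) = (\<Sum>i<N. (p x * Q' i x y + q y * Q i x y) * (x $ i - y $ i))" .
  next
    fix w x y i assume h: "w \<in> carrier_vec N" "conv N w x" "conv N w y" "i < N"
    then show "(\<lambda>n. p (x n) * Q' i (x n) (y n) + q (y n) * Q i (x n) (y n)) \<longlonglongrightarrow> p w * Q' i w w + q w * Q i w w"
      by (intro tendsto_intros slope_lim[OF Q(1)] slope_lim[OF Q(2)] slope_cont[OF Q(1)] slope_cont[OF Q(2)])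
  next
    fix w v :: "complex vec" assume wv: "w \<in> carrier_vec N" "v \<in> carrier_vec N"
    have w0: "w + 0 \<cdot>\<^sub>v v = w" using wv by (intro eq_vecI) auto
    show "((\<lambda>t. p (w + t \<cdot>\<^sub>v v) * q (w + t \<cdot>\<^sub>v v)) has_field_derivative
      (\<Sum>i<N. (p w * Q' i w w + q w * Q i w w) * v $ i)) (at 0)"
      by (rule DERIV_cong[OF DERIV_mult[OF slope_deriv[OF Q(1) wv] slope_deriv[OF Q(2) wv]]])
        (unfold w0 sum_distrib_left sum_distrib_right sum.distrib[symmetric],
          intro sum.cong refl, simp add: algebra_simps)
  qed
qed

lemma jacobian_entry:
  assumes s: "slope N (ps ! r) Q" and w: "w \<in> carrier_vec N" and ri: "r < length ps" "i < N"
  shows "jacobian N ps w $$ (r, i) = Q i w w"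
proof -
  have "(\<Sum>j<N. Q j w w * unit_vec N i $ j) = (\<Sum>j<N. if j = i then Q j w w else 0)"
    using ri by (intro sum.cong) auto
  also have "\<dots> = Q i w w" using ri by simp
  finally show ?thesis
    using DERIV_imp_deriv[OF slope_deriv[OF s w, of "unit_vec N i"]] ri by (simp add: jacobian_def)
qed

lemma jacobian_directional:
  assumes ps: "set ps \<subseteq> poly_funs (vec_coords N)" and w: "w \<in> carrier_vec N" and v: "v \<in> carrier_vec N"
    and r: "r < length ps"
  shows "((\<lambda>t. (ps ! r) (w + t \<cdot>\<^sub>v v)) has_field_derivative (\<Sum>i<N. jacobian N ps w $$ (r, i) * v $ i)) (at 0)"
proof -
  have "ps ! r \<in> poly_funs (vec_coords N)" using ps r by auto
  from poly_slope[OF this] obtain Q where Q: "slope N (ps ! r) Q" by blast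
  from slope_deriv[OF this w v] show ?thesis by (simp add: jacobian_entry[OF Q w r])
qed

text \<open>
  Sequential continuity at the diagonal point \<open>(w, w)\<close> gives uniform closeness on a
  neighbourhood.
\<close>

lemma slope_uniform:
  assumes s: "slope N p Q" and w: "w \<in> carrier_vec N" and i: "i < N" and e: "e > 0"
  shows "\<forall>\<^sub>F d in at_right 0. \<forall>x\<in>carrier_vec N. \<forall>y\<in>carrier_vec N.
    (\<forall>j<N. cmod (x $ j - w $ j) < d) \<longrightarrow> (\<forall>j<N. cmod (y $ j - w $ j) < d) \<longrightarrow> cmod (Q i x y - Q i w w) < e"
proof (rule ccontr)
  let ?P = "\<lambda>d x y. (\<forall>j<N. cmod (x $ j - w $ j) < d) \<and> (\<forall>j<N. cmod (y $ j - w $ j) < d) \<and>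
    \<not> cmod (Q i x y - Q i w w) < e"
  assume neg: "\<not> ?thesis"
  have "\<exists>x\<in>carrier_vec N. \<exists>y\<in>carrier_vec N. ?P d x y" if d: "d > 0" for d :: real
  proof (rule ccontr)
    assume c: "\<not> ?thesis"
    have "\<forall>\<^sub>F d in at_right 0. \<forall>x\<in>carrier_vec N. \<forall>y\<in>carrier_vec N.
    (\<forall>j<N. cmod (x $ j - w $ j) < d) \<longrightarrow> (\<forall>j<N. cmod (y $ j - w $ j) < d) \<longrightarrow> cmod (Q i x y - Q i w w) < e"
      unfolding eventually_at_right_field
    proof (intro exI[of _ d] conjI d allI impI ballI)
      fix d' x y assume "0 < d'" "d' < d" "x \<in> carrier_vec N" "y \<in> carrier_vec N"
        "\<forall>j<N. cmod (x $ j - w $ j) < d'" "\<forall>j<N. cmod (y $ j - w $ j) < d'"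
      then show "cmod (Q i x y - Q i w w) < e" using c by (meson less_trans)
    qed
    then show False using neg by blast
  qed
  then have "\<exists>x\<in>carrier_vec N. \<exists>y\<in>carrier_vec N. ?P (inverse (real (Suc n))) x y" for n by simp
  then obtain x y where xy: "\<And>n. x n \<in> carrier_vec N" "\<And>n. y n \<in> carrier_vec N"
    "\<And>n. ?P (inverse (real (Suc n))) (x n) (y n)" by metis
  have "conv N w z" if z: "\<And>n. z n \<in> carrier_vec N" "\<And>n j. j < N \<Longrightarrow> cmod (z n $ j - w $ j) < inverse (real (Suc n))"
    for z
    unfolding conv_def
  proof (intro conjI allI impI z)
    fix j assume j: "j < N"
    have "(\<lambda>n. z n $ j - w $ j) \<longlonglongrightarrow> 0"
      by (rule Lim_null_comparison[OF _ LIMSEQ_inverse_real_of_nat])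
        (use z(2)[OF j] in \<open>auto intro!: always_eventually less_imp_le\<close>)
    then show "(\<lambda>n. z n $ j) \<longlonglongrightarrow> w $ j" by (simp add: LIM_zero_iff)
  qed
  then have "(\<lambda>n. Q i (x n) (y n)) \<longlonglongrightarrow> Q i w w"
    using xy by (intro slope_lim[OF s w _ _ i]) blast+
  then have "\<forall>\<^sub>F n in sequentially. dist (Q i (x n) (y n)) (Q i w w) < e"
    using e by (rule tendstoD)
  then show False using xy(3) by (auto simp: dist_norm eventually_sequentially)
qed

abbreviation "l1 c u \<equiv> (\<Sum>j<c. cmod (u j))"

text \<open>
  Banach's fixed point theorem on a ball: the iterates of \<open>0\<close> move by at most
  \<open>b\<close>, \<open>b/2\<close>, \<open>b/4\<close> and so on, and therefore stay in the
  ball of radius \<open>2 * b\<close>.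
\<close>

lemma contraction_fixed_point:
  fixes T :: "(nat \<Rightarrow> complex) \<Rightarrow> nat \<Rightarrow> complex"
  assumes lip: "\<And>u u'. l1 c u \<le> r \<Longrightarrow> l1 c u' \<le> r \<Longrightarrow>
      l1 c (\<lambda>j. T u j - T u' j) \<le> l1 c (\<lambda>j. u j - u' j) / 2"
    and b: "l1 c (T (\<lambda>_. 0)) \<le> b" "2 * b \<le> r"
  shows "\<exists>u. l1 c u \<le> 2 * b \<and> (\<forall>j<c. T u j = u j)"
proof -
  have b0: "b \<ge> 0" using b(1) by (smt (verit) norm_ge_zero sum_nonneg)
  define s where "s = rec_nat (\<lambda>_. 0) (\<lambda>_. T)"
  have s0: "s 0 = (\<lambda>_. 0)" and sS: "s (Suc n) = T (s n)" for n by (simp_all add: s_def)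
  have tri: "l1 c u \<le> l1 c (\<lambda>j. u j - u' j) + l1 c u'" for u u' :: "nat \<Rightarrow> complex"
    unfolding sum.distrib[symmetric] by (intro sum_mono) (metis diff_add_cancel norm_triangle_ineq)
  have inv: "l1 c (s n) \<le> 2 * b * (1 - (1/2)^n) \<and> l1 c (\<lambda>j. s (Suc n) j - s n j) \<le> b * (1/2)^n" for n
  proof (induction n)
    case 0
    then show ?case using b by (simp add: s0 sS)
  next
    case (Suc n)
    have le: "l1 c (s (Suc n)) \<le> 2 * b * (1 - (1/2)^Suc n)"
      using tri[of "s (Suc n)" "s n"] Suc by (simp add: algebra_simps)
    have "2 * b * (1 - (1/2)^k) \<le> r" for k
      using b b0 by (smt (verit) mult_left_le power_le_one zero_le_power divide_nonneg_nonneg)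
    then have "l1 c (s n) \<le> r" "l1 c (s (Suc n)) \<le> r" using le Suc by (meson order_trans)+
    from lip[OF this(2,1)] show ?case using le Suc by (simp add: sS)
  qed
  have "\<exists>l. (\<lambda>n. s n j) \<longlonglongrightarrow> l" if j: "j < c" for j
  proof -
    have le: "cmod (s (Suc n) j - s n j) \<le> b * (1/2)^n" for n
      using inv[of n] member_le_sum[of j "{..<c}" "\<lambda>j. cmod (s (Suc n) j - s n j)"] j by force
    have "summable (\<lambda>n. s (Suc n) j - s n j)"
      by (rule summable_comparison_test[of _ "\<lambda>n. b * (1/2)^n"])
        (use le in \<open>auto intro!: summable_mult summable_geometric\<close>)
    then have "(\<lambda>n. \<Sum>k<n. s (Suc k) j - s k j) \<longlonglongrightarrow> (\<Sum>k. s (Suc k) j - s k j)"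
      by (rule summable_LIMSEQ)
    then show ?thesis unfolding sum_lessThan_telescope[of "\<lambda>k. s k j"] by (simp add: s0) blast
  qed
  then obtain u where u: "\<And>j. j < c \<Longrightarrow> (\<lambda>n. s n j) \<longlonglongrightarrow> u j" by metis
  have sb: "l1 c (s n) \<le> 2 * b" for n
    using inv[of n] b0 by (smt (verit) mult_left_le power_le_one zero_le_power divide_nonneg_nonneg)
  have ub: "l1 c u \<le> 2 * b"
    by (rule tendsto_upperbound[of "\<lambda>n. l1 c (s n)"]) (use sb u in \<open>auto intro!: tendsto_intros\<close>)
  have "T u j = u j" if j: "j < c" for j
  proof -
    have "(\<lambda>n. l1 c (\<lambda>j. u j - s n j) / 2) \<longlonglongrightarrow> l1 c (\<lambda>j. u j - u j) / 2"
      by (intro tendsto_intros u) auto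
    moreover have "cmod (T u j - s (Suc n) j) \<le> l1 c (\<lambda>j. u j - s n j) / 2" for n
    proof -
      have "cmod (T u j - s (Suc n) j) \<le> l1 c (\<lambda>j. T u j - T (s n) j)"
        using member_le_sum[of j "{..<c}" "\<lambda>j. cmod (T u j - T (s n) j)"] j by (simp add: sS)
      also have "\<dots> \<le> l1 c (\<lambda>j. u j - s n j) / 2"
        using ub sb[of n] b by (intro lip) auto
      finally show ?thesis .
    qed
    ultimately have "(\<lambda>n. T u j - s (Suc n) j) \<longlonglongrightarrow> 0"
      by (intro Lim_null_comparison[of "\<lambda>n. T u j - s (Suc n) j" "\<lambda>n. l1 c (\<lambda>j. u j - s n j) / 2"]) auto
    moreover have "(\<lambda>n. T u j - s (Suc n) j) \<longlonglongrightarrow> T u j - u j"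
      by (intro tendsto_intros LIMSEQ_Suc u j)
    ultimately show ?thesis using LIMSEQ_unique by fastforce
  qed
  then show ?thesis using ub by blast
qed

text \<open>
  Sequences with a limit direction take the place of curves with a tangent vector.
\<close>

definition approach :: "complex vec set \<Rightarrow> nat \<Rightarrow> complex vec \<Rightarrow> complex vec \<Rightarrow> (nat \<Rightarrow> complex vec) \<Rightarrow> (nat \<Rightarrow> complex) \<Rightarrow> bool" where
  "approach Z N w v x t \<longleftrightarrow> (\<forall>n. x n \<in> Z) \<and> (\<forall>n. t n \<noteq> 0) \<and> t \<longlonglongrightarrow> 0 \<and>
     (\<forall>i<N. (\<lambda>n. (x n $ i - w $ i) / t n) \<longlonglongrightarrow> v $ i)"

lemma approach_conv:
  assumes a: "approach Z N w v x t" and Z: "Z \<subseteq> carrier_vec N"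
  shows "conv N w x"
  unfolding conv_def
proof (intro conjI allI impI)
  show "x n \<in> carrier_vec N" for n using a Z by (auto simp: approach_def)
  fix i assume i: "i < N"
  have "(\<lambda>n. (x n $ i - w $ i) / t n * t n) \<longlonglongrightarrow> v $ i * 0"
    using a i by (intro tendsto_intros) (auto simp: approach_def)
  then have "(\<lambda>n. x n $ i - w $ i) \<longlonglongrightarrow> 0" using a by (simp add: approach_def)
  then show "(\<lambda>n. x n $ i) \<longlonglongrightarrow> w $ i" by (simp add: LIM_zero_iff)
qed

lemma slope_approach:
  fixes v :: "complex vec"
  assumes s: "slope N p Q" and a: "approach Z N w v x t" and Z: "Z \<subseteq> carrier_vec N" and w: "w \<in> carrier_vec N"
  shows "(\<lambda>n. (p (x n) - p w) / t n) \<longlonglongrightarrow> (\<Sum>i<N. Q i w w * v $ i)"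
proof -
  have c: "conv N w x" by (rule approach_conv[OF a Z])
  have "(\<lambda>n. \<Sum>i<N. Q i (x n) w * ((x n $ i - w $ i) / t n)) \<longlonglongrightarrow> (\<Sum>i<N. Q i w w * v $ i)"
    by (intro tendsto_intros slope_lim[OF s w c conv_const[OF w]]) (use a in \<open>auto simp: approach_def\<close>)
  moreover have "(p (x n) - p w) / t n = (\<Sum>i<N. Q i (x n) w * ((x n $ i - w $ i) / t n))" for n
    using c w by (subst slope_id[OF s]) (auto simp: conv_def sum_divide_distrib)
  ultimately show ?thesis by simp
qed

text \<open>
  A vector in the kernel of a Jacobian of full rank is tangent to the zero locus: the point
  \<open>w + s v\<close> misses it only to second order in \<open>s\<close>, and is corrected by a
  vector in the image of the right inverse \<open>R\<close>. The correction is a fixed point of a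
  simplified Newton iteration.
\<close>

lemma newton_curve:
  assumes ps: "set ps \<subseteq> poly_funs (vec_coords N)"
    and w: "w \<in> zero_locus N (set ps)"
    and R: "R \<in> carrier_mat N (length ps)" "jacobian N ps w * R = 1\<^sub>m (length ps)"
    and v: "v \<in> carrier_vec N" "jacobian N ps w *\<^sub>v v = 0\<^sub>v (length ps)"
  shows "\<exists>x t. approach (zero_locus N (set ps)) N w v x t"
proof -
  define c where "c = length ps"
  let ?p = "\<lambda>r. ps ! r"
  have wc: "w \<in> carrier_vec N" using w by (simp add: zero_locus_def)
  have pw: "?p r w = 0" if "r < c" for r
    using w that by (auto simp: zero_locus_def c_def)
  have "\<exists>Q. slope N (?p r) Q" if "r < c" for r
    using ps that by (intro poly_slope) (auto simp: c_def)
  then obtain Q where Q: "\<And>r. r < c \<Longrightarrow> slope N (?p r) (Q r)" by metis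
  have jac: "jacobian N ps w \<in> carrier_mat c N" by (simp add: jacobian_def c_def)
  have jacQ: "jacobian N ps w $$ (r, i) = Q r i w w" if "r < c" "i < N" for r i
    using that by (intro jacobian_entry[OF Q wc]) (auto simp: c_def)
  have QR: "(\<Sum>i<N. Q r i w w * R $$ (i, j)) = (if r = j then 1 else 0)" if "r < c" "j < c" for r j
  proof -
    have "(\<Sum>i<N. Q r i w w * R $$ (i, j)) = (jacobian N ps w * R) $$ (r, j)"
      using that jac R(1) by (subst mult_mat_index[of _ c N]) (auto simp: jacQ c_def)
    then show ?thesis using R(2) that by (simp add: c_def)
  qed
  have Qv: "(\<Sum>i<N. Q r i w w * v $ i) = 0" if "r < c" for r
  proof -
    have "(\<Sum>i<N. Q r i w w * v $ i) = (jacobian N ps w *\<^sub>v v) $ r"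
      using that by (subst mult_mat_vec_index[OF jac v(1)]) (auto simp: jacQ)
    then show ?thesis using v(2) that by (simp add: c_def)
  qed
  define Rb where "Rb = (\<Sum>i<N. \<Sum>j<c. cmod (R $$ (i, j)))"
  have Rb0: "Rb \<ge> 0" by (auto simp: Rb_def intro!: sum_nonneg)
  have Rle: "(\<Sum>j<c. cmod (R $$ (i, j)) * cmod (u j)) \<le> Rb * l1 c u" if "i < N" for i and u :: "nat \<Rightarrow> complex"
  proof -
    have "(\<Sum>j<c. cmod (R $$ (i, j)) * cmod (u j)) \<le> (\<Sum>j<c. cmod (R $$ (i, j)) * l1 c u)"
      by (intro sum_mono mult_left_mono) (auto intro: member_le_sum)
    also have "\<dots> = (\<Sum>j<c. cmod (R $$ (i, j))) * l1 c u" by (simp add: sum_distrib_right)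
    also have "\<dots> \<le> Rb * l1 c u"
      unfolding Rb_def using that by (intro mult_right_mono member_le_sum[of i "{..<N}" "\<lambda>i. \<Sum>j<c. cmod (R $$ (i, j))"]) (auto intro!: sum_nonneg)
    finally show ?thesis .
  qed
  \<comment> \<open>If the gradients vary by less than \<open>e\<close>, the iteration has Lipschitz constant at most \<open>1/2\<close>.\<close>
  define e where "e = 1 / (2 * (real c * (real N * Rb) + 1))"
  have e: "e > 0" and ce: "real c * (real N * (e * Rb)) \<le> 1 / 2"
  proof -
    have p: "real c * (real N * Rb) \<ge> 0" using Rb0 by simp
    then show "e > 0" by (auto simp: e_def intro!: divide_pos_pos add_nonneg_pos)
    have "real c * (real N * (e * Rb)) = (real c * (real N * Rb)) * e" by simp
    also have "\<dots> \<le> 1 / 2" using p by (simp add: e_def divide_simps)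
    finally show "real c * (real N * (e * Rb)) \<le> 1 / 2" .
  qed
  have "\<forall>\<^sub>F d in at_right 0. \<forall>r\<in>{..<c}. \<forall>i\<in>{..<N}. \<forall>x\<in>carrier_vec N. \<forall>y\<in>carrier_vec N.
    (\<forall>j<N. cmod (x $ j - w $ j) < d) \<longrightarrow> (\<forall>j<N. cmod (y $ j - w $ j) < d) \<longrightarrow> cmod (Q r i x y - Q r i w w) < e"
    by (intro eventually_ball_finite ballI finite_lessThan slope_uniform[OF Q wc _ e]) auto
  then obtain d where d: "d > 0" and dQ: "\<And>r i x y. r < c \<Longrightarrow> i < N \<Longrightarrow> x \<in> carrier_vec N \<Longrightarrow> y \<in> carrier_vec N \<Longrightarrow>
    (\<forall>j<N. cmod (x $ j - w $ j) < d) \<Longrightarrow> (\<forall>j<N. cmod (y $ j - w $ j) < d) \<Longrightarrow> cmod (Q r i x y - Q r i w w) < e"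
    unfolding eventually_at_right_field
    by (metis (no_types, lifting) dense lessThan_iff)
  define r0 where "r0 = d / (2 * (Rb + 1))"
  have r0: "r0 > 0" and Rr0: "Rb * r0 < d / 2"
    using d Rb0 by (auto simp: r0_def field_simps intro!: divide_pos_pos add_nonneg_pos)
  define X where "X s u = vec N (\<lambda>i. w $ i + s * v $ i + (\<Sum>j<c. R $$ (i, j) * u j))" for s u
  have Xc: "X s u \<in> carrier_vec N" for s u by (simp add: X_def)
  define V where "V = l1 N (\<lambda>i. v $ i)"
  have Xnear: "cmod (X s u $ i - w $ i) < d" if s: "cmod s * V < d / 2" and u: "l1 c u \<le> r0" and i: "i < N" for s u i
  proof -
    have "cmod (X s u $ i - w $ i) \<le> cmod (s * v $ i) + cmod (\<Sum>j<c. R $$ (i, j) * u j)"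
      using i norm_triangle_ineq by (simp add: X_def add.assoc)
    moreover have "cmod (s * v $ i) \<le> cmod s * V"
      unfolding V_def norm_mult using i by (intro mult_left_mono member_le_sum) auto
    moreover have "cmod (\<Sum>j<c. R $$ (i, j) * u j) \<le> Rb * l1 c u"
      using Rle[OF i, of u] norm_sum[of "\<lambda>j. R $$ (i, j) * u j" "{..<c}"] by (simp add: norm_mult)
    moreover have "Rb * l1 c u \<le> Rb * r0" using Rb0 u by (intro mult_left_mono)
    ultimately show ?thesis using s Rr0 by linarith
  qed
  \<comment> \<open>A fixed point \<open>u\<close> of \<open>T s\<close> makes \<open>X s u\<close> a common zero of \<open>ps\<close>.\<close>
  define T where "T s u r = u r - ?p r (X s u)" for s u r
  have lip: "l1 c (\<lambda>r. T s u r - T s u' r) \<le> l1 c (\<lambda>j. u j - u' j) / 2"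
    if s: "cmod s * V < d / 2" and u: "l1 c u \<le> r0" "l1 c u' \<le> r0" for s u u'
  proof -
    have one: "cmod (T s u r - T s u' r) \<le> real N * (e * Rb) * l1 c (\<lambda>j. u j - u' j)" if r: "r < c" for r
    proof -
      let ?E = "\<lambda>i. Q r i (X s u) (X s u') - Q r i w w"
      let ?h = "\<lambda>i. \<Sum>j<c. R $$ (i, j) * (u j - u' j)"
      have Xd: "X s u $ i - X s u' $ i = ?h i" if "i < N" for i
        using that by (simp add: X_def sum_subtractf[symmetric] algebra_simps)
      have "?p r (X s u) - ?p r (X s u') = (\<Sum>i<N. Q r i (X s u) (X s u') * ?h i)"
        unfolding slope_id[OF Q[OF r] Xc Xc] by (intro sum.cong) (simp_all add: Xd)
      moreover have "(\<Sum>i<N. Q r i w w * ?h i) = (\<Sum>j<c. (\<Sum>i<N. Q r i w w * R $$ (i, j)) * (u j - u' j))"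
        by (simp add: sum_distrib_left sum_distrib_right mult.assoc) (rule sum.swap)
      moreover have "\<dots> = u r - u' r"
        using r by (simp add: QR if_distrib[of "\<lambda>a. a * _"] cong: if_cong)
      ultimately have "T s u r - T s u' r = - (\<Sum>i<N. ?E i * ?h i)"
        by (simp add: T_def left_diff_distrib sum_subtractf minus_diff_eq[symmetric, of "?p r (X s u')"] del: minus_diff_eq)
      then have "cmod (T s u r - T s u' r) \<le> (\<Sum>i<N. cmod (?E i * ?h i))"
        using norm_sum[of "\<lambda>i. ?E i * ?h i" "{..<N}"] by simp
      also have "\<dots> \<le> (\<Sum>i<N. e * (Rb * l1 c (\<lambda>j. u j - u' j)))"
      proof (intro sum_mono)
        fix i assume "i \<in> {..<N}"
        then have i: "i < N" by simp
        have "cmod (?E i) \<le> e"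
          using Xnear[OF s u(1)] Xnear[OF s u(2)] by (intro less_imp_le dQ r i Xc) auto
        moreover have "cmod (?h i) \<le> Rb * l1 c (\<lambda>j. u j - u' j)"
          using Rle[OF i, of "\<lambda>j. u j - u' j"] norm_sum[of "\<lambda>j. R $$ (i, j) * (u j - u' j)" "{..<c}"]
          by (simp add: norm_mult)
        ultimately show "cmod (?E i * ?h i) \<le> e * (Rb * l1 c (\<lambda>j. u j - u' j))"
          unfolding norm_mult using e by (intro mult_mono) auto
      qed
      finally show ?thesis by (simp add: algebra_simps)
    qed
    have "l1 c (\<lambda>r. T s u r - T s u' r) \<le> (\<Sum>r<c. real N * (e * Rb) * l1 c (\<lambda>j. u j - u' j))"
      by (intro sum_mono one) simp
    also have "\<dots> = real c * (real N * (e * Rb)) * l1 c (\<lambda>j. u j - u' j)" by simp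
    also have "\<dots> \<le> 1 / 2 * l1 c (\<lambda>j. u j - u' j)" by (intro mult_right_mono ce) (auto intro!: sum_nonneg)
    finally show ?thesis by simp
  qed
  \<comment> \<open>The defect \<open>a n\<close> of the tangent line at time \<open>s n\<close> is of second order in \<open>s n\<close>.\<close>
  define s where "s n = complex_of_real (inverse (real (Suc n)))" for n
  have s_lim: "s \<longlonglongrightarrow> 0"
    unfolding s_def using tendsto_of_real[OF LIMSEQ_inverse_real_of_nat, where ?'a = complex]
    by (simp only: of_real_0)
  have s_nz: "s n \<noteq> 0" for n unfolding s_def of_real_eq_0_iff by simp
  let ?z = "\<lambda>_::nat. 0 :: complex"
  have cX: "conv N w (\<lambda>n. X (s n) ?z)"
    unfolding conv_def
  proof (intro conjI allI impI Xc)
    fix i assume i: "i < N"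
    have "(\<lambda>n. w $ i + s n * v $ i) \<longlonglongrightarrow> w $ i + 0 * v $ i" by (intro tendsto_intros s_lim)
    then show "(\<lambda>n. X (s n) ?z $ i) \<longlonglongrightarrow> w $ i" using i by (simp add: X_def)
  qed
  define a where "a n = (\<Sum>r<c. cmod (\<Sum>i<N. Q r i (X (s n) ?z) w * v $ i))" for n
  have "a \<longlonglongrightarrow> (\<Sum>r<c. cmod (\<Sum>i<N. Q r i w w * v $ i))"
    unfolding a_def by (intro tendsto_intros slope_lim[OF Q wc cX conv_const[OF wc]]) auto
  then have a_lim: "a \<longlonglongrightarrow> 0" by (simp add: Qv)
  have T0: "l1 c (T (s n) ?z) = cmod (s n) * a n" for n
  proof -
    have "cmod (T (s n) ?z r) = cmod (s n) * cmod (\<Sum>i<N. Q r i (X (s n) ?z) w * v $ i)" if r: "r < c" for r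
    proof -
      have "?p r (X (s n) ?z) - ?p r w = (\<Sum>i<N. Q r i (X (s n) ?z) w * (s n * v $ i))"
        unfolding slope_id[OF Q[OF r] Xc wc] by (intro sum.cong) (auto simp: X_def)
      also have "\<dots> = s n * (\<Sum>i<N. Q r i (X (s n) ?z) w * v $ i)"
        by (simp add: sum_distrib_left mult_ac)
      finally show ?thesis using pw[OF r] by (simp add: T_def norm_mult)
    qed
    then show ?thesis by (simp add: a_def sum_distrib_left)
  qed
  have "(\<lambda>n. cmod (s n) * V) \<longlonglongrightarrow> cmod 0 * V" "(\<lambda>n. 2 * (cmod (s n) * a n)) \<longlonglongrightarrow> 2 * (cmod 0 * 0)"
    by (intro tendsto_intros s_lim a_lim)+
  then have "\<forall>\<^sub>F n in sequentially. cmod (s n) * V < d / 2" "\<forall>\<^sub>F n in sequentially. 2 * (cmod (s n) * a n) < r0"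
    using d r0 by (auto intro!: order_tendstoD(2)[of _ 0])
  then have "\<forall>\<^sub>F n in sequentially. cmod (s n) * V < d / 2 \<and> 2 * (cmod (s n) * a n) < r0"
    by (rule eventually_conj)
  then obtain n0 where n0: "\<And>n. n \<ge> n0 \<Longrightarrow> cmod (s n) * V < d / 2" "\<And>n. n \<ge> n0 \<Longrightarrow> 2 * (cmod (s n) * a n) < r0"
    unfolding eventually_sequentially by blast
  have "\<exists>u. l1 c u \<le> 2 * (cmod (s n) * a n) \<and> (\<forall>j<c. T (s n) u j = u j)" if "n \<ge> n0" for n
    using n0[OF that] T0[of n] lip[of "s n"] by (intro contraction_fixed_point[where r = r0]) auto
  then obtain u where u: "\<And>n. n \<ge> n0 \<Longrightarrow> l1 c (u n) \<le> 2 * (cmod (s n) * a n)"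
    "\<And>n j. n \<ge> n0 \<Longrightarrow> j < c \<Longrightarrow> T (s n) (u n) j = u n j" by metis
  have "approach (zero_locus N (set ps)) N w v (\<lambda>n. X (s (n + n0)) (u (n + n0))) (\<lambda>n. s (n + n0))"
    unfolding approach_def
  proof (intro conjI allI impI s_nz)
    show "X (s (n + n0)) (u (n + n0)) \<in> zero_locus N (set ps)" for n
      using u(2)[of "n + n0"] Xc by (auto simp: zero_locus_def T_def in_set_conv_nth c_def)
    show "(\<lambda>n. s (n + n0)) \<longlonglongrightarrow> 0" by (rule LIMSEQ_ignore_initial_segment[OF s_lim])
    fix i assume i: "i < N"
    have "(\<lambda>n. u (n + n0) j / s (n + n0)) \<longlonglongrightarrow> 0" if j: "j < c" for j
    proof (rule Lim_null_comparison)
      show "\<forall>\<^sub>F n in sequentially. cmod (u (n + n0) j / s (n + n0)) \<le> 2 * a (n + n0)"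
      proof (intro always_eventually allI)
        fix n
        have "cmod (u (n + n0) j) \<le> l1 c (u (n + n0))" using j by (intro member_le_sum) auto
        also have "\<dots> \<le> 2 * (cmod (s (n + n0)) * a (n + n0))" by (rule u(1)) simp
        finally show "cmod (u (n + n0) j / s (n + n0)) \<le> 2 * a (n + n0)"
          using s_nz[of "n + n0"] by (simp add: norm_divide field_simps)
      qed
      show "(\<lambda>n. 2 * a (n + n0)) \<longlonglongrightarrow> 0"
        using tendsto_mult[OF tendsto_const[of 2] LIMSEQ_ignore_initial_segment[OF a_lim, of n0]] by simp
    qed
    then have "(\<lambda>n. v $ i + (\<Sum>j<c. R $$ (i, j) * (u (n + n0) j / s (n + n0)))) \<longlonglongrightarrow> v $ i + (\<Sum>j<c. R $$ (i, j) * 0)"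
      by (intro tendsto_intros) auto
    moreover have "(X (s (n + n0)) (u (n + n0)) $ i - w $ i) / s (n + n0) =
        v $ i + (\<Sum>j<c. R $$ (i, j) * (u (n + n0) j / s (n + n0)))" for n
      using i s_nz[of "n + n0"] by (simp add: X_def add_divide_distrib sum_divide_distrib)
    ultimately show "(\<lambda>n. (X (s (n + n0)) (u (n + n0)) $ i - w $ i) / s (n + n0)) \<longlonglongrightarrow> v $ i" by simp
  qed
  then show ?thesis by blast
qed

text \<open>
  Near \<open>w\<close> a regular function is a quotient of polynomials, and polynomials are
  strictly differentiable.
\<close>

lemma reg_approach:
  assumes h: "h \<in> reg (zero_locus N P) (vec_coords N) W" and w: "w \<in> W"
  shows "\<exists>D. \<forall>v x t. approach (zero_locus N P) N w v x t \<longrightarrow>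
    (\<lambda>n. (h (x n) - h w) / t n) \<longlonglongrightarrow> (\<Sum>i<N. D i * v $ i)"
proof -
  let ?Z = "zero_locus N P"
  have Zc: "?Z \<subseteq> carrier_vec N" by (auto simp: zero_locus_def)
  obtain V p q where 1: "openin (zariski_topology ?Z (vec_coords N)) V" "w \<in> V" "V \<subseteq> W"
    "p \<in> poly_funs (vec_coords N)" "q \<in> poly_funs (vec_coords N)"
    "\<And>y. y \<in> V \<Longrightarrow> q y \<noteq> 0" "\<And>y. y \<in> V \<Longrightarrow> h y = p y / q y"
    using regE[OF h w] by blast
  obtain g where g: "g \<in> poly_funs (vec_coords N)" "g w \<noteq> 0" "{y\<in>?Z. g y \<noteq> 0} \<subseteq> V"
    using 1(1,2) unfolding openin_zariski by blast
  have "w \<in> ?Z" using openin_subset[OF 1(1)] 1(2) by (auto simp: topspace_zariski)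
  then have wc: "w \<in> carrier_vec N" using Zc by blast
  obtain Qp Qq Qg where Q: "slope N p Qp" "slope N q Qq" "slope N g Qg"
    using poly_slope 1(4,5) g(1) by metis
  define D where "D i = (Qp i w w * q w - p w * Qq i w w) / (q w * q w)" for i
  have "(\<lambda>n. (h (x n) - h w) / t n) \<longlonglongrightarrow> (\<Sum>i<N. D i * v $ i)" if a: "approach ?Z N w v x t" for v x t
  proof -
    have c: "conv N w x" by (rule approach_conv[OF a Zc])
    have "\<forall>\<^sub>F n in sequentially. g (x n) \<noteq> 0"
      by (rule tendsto_imp_eventually_ne[OF slope_cont[OF Q(3) wc c] g(2)])
    then have ev: "\<forall>\<^sub>F n in sequentially. (h (x n) - h w) / t n =
       ((p (x n) - p w) / t n * q w - p w * ((q (x n) - q w) / t n)) / (q (x n) * q w)"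
    proof eventually_elim
      case (elim n)
      then have "x n \<in> V" using g(3) a by (auto simp: approach_def)
      then show ?case using 1(6,7) 1(2) a by (simp add: approach_def field_simps)
    qed
    have "(\<lambda>n. ((p (x n) - p w) / t n * q w - p w * ((q (x n) - q w) / t n)) / (q (x n) * q w)) \<longlonglongrightarrow>
      ((\<Sum>i<N. Qp i w w * v $ i) * q w - p w * (\<Sum>i<N. Qq i w w * v $ i)) / (q w * q w)"
      using 1(6)[OF 1(2)]
      by (intro tendsto_intros slope_approach[OF Q(1) a Zc wc] slope_approach[OF Q(2) a Zc wc]
          slope_cont[OF Q(2) wc c]) auto
    also have "((\<Sum>i<N. Qp i w w * v $ i) * q w - p w * (\<Sum>i<N. Qq i w w * v $ i)) / (q w * q w) = (\<Sum>i<N. D i * v $ i)"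
      by (simp add: D_def sum_distrib_left sum_distrib_right sum_subtractf[symmetric] sum_divide_distrib algebra_simps)
    finally show ?thesis by (simp add: tendsto_cong[OF ev])
  qed
  then show ?thesis by blast
qed

text \<open>
  Zariski open sets are open for the usual topology, so the sequence eventually stays in
  \<open>W\<close>.
\<close>

lemma approach_open:
  assumes a: "approach (zero_locus N P) N w v x t"
    and W: "openin (zariski_topology (zero_locus N P) (vec_coords N)) W" "w \<in> W"
  shows "\<exists>k. approach W N w v (\<lambda>n. x (n + k)) (\<lambda>n. t (n + k))"
proof -
  let ?Z = "zero_locus N P"
  have Zc: "?Z \<subseteq> carrier_vec N" by (auto simp: zero_locus_def)
  obtain g where g: "g \<in> poly_funs (vec_coords N)" "g w \<noteq> 0" "{y\<in>?Z. g y \<noteq> 0} \<subseteq> W"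
    using W unfolding openin_zariski by blast
  have "w \<in> ?Z" using openin_subset[OF W(1)] W(2) by (auto simp: topspace_zariski)
  then have wc: "w \<in> carrier_vec N" using Zc by blast
  obtain Q where Q: "slope N g Q" using poly_slope g(1) by metis
  have "\<forall>\<^sub>F n in sequentially. g (x n) \<noteq> 0"
    by (rule tendsto_imp_eventually_ne[OF slope_cont[OF Q wc approach_conv[OF a Zc]] g(2)])
  then obtain k where "\<And>n. n \<ge> k \<Longrightarrow> g (x n) \<noteq> 0" unfolding eventually_sequentially by blast
  then have xW: "x (n + k) \<in> W" for n using g(3) a by (auto simp: approach_def)
  have "approach W N w v (\<lambda>n. x (n + k)) (\<lambda>n. t (n + k))"
    unfolding approach_def
  proof (intro conjI allI impI xW)
    show "t (n + k) \<noteq> 0" for n using a by (simp add: approach_def)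
    show "(\<lambda>n. t (n + k)) \<longlonglongrightarrow> 0"
      using a by (intro LIMSEQ_ignore_initial_segment) (simp add: approach_def)
    show "(\<lambda>n. (x (n + k) $ i - w $ i) / t (n + k)) \<longlonglongrightarrow> v $ i" if "i < N" for i
      using a that LIMSEQ_ignore_initial_segment[of "\<lambda>n. (x n $ i - w $ i) / t n" _ k]
      by (simp add: approach_def)
  qed
  then show ?thesis by blast
qed

text \<open>
  The data that \<open>smooth_of_dim\<close> provides at a point, with the isomorphism and its
  inverse named.
\<close>

definition smooth_chart ::
  "'a fun_space \<Rightarrow> nat \<Rightarrow> 'a \<Rightarrow> 'a set \<Rightarrow> (complex vec \<Rightarrow> complex) list \<Rightarrow> complex vec set \<Rightarrow>
   ('a \<Rightarrow> complex vec) \<Rightarrow> (complex vec \<Rightarrow> 'a) \<Rightarrow> bool" where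
  "smooth_chart X n x U ps W \<phi> \<psi> \<longleftrightarrow> openin (fs_top X) U \<and> x \<in> U \<and>
     set ps \<subseteq> poly_funs (vec_coords (n + length ps)) \<and>
     openin (fs_top (affine_closed_space (n + length ps) (set ps))) W \<and>
     (\<forall>w \<in> W. vec_space.rank (length ps) (jacobian (n + length ps) ps w) = length ps) \<and>
     fs_morphism (fs_restrict X U) (fs_restrict (affine_closed_space (n + length ps) (set ps)) W) \<phi> \<and>
     fs_morphism (fs_restrict (affine_closed_space (n + length ps) (set ps)) W) (fs_restrict X U) \<psi> \<and>
     (\<forall>y\<in>U. \<psi> (\<phi> y) = y) \<and> (\<forall>w\<in>W. \<phi> (\<psi> w) = w)"

lemma topspace_fs_restrict:
  "openin (fs_top X) U \<Longrightarrow> topspace (fs_top (fs_restrict X U)) = U"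
  using openin_subset[of "fs_top X" U] by (auto simp: fs_restrict_def)

lemma openin_fs_restrict:
  "openin (fs_top X) U \<Longrightarrow> openin (fs_top (fs_restrict X U)) V \<longleftrightarrow> openin (fs_top X) V \<and> V \<subseteq> U"
  by (simp add: fs_restrict_def openin_open_subtopology)

lemma fs_reg_restrict: "fs_reg (fs_restrict X U) = fs_reg X"
  by (simp add: fs_restrict_def)

lemma smooth_chart_exists:
  assumes s: "smooth_of_dim n X" and x: "x \<in> topspace (fs_top X)"
  obtains U ps W \<phi> \<psi> where "smooth_chart X n x U ps W \<phi> \<psi>"
proof -
  obtain U ps W where 1: "openin (fs_top X) U" "x \<in> U"
    "set ps \<subseteq> poly_funs (vec_coords (n + length ps))"
    "openin (fs_top (affine_closed_space (n + length ps) (set ps))) W"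
    "\<forall>w \<in> W. vec_space.rank (length ps) (jacobian (n + length ps) ps w) = length ps"
    and iso: "fs_isomorphic (fs_restrict X U) (fs_restrict (affine_closed_space (n + length ps) (set ps)) W)"
    using bspec[OF s[unfolded smooth_of_dim_def] x] by (elim exE conjE)
  from iso obtain \<phi> \<psi> where 2:
    "fs_morphism (fs_restrict X U) (fs_restrict (affine_closed_space (n + length ps) (set ps)) W) \<phi>"
    "fs_morphism (fs_restrict (affine_closed_space (n + length ps) (set ps)) W) (fs_restrict X U) \<psi>"
    "\<forall>y\<in>U. \<psi> (\<phi> y) = y" "\<forall>w\<in>W. \<phi> (\<psi> w) = w"
    unfolding fs_isomorphic_def topspace_fs_restrict[OF 1(1)] topspace_fs_restrict[OF 1(4)] by (elim exE conjE)
  from 1 2 have "smooth_chart X n x U ps W \<phi> \<psi>" unfolding smooth_chart_def by (intro conjI)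
  then show ?thesis by (rule that)
qed

lemma fs_morphism_restrict:
  assumes m: "fs_morphism (fs_restrict X U) (fs_restrict Y W) \<phi>"
    and U: "openin (fs_top X) U" and W: "openin (fs_top Y) W" and V: "openin (fs_top Y) V" "V \<subseteq> W"
  shows "x \<in> U \<Longrightarrow> \<phi> x \<in> W" and "openin (fs_top X) {x\<in>U. \<phi> x \<in> V}"
    and "h \<in> fs_reg Y V \<Longrightarrow> (\<lambda>x. h (\<phi> x)) \<in> fs_reg X {x\<in>U. \<phi> x \<in> V}"
proof -
  note c = m[unfolded fs_morphism_def continuous_map_def topspace_fs_restrict[OF U]
      topspace_fs_restrict[OF W] openin_fs_restrict[OF U] openin_fs_restrict[OF W] fs_reg_restrict]
  show "x \<in> U \<Longrightarrow> \<phi> x \<in> W" using c by blast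
  show "openin (fs_top X) {x\<in>U. \<phi> x \<in> V}" using c V by blast
  show "h \<in> fs_reg Y V \<Longrightarrow> (\<lambda>x. h (\<phi> x)) \<in> fs_reg X {x\<in>U. \<phi> x \<in> V}"
    using conjunct2[OF c] V unfolding comp_def by blast
qed

lemma smooth_chart_transition:
  assumes 1: "smooth_chart X n x U ps W \<phi> \<psi>" and 2: "smooth_chart X n' x U' ps' W' \<phi>' \<psi>'"
  defines "N \<equiv> n + length ps" and "N' \<equiv> n' + length ps'"
  defines "Z \<equiv> zero_locus N (set ps)"
  shows "openin (zariski_topology Z (vec_coords N)) {w\<in>W. \<psi> w \<in> U'}"
    and "\<phi> x \<in> {w\<in>W. \<psi> w \<in> U'}"
    and "w \<in> W \<Longrightarrow> \<psi> w \<in> U' \<Longrightarrow> \<phi>' (\<psi> w) \<in> W'"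
    and "w \<in> W \<Longrightarrow> \<psi> w \<in> U' \<Longrightarrow> \<phi> (\<psi>' (\<phi>' (\<psi> w))) = w"
    and "j < N' \<Longrightarrow> (\<lambda>w. \<phi>' (\<psi> w) $ j) \<in> reg Z (vec_coords N) {w\<in>W. \<psi> w \<in> U'}"
proof -
  note c1 = 1[unfolded smooth_chart_def, folded N_def] and c2 = 2[unfolded smooth_chart_def, folded N'_def]
  let ?A = "affine_closed_space N (set ps)" and ?A' = "affine_closed_space N' (set ps')"
  have topA: "fs_top ?A = zariski_topology Z (vec_coords N)" "fs_reg ?A = reg Z (vec_coords N)"
    by (simp_all add: affine_closed_space_def fs_top_zariski_space fs_reg_zariski_space Z_def fun_eq_iff)
  have topA': "fs_top ?A' = zariski_topology (zero_locus N' (set ps')) (vec_coords N')"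
    "fs_reg ?A' = reg (zero_locus N' (set ps')) (vec_coords N')"
    by (simp_all add: affine_closed_space_def fs_top_zariski_space fs_reg_zariski_space fun_eq_iff)
  have U: "openin (fs_top X) U" "x \<in> U" and W: "openin (fs_top ?A) W"
    and m: "fs_morphism (fs_restrict X U) (fs_restrict ?A W) \<phi>" "fs_morphism (fs_restrict ?A W) (fs_restrict X U) \<psi>"
    and inv: "\<And>y. y \<in> U \<Longrightarrow> \<psi> (\<phi> y) = y" "\<And>w. w \<in> W \<Longrightarrow> \<phi> (\<psi> w) = w"
    using c1 by auto
  have U': "openin (fs_top X) U'" "x \<in> U'" and W': "openin (fs_top ?A') W'"
    and m': "fs_morphism (fs_restrict X U') (fs_restrict ?A' W') \<phi>'" "fs_morphism (fs_restrict ?A' W') (fs_restrict X U') \<psi>'"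
    and inv': "\<And>y. y \<in> U' \<Longrightarrow> \<psi>' (\<phi>' y) = y" "\<And>w. w \<in> W' \<Longrightarrow> \<phi>' (\<psi>' w) = w"
    using c2 by auto
  have \<phi>W: "y \<in> U \<Longrightarrow> \<phi> y \<in> W" for y
    using fs_morphism_restrict(1)[OF m(1) U(1) W W subset_refl] .
  have \<psi>U: "w \<in> W \<Longrightarrow> \<psi> w \<in> U" for w
    using fs_morphism_restrict(1)[OF m(2) W U(1) U(1) subset_refl] .
  have \<phi>W': "y \<in> U' \<Longrightarrow> \<phi>' y \<in> W'" for y
    using fs_morphism_restrict(1)[OF m'(1) U'(1) W' W' subset_refl] .
  have UU: "openin (fs_top X) (U \<inter> U')" using U U' by blast
  have eq1: "{w\<in>W. \<psi> w \<in> U \<inter> U'} = {w\<in>W. \<psi> w \<in> U'}" using \<psi>U by auto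
  show "openin (zariski_topology Z (vec_coords N)) {w\<in>W. \<psi> w \<in> U'}"
    using fs_morphism_restrict(2)[OF m(2) W U(1) UU Int_lower1] unfolding eq1 topA .
  show "\<phi> x \<in> {w\<in>W. \<psi> w \<in> U'}" using \<phi>W U U' inv by auto
  show "w \<in> W \<Longrightarrow> \<psi> w \<in> U' \<Longrightarrow> \<phi>' (\<psi> w) \<in> W'" by (rule \<phi>W')
  show "w \<in> W \<Longrightarrow> \<psi> w \<in> U' \<Longrightarrow> \<phi> (\<psi>' (\<phi>' (\<psi> w))) = w" using inv inv' by simp
  show "(\<lambda>w. \<phi>' (\<psi> w) $ j) \<in> reg Z (vec_coords N) {w\<in>W. \<psi> w \<in> U'}" if j: "j < N'"
  proof -
    let ?V = "{w\<in>W'. \<psi>' w \<in> U \<inter> U'}"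
    have V: "openin (fs_top ?A') ?V"
      using fs_morphism_restrict(2)[OF m'(2) W' U'(1) UU Int_lower2] .
    have "(\<lambda>w. w $ j) \<in> fs_reg ?A' ?V"
      unfolding topA' using V j unfolding topA'
      by (intro poly_reg poly_funs.coord) (auto simp: vec_coords_def)
    from fs_morphism_restrict(3)[OF m'(1) U'(1) W' V _ this]
    have "(\<lambda>y. \<phi>' y $ j) \<in> fs_reg X {y\<in>U'. \<phi>' y \<in> ?V}" by blast
    moreover have "{y\<in>U'. \<phi>' y \<in> ?V} = U \<inter> U'" using \<phi>W' inv' by auto
    ultimately have "(\<lambda>y. \<phi>' y $ j) \<in> fs_reg X (U \<inter> U')" by simp
    from fs_morphism_restrict(3)[OF m(2) W U(1) UU Int_lower1 this]
    show ?thesis unfolding eq1 topA .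
  qed
qed

text \<open>
  The transition map between the two charts has a linear derivative along sequences with a limit
  direction. It maps the kernel of the first Jacobian into that of the second, because the image
  sequences stay on the second zero locus, and is injective there, because the derivative of the
  inverse transition undoes it.
\<close>

lemma smooth_chart_dim_le:
  assumes 1: "smooth_chart X n x U ps W \<phi> \<psi>" and 2: "smooth_chart X n' x U' ps' W' \<phi>' \<psi>'"
  shows "n \<le> n'"
proof -
  define N N' c c' where "N = n + length ps" and "N' = n' + length ps'" and "c = length ps" and "c' = length ps'"
  define Z Z' where "Z = zero_locus N (set ps)" and "Z' = zero_locus N' (set ps')"
  let ?w = "\<phi> x" and ?w' = "\<phi>' x"
  let ?V = "{w\<in>W. \<psi> w \<in> U'}" and ?V' = "{w\<in>W'. \<psi>' w \<in> U}"
  note t = smooth_chart_transition[OF 1 2, folded N_def N'_def, folded Z_def]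
  note t' = smooth_chart_transition[OF 2 1, folded N_def N'_def, folded Z'_def]
  have ps: "set ps \<subseteq> poly_funs (vec_coords N)" "set ps' \<subseteq> poly_funs (vec_coords N')"
    and rank: "\<And>w. w \<in> W \<Longrightarrow> vec_space.rank c (jacobian N ps w) = c"
      "\<And>w. w \<in> W' \<Longrightarrow> vec_space.rank c' (jacobian N' ps' w) = c'"
    and inv: "\<psi> ?w = x" "\<psi>' ?w' = x"
    using 1[unfolded smooth_chart_def, folded N_def c_def] 2[unfolded smooth_chart_def, folded N'_def c'_def]
    by blast+
  have VZ: "?V \<subseteq> Z" "?V' \<subseteq> Z'"
    using openin_subset[OF t(1)] openin_subset[OF t'(1)] by (simp_all add: topspace_zariski)
  have wZ: "?w \<in> Z" "?w' \<in> Z'" using t(2) t'(2) VZ by auto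
  have Zc: "Z \<subseteq> carrier_vec N" "Z' \<subseteq> carrier_vec N'" by (auto simp: Z_def Z'_def zero_locus_def)
  let ?J = "jacobian N ps ?w" and ?J' = "jacobian N' ps' ?w'"
  have J: "?J \<in> carrier_mat c N" and J': "?J' \<in> carrier_mat c' N'" by (simp_all add: jacobian_def c_def c'_def)
  obtain R where R: "R \<in> carrier_mat N c" "?J * R = 1\<^sub>m c"
    using vec_space.rank_eq_iff_right_inverse[OF J] rank(1)[of ?w] t(2) by auto
  obtain R' where R': "R' \<in> carrier_mat N' c'" "?J' * R' = 1\<^sub>m c'"
    using vec_space.rank_eq_iff_right_inverse[OF J'] rank(2)[of ?w'] t'(2) by auto
  have "\<exists>d. \<forall>v y s. approach Z N ?w v y s \<longrightarrow>
      (\<lambda>m. (\<phi>' (\<psi> (y m)) $ j - \<phi>' (\<psi> ?w) $ j) / s m) \<longlonglongrightarrow> (\<Sum>i<N. d i * v $ i)" if "j < N'" for j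
    using reg_approach[OF t(5)[OF that, unfolded Z_def] t(2)] unfolding Z_def by blast
  then have "\<forall>j. \<exists>d. j < N' \<longrightarrow> (\<forall>v y s. approach Z N ?w v y s \<longrightarrow>
      (\<lambda>m. (\<phi>' (\<psi> (y m)) $ j - \<phi>' (\<psi> ?w) $ j) / s m) \<longlonglongrightarrow> (\<Sum>i<N. d i * v $ i))"
    by blast
  from choice[OF this] obtain d where d: "\<And>j v y s. j < N' \<Longrightarrow> approach Z N ?w v y s \<Longrightarrow>
      (\<lambda>m. (\<phi>' (\<psi> (y m)) $ j - \<phi>' (\<psi> ?w) $ j) / s m) \<longlonglongrightarrow> (\<Sum>i<N. d j i * v $ i)" by blast
  have "\<exists>d. \<forall>v y s. approach Z' N' ?w' v y s \<longrightarrow>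
      (\<lambda>m. (\<phi> (\<psi>' (y m)) $ j - \<phi> (\<psi>' ?w') $ j) / s m) \<longlonglongrightarrow> (\<Sum>i<N'. d i * v $ i)" if "j < N" for j
    using reg_approach[OF t'(5)[OF that, unfolded Z'_def] t'(2)] unfolding Z'_def by blast
  then have "\<forall>j. \<exists>d. j < N \<longrightarrow> (\<forall>v y s. approach Z' N' ?w' v y s \<longrightarrow>
      (\<lambda>m. (\<phi> (\<psi>' (y m)) $ j - \<phi> (\<psi>' ?w') $ j) / s m) \<longlonglongrightarrow> (\<Sum>i<N'. d i * v $ i))"
    by blast
  from choice[OF this] obtain d' where d': "\<And>j v y s. j < N \<Longrightarrow> approach Z' N' ?w' v y s \<Longrightarrow>
      (\<lambda>m. (\<phi> (\<psi>' (y m)) $ j - \<phi> (\<psi>' ?w') $ j) / s m) \<longlonglongrightarrow> (\<Sum>i<N'. d' j i * v $ i)" by blast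
  define D where "D = mat N' N (\<lambda>(j, i). d j i)"
  have D: "D \<in> carrier_mat N' N" by (simp add: D_def)
  have curve: "\<exists>y s. approach Z N ?w v y s \<and> approach Z' N' ?w' (D *\<^sub>v v) (\<lambda>m. \<phi>' (\<psi> (y m))) s \<and>
      (\<forall>m. \<phi> (\<psi>' (\<phi>' (\<psi> (y m)))) = y m)"
    if v: "v \<in> carrier_vec N" "?J *\<^sub>v v = 0\<^sub>v c" for v
  proof -
    obtain y0 s0 where "approach Z N ?w v y0 s0"
      using newton_curve[OF ps(1), of ?w R v] wZ(1) R v unfolding Z_def c_def by blast
    then obtain k where a: "approach ?V N ?w v (\<lambda>m. y0 (m + k)) (\<lambda>m. s0 (m + k))"
      using approach_open[OF _ t(1)[unfolded Z_def] t(2), folded Z_def] by blast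
    define y s where "y = (\<lambda>m. y0 (m + k))" and "s = (\<lambda>m. s0 (m + k))"
    have a: "approach ?V N ?w v y s" using a unfolding y_def s_def .
    have yV: "y m \<in> ?V" for m using a by (simp add: approach_def)
    have aZ: "approach Z N ?w v y s" using a VZ by (auto simp: approach_def)
    have "approach Z' N' ?w' (D *\<^sub>v v) (\<lambda>m. \<phi>' (\<psi> (y m))) s"
      unfolding approach_def
    proof (intro conjI allI impI)
      fix m
      have "\<phi>' (\<psi> (y m)) \<in> W'" using t(3) yV by blast
      moreover have "\<psi>' (\<phi>' (\<psi> (y m))) \<in> U"
      proof -
        have "\<psi> (y m) \<in> U'" using yV by blast
        then have "\<psi>' (\<phi>' (\<psi> (y m))) = \<psi> (y m)" using 2 by (simp add: smooth_chart_def)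
        moreover have "openin (fs_top X) U" "openin (fs_top (affine_closed_space N (set ps))) W"
          "fs_morphism (fs_restrict (affine_closed_space N (set ps)) W) (fs_restrict X U) \<psi>"
          using 1 by (simp_all add: smooth_chart_def N_def)
        then have "\<psi> (y m) \<in> U" using fs_morphism_restrict(1)[of _ W X U \<psi> U "y m"] yV by blast
        ultimately show ?thesis by simp
      qed
      ultimately show "\<phi>' (\<psi> (y m)) \<in> Z'" using VZ(2) by blast
    next
      fix j assume j: "j < N'"
      have "(\<Sum>i<N. d j i * v $ i) = (D *\<^sub>v v) $ j"
        using j by (simp add: mult_mat_vec_index[OF D v(1)]) (simp add: D_def)
      then show "(\<lambda>m. (\<phi>' (\<psi> (y m)) $ j - ?w' $ j) / s m) \<longlonglongrightarrow> (D *\<^sub>v v) $ j"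
        using d[OF j aZ] by (simp add: inv)
    qed (use a in \<open>auto simp: approach_def\<close>)
    moreover have "\<phi> (\<psi>' (\<phi>' (\<psi> (y m)))) = y m" for m using t(4) yV by blast
    ultimately show ?thesis using aZ by blast
  qed
  have "N + c' \<le> c + N'"
  proof (rule kernel_embedding_dim_le[OF J J' R'(1,2) D])
    fix v assume v: "v \<in> carrier_vec N" "?J *\<^sub>v v = 0\<^sub>v c"
    obtain y s where a: "approach Z N ?w v y s" "approach Z' N' ?w' (D *\<^sub>v v) (\<lambda>m. \<phi>' (\<psi> (y m))) s"
      "\<And>m. \<phi> (\<psi>' (\<phi>' (\<psi> (y m)))) = y m" using curve[OF v] by blast
    have Dv: "D *\<^sub>v v \<in> carrier_vec N'" using D v by simp
    have w'c: "?w' \<in> carrier_vec N'" using wZ Zc by blast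
    show "?J' *\<^sub>v (D *\<^sub>v v) = 0\<^sub>v c'"
    proof (rule eq_vecI)
      fix r assume "r < dim_vec (0\<^sub>v c' :: complex vec)"
      then have r: "r < c'" by simp
      then have "ps' ! r \<in> set ps'" by (simp add: c'_def)
      then obtain Q where Q: "slope N' (ps' ! r) Q" using poly_slope ps(2) by blast
      have z: "(ps' ! r) z = 0" if "z \<in> Z'" for z
        using that \<open>ps' ! r \<in> set ps'\<close> by (simp add: Z'_def zero_locus_def)
      have "(\<lambda>m. ((ps' ! r) (\<phi>' (\<psi> (y m))) - (ps' ! r) ?w') / s m) \<longlonglongrightarrow> (\<Sum>i<N'. Q i ?w' ?w' * (D *\<^sub>v v) $ i)"
        by (rule slope_approach[OF Q a(2) Zc(2) w'c])
      moreover have "\<phi>' (\<psi> (y m)) \<in> Z'" for m using a(2) by (simp add: approach_def)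
      ultimately have "(\<Sum>i<N'. Q i ?w' ?w' * (D *\<^sub>v v) $ i) = 0"
        using wZ(2) by (simp add: z LIMSEQ_const_iff)
      then show "(?J' *\<^sub>v (D *\<^sub>v v)) $ r = 0\<^sub>v c' $ r"
        unfolding mult_mat_vec_index[OF J' Dv r] using r jacobian_entry[OF Q w'c] by (simp add: c'_def)
    qed (use J' in auto)
    assume D0: "D *\<^sub>v v = 0\<^sub>v N'"
    show "v = 0\<^sub>v N"
    proof (rule eq_vecI)
      fix i assume "i < dim_vec (0\<^sub>v N :: complex vec)"
      then have i: "i < N" by simp
      have "(\<lambda>m. (y m $ i - ?w $ i) / s m) \<longlonglongrightarrow> 0"
        using d'[OF i a(2)] by (simp add: a(3) inv D0)
      moreover have "(\<lambda>m. (y m $ i - ?w $ i) / s m) \<longlonglongrightarrow> v $ i"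
        using a(1) i by (simp add: approach_def)
      ultimately show "v $ i = 0\<^sub>v N $ i" using i LIMSEQ_unique by fastforce
    qed (use v in auto)
  qed
  then show ?thesis by (simp add: N_def N'_def c_def c'_def)
qed

theorem smooth_dim_unique:
  assumes "smooth_of_dim n X" "smooth_of_dim n' X" "topspace (fs_top X) \<noteq> {}"
  shows "n = n'"
proof -
  obtain x where x: "x \<in> topspace (fs_top X)" using assms(3) by blast
  obtain U ps W \<phi> \<psi> where "smooth_chart X n x U ps W \<phi> \<psi>" using smooth_chart_exists[OF assms(1) x] .
  moreover obtain U' ps' W' \<phi>' \<psi>' where "smooth_chart X n' x U' ps' W' \<phi>' \<psi>'"
    using smooth_chart_exists[OF assms(2) x] .
  ultimately show ?thesis using smooth_chart_dim_le by (metis order_antisym)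
qed


section \<open>Homomorphisms of representations\<close>

lemma mat_assoc:
  "dim_col A = dim_row B \<Longrightarrow> dim_col B = dim_row C \<Longrightarrow> (A * B) * C = A * (B * (C :: complex mat))"
  by (rule assoc_mult_mat[of A "dim_row A" "dim_col A" B "dim_col B" C "dim_col C"]) auto

lemma mat_distrib:
  fixes A B C :: "complex mat"
  shows "dim_col A = dim_row B \<Longrightarrow> dim_row B = dim_row C \<Longrightarrow> dim_col B = dim_col C \<Longrightarrow> A * (B + C) = A * B + A * C"
    and "dim_col A = dim_row B \<Longrightarrow> dim_row B = dim_row C \<Longrightarrow> dim_col B = dim_col C \<Longrightarrow> A * (B - C) = A * B - A * C"
    and "dim_col B = dim_row A \<Longrightarrow> dim_row B = dim_row C \<Longrightarrow> dim_col B = dim_col C \<Longrightarrow> (B + C) * A = B * A + C * A"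
    and "dim_col B = dim_row A \<Longrightarrow> dim_row B = dim_row C \<Longrightarrow> dim_col B = dim_col C \<Longrightarrow> (B - C) * A = B * A - C * A"
proof -
  show "dim_col A = dim_row B \<Longrightarrow> dim_row B = dim_row C \<Longrightarrow> dim_col B = dim_col C \<Longrightarrow> A * (B + C) = A * B + A * C"
    by (rule mult_add_distrib_mat[of A "dim_row A" "dim_col A" B "dim_col B"]) auto
  show "dim_col A = dim_row B \<Longrightarrow> dim_row B = dim_row C \<Longrightarrow> dim_col B = dim_col C \<Longrightarrow> A * (B - C) = A * B - A * C"
    by (rule mult_minus_distrib_mat[of A "dim_row A" "dim_col A" B "dim_col B"]) auto
  show "dim_col B = dim_row A \<Longrightarrow> dim_row B = dim_row C \<Longrightarrow> dim_col B = dim_col C \<Longrightarrow> (B + C) * A = B * A + C * A"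
    by (rule add_mult_distrib_mat[of B "dim_row B" "dim_col B" C A "dim_col A"]) auto
  show "dim_col B = dim_row A \<Longrightarrow> dim_row B = dim_row C \<Longrightarrow> dim_col B = dim_col C \<Longrightarrow> (B - C) * A = B * A - C * A"
    by (rule minus_mult_distrib_mat[of B "dim_row B" "dim_col B" C A "dim_col A"]) auto
qed

text \<open>
  Matrices of a given shape are not a type, so there is no library sum of a family of them; the
  shape makes the empty sum meaningful.
\<close>

definition msum :: "nat \<Rightarrow> nat \<Rightarrow> ('i \<Rightarrow> complex mat) \<Rightarrow> 'i set \<Rightarrow> complex mat" where
  "msum n m F E = mat n m (\<lambda>(r, c). \<Sum>e\<in>E. F e $$ (r, c))"

lemma msum_carrier [simp]: "msum n m F E \<in> carrier_mat n m"
  by (simp add: msum_def)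

lemma msum_dim [simp]: "dim_row (msum n m F E) = n" "dim_col (msum n m F E) = m"
  by (simp_all add: msum_def)

lemma msum_index [simp]: "r < n \<Longrightarrow> c < m \<Longrightarrow> msum n m F E $$ (r, c) = (\<Sum>e\<in>E. F e $$ (r, c))"
  by (simp add: msum_def)

lemma msum_cong: "(\<And>e. e \<in> E \<Longrightarrow> F e = G e) \<Longrightarrow> msum n m F E = msum n m G E"
  by (simp add: msum_def)

lemma mult_msum:
  assumes A: "A \<in> carrier_mat k n" and F: "\<And>e. e \<in> E \<Longrightarrow> F e \<in> carrier_mat n m"
  shows "A * msum n m F E = msum k m (\<lambda>e. A * F e) E"
proof (rule eq_matI)
  fix r c assume "r < dim_row (msum k m (\<lambda>e. A * F e) E)" "c < dim_col (msum k m (\<lambda>e. A * F e) E)"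
  then have rc: "r < k" "c < m" by auto
  have "(A * msum n m F E) $$ (r, c) = (\<Sum>i<n. \<Sum>e\<in>E. A $$ (r, i) * F e $$ (i, c))"
    by (subst mult_mat_index[OF A msum_carrier rc]) (simp add: rc sum_distrib_left)
  also have "\<dots> = (\<Sum>e\<in>E. \<Sum>i<n. A $$ (r, i) * F e $$ (i, c))" by (rule sum.swap)
  also have "\<dots> = (\<Sum>e\<in>E. (A * F e) $$ (r, c))"
    by (intro sum.cong refl) (simp add: mult_mat_index[OF A F rc])
  finally show "(A * msum n m F E) $$ (r, c) = msum k m (\<lambda>e. A * F e) E $$ (r, c)" using rc by simp
qed (use A in auto)

lemma msum_mult:
  assumes A: "A \<in> carrier_mat m k" and F: "\<And>e. e \<in> E \<Longrightarrow> F e \<in> carrier_mat n m"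
  shows "msum n m F E * A = msum n k (\<lambda>e. F e * A) E"
proof (rule eq_matI)
  fix r c assume "r < dim_row (msum n k (\<lambda>e. F e * A) E)" "c < dim_col (msum n k (\<lambda>e. F e * A) E)"
  then have rc: "r < n" "c < k" by auto
  have "(msum n m F E * A) $$ (r, c) = (\<Sum>i<m. \<Sum>e\<in>E. F e $$ (r, i) * A $$ (i, c))"
    by (subst mult_mat_index[OF msum_carrier A rc]) (simp add: rc sum_distrib_right)
  also have "\<dots> = (\<Sum>e\<in>E. \<Sum>i<m. F e $$ (r, i) * A $$ (i, c))" by (rule sum.swap)
  also have "\<dots> = (\<Sum>e\<in>E. (F e * A) $$ (r, c))"
    by (intro sum.cong refl) (simp add: mult_mat_index[OF F A rc])
  finally show "(msum n m F E * A) $$ (r, c) = msum n k (\<lambda>e. F e * A) E $$ (r, c)" using rc by simp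
qed (use A in auto)

definition moment :: "('v, 'e) pre_digraph \<Rightarrow> ('v \<Rightarrow> nat) \<Rightarrow> ('v, 'e) qrep \<Rightarrow> 'v \<Rightarrow> complex mat" where
  "moment Q d x v =
     msum (d v) (d v) (\<lambda>e. Amap x e * Bmap x e) {e \<in> arcs Q. head Q e = v}
     - msum (d v) (d v) (\<lambda>e. Bmap x e * Amap x e) {e \<in> arcs Q. tail Q e = v}
     + imap x v * jmap x v"

text \<open>
  Compatible families of linear maps. Both the maps between the steps of a chain and the
  isomorphisms given by the group are of this kind.
\<close>

definition qhom :: "('v, 'e) pre_digraph \<Rightarrow> ('v \<Rightarrow> complex mat) \<Rightarrow> ('v, 'e) qrep \<Rightarrow> ('v, 'e) qrep \<Rightarrow> bool" where
  "qhom Q g x y \<longleftrightarrow>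
     (\<forall>e\<in>arcs Q. g (head Q e) * Amap x e = Amap y e * g (tail Q e) \<and>
        g (tail Q e) * Bmap x e = Bmap y e * g (head Q e)) \<and>
     (\<forall>v\<in>verts Q. g v * imap x v = imap y v \<and> jmap y v * g v = jmap x v)"

lemma subspace_iff:
  "VectorSpace.subspace class_ring S (module_vec TYPE(complex) n) \<longleftrightarrow>
     S \<subseteq> carrier_vec n \<and> 0\<^sub>v n \<in> S \<and> (\<forall>u\<in>S. \<forall>w\<in>S. u + w \<in> S) \<and> (\<forall>c. \<forall>u\<in>S. c \<cdot>\<^sub>v u \<in> S)"
  using vec_vs[where 'a = complex, of n] vec_module[where 'a = complex, of n]
  by (auto simp: VectorSpace.subspace_def LinearCombinations.submodule_def module_vec_simps class_ring_simps)

lemma subspace_mult_mat_vec: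
  assumes S: "S \<subseteq> carrier_vec n" "0\<^sub>v n \<in> S" "\<And>u w. u \<in> S \<Longrightarrow> w \<in> S \<Longrightarrow> u + w \<in> S" "\<And>c u. u \<in> S \<Longrightarrow> c \<cdot>\<^sub>v u \<in> S"
    and A: "A \<in> carrier_mat n m" and cols: "\<And>c. c < m \<Longrightarrow> col A c \<in> (S :: complex vec set)" and u: "u \<in> carrier_vec m"
  shows "A *\<^sub>v u \<in> S"
proof -
  have "vec n (\<lambda>i. \<Sum>c<k. A $$ (i, c) * u $ c) \<in> S" if "k \<le> m" for k
    using that
  proof (induction k)
    case 0
    have "vec n (\<lambda>i. \<Sum>c<0. A $$ (i, c) * u $ c) = 0\<^sub>v n" by (intro eq_vecI) auto
    then show ?case using S(2) by simp
  next
    case (Suc k)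
    have "vec n (\<lambda>i. \<Sum>c<Suc k. A $$ (i, c) * u $ c) = vec n (\<lambda>i. \<Sum>c<k. A $$ (i, c) * u $ c) + u $ k \<cdot>\<^sub>v col A k"
      using A Suc(2) by (intro eq_vecI) auto
    then show ?case using Suc cols[of k] S(3,4) by simp
  qed
  from this[of m] have "vec n (\<lambda>i. \<Sum>c<m. A $$ (i, c) * u $ c) \<in> S" by simp
  moreover have "A *\<^sub>v u = vec n (\<lambda>i. \<Sum>c<m. A $$ (i, c) * u $ c)"
    using A by (intro eq_vecI) (simp_all add: mult_mat_vec_index[OF A u] del: index_mult_mat_vec)
  ultimately show ?thesis by simp
qed

text \<open>
  Paths of the double quiver that begin with a framing vector; \<open>Gen v k\<close> stands for
  the image under \<open>i\<close> of the basis vector with number \<open>k\<close>.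
\<close>

datatype ('v, 'e) word = Gen 'v nat | StepA 'e "('v, 'e) word" | StepB 'e "('v, 'e) word"

locale quiver =
  fixes Q :: "('v, 'e) pre_digraph"
  assumes fin_digraph: "fin_digraph Q"
begin

lemma finite_arcs [simp]: "finite (arcs Q)"
  and finite_verts [simp]: "finite (verts Q)"
  and head_in [simp]: "e \<in> arcs Q \<Longrightarrow> head Q e \<in> verts Q"
  and tail_in [simp]: "e \<in> arcs Q \<Longrightarrow> tail Q e \<in> verts Q"
  using fin_digraph by (auto simp: fin_digraph_def fin_digraph_axioms_def wf_digraph_def)

lemma qreps_carrier:
  assumes "x \<in> qreps Q d f"
  shows "e \<in> arcs Q \<Longrightarrow> Amap x e \<in> carrier_mat (d (head Q e)) (d (tail Q e))"
    and "e \<in> arcs Q \<Longrightarrow> Bmap x e \<in> carrier_mat (d (tail Q e)) (d (head Q e))"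
    and "v \<in> verts Q \<Longrightarrow> imap x v \<in> carrier_mat (d v) (f v)"
    and "v \<in> verts Q \<Longrightarrow> jmap x v \<in> carrier_mat (f v) (d v)"
  using assms by (auto simp: qreps_def PiE_iff)

lemma qreps_dim:
  assumes "x \<in> qreps Q d f"
  shows "e \<in> arcs Q \<Longrightarrow> dim_row (Amap x e) = d (head Q e)" "e \<in> arcs Q \<Longrightarrow> dim_col (Amap x e) = d (tail Q e)"
    and "e \<in> arcs Q \<Longrightarrow> dim_row (Bmap x e) = d (tail Q e)" "e \<in> arcs Q \<Longrightarrow> dim_col (Bmap x e) = d (head Q e)"
    and "v \<in> verts Q \<Longrightarrow> dim_row (imap x v) = d v" "v \<in> verts Q \<Longrightarrow> dim_col (imap x v) = f v"
    and "v \<in> verts Q \<Longrightarrow> dim_row (jmap x v) = f v" "v \<in> verts Q \<Longrightarrow> dim_col (jmap x v) = d v"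
  using carrier_matD[OF qreps_carrier(1)[OF assms]] carrier_matD[OF qreps_carrier(2)[OF assms]]
    carrier_matD[OF qreps_carrier(3)[OF assms]] carrier_matD[OF qreps_carrier(4)[OF assms]]
  by blast+

lemma qreps_eqI:
  assumes x: "x \<in> qreps Q d f" and y: "y \<in> qreps Q d f"
    and "\<And>e. e \<in> arcs Q \<Longrightarrow> Amap x e = Amap y e" "\<And>e. e \<in> arcs Q \<Longrightarrow> Bmap x e = Bmap y e"
    and "\<And>v. v \<in> verts Q \<Longrightarrow> imap x v = imap y v" "\<And>v. v \<in> verts Q \<Longrightarrow> jmap x v = jmap y v"
  shows "x = y"
proof (rule qrep.equality)
  show "Amap x = Amap y" "Bmap x = Bmap y" "imap x = imap y" "jmap x = jmap y"
    using x y unfolding qreps_def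
    by (auto intro: PiE_ext[of "Amap x" "arcs Q" _ "Amap y"] PiE_ext[of "Bmap x" "arcs Q" _ "Bmap y"]
      PiE_ext[of "imap x" "verts Q" _ "imap y"] PiE_ext[of "jmap x" "verts Q" _ "jmap y"] assms(3-6))
qed simp

lemma moment_carrier: "x \<in> qreps Q d f \<Longrightarrow> v \<in> verts Q \<Longrightarrow> moment Q d x v \<in> carrier_mat (d v) (d v)"
  using qreps_carrier(3,4)[of x d f v] by (auto simp: moment_def)

lemma moment_map_eqs_iff:
  assumes x: "x \<in> qreps Q d f"
  shows "moment_map_eqs Q d x \<longleftrightarrow> (\<forall>v\<in>verts Q. moment Q d x v = 0\<^sub>m (d v) (d v))"
proof -
  have "moment Q d x v = 0\<^sub>m (d v) (d v) \<longleftrightarrow> (\<forall>r<d v. \<forall>c<d v. moment Q d x v $$ (r, c) = 0)" if "v \<in> verts Q" for v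
    using moment_carrier[OF x that] by (auto intro: eq_matI)
  moreover have "moment Q d x v $$ (r, c) = (\<Sum>e | e \<in> arcs Q \<and> head Q e = v. (Amap x e * Bmap x e) $$ (r, c))
     - (\<Sum>e | e \<in> arcs Q \<and> tail Q e = v. (Bmap x e * Amap x e) $$ (r, c))
     + (imap x v * jmap x v) $$ (r, c)" if "v \<in> verts Q" "r < d v" "c < d v" for v r c
    using qreps_dim(5,8)[OF x that(1)] that unfolding moment_def by (simp del: index_mult_mat(1))
  ultimately show ?thesis by (auto simp: moment_map_eqs_def)
qed

text \<open>
  The moment map is natural, so that its vanishing passes to conjugate representations and to
  quotients.
\<close>

lemma moment_qhom:
  assumes x: "x \<in> qreps Q d f" and y: "y \<in> qreps Q d' f"
    and g: "\<And>v. v \<in> verts Q \<Longrightarrow> g v \<in> carrier_mat (d' v) (d v)"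
    and h: "qhom Q g x y" and v: "v \<in> verts Q"
  shows "moment Q d' y v * g v = g v * moment Q d x v"
proof -
  note cx = qreps_carrier[OF x] and cy = qreps_carrier[OF y]
  note dx = qreps_dim[OF x] and dy = qreps_dim[OF y]
  have gd: "dim_row (g u) = d' u" "dim_col (g u) = d u" if "u \<in> verts Q" for u using g[OF that] by auto
  let ?H = "{e \<in> arcs Q. head Q e = v}" and ?T = "{e \<in> arcs Q. tail Q e = v}"
  have hA: "g (head Q e) * Amap x e = Amap y e * g (tail Q e)" and hB: "g (tail Q e) * Bmap x e = Bmap y e * g (head Q e)"
    if "e \<in> arcs Q" for e using h that by (auto simp: qhom_def)
  have 1: "msum (d' v) (d' v) (\<lambda>e. Amap y e * Bmap y e) ?H * g v = g v * msum (d v) (d v) (\<lambda>e. Amap x e * Bmap x e) ?H"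
  proof -
    have "Amap y e * Bmap y e * g v = g v * (Amap x e * Bmap x e)" if e: "e \<in> ?H" for e
    proof -
      have ee: "e \<in> arcs Q" "head Q e = v" using e by auto
      have dv: "d' (head Q e) = d' v" "d (head Q e) = d v" using ee by auto
      have "Amap y e * Bmap y e * g v = Amap y e * (Bmap y e * g v)"
        using ee(1) v dv by (simp add: mat_assoc dy gd)
      also have "\<dots> = Amap y e * g (tail Q e) * Bmap x e"
        using ee(1) hB[OF ee(1)] unfolding ee(2) by (simp add: mat_assoc dx dy gd)
      also have "\<dots> = g v * (Amap x e * Bmap x e)"
        using ee(1) v dv unfolding hA[OF ee(1), unfolded ee(2), symmetric] by (simp add: mat_assoc dx dy gd)
      finally show ?thesis .
    qed
    then show ?thesis
      using g[OF v] cx(1,2) cy(1,2)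
      by (subst msum_mult[of _ _ "d v"] mult_msum[of _ "d' v"]; (subst mult_msum[of _ "d' v"])?)
        (auto intro!: msum_cong mult_carrier_mat)
  qed
  have 2: "msum (d' v) (d' v) (\<lambda>e. Bmap y e * Amap y e) ?T * g v = g v * msum (d v) (d v) (\<lambda>e. Bmap x e * Amap x e) ?T"
  proof -
    have "Bmap y e * Amap y e * g v = g v * (Bmap x e * Amap x e)" if e: "e \<in> ?T" for e
    proof -
      have ee: "e \<in> arcs Q" "tail Q e = v" using e by auto
      have dv: "d' (tail Q e) = d' v" "d (tail Q e) = d v" using ee by auto
      have "Bmap y e * Amap y e * g v = Bmap y e * (Amap y e * g v)"
        using ee(1) v dv by (simp add: mat_assoc dy gd)
      also have "\<dots> = Bmap y e * g (head Q e) * Amap x e"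
        using ee(1) hA[OF ee(1)] unfolding ee(2) by (simp add: mat_assoc dx dy gd)
      also have "\<dots> = g v * (Bmap x e * Amap x e)"
        using ee(1) v dv unfolding hB[OF ee(1), unfolded ee(2), symmetric] by (simp add: mat_assoc dx dy gd)
      finally show ?thesis .
    qed
    then show ?thesis
      using g[OF v] cx(1,2) cy(1,2)
      by (subst msum_mult[of _ _ "d v"] mult_msum[of _ "d' v"]; (subst mult_msum[of _ "d' v"])?)
        (auto intro!: msum_cong mult_carrier_mat)
  qed
  have 3: "imap y v * jmap y v * g v = g v * (imap x v * jmap x v)"
  proof -
    have "imap y v * jmap y v * g v = imap y v * (jmap y v * g v)" using v by (simp add: mat_assoc dx dy gd)
    also have "\<dots> = g v * imap x v * jmap x v" using h v by (simp add: qhom_def)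
    finally show ?thesis using v by (simp add: mat_assoc dx dy gd)
  qed
  have cy': "imap y v * jmap y v \<in> carrier_mat (d' v) (d' v)" and cx': "imap x v * jmap x v \<in> carrier_mat (d v) (d v)"
    using cx(3,4)[OF v] cy(3,4)[OF v] by auto
  show ?thesis
    unfolding moment_def
    using g[OF v] cx' cy' 1 2 3
    by (simp add: mat_distrib gd[OF v] dx(5-8)[OF v] dy(5-8)[OF v])
qed

lemma qhom_comp:
  assumes x: "x \<in> qreps Q d f" and y: "y \<in> qreps Q d' f" and z: "z \<in> qreps Q d'' f"
    and g: "\<And>v. v \<in> verts Q \<Longrightarrow> g v \<in> carrier_mat (d' v) (d v)"
    and g': "\<And>v. v \<in> verts Q \<Longrightarrow> g' v \<in> carrier_mat (d'' v) (d' v)"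
    and h: "qhom Q g x y" and h': "qhom Q g' y z"
  shows "qhom Q (\<lambda>v. g' v * g v) x z"
proof -
  note dx = qreps_dim[OF x] and dy = qreps_dim[OF y] and dz = qreps_dim[OF z]
  have gd: "dim_row (g u) = d' u" "dim_col (g u) = d u" "dim_row (g' u) = d'' u" "dim_col (g' u) = d' u"
    if "u \<in> verts Q" for u using g[OF that] g'[OF that] by auto
  have A: "g (head Q e) * Amap x e = Amap y e * g (tail Q e)" "g (tail Q e) * Bmap x e = Bmap y e * g (head Q e)"
    "g' (head Q e) * Amap y e = Amap z e * g' (tail Q e)" "g' (tail Q e) * Bmap y e = Bmap z e * g' (head Q e)"
    if "e \<in> arcs Q" for e using h h' that by (auto simp: qhom_def)
  have I: "g v * imap x v = imap y v" "jmap y v * g v = jmap x v" "g' v * imap y v = imap z v" "jmap z v * g' v = jmap y v"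
    if "v \<in> verts Q" for v using h h' that by (auto simp: qhom_def)
  show ?thesis
    unfolding qhom_def
  proof (intro conjI ballI)
    fix e assume e: "e \<in> arcs Q"
    have "g' (head Q e) * (Amap y e * g (tail Q e)) = Amap z e * (g' (tail Q e) * g (tail Q e))"
      using e A(3)[OF e] by (simp flip: mat_assoc add: dx dy dz gd)
    then show "g' (head Q e) * g (head Q e) * Amap x e = Amap z e * (g' (tail Q e) * g (tail Q e))"
      using e A(1)[OF e] by (simp add: mat_assoc dx dy dz gd)
    have "g' (tail Q e) * (Bmap y e * g (head Q e)) = Bmap z e * (g' (head Q e) * g (head Q e))"
      using e A(4)[OF e] by (simp flip: mat_assoc add: dx dy dz gd)
    then show "g' (tail Q e) * g (tail Q e) * Bmap x e = Bmap z e * (g' (head Q e) * g (head Q e))"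
      using e A(2)[OF e] by (simp add: mat_assoc dx dy dz gd)
  next
    fix v assume v: "v \<in> verts Q"
    show "g' v * g v * imap x v = imap z v" using v I[OF v] by (simp add: mat_assoc dx dy dz gd)
    show "jmap z v * (g' v * g v) = jmap x v" using v I[OF v] by (simp flip: mat_assoc add: dx dy dz gd)
  qed
qed

lemma qhom_inverse:
  assumes x: "x \<in> qreps Q d f" and y: "y \<in> qreps Q d f"
    and g: "\<And>v. v \<in> verts Q \<Longrightarrow> g v \<in> carrier_mat (d v) (d v)"
    and k: "\<And>v. v \<in> verts Q \<Longrightarrow> k v \<in> carrier_mat (d v) (d v)"
    and gk: "\<And>v. v \<in> verts Q \<Longrightarrow> g v * k v = 1\<^sub>m (d v)" and kg: "\<And>v. v \<in> verts Q \<Longrightarrow> k v * g v = 1\<^sub>m (d v)"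
    and h: "qhom Q g x y"
  shows "qhom Q k y x"
proof -
  note dx = qreps_dim[OF x] and dy = qreps_dim[OF y]
  note cx = qreps_carrier[OF x] and cy = qreps_carrier[OF y]
  have gd: "dim_row (g u) = d u" "dim_col (g u) = d u" "dim_row (k u) = d u" "dim_col (k u) = d u"
    if "u \<in> verts Q" for u using g[OF that] k[OF that] by auto
  \<comment> \<open>Cancelling an intertwiner on both sides.\<close>
  have cancel: "k u * N = M * k w"
    if u: "u \<in> verts Q" and w: "w \<in> verts Q" and M: "M \<in> carrier_mat (d u) (d w)" and N: "N \<in> carrier_mat (d u) (d w)"
      and eq: "g u * M = N * g w" for u w M N
  proof -
    have "k u * N = k u * (N * (g w * k w))" using N gk[OF w] by simp
    also have "\<dots> = k u * (N * g w) * k w" using N u w by (simp add: mat_assoc gd)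
    also have "\<dots> = k u * (g u * M) * k w" by (simp add: eq)
    also have "\<dots> = (k u * g u) * M * k w" using M u w by (simp add: mat_assoc gd)
    also have "\<dots> = M * k w" using M kg[OF u] by simp
    finally show ?thesis .
  qed
  show ?thesis
    unfolding qhom_def
  proof (intro conjI ballI)
    fix e assume e: "e \<in> arcs Q"
    show "k (head Q e) * Amap y e = Amap x e * k (tail Q e)"
      using h e cx(1) cy(1) by (intro cancel) (auto simp: qhom_def)
    show "k (tail Q e) * Bmap y e = Bmap x e * k (head Q e)"
      using h e cx(2) cy(2) by (intro cancel) (auto simp: qhom_def)
  next
    fix v assume v: "v \<in> verts Q"
    have "k v * (g v * imap x v) = imap x v" using v cx(3)[OF v] kg[OF v] by (simp flip: mat_assoc add: gd dx)
    then show "k v * imap y v = imap x v" using h v by (simp add: qhom_def)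
    have "(jmap y v * g v) * k v = jmap y v" using v cy(4)[OF v] gk[OF v] by (simp add: mat_assoc gd dy)
    then show "jmap x v * k v = jmap y v" using h v by (simp add: qhom_def)
  qed
qed


section \<open>Words\<close>

fun target :: "('v, 'e) word \<Rightarrow> 'v" where
  "target (Gen v k) = v"
| "target (StepA e w) = head Q e"
| "target (StepB e w) = tail Q e"

fun valid :: "('v \<Rightarrow> nat) \<Rightarrow> ('v, 'e) word \<Rightarrow> bool" where
  "valid f (Gen v k) \<longleftrightarrow> v \<in> verts Q \<and> k < f v"
| "valid f (StepA e w) \<longleftrightarrow> e \<in> arcs Q \<and> target w = tail Q e \<and> valid f w"
| "valid f (StepB e w) \<longleftrightarrow> e \<in> arcs Q \<and> target w = head Q e \<and> valid f w"

fun ev :: "('v, 'e) qrep \<Rightarrow> ('v, 'e) word \<Rightarrow> complex vec" where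
  "ev x (Gen v k) = col (imap x v) k"
| "ev x (StepA e w) = Amap x e *\<^sub>v ev x w"
| "ev x (StepB e w) = Bmap x e *\<^sub>v ev x w"

lemma valid_target: "valid f w \<Longrightarrow> target w \<in> verts Q"
  by (cases w) auto

lemma ev_carrier: "x \<in> qreps Q d f \<Longrightarrow> valid f w \<Longrightarrow> ev x w \<in> carrier_vec (d (target w))"
proof (induction w)
  case (Gen v k)
  then show ?case using qreps_carrier(3)[OF Gen(1), of v] by auto
next
  case (StepA e w)
  then show ?case using qreps_carrier(1)[OF StepA(2), of e] by auto
next
  case (StepB e w)
  then show ?case using qreps_carrier(2)[OF StepB(2), of e] by auto
qed

lemma ev_qhom:
  assumes x: "x \<in> qreps Q d f" and y: "y \<in> qreps Q d' f"
    and g: "\<And>v. v \<in> verts Q \<Longrightarrow> g v \<in> carrier_mat (d' v) (d v)" and h: "qhom Q g x y"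
  shows "valid f w \<Longrightarrow> ev y w = g (target w) *\<^sub>v ev x w"
proof (induction w)
  case (Gen v k)
  then have v: "v \<in> verts Q" "k < f v" by auto
  have "imap y v = g v * imap x v" using h v by (simp add: qhom_def)
  then show ?case using col_mult2[OF g[OF v(1)] qreps_carrier(3)[OF x v(1)] v(2)] by simp
next
  case (StepA e w)
  then have e: "e \<in> arcs Q" "target w = tail Q e" "valid f w" by auto
  have u: "ev x w \<in> carrier_vec (d (tail Q e))" using ev_carrier[OF x e(3)] e(2) by simp
  have "ev y (StepA e w) = (Amap y e * g (tail Q e)) *\<^sub>v ev x w"
    using StepA.IH e u assoc_mult_mat_vec[OF qreps_carrier(1)[OF y e(1)] g[OF tail_in[OF e(1)]] u] by simp
  also have "\<dots> = (g (head Q e) * Amap x e) *\<^sub>v ev x w" using h e(1) by (simp add: qhom_def)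
  also have "\<dots> = g (head Q e) *\<^sub>v (Amap x e *\<^sub>v ev x w)"
    by (rule assoc_mult_mat_vec[OF g[OF head_in[OF e(1)]] qreps_carrier(1)[OF x e(1)] u])
  finally show ?case by simp
next
  case (StepB e w)
  then have e: "e \<in> arcs Q" "target w = head Q e" "valid f w" by auto
  have u: "ev x w \<in> carrier_vec (d (head Q e))" using ev_carrier[OF x e(3)] e(2) by simp
  have "ev y (StepB e w) = (Bmap y e * g (head Q e)) *\<^sub>v ev x w"
    using StepB.IH e u assoc_mult_mat_vec[OF qreps_carrier(2)[OF y e(1)] g[OF head_in[OF e(1)]] u] by simp
  also have "\<dots> = (g (tail Q e) * Bmap x e) *\<^sub>v ev x w" using h e(1) by (simp add: qhom_def)
  also have "\<dots> = g (tail Q e) *\<^sub>v (Bmap x e *\<^sub>v ev x w)"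
    by (rule assoc_mult_mat_vec[OF g[OF tail_in[OF e(1)]] qreps_carrier(2)[OF x e(1)] u])
  finally show ?case by simp
qed

lemma finite_words: "finite {w. valid f w \<and> size w \<le> n}"
proof (induction n)
  case 0
  have "{w. valid f w \<and> size w \<le> 0} \<subseteq> (\<lambda>(v, k). Gen v k) ` (SIGMA v:verts Q. {..<f v})"
  proof
    fix w assume "w \<in> {w. valid f w \<and> size w \<le> 0}"
    then show "w \<in> (\<lambda>(v, k). Gen v k) ` (SIGMA v:verts Q. {..<f v})" by (cases w) auto
  qed
  then show ?case by (rule finite_subset) auto
next
  case (Suc n)
  let ?S = "{w. valid f w \<and> size w \<le> n}"
  have "{w. valid f w \<and> size w \<le> Suc n} \<subseteq> (\<lambda>(v, k). Gen v k) ` (SIGMA v:verts Q. {..<f v}) \<union>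
    (\<lambda>(e, w). StepA e w) ` (arcs Q \<times> ?S) \<union> (\<lambda>(e, w). StepB e w) ` (arcs Q \<times> ?S)"
  proof
    fix w assume "w \<in> {w. valid f w \<and> size w \<le> Suc n}"
    then show "w \<in> (\<lambda>(v, k). Gen v k) ` (SIGMA v:verts Q. {..<f v}) \<union>
      (\<lambda>(e, w). StepA e w) ` (arcs Q \<times> ?S) \<union> (\<lambda>(e, w). StepB e w) ` (arcs Q \<times> ?S)"
      by (cases w) auto
  qed
  then show ?case by (rule finite_subset) (use Suc in auto)
qed

text \<open>
  Only the first \<open>d v\<close> words at \<open>v\<close> enter, so a single family
  \<open>L\<close> serves all the representations of a chain with decreasing dimensions.
\<close>

definition wmat :: "('v \<Rightarrow> nat) \<Rightarrow> ('v, 'e) qrep \<Rightarrow> ('v \<Rightarrow> nat \<Rightarrow> ('v, 'e) word) \<Rightarrow> 'v \<Rightarrow> complex mat" where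
  "wmat d x L v = mat (d v) (d v) (\<lambda>(r, c). ev x (L v c) $ r)"

definition word_family :: "('v \<Rightarrow> nat) \<Rightarrow> ('v \<Rightarrow> nat) \<Rightarrow> ('v \<Rightarrow> nat \<Rightarrow> ('v, 'e) word) \<Rightarrow> bool" where
  "word_family d f L \<longleftrightarrow> (\<forall>v\<in>verts Q. \<forall>c<d v. valid f (L v c) \<and> target (L v c) = v)"

lemma wmat_carrier [simp]: "wmat d x L v \<in> carrier_mat (d v) (d v)"
  by (simp add: wmat_def)

lemma wmat_dim [simp]: "dim_row (wmat d x L v) = d v" "dim_col (wmat d x L v) = d v"
  by (simp_all add: wmat_def)

lemma col_wmat:
  assumes "x \<in> qreps Q d f" "word_family d f L" "v \<in> verts Q" "c < d v"
  shows "col (wmat d x L v) c = ev x (L v c)"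
proof -
  have "ev x (L v c) \<in> carrier_vec (d v)"
    using ev_carrier[OF assms(1), of "L v c"] assms(2-4) by (auto simp: word_family_def)
  then show ?thesis using assms(4) by (auto simp: wmat_def col_def)
qed

lemma wmat_qhom:
  assumes x: "x \<in> qreps Q d f" and y: "y \<in> qreps Q d f"
    and g: "\<And>v. v \<in> verts Q \<Longrightarrow> g v \<in> carrier_mat (d v) (d v)" and h: "qhom Q g x y"
    and L: "word_family d f L" and v: "v \<in> verts Q"
  shows "wmat d y L v = g v * wmat d x L v"
proof (rule mat_col_eqI)
  fix c assume "c < dim_col (g v * wmat d x L v)"
  then have c: "c < d v" by simp
  have "ev y (L v c) = g v *\<^sub>v ev x (L v c)"
    using ev_qhom[OF x y g h, of "L v c"] L v c by (auto simp: word_family_def)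
  then show "col (wmat d y L v) c = col (g v * wmat d x L v) c"
    using col_mult2[OF g[OF v] wmat_carrier[of d x L v] c] col_wmat[OF x L v c] col_wmat[OF y L v c] by simp
qed (use g[OF v] in auto)

text \<open>
  A subrepresentation that contains the image of the framing contains the values of all words,
  among them a basis.
\<close>

lemma stableI_words:
  assumes x: "x \<in> qreps Q d f" and L: "word_family d f L"
    and det: "\<And>v. v \<in> verts Q \<Longrightarrow> det (wmat d x L v) \<noteq> 0"
  shows "stable Q d f x"
  unfolding stable_def
proof (intro allI impI ballI)
  fix S v
  assume S: "(\<forall>v\<in>verts Q. VectorSpace.subspace class_ring (S v) (module_vec TYPE(complex) (d v)) \<and>
        (\<forall>u \<in> carrier_vec (f v). imap x v *\<^sub>v u \<in> S v)) \<and>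
     (\<forall>e \<in> arcs Q. (\<forall>u \<in> S (tail Q e). Amap x e *\<^sub>v u \<in> S (head Q e)) \<and>
        (\<forall>u \<in> S (head Q e). Bmap x e *\<^sub>v u \<in> S (tail Q e)))" and v: "v \<in> verts Q"
  have ev: "valid f w \<Longrightarrow> ev x w \<in> S (target w)" for w
  proof (induction w)
    case (Gen v k)
    then have v: "v \<in> verts Q" "k < f v" by auto
    have "imap x v *\<^sub>v unit_vec (f v) k \<in> S v" using S v(1) by auto
    moreover have "imap x v *\<^sub>v unit_vec (f v) k = col (imap x v) k"
      using qreps_carrier(3)[OF x v(1)] v(2) by (intro eq_vecI) auto
    ultimately show ?case by simp
  qed (use S in auto)
  have sub: "S v \<subseteq> carrier_vec (d v)" "0\<^sub>v (d v) \<in> S v" "\<And>u w. u \<in> S v \<Longrightarrow> w \<in> S v \<Longrightarrow> u + w \<in> S v"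
    "\<And>c u. u \<in> S v \<Longrightarrow> c \<cdot>\<^sub>v u \<in> S v" using S v unfolding subspace_iff by auto
  have "u \<in> S v" if u: "u \<in> carrier_vec (d v)" for u
  proof -
    note m = minv[OF wmat_carrier det[OF v]]
    have "u = wmat d x L v *\<^sub>v (minv (wmat d x L v) *\<^sub>v u)"
      using m u by (simp flip: assoc_mult_mat_vec[of _ "d v" "d v" _ "d v"])
    also have "\<dots> \<in> S v"
    proof (rule subspace_mult_mat_vec[OF sub wmat_carrier[of d x L v]])
      fix c assume c: "c < d v"
      show "col (wmat d x L v) c \<in> S v"
        using ev[of "L v c"] L v c by (auto simp: col_wmat[OF x L v c] word_family_def)
    qed (use m(1) u in auto)
    finally show ?thesis .
  qed
  then show "S v = carrier_vec (d v)" using sub(1) by blast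
qed

end

definition colmat :: "nat \<Rightarrow> complex vec list \<Rightarrow> complex mat" where
  "colmat n us = mat n (length us) (\<lambda>(r, c). us ! c $ r)"

lemma colmat_carrier [simp]: "colmat n us \<in> carrier_mat n (length us)"
  by (simp add: colmat_def)

lemma col_colmat: "set us \<subseteq> carrier_vec n \<Longrightarrow> c < length us \<Longrightarrow> col (colmat n us) c = us ! c"
proof -
  assume us: "set us \<subseteq> carrier_vec n" and c: "c < length us"
  then have "us ! c \<in> carrier_vec n" using nth_mem by blast
  then show ?thesis using c by (auto simp: colmat_def)
qed

text \<open>Independence of a list, so that a repetition is a dependence.\<close>

definition indep :: "nat \<Rightarrow> complex vec list \<Rightarrow> bool" where
  "indep n us \<longleftrightarrow> (\<forall>a\<in>carrier_vec (length us). colmat n us *\<^sub>v a = 0\<^sub>v n \<longrightarrow> a = 0\<^sub>v (length us))"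

definition vspan :: "nat \<Rightarrow> complex vec list \<Rightarrow> complex vec set" where
  "vspan n us = (\<lambda>a. colmat n us *\<^sub>v a) ` carrier_vec (length us)"

lemma vspan_subspace:
  "vspan n us \<subseteq> carrier_vec n" "0\<^sub>v n \<in> vspan n us"
  "u \<in> vspan n us \<Longrightarrow> w \<in> vspan n us \<Longrightarrow> u + w \<in> vspan n us" "u \<in> vspan n us \<Longrightarrow> c \<cdot>\<^sub>v u \<in> vspan n us"
proof -
  show "vspan n us \<subseteq> carrier_vec n" unfolding vspan_def using mult_mat_vec_carrier[OF colmat_carrier] by blast
  have "colmat n us *\<^sub>v 0\<^sub>v (length us) = 0\<^sub>v n" by (intro eq_vecI) (auto simp: colmat_def scalar_prod_def)
  then show "0\<^sub>v n \<in> vspan n us" unfolding vspan_def by (metis image_eqI zero_carrier_vec)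
  show "u \<in> vspan n us \<Longrightarrow> w \<in> vspan n us \<Longrightarrow> u + w \<in> vspan n us"
    unfolding vspan_def
    by (auto simp: mult_add_distrib_mat_vec[OF colmat_carrier, symmetric] intro!: imageI add_carrier_vec)
  show "u \<in> vspan n us \<Longrightarrow> c \<cdot>\<^sub>v u \<in> vspan n us"
    unfolding vspan_def by (auto simp: mult_mat_vec[OF colmat_carrier, symmetric] intro!: imageI)
qed

lemma indep_length: "indep n us \<Longrightarrow> length us \<le> n"
  using wide_matrix_kernel[OF colmat_carrier[of n us]] unfolding indep_def by (meson not_le)

lemma indep_snoc:
  assumes i: "indep n us" and u: "u \<in> carrier_vec n" "u \<notin> vspan n us"
  shows "indep n (us @ [u])"
  unfolding indep_def
proof (intro ballI impI)
  let ?k = "length us"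
  fix a assume a: "a \<in> carrier_vec (length (us @ [u]))" and z: "colmat n (us @ [u]) *\<^sub>v a = 0\<^sub>v n"
  define b where "b = vec ?k (\<lambda>c. a $ c)"
  have b: "b \<in> carrier_vec ?k" by (simp add: b_def)
  have eq: "(colmat n us *\<^sub>v b) $ r + a $ ?k * u $ r = 0" if r: "r < n" for r
  proof -
    have "(colmat n (us @ [u]) *\<^sub>v a) $ r = (\<Sum>c<Suc ?k. colmat n (us @ [u]) $$ (r, c) * a $ c)"
      using r a by (subst mult_mat_vec_index[OF colmat_carrier]) auto
    also have "\<dots> = (\<Sum>c<?k. colmat n us $$ (r, c) * b $ c) + u $ r * a $ ?k"
      using r by (auto simp: colmat_def b_def nth_append intro!: sum.cong)
    also have "(\<Sum>c<?k. colmat n us $$ (r, c) * b $ c) = (colmat n us *\<^sub>v b) $ r"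
      by (rule mult_mat_vec_index[OF colmat_carrier b r, symmetric])
    finally show ?thesis using z r by (simp add: mult.commute)
  qed
  have a0: "a $ ?k = 0"
  proof (rule ccontr)
    assume ne: "a $ ?k \<noteq> 0"
    have "u = colmat n us *\<^sub>v ((- 1 / a $ ?k) \<cdot>\<^sub>v b)"
    proof (rule eq_vecI)
      fix r assume "r < dim_vec (colmat n us *\<^sub>v ((- 1 / a $ ?k) \<cdot>\<^sub>v b))"
      then have r: "r < n" by (simp add: colmat_def)
      have "(colmat n us *\<^sub>v ((- 1 / a $ ?k) \<cdot>\<^sub>v b)) $ r = (- 1 / a $ ?k) * (colmat n us *\<^sub>v b) $ r"
        using r colmat_carrier[of n us] by (subst mult_mat_vec[OF colmat_carrier b]) (simp add: colmat_def)
      also have "\<dots> = (- 1 / a $ ?k) * (- (a $ ?k * u $ r))" unfolding eq_neg_iff_add_eq_0[THEN iffD2, OF eq[OF r]] ..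
      also have "\<dots> = u $ r" using ne by simp
      finally show "u $ r = (colmat n us *\<^sub>v ((- 1 / a $ ?k) \<cdot>\<^sub>v b)) $ r" by simp
    qed (use u in \<open>simp add: colmat_def\<close>)
    then have "u \<in> vspan n us" unfolding vspan_def using b by (intro image_eqI[of _ _ "(- 1 / a $ ?k) \<cdot>\<^sub>v b"]) auto
    then show False using u by simp
  qed
  have "colmat n us *\<^sub>v b = 0\<^sub>v n" using eq a0 by (intro eq_vecI) (auto simp: colmat_def)
  then have b0: "b = 0\<^sub>v ?k" using i b by (auto simp: indep_def)
  show "a = 0\<^sub>v (length (us @ [u]))"
  proof (rule eq_vecI)
    fix c assume "c < dim_vec (0\<^sub>v (length (us @ [u])) :: complex vec)"
    then have "c < ?k \<or> c = ?k" by auto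
    then show "a $ c = 0\<^sub>v (length (us @ [u])) $ c"
    proof
      assume c: "c < ?k"
      then have "a $ c = b $ c" by (simp add: b_def)
      then show ?thesis using b0 c by simp
    qed (simp add: a0)
  qed (use a in simp)
qed

lemma vspan_proper:
  assumes "length us < n" shows "vspan n us \<noteq> carrier_vec n"
proof
  assume eq: "vspan n us = carrier_vec n"
  let ?k = "length us"
  have "\<exists>a. a \<in> carrier_vec ?k \<and> colmat n us *\<^sub>v a = unit_vec n j" for j
  proof -
    have "unit_vec n j \<in> vspan n us" unfolding eq by simp
    then show ?thesis unfolding vspan_def by auto
  qed
  then obtain a where a: "\<And>j. a j \<in> carrier_vec ?k" "\<And>j. colmat n us *\<^sub>v a j = unit_vec n j" by metis
  define B where "B = mat ?k n (\<lambda>(r, c). a c $ r)"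
  have B: "B \<in> carrier_mat ?k n" by (simp add: B_def)
  have colB: "col B j = a j" if "j < n" for j using a(1)[of j] that by (auto simp: B_def)
  have "colmat n us * B = 1\<^sub>m n"
  proof (rule mat_col_eqI)
    fix j assume "j < dim_col (1\<^sub>m n :: complex mat)"
    then have j: "j < n" by simp
    show "col (colmat n us * B) j = col (1\<^sub>m n) j"
      using j by (simp add: col_mult2[OF colmat_carrier B j] colB[OF j] a(2))
  qed (use B in \<open>auto simp: colmat_def\<close>)
  moreover obtain z where z: "z \<in> carrier_vec n" "z \<noteq> 0\<^sub>v n" "B *\<^sub>v z = 0\<^sub>v ?k"
    using wide_matrix_kernel[OF B assms] by blast
  ultimately have "z = colmat n us *\<^sub>v 0\<^sub>v ?k"
    using B assoc_mult_mat_vec[OF colmat_carrier[of n us] B z(1)] by simp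
  also have "\<dots> = 0\<^sub>v n" by (intro eq_vecI) (auto simp: colmat_def scalar_prod_def)
  finally show False using z(2) by simp
qed

lemma indep_det:
  assumes "indep n us" "length us = n" shows "det (colmat n us) \<noteq> 0"
  using assms det_0_iff_vec_prod_zero[of "colmat n us" n] colmat_carrier[of n us] unfolding indep_def by auto

lemma vspan_mult_mat_vec:
  assumes S: "S \<subseteq> carrier_vec m" "0\<^sub>v m \<in> S" "\<And>u w. u \<in> S \<Longrightarrow> w \<in> S \<Longrightarrow> u + w \<in> S" "\<And>c u. u \<in> S \<Longrightarrow> c \<cdot>\<^sub>v u \<in> S"
    and A: "A \<in> carrier_mat m n" and us: "set us \<subseteq> carrier_vec n" and im: "\<And>u. u \<in> set us \<Longrightarrow> A *\<^sub>v u \<in> S"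
    and u: "u \<in> vspan n us"
  shows "A *\<^sub>v u \<in> S"
proof -
  obtain a where a: "a \<in> carrier_vec (length us)" "u = colmat n us *\<^sub>v a" using u by (auto simp: vspan_def)
  have "(A * colmat n us) *\<^sub>v a \<in> S"
  proof (rule subspace_mult_mat_vec[OF S _ _ a(1)])
    show "A * colmat n us \<in> carrier_mat m (length us)" using A by (intro mult_carrier_mat) auto
    show "col (A * colmat n us) c \<in> S" if "c < length us" for c
      using col_mult2[OF A colmat_carrier that] col_colmat[OF us that] im that by simp
  qed
  then show ?thesis using assoc_mult_mat_vec[OF A colmat_carrier a(1)] a(2) by simp
qed

context quiver
begin

text \<open>
  Independent words at each vertex. The bound on their size leaves finitely many possibilities.
\<close>

definition word_lists :: "('v \<Rightarrow> nat) \<Rightarrow> ('v \<Rightarrow> nat) \<Rightarrow> ('v, 'e) qrep \<Rightarrow> ('v \<Rightarrow> ('v, 'e) word list) \<Rightarrow> bool" where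
  "word_lists d f x W \<longleftrightarrow> (\<forall>v\<in>verts Q. indep (d v) (map (ev x) (W v)) \<and>
     (\<forall>w\<in>set (W v). valid f w \<and> target w = v \<and> size w \<le> (\<Sum>v\<in>verts Q. length (W v))))"

lemma word_lists_length: "word_lists d f x W \<Longrightarrow> v \<in> verts Q \<Longrightarrow> length (W v) \<le> d v"
  using indep_length[of "d v" "map (ev x) (W v)"] by (auto simp: word_lists_def)

lemma word_lists_Nil: "word_lists d f x (\<lambda>_. [])"
  by (auto simp: word_lists_def indep_def intro!: eq_vecI)

lemma word_lists_snoc:
  assumes x: "x \<in> qreps Q d f" and W: "word_lists d f x W" and w: "valid f w"
    "size w \<le> Suc (\<Sum>v\<in>verts Q. length (W v))" "ev x w \<notin> vspan (d (target w)) (map (ev x) (W (target w)))"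
  shows "word_lists d f x (W(target w := W (target w) @ [w]))"
proof -
  let ?W = "W(target w := W (target w) @ [w])"
  have t: "target w \<in> verts Q" by (rule valid_target[OF w(1)])
  have "(\<Sum>v\<in>verts Q. length (?W v)) = length (?W (target w)) + (\<Sum>v\<in>verts Q - {target w}. length (?W v))"
    by (rule sum.remove[OF finite_verts t])
  also have "(\<Sum>v\<in>verts Q - {target w}. length (?W v)) = (\<Sum>v\<in>verts Q - {target w}. length (W v))"
    by (intro sum.cong) auto
  finally have T: "(\<Sum>v\<in>verts Q. length (?W v)) = Suc (\<Sum>v\<in>verts Q. length (W v))"
    using sum.remove[OF finite_verts t, of "\<lambda>v. length (W v)"] by simp
  show ?thesis
    unfolding word_lists_def T
  proof (intro ballI conjI)
    fix v assume v: "v \<in> verts Q"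
    show "indep (d v) (map (ev x) (?W v))"
      using W v indep_snoc[OF _ ev_carrier[OF x w(1)] w(3)] by (auto simp: word_lists_def)
    fix u assume "u \<in> set (?W v)"
    then have "u \<in> set (W v) \<or> (u = w \<and> v = target w)" by (auto split: if_splits)
    then show "valid f u" "target u = v" "size u \<le> Suc (\<Sum>v\<in>verts Q. length (W v))"
      using W v w by (auto simp: word_lists_def intro: le_SucI)
  qed
qed

text \<open>
  If all words of the next size stayed in the spans, the spans would form a subrepresentation that
  contains the image of the framing, and stability would make them everything.
\<close>

lemma word_lists_escape:
  assumes x: "x \<in> qreps Q d f" and st: "stable Q d f x" and W: "word_lists d f x W"
    and v: "v \<in> verts Q" "length (W v) < d v"
  shows "\<exists>w. valid f w \<and> size w \<le> Suc (\<Sum>v\<in>verts Q. length (W v)) \<and>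
    ev x w \<notin> vspan (d (target w)) (map (ev x) (W (target w)))"
proof (rule ccontr)
  let ?S = "\<lambda>v. vspan (d v) (map (ev x) (W v))"
  assume "\<not> ?thesis"
  then have in_S: "ev x w \<in> ?S (target w)" if "valid f w" "size w \<le> Suc (\<Sum>v\<in>verts Q. length (W v))" for w
    using that by blast
  have Wc: "set (map (ev x) (W u)) \<subseteq> carrier_vec (d u)" if "u \<in> verts Q" for u
    using W that ev_carrier[OF x] by (fastforce simp: word_lists_def)
  have "(\<forall>v \<in> verts Q. VectorSpace.subspace class_ring (?S v) (module_vec TYPE(complex) (d v)) \<and>
        (\<forall>u \<in> carrier_vec (f v). imap x v *\<^sub>v u \<in> ?S v)) \<and>
     (\<forall>e \<in> arcs Q. (\<forall>u \<in> ?S (tail Q e). Amap x e *\<^sub>v u \<in> ?S (head Q e)) \<and>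
        (\<forall>u \<in> ?S (head Q e). Bmap x e *\<^sub>v u \<in> ?S (tail Q e)))"
  proof (intro conjI ballI)
    fix v assume v: "v \<in> verts Q"
    show "VectorSpace.subspace class_ring (?S v) (module_vec TYPE(complex) (d v))"
      unfolding subspace_iff using vspan_subspace by blast
    fix u :: "complex vec" assume u: "u \<in> carrier_vec (f v)"
    show "imap x v *\<^sub>v u \<in> ?S v"
      by (rule subspace_mult_mat_vec[OF vspan_subspace qreps_carrier(3)[OF x v] _ u])
        (use in_S[of "Gen v _"] v in auto)
  next
    fix e u assume e: "e \<in> arcs Q" and u: "u \<in> ?S (tail Q e)"
    show "Amap x e *\<^sub>v u \<in> ?S (head Q e)"
    proof (rule vspan_mult_mat_vec[OF vspan_subspace qreps_carrier(1)[OF x e] Wc _ u])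
      fix y assume "y \<in> set (map (ev x) (W (tail Q e)))"
      then obtain w where "w \<in> set (W (tail Q e))" "y = ev x w" by auto
      then show "Amap x e *\<^sub>v y \<in> ?S (head Q e)"
        using in_S[of "StepA e w"] bspec[OF W[unfolded word_lists_def] tail_in[OF e]] e by auto
    qed (use tail_in[OF e] in auto)
  next
    fix e u assume e: "e \<in> arcs Q" and u: "u \<in> ?S (head Q e)"
    show "Bmap x e *\<^sub>v u \<in> ?S (tail Q e)"
    proof (rule vspan_mult_mat_vec[OF vspan_subspace qreps_carrier(2)[OF x e] Wc _ u])
      fix y assume "y \<in> set (map (ev x) (W (head Q e)))"
      then obtain w where "w \<in> set (W (head Q e))" "y = ev x w" by auto
      then show "Bmap x e *\<^sub>v y \<in> ?S (tail Q e)"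
        using in_S[of "StepB e w"] bspec[OF W[unfolded word_lists_def] head_in[OF e]] e by auto
    qed (use head_in[OF e] in auto)
  qed
  then have "?S v = carrier_vec (d v)" using st[unfolded stable_def, rule_format, of ?S] v(1) by blast
  then show False using vspan_proper[of "map (ev x) (W v)" "d v"] v(2) by simp
qed

lemma word_lists_extend:
  assumes x: "x \<in> qreps Q d f" and st: "stable Q d f x" and W: "word_lists d f x W"
  shows "\<exists>W'. word_lists d f x W' \<and> (\<forall>v\<in>verts Q. length (W' v) = d v \<and> (\<exists>ys. W' v = W v @ ys))"
  using W
proof (induction "\<Sum>v\<in>verts Q. d v - length (W v)" arbitrary: W rule: less_induct)
  case less
  show ?case
  proof (cases "\<forall>v\<in>verts Q. length (W v) = d v")
    case True
    then show ?thesis using less.prems by (intro exI[of _ W]) auto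
  next
    case False
    then obtain v where v: "v \<in> verts Q" "length (W v) < d v"
      using word_lists_length[OF less.prems] by (auto simp: order.strict_iff_order)
    obtain w where w: "valid f w" "size w \<le> Suc (\<Sum>v\<in>verts Q. length (W v))"
      "ev x w \<notin> vspan (d (target w)) (map (ev x) (W (target w)))"
      using word_lists_escape[OF x st less.prems v] by blast
    let ?W = "W(target w := W (target w) @ [w])"
    have t: "target w \<in> verts Q" by (rule valid_target[OF w(1)])
    have W': "word_lists d f x ?W" by (rule word_lists_snoc[OF x less.prems w])
    have "length (?W (target w)) \<le> d (target w)" by (rule word_lists_length[OF W' t])
    then have "(\<Sum>v\<in>verts Q. d v - length (?W v)) < (\<Sum>v\<in>verts Q. d v - length (W v))"
      by (intro sum_strict_mono_ex1 finite_verts) (use t in \<open>auto intro!: bexI[of _ "target w"]\<close>)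
    from less.hyps[OF this W'] obtain W' where
      W': "word_lists d f x W'" "\<forall>v\<in>verts Q. length (W' v) = d v \<and> (\<exists>ys. W' v = ?W v @ ys)" by blast
    have "\<exists>ys. W' v = W v @ ys" if "v \<in> verts Q" for v
      using W'(2) that by (cases "v = target w") auto
    then show ?thesis using W' by blast
  qed
qed

text \<open>
  A homomorphism sends the value of a word to the value of the same word, so a relation in
  \<open>x\<close> is one in \<open>y\<close>.
\<close>

lemma word_lists_lift:
  assumes x: "x \<in> qreps Q d f" and y: "y \<in> qreps Q d' f"
    and g: "\<And>v. v \<in> verts Q \<Longrightarrow> g v \<in> carrier_mat (d' v) (d v)" and h: "qhom Q g x y"
    and W: "word_lists d' f y W"
  shows "word_lists d f x W"
  unfolding word_lists_def
proof (intro ballI conjI)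
  fix v assume v: "v \<in> verts Q"
  show "indep (d v) (map (ev x) (W v))"
    unfolding indep_def
  proof (intro ballI impI)
    let ?k = "length (W v)"
    fix a assume "a \<in> carrier_vec (length (map (ev x) (W v)))" and z: "colmat (d v) (map (ev x) (W v)) *\<^sub>v a = 0\<^sub>v (d v)"
    then have a: "a \<in> carrier_vec ?k" by simp
    have cx: "colmat (d v) (map (ev x) (W v)) \<in> carrier_mat (d v) ?k"
      and cy: "colmat (d' v) (map (ev y) (W v)) \<in> carrier_mat (d' v) ?k"
      using colmat_carrier[of _ "map _ (W v)"] by auto
    have Wv: "valid f w" "target w = v" if "w \<in> set (W v)" for w using W v that by (auto simp: word_lists_def)
    have "colmat (d' v) (map (ev y) (W v)) = g v * colmat (d v) (map (ev x) (W v))"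
    proof (rule mat_col_eqI)
      fix c assume "c < dim_col (g v * colmat (d v) (map (ev x) (W v)))"
      then have c: "c < ?k" using cx by simp
      have s: "set (map (ev x) (W v)) \<subseteq> carrier_vec (d v)" "set (map (ev y) (W v)) \<subseteq> carrier_vec (d' v)"
        using ev_carrier[OF x] ev_carrier[OF y] Wv by fastforce+
      have "ev y (W v ! c) = g v *\<^sub>v ev x (W v ! c)"
        using ev_qhom[OF x y g h, of "W v ! c"] Wv[of "W v ! c"] c by simp
      then show "col (colmat (d' v) (map (ev y) (W v))) c = col (g v * colmat (d v) (map (ev x) (W v))) c"
        using c col_mult2[OF g[OF v] cx c] col_colmat[OF s(1)] col_colmat[OF s(2)] by simp
    qed (use cx cy g[OF v] in auto)
    then have "colmat (d' v) (map (ev y) (W v)) *\<^sub>v a = g v *\<^sub>v 0\<^sub>v (d v)"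
      using assoc_mult_mat_vec[OF g[OF v] cx a] z by simp
    also have "\<dots> = 0\<^sub>v (d' v)" using g[OF v] by (intro eq_vecI) (auto simp: scalar_prod_def)
    finally show "a = 0\<^sub>v (length (map (ev x) (W v)))"
      using W v a by (auto simp: word_lists_def indep_def)
  qed
qed (use W in \<open>auto simp: word_lists_def\<close>)

lemma word_lists_det:
  assumes x: "x \<in> qreps Q d f" and W: "word_lists d f x W" and v: "v \<in> verts Q" "length (W v) = d v"
  shows "det (wmat d x (\<lambda>v c. W v ! c) v) \<noteq> 0"
proof -
  have "wmat d x (\<lambda>v c. W v ! c) v = colmat (d v) (map (ev x) (W v))"
    using v by (auto simp: wmat_def colmat_def)
  then show ?thesis using W v indep_det[of "d v" "map (ev x) (W v)"] by (auto simp: word_lists_def)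
qed

end


section \<open>Orbits of the prequotient\<close>

lemma GL_iff: "g \<in> carrier (GL n) \<longleftrightarrow> g \<in> carrier_mat n n \<and> det g \<noteq> 0"
  unfolding GL_def units_of_carrier
  using unit_imp_det_non_zero[of g n "()"] det_non_zero_imp_unit[of g n "()"]
  by (auto simp: Units_def ring_mat_def)

lemma GL_group: "group (GL n)"
  unfolding GL_def by (rule monoid.units_group[OF ring.is_monoid[OF ring_mat]])

lemma GL_inv:
  assumes "g \<in> carrier (GL n)"
  shows "inv\<^bsub>GL n\<^esub> g \<in> carrier (GL n)" "inv\<^bsub>GL n\<^esub> g \<in> carrier_mat n n"
    "g * inv\<^bsub>GL n\<^esub> g = 1\<^sub>m n" "inv\<^bsub>GL n\<^esub> g * g = 1\<^sub>m n"
proof -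
  show 1: "inv\<^bsub>GL n\<^esub> g \<in> carrier (GL n)" by (rule group.inv_closed[OF GL_group assms])
  then show "inv\<^bsub>GL n\<^esub> g \<in> carrier_mat n n" by (simp add: GL_iff)
  show "g * inv\<^bsub>GL n\<^esub> g = 1\<^sub>m n" "inv\<^bsub>GL n\<^esub> g * g = 1\<^sub>m n"
    using group.r_inv[OF GL_group assms] group.l_inv[OF GL_group assms]
    by (simp_all add: GL_def units_of_mult units_of_one ring_mat_def)
qed

lemma mat_right_cancel:
  assumes "M * g = N * g" "M \<in> carrier_mat r n" "N \<in> carrier_mat r n" "g \<in> carrier (GL n)"
  shows "M = N"
proof -
  note i = GL_inv[OF assms(4)]
  have g: "g \<in> carrier_mat n n" using assms(4) by (simp add: GL_iff)
  have "(M * g) * inv\<^bsub>GL n\<^esub> g = (N * g) * inv\<^bsub>GL n\<^esub> g" using assms(1) by simp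
  then show ?thesis
    using assms(2,3) by (simp add: assoc_mult_mat[OF _ g i(2)] i(3))
qed

definition pshape ::
  "('v, 'e) pre_digraph \<Rightarrow> nat \<Rightarrow> (nat \<Rightarrow> 'v \<Rightarrow> nat) \<Rightarrow> ('v \<Rightarrow> nat) \<Rightarrow> ('v, 'e) parabolic_rep set" where
  "pshape Q l ds f = (\<Pi>\<^sub>E m \<in> {..l}. qreps Q (ds m) f) \<times>
     (\<Pi>\<^sub>E m \<in> {..<l}. \<Pi>\<^sub>E v \<in> verts Q. carrier_mat (ds (Suc m) v) (ds m v))"

text \<open>
  For \<open>g\<close> in the group this says that \<open>g\<close> maps \<open>x\<close> to
  \<open>y\<close>, in a form that is polynomial in \<open>g\<close>, \<open>x\<close> and
  \<open>y\<close>.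
\<close>

definition phom ::
  "('v, 'e) pre_digraph \<Rightarrow> nat \<Rightarrow> (nat \<Rightarrow> 'v \<Rightarrow> complex mat) \<Rightarrow> ('v, 'e) parabolic_rep \<Rightarrow> ('v, 'e) parabolic_rep \<Rightarrow> bool" where
  "phom Q l g x y \<longleftrightarrow> (\<forall>m\<le>l. qhom Q (g m) (fst x m) (fst y m)) \<and>
     (\<forall>m<l. \<forall>v\<in>verts Q. g (Suc m) v * snd x m v = snd y m v * g m v)"

locale parabolic_data = quiver Q for Q :: "('v, 'e) pre_digraph" +
  fixes f :: "'v \<Rightarrow> nat" and l :: nat and ds :: "nat \<Rightarrow> 'v \<Rightarrow> nat"
begin

abbreviation "reps \<equiv> split_parabolic_reps Q l ds f"
abbreviation "shape \<equiv> pshape Q l ds f"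
abbreviation "grp \<equiv> parabolic_group Q l ds"
abbreviation "act \<equiv> parabolic_act Q l ds"

lemma shape_qreps: "x \<in> shape \<Longrightarrow> m \<le> l \<Longrightarrow> fst x m \<in> qreps Q (ds m) f"
  by (auto simp: pshape_def)

lemma shape_pi: "x \<in> shape \<Longrightarrow> m < l \<Longrightarrow> v \<in> verts Q \<Longrightarrow> snd x m v \<in> carrier_mat (ds (Suc m) v) (ds m v)"
proof -
  assume "x \<in> shape" "m < l" and v: "v \<in> verts Q"
  then have "snd x m \<in> (\<Pi>\<^sub>E v \<in> verts Q. carrier_mat (ds (Suc m) v) (ds m v))"
    by (auto simp: pshape_def mem_Times_iff)
  from PiE_mem[OF this v] show ?thesis .
qed

lemma shape_eqI:
  assumes "x \<in> shape" "y \<in> shape" "\<And>m. m \<le> l \<Longrightarrow> fst x m = fst y m"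
    "\<And>m v. m < l \<Longrightarrow> v \<in> verts Q \<Longrightarrow> snd x m v = snd y m v"
  shows "x = y"
proof (rule prod_eqI)
  show "fst x = fst y"
    using assms(1-3) by (auto simp: pshape_def mem_Times_iff intro: PiE_ext)
  show "snd x = snd y"
  proof (rule PiE_ext)
    show "snd x \<in> (\<Pi>\<^sub>E m \<in> {..<l}. \<Pi>\<^sub>E v \<in> verts Q. carrier_mat (ds (Suc m) v) (ds m v))"
      "snd y \<in> (\<Pi>\<^sub>E m \<in> {..<l}. \<Pi>\<^sub>E v \<in> verts Q. carrier_mat (ds (Suc m) v) (ds m v))"
      using assms(1,2) by (auto simp: pshape_def mem_Times_iff)
    then show "snd x m = snd y m" if "m \<in> {..<l}" for m
      using that assms(4) by (intro PiE_ext[of "snd x m" "verts Q" "\<lambda>v. carrier_mat (ds (Suc m) v) (ds m v)"]) auto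
  qed
qed

lemma reps_iff: "x \<in> reps \<longleftrightarrow> x \<in> shape \<and>
    (\<forall>m\<le>l. stable Q (ds m) f (fst x m) \<and> moment_map_eqs Q (ds m) (fst x m)) \<and>
    (\<forall>m<l. qhom Q (snd x m) (fst x m) (fst x (Suc m))) \<and> parabolic_split Q l ds f x"
  by (cases x) (auto simp: split_parabolic_reps_def pshape_def stable_qreps_def parabolic_intertwining_def
      qhom_def PiE_iff)

lemma reps_shape: "x \<in> reps \<Longrightarrow> x \<in> shape"
  by (simp add: reps_iff)

lemma grp_iff: "g \<in> carrier grp \<longleftrightarrow> g \<in> (\<Pi>\<^sub>E m\<in>{..l}. \<Pi>\<^sub>E v\<in>verts Q. carrier (GL (ds m v)))"
  by (simp add: parabolic_group_def gauge_group_def)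

lemma grp_GL: "g \<in> carrier grp \<Longrightarrow> m \<le> l \<Longrightarrow> v \<in> verts Q \<Longrightarrow> g m v \<in> carrier (GL (ds m v))"
  unfolding grp_iff by (meson PiE_mem atMost_iff)

lemma grp_carrier_mat: "g \<in> carrier grp \<Longrightarrow> m \<le> l \<Longrightarrow> v \<in> verts Q \<Longrightarrow> g m v \<in> carrier_mat (ds m v) (ds m v)"
  using grp_GL[of g m v] by (simp add: GL_iff)

lemma grpI: "(\<And>m v. m \<le> l \<Longrightarrow> v \<in> verts Q \<Longrightarrow> g m v \<in> carrier (GL (ds m v))) \<Longrightarrow>
    (\<lambda>m\<in>{..l}. \<lambda>v\<in>verts Q. g m v) \<in> carrier grp"
  unfolding grp_iff by auto

lemma phom_cong:
  assumes "\<And>m v. m \<le> l \<Longrightarrow> v \<in> verts Q \<Longrightarrow> g m v = h m v" shows "phom Q l g x y \<longleftrightarrow> phom Q l h x y"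
  using assms by (simp add: phom_def qhom_def)

lemma gauge_act_qreps:
  assumes x: "x \<in> qreps Q d f" and g: "\<And>v. v \<in> verts Q \<Longrightarrow> g v \<in> carrier (GL (d v))"
  shows "gauge_act Q d g x \<in> qreps Q d f" "qhom Q g x (gauge_act Q d g x)"
proof -
  note cx = qreps_carrier[OF x] and dx = qreps_dim[OF x]
  have gc: "g v \<in> carrier_mat (d v) (d v)" if "v \<in> verts Q" for v using g[OF that] by (simp add: GL_iff)
  note gi = GL_inv[OF g]
  have dg: "dim_row (g v) = d v" "dim_col (g v) = d v" "dim_row (inv\<^bsub>GL (d v)\<^esub> g v) = d v" "dim_col (inv\<^bsub>GL (d v)\<^esub> g v) = d v"
    if "v \<in> verts Q" for v using gc[OF that] gi(2)[OF that] by auto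
  show "gauge_act Q d g x \<in> qreps Q d f"
    unfolding qreps_def gauge_act_def
    by (auto intro!: carrier_matI simp: dx dg)
  show "qhom Q g x (gauge_act Q d g x)"
    unfolding qhom_def gauge_act_def
    using cx gc gi by (auto simp: mat_assoc dx dg)
qed

lemma act_phom:
  assumes x: "x \<in> shape" and g: "g \<in> carrier grp"
  shows "act g x \<in> shape" "phom Q l g x (act g x)"
proof -
  have gi: "g m v * inv\<^bsub>GL (ds m v)\<^esub> g m v = 1\<^sub>m (ds m v)" "inv\<^bsub>GL (ds m v)\<^esub> g m v * g m v = 1\<^sub>m (ds m v)"
    "inv\<^bsub>GL (ds m v)\<^esub> g m v \<in> carrier_mat (ds m v) (ds m v)" "g m v \<in> carrier_mat (ds m v) (ds m v)"
    if "m \<le> l" "v \<in> verts Q" for m v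
    using GL_inv[OF grp_GL[OF g that]] grp_carrier_mat[OF g that] by auto
  show "act g x \<in> shape"
    unfolding pshape_def parabolic_act_def case_prod_unfold
  proof (intro SigmaI restrict_PiE_iff[THEN iffD2] ballI)
    show "gauge_act Q (ds m) (g m) (fst x m) \<in> qreps Q (ds m) f" if "m \<in> {..l}" for m
      using gauge_act_qreps(1)[OF shape_qreps[OF x, of m], of "g m"] grp_GL[OF g] that by simp
    show "g (Suc m) v * snd x m v * inv\<^bsub>GL (ds m v)\<^esub> g m v \<in> carrier_mat (ds (Suc m) v) (ds m v)"
      if "m \<in> {..<l}" "v \<in> verts Q" for m v
      using that gi(3)[of m v] gi(4)[of "Suc m" v] shape_pi[OF x, of m v] by auto
  qed
  show "phom Q l g x (act g x)"
    unfolding phom_def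
  proof (intro conjI allI impI ballI)
    show "qhom Q (g m) (fst x m) (fst (act g x) m)" if "m \<le> l" for m
      using gauge_act_qreps(2)[OF shape_qreps[OF x that], of "g m"] grp_GL[OF g that] that
      by (simp add: parabolic_act_def case_prod_unfold)
    fix m v assume m: "m < l" and v: "v \<in> verts Q"
    note dims = carrier_matD[OF gi(4)[of "Suc m" v]] carrier_matD[OF gi(4)[of m v]]
      carrier_matD[OF gi(3)[of m v]] carrier_matD[OF shape_pi[OF x m v]]
    show "g (Suc m) v * snd x m v = snd (act g x) m v * g m v"
      using m v gi(2)[of m v] by (simp add: parabolic_act_def case_prod_unfold mat_assoc dims)
  qed
qed

lemma phom_unique:
  assumes x: "x \<in> shape" and y: "y \<in> shape" and y': "y' \<in> shape" and g: "g \<in> carrier grp"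
    and h: "phom Q l g x y" and h': "phom Q l g x y'"
  shows "y = y'"
proof (rule shape_eqI[OF y y'])
  fix m assume m: "m \<le> l"
  note G = grp_GL[OF g m]
  note q = shape_qreps[OF y m] and q' = shape_qreps[OF y' m]
  have e: "qhom Q (g m) (fst x m) (fst y m)" "qhom Q (g m) (fst x m) (fst y' m)" using h h' m by (auto simp: phom_def)
  show "fst y m = fst y' m"
  proof (rule qreps_eqI[OF q q'])
    fix e assume a: "e \<in> arcs Q"
    show "Amap (fst y m) e = Amap (fst y' m) e"
      by (rule mat_right_cancel[OF _ qreps_carrier(1)[OF q a] qreps_carrier(1)[OF q' a] G[OF tail_in[OF a]]])
        (use e a in \<open>simp add: qhom_def\<close>)
    show "Bmap (fst y m) e = Bmap (fst y' m) e"
      by (rule mat_right_cancel[OF _ qreps_carrier(2)[OF q a] qreps_carrier(2)[OF q' a] G[OF head_in[OF a]]])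
        (use e a in \<open>simp add: qhom_def\<close>)
  next
    fix v assume v: "v \<in> verts Q"
    show "imap (fst y m) v = imap (fst y' m) v" using e v by (simp add: qhom_def)
    show "jmap (fst y m) v = jmap (fst y' m) v"
      by (rule mat_right_cancel[OF _ qreps_carrier(4)[OF q v] qreps_carrier(4)[OF q' v] G[OF v]])
        (use e v in \<open>simp add: qhom_def\<close>)
  qed
next
  fix m v assume m: "m < l" and v: "v \<in> verts Q"
  show "snd y m v = snd y' m v"
    by (rule mat_right_cancel[OF _ shape_pi[OF y m v] shape_pi[OF y' m v] grp_GL[OF g _ v]])
      (use h h' m v in \<open>auto simp: phom_def\<close>)
qed

lemma orbit_iff:
  assumes x: "x \<in> shape"
  shows "y \<in> orbit grp act x \<longleftrightarrow> y \<in> shape \<and> (\<exists>g\<in>carrier grp. phom Q l g x y)"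
proof
  assume "y \<in> orbit grp act x"
  then obtain g where "g \<in> carrier grp" "y = act g x" by (auto simp: orbit_def)
  then show "y \<in> shape \<and> (\<exists>g\<in>carrier grp. phom Q l g x y)" using act_phom[OF x] by blast
next
  assume "y \<in> shape \<and> (\<exists>g\<in>carrier grp. phom Q l g x y)"
  then obtain g where g: "y \<in> shape" "g \<in> carrier grp" "phom Q l g x y" by blast
  have "y = act g x" by (rule phom_unique[OF x g(1) act_phom(1)[OF x g(2)] g(2,3) act_phom(2)[OF x g(2)]])
  then show "y \<in> orbit grp act x" using g(2) by (auto simp: orbit_def)
qed

lemma phom_one: "x \<in> shape \<Longrightarrow> \<exists>g\<in>carrier grp. phom Q l g x x"
proof -
  assume x: "x \<in> shape"
  let ?g = "\<lambda>m\<in>{..l}. \<lambda>v\<in>verts Q. 1\<^sub>m (ds m v)"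
  have "?g \<in> carrier grp" by (rule grpI) (simp add: GL_iff)
  moreover have "phom Q l ?g x x"
    using carrier_matD[OF shape_pi[OF x]] by (auto simp: phom_def qhom_def qreps_dim[OF shape_qreps[OF x]])
  ultimately show ?thesis by blast
qed

lemma phom_inverse:
  assumes x: "x \<in> shape" and y: "y \<in> shape" and g: "g \<in> carrier grp" and h: "phom Q l g x y"
  shows "\<exists>k\<in>carrier grp. phom Q l k y x"
proof -
  let ?i = "\<lambda>m v. inv\<^bsub>GL (ds m v)\<^esub> g m v"
  let ?k = "\<lambda>m\<in>{..l}. \<lambda>v\<in>verts Q. ?i m v"
  note gi = GL_inv[OF grp_GL[OF g]] and gc = grp_carrier_mat[OF g]
  have "?k \<in> carrier grp" by (rule grpI) (rule gi(1))
  moreover have "phom Q l ?i y x"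
    unfolding phom_def
  proof (intro conjI allI impI ballI)
    show "qhom Q (?i m) (fst y m) (fst x m)" if "m \<le> l" for m
      by (rule qhom_inverse[OF shape_qreps[OF x that] shape_qreps[OF y that], of "g m"])
        (use that gi gc h in \<open>auto simp: phom_def\<close>)
    fix m v assume m: "m < l" and v: "v \<in> verts Q"
    have S: "Suc m \<le> l" "m \<le> l" using m by auto
    have e: "g (Suc m) v * snd x m v = snd y m v * g m v" using h m v by (simp add: phom_def)
    have px: "snd x m v \<in> carrier_mat (ds (Suc m) v) (ds m v)" and py: "snd y m v \<in> carrier_mat (ds (Suc m) v) (ds m v)"
      using shape_pi x y m v by auto
    note dims = carrier_matD[OF px] carrier_matD[OF py] carrier_matD[OF gi(2)[OF S(1) v]] carrier_matD[OF gi(2)[OF S(2) v]]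
      carrier_matD[OF gc[OF S(1) v]] carrier_matD[OF gc[OF S(2) v]]
    have "?i (Suc m) v * snd y m v = ?i (Suc m) v * (snd y m v * g m v) * ?i m v"
      using gi(3)[OF S(2) v] py by (simp add: mat_assoc dims)
    also have "\<dots> = (?i (Suc m) v * g (Suc m) v) * snd x m v * ?i m v"
      unfolding e[symmetric] by (simp add: mat_assoc dims)
    also have "\<dots> = snd x m v * ?i m v" using gi(4)[OF S(1) v] px by simp
    finally show "?i (Suc m) v * snd y m v = snd x m v * ?i m v" .
  qed
  ultimately show ?thesis using phom_cong[of ?k ?i y x] by auto
qed

lemma phom_comp:
  assumes x: "x \<in> shape" and y: "y \<in> shape" and z: "z \<in> shape"
    and g: "g \<in> carrier grp" and h: "h \<in> carrier grp" and gh: "phom Q l g x y" "phom Q l h y z"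
  shows "\<exists>k\<in>carrier grp. phom Q l k x z"
proof -
  let ?p = "\<lambda>m v. h m v * g m v"
  let ?k = "\<lambda>m\<in>{..l}. \<lambda>v\<in>verts Q. ?p m v"
  note gc = grp_carrier_mat[OF g] and hc = grp_carrier_mat[OF h]
  have "?k \<in> carrier grp"
  proof (rule grpI)
    fix m v assume "m \<le> l" "v \<in> verts Q"
    then show "?p m v \<in> carrier (GL (ds m v))"
      using grp_GL[OF g, of m v] grp_GL[OF h, of m v] by (auto simp: GL_iff det_mult)
  qed
  moreover have "phom Q l ?p x z"
    unfolding phom_def
  proof (intro conjI allI impI ballI)
    show "qhom Q (?p m) (fst x m) (fst z m)" if "m \<le> l" for m
      by (rule qhom_comp[OF shape_qreps[OF x that] shape_qreps[OF y that] shape_qreps[OF z that]])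
        (use that gc hc gh in \<open>auto simp: phom_def\<close>)
    fix m v assume m: "m < l" and v: "v \<in> verts Q"
    have S: "Suc m \<le> l" "m \<le> l" using m by auto
    note dims = carrier_matD[OF shape_pi[OF x m v]] carrier_matD[OF shape_pi[OF y m v]] carrier_matD[OF shape_pi[OF z m v]]
      carrier_matD[OF gc[OF S(1) v]] carrier_matD[OF gc[OF S(2) v]] carrier_matD[OF hc[OF S(1) v]] carrier_matD[OF hc[OF S(2) v]]
    have e: "g (Suc m) v * snd x m v = snd y m v * g m v" "h (Suc m) v * snd y m v = snd z m v * h m v"
      using gh m v by (auto simp: phom_def)
    have "?p (Suc m) v * snd x m v = (h (Suc m) v * snd y m v) * g m v"
      by (simp add: mat_assoc dims e(1))
    also have "\<dots> = snd z m v * ?p m v" unfolding e(2) by (simp add: mat_assoc dims)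
    finally show "?p (Suc m) v * snd x m v = snd z m v * ?p m v" .
  qed
  ultimately show ?thesis using phom_cong[of ?k ?p x z] by auto
qed

lemma pi_comp_carrier:
  assumes "\<And>m. m < l \<Longrightarrow> \<pi> m v \<in> carrier_mat (ds (Suc m) v) (ds m v)" "m \<le> l"
  shows "pi_comp (ds 0 v) \<pi> v m \<in> carrier_mat (ds m v) (ds 0 v)"
  using assms(2)
proof (induction m)
  case (Suc m)
  then show ?case using assms(1)[of m] by (auto intro: mult_carrier_mat)
qed simp

lemma pi_comp_cong: "(\<And>k. k < m \<Longrightarrow> \<pi> k v = \<pi>' k v) \<Longrightarrow> pi_comp n \<pi> v m = pi_comp n \<pi>' v m"
  by (induction m) auto

lemma phom_pi_comp:
  assumes x: "x \<in> shape" and y: "y \<in> shape" and g: "g \<in> carrier grp" and h: "phom Q l g x y" and v: "v \<in> verts Q"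
  shows "m \<le> l \<Longrightarrow> pi_comp (ds 0 v) (snd y) v m * g 0 v = g m v * pi_comp (ds 0 v) (snd x) v m"
proof (induction m)
  case 0
  show ?case using grp_carrier_mat[OF g, of 0 v] v by simp
next
  case (Suc m)
  then have m: "m < l" by simp
  have S: "Suc m \<le> l" "m \<le> l" using m by auto
  have cx: "pi_comp (ds 0 v) (snd x) v m \<in> carrier_mat (ds m v) (ds 0 v)"
    by (rule pi_comp_carrier) (use shape_pi[OF x] v S in auto)
  have cy: "pi_comp (ds 0 v) (snd y) v m \<in> carrier_mat (ds m v) (ds 0 v)"
    by (rule pi_comp_carrier) (use shape_pi[OF y] v S in auto)
  note dims = carrier_matD[OF cx] carrier_matD[OF cy] carrier_matD[OF shape_pi[OF x m v]] carrier_matD[OF shape_pi[OF y m v]]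
    carrier_matD[OF grp_carrier_mat[OF g S(1) v]] carrier_matD[OF grp_carrier_mat[OF g S(2) v]]
    carrier_matD[OF grp_carrier_mat[OF g le0 v]]
  have e: "g (Suc m) v * snd x m v = snd y m v * g m v" using h m v by (simp add: phom_def)
  have "pi_comp (ds 0 v) (snd y) v (Suc m) * g 0 v = snd y m v * (g m v * pi_comp (ds 0 v) (snd x) v m)"
    using Suc.IH[OF S(2)] by (simp add: mat_assoc dims)
  also have "\<dots> = (snd y m v * g m v) * pi_comp (ds 0 v) (snd x) v m" by (simp add: mat_assoc dims)
  also have "\<dots> = g (Suc m) v * pi_comp (ds 0 v) (snd x) v (Suc m)" unfolding e[symmetric] by (simp add: mat_assoc dims)
  finally show ?case .
qed

lemma stable_qhom:
  assumes x: "x \<in> qreps Q d f" and y: "y \<in> qreps Q d f" and st: "stable Q d f x"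
    and g: "\<And>v. v \<in> verts Q \<Longrightarrow> g v \<in> carrier (GL (d v))" and h: "qhom Q g x y"
  shows "stable Q d f y"
proof -
  obtain W where W: "word_lists d f x W" "\<forall>v\<in>verts Q. length (W v) = d v"
    using word_lists_extend[OF x st word_lists_Nil] by blast
  let ?L = "\<lambda>v c. W v ! c"
  have L: "word_family d f ?L" using W by (auto simp: word_family_def word_lists_def)
  have gc: "g v \<in> carrier_mat (d v) (d v)" "det (g v) \<noteq> 0" if "v \<in> verts Q" for v using g[OF that] by (auto simp: GL_iff)
  show ?thesis
  proof (rule stableI_words[OF y L])
    fix v assume v: "v \<in> verts Q"
    have "det (wmat d x ?L v) \<noteq> 0" using W v by (intro word_lists_det[OF x]) auto
    then show "det (wmat d y ?L v) \<noteq> 0"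
      using wmat_qhom[OF x y gc(1) h L v] gc[OF v] by (simp add: det_mult[OF gc(1)[OF v] wmat_carrier[of d x ?L v]])
  qed
qed

text \<open>
  All conditions on a chain are invariant; for the split condition, \<open>g\<close> identifies
  the kernels of the composed projections.
\<close>

lemma reps_phom:
  assumes x: "x \<in> reps" and y: "y \<in> shape" and g: "g \<in> carrier grp" and h: "phom Q l g x y"
  shows "y \<in> reps"
proof -
  note xs = reps_shape[OF x]
  note qx = shape_qreps[OF xs] and qy = shape_qreps[OF y]
  note gc = grp_carrier_mat[OF g] and gi = GL_inv[OF grp_GL[OF g]]
  have hm: "qhom Q (g m) (fst x m) (fst y m)" if "m \<le> l" for m using h that by (simp add: phom_def)
  have st: "stable Q (ds m) f (fst y m)" if m: "m \<le> l" for m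
    by (rule stable_qhom[OF qx[OF m] qy[OF m] _ _ hm[OF m]]) (use x m grp_GL[OF g m] in \<open>auto simp: reps_iff\<close>)
  have mo: "moment_map_eqs Q (ds m) (fst y m)" if m: "m \<le> l" for m
    unfolding moment_map_eqs_iff[OF qy[OF m]]
  proof
    fix v assume v: "v \<in> verts Q"
    have "moment Q (ds m) (fst y m) v * g m v = g m v * moment Q (ds m) (fst x m) v"
      by (rule moment_qhom[OF qx[OF m] qy[OF m] _ hm[OF m] v]) (use gc m in auto)
    also have "moment Q (ds m) (fst x m) v = 0\<^sub>m (ds m v) (ds m v)"
      using x m v moment_map_eqs_iff[OF qx[OF m]] by (auto simp: reps_iff)
    also have "g m v * 0\<^sub>m (ds m v) (ds m v) = 0\<^sub>m (ds m v) (ds m v) * g m v"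
      using gc[OF m v] by simp
    finally show "moment Q (ds m) (fst y m) v = 0\<^sub>m (ds m v) (ds m v)"
      by (rule mat_right_cancel[OF _ moment_carrier[OF qy[OF m] v] _ grp_GL[OF g m v]]) simp
  qed
  have inter: "qhom Q (snd y m) (fst y m) (fst y (Suc m))" if m: "m < l" for m
  proof -
    have S: "Suc m \<le> l" "m \<le> l" using m by auto
    let ?i = "\<lambda>v. inv\<^bsub>GL (ds m v)\<^esub> g m v"
    have 1: "qhom Q ?i (fst y m) (fst x m)"
      by (rule qhom_inverse[OF qx[OF S(2)] qy[OF S(2)], of "g m"]) (use S gi gc hm in auto)
    have 2: "qhom Q (snd x m) (fst x m) (fst x (Suc m))" using x m by (simp add: reps_iff)
    have 3: "qhom Q (\<lambda>v. snd x m v * ?i v) (fst y m) (fst x (Suc m))"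
      by (rule qhom_comp[OF qy[OF S(2)] qx[OF S(2)] qx[OF S(1)] _ _ 1 2]) (use gi(2)[OF S(2)] shape_pi[OF xs m] in auto)
    have 4: "qhom Q (\<lambda>v. g (Suc m) v * (snd x m v * ?i v)) (fst y m) (fst y (Suc m))"
      by (rule qhom_comp[OF qy[OF S(2)] qx[OF S(1)] qy[OF S(1)] _ _ 3 hm[OF S(1)]])
        (use gi(2)[OF S(2)] shape_pi[OF xs m] gc[OF S(1)] in \<open>auto intro: mult_carrier_mat\<close>)
    have "g (Suc m) v * (snd x m v * ?i v) = snd y m v" if v: "v \<in> verts Q" for v
    proof -
      note dims = carrier_matD[OF shape_pi[OF xs m v]] carrier_matD[OF shape_pi[OF y m v]]
        carrier_matD[OF gc[OF S(1) v]] carrier_matD[OF gc[OF S(2) v]] carrier_matD[OF gi(2)[OF S(2) v]]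
      have e: "g (Suc m) v * snd x m v = snd y m v * g m v" using h m v by (simp add: phom_def)
      have "g (Suc m) v * (snd x m v * ?i v) = (g (Suc m) v * snd x m v) * ?i v" by (simp add: mat_assoc dims)
      also have "\<dots> = snd y m v" unfolding e using gi(3)[OF S(2) v] shape_pi[OF y m v] by (simp add: mat_assoc dims)
      finally show ?thesis .
    qed
    then show ?thesis using 4 by (simp add: qhom_def)
  qed
  have split: "parabolic_split Q l ds f y"
    unfolding parabolic_split_def case_prod_unfold
  proof (intro ballI)
    fix v u assume v: "v \<in> verts Q" and "u \<in> mat_kernel (pi_comp (ds 0 v) (snd y) v l)"
    have cx: "pi_comp (ds 0 v) (snd x) v l \<in> carrier_mat (ds l v) (ds 0 v)"
      by (rule pi_comp_carrier) (use shape_pi[OF xs] v in auto)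
    have cy: "pi_comp (ds 0 v) (snd y) v l \<in> carrier_mat (ds l v) (ds 0 v)"
      by (rule pi_comp_carrier) (use shape_pi[OF y] v in auto)
    then have u: "u \<in> carrier_vec (ds 0 v)" "pi_comp (ds 0 v) (snd y) v l *\<^sub>v u = 0\<^sub>v (ds l v)"
      using mat_kernelD[OF cy] \<open>u \<in> mat_kernel (pi_comp (ds 0 v) (snd y) v l)\<close> by auto
    let ?u = "inv\<^bsub>GL (ds 0 v)\<^esub> g 0 v *\<^sub>v u"
    have u': "?u \<in> carrier_vec (ds 0 v)" using gi(2)[OF le0 v] u by simp
    have gu: "g 0 v *\<^sub>v ?u = u"
      using gi(3)[OF le0 v] u(1) assoc_mult_mat_vec[OF gc[OF le0 v] gi(2)[OF le0 v] u(1)] by simp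
    have "g l v *\<^sub>v (pi_comp (ds 0 v) (snd x) v l *\<^sub>v ?u) = (pi_comp (ds 0 v) (snd y) v l * g 0 v) *\<^sub>v ?u"
      unfolding phom_pi_comp[OF xs y g h v order_refl] using assoc_mult_mat_vec[OF gc[OF order_refl v] cx u'] by simp
    also have "\<dots> = 0\<^sub>v (ds l v)" using assoc_mult_mat_vec[OF cy gc[OF le0 v] u'] gu u(2) by simp
    finally have z: "g l v *\<^sub>v (pi_comp (ds 0 v) (snd x) v l *\<^sub>v ?u) = 0\<^sub>v (ds l v)" .
    have c: "pi_comp (ds 0 v) (snd x) v l *\<^sub>v ?u \<in> carrier_vec (ds l v)" using cx u' by simp
    have "pi_comp (ds 0 v) (snd x) v l *\<^sub>v ?u = inv\<^bsub>GL (ds l v)\<^esub> g l v *\<^sub>v (g l v *\<^sub>v (pi_comp (ds 0 v) (snd x) v l *\<^sub>v ?u))"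
      using gi(4)[OF order_refl v] c assoc_mult_mat_vec[OF gi(2)[OF order_refl v] gc[OF order_refl v] c] by simp
    also have "\<dots> = 0\<^sub>v (ds l v)" unfolding z using gi(2)[OF order_refl v] by (intro eq_vecI) (auto simp: scalar_prod_def)
    finally have "?u \<in> mat_kernel (pi_comp (ds 0 v) (snd x) v l)" using mat_kernelI[OF cx u'] by simp
    then have k: "\<And>e. e \<in> arcs Q \<Longrightarrow> tail Q e = v \<Longrightarrow> Amap (fst x 0) e *\<^sub>v ?u = 0\<^sub>v (ds 0 (head Q e))"
      "\<And>e. e \<in> arcs Q \<Longrightarrow> head Q e = v \<Longrightarrow> Bmap (fst x 0) e *\<^sub>v ?u = 0\<^sub>v (ds 0 (tail Q e))"
      "jmap (fst x 0) v *\<^sub>v ?u = 0\<^sub>v (f v)"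
      using x v unfolding reps_iff parabolic_split_def case_prod_unfold by blast+
    have h0: "qhom Q (g 0) (fst x 0) (fst y 0)" by (rule hm) simp
    have z0: "M *\<^sub>v 0\<^sub>v n = 0\<^sub>v r" if "M \<in> carrier_mat r n" for M :: "complex mat" and r n
      using that by (intro eq_vecI) (auto simp: scalar_prod_def)
    have "Amap (fst y 0) e *\<^sub>v u = 0\<^sub>v (ds 0 (head Q e))" if e: "e \<in> arcs Q" "tail Q e = v" for e
    proof -
      have cA: "Amap (fst y 0) e \<in> carrier_mat (ds 0 (head Q e)) (ds 0 v)" "Amap (fst x 0) e \<in> carrier_mat (ds 0 (head Q e)) (ds 0 v)"
        using qreps_carrier(1)[OF qy[OF le0] e(1)] qreps_carrier(1)[OF qx[OF le0] e(1)] e(2) by auto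
      have "Amap (fst y 0) e *\<^sub>v u = (Amap (fst y 0) e * g 0 v) *\<^sub>v ?u"
        using assoc_mult_mat_vec[OF cA(1) gc[OF le0 v] u'] gu by simp
      also have "Amap (fst y 0) e * g 0 v = g 0 (head Q e) * Amap (fst x 0) e" using h0 e by (auto simp: qhom_def)
      also have "\<dots> *\<^sub>v ?u = g 0 (head Q e) *\<^sub>v 0\<^sub>v (ds 0 (head Q e))"
        using assoc_mult_mat_vec[OF gc[OF le0 head_in[OF e(1)]] cA(2) u'] k(1)[OF e] by simp
      also have "\<dots> = 0\<^sub>v (ds 0 (head Q e))" by (rule z0[OF gc[OF le0 head_in[OF e(1)]]])
      finally show ?thesis .
    qed
    moreover have "Bmap (fst y 0) e *\<^sub>v u = 0\<^sub>v (ds 0 (tail Q e))" if e: "e \<in> arcs Q" "head Q e = v" for e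
    proof -
      have cA: "Bmap (fst y 0) e \<in> carrier_mat (ds 0 (tail Q e)) (ds 0 v)" "Bmap (fst x 0) e \<in> carrier_mat (ds 0 (tail Q e)) (ds 0 v)"
        using qreps_carrier(2)[OF qy[OF le0] e(1)] qreps_carrier(2)[OF qx[OF le0] e(1)] e(2) by auto
      have "Bmap (fst y 0) e *\<^sub>v u = (Bmap (fst y 0) e * g 0 v) *\<^sub>v ?u"
        using assoc_mult_mat_vec[OF cA(1) gc[OF le0 v] u'] gu by simp
      also have "Bmap (fst y 0) e * g 0 v = g 0 (tail Q e) * Bmap (fst x 0) e" using h0 e by (auto simp: qhom_def)
      also have "\<dots> *\<^sub>v ?u = g 0 (tail Q e) *\<^sub>v 0\<^sub>v (ds 0 (tail Q e))"
        using assoc_mult_mat_vec[OF gc[OF le0 tail_in[OF e(1)]] cA(2) u'] k(2)[OF e] by simp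
      also have "\<dots> = 0\<^sub>v (ds 0 (tail Q e))" by (rule z0[OF gc[OF le0 tail_in[OF e(1)]]])
      finally show ?thesis .
    qed
    moreover have "jmap (fst y 0) v *\<^sub>v u = 0\<^sub>v (f v)"
    proof -
      have "jmap (fst y 0) v *\<^sub>v u = (jmap (fst y 0) v * g 0 v) *\<^sub>v ?u"
        using assoc_mult_mat_vec[OF qreps_carrier(4)[OF qy[OF le0] v] gc[OF le0 v] u'] gu by simp
      also have "jmap (fst y 0) v * g 0 v = jmap (fst x 0) v" using h0 v by (simp add: qhom_def)
      finally show ?thesis using k(3) by simp
    qed
    ultimately show "(\<forall>e \<in> arcs Q. tail Q e = v \<longrightarrow> Amap (fst y 0) e *\<^sub>v u = 0\<^sub>v (ds 0 (head Q e))) \<and>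
       (\<forall>e \<in> arcs Q. head Q e = v \<longrightarrow> Bmap (fst y 0) e *\<^sub>v u = 0\<^sub>v (ds 0 (tail Q e))) \<and>
       jmap (fst y 0) v *\<^sub>v u = 0\<^sub>v (f v)" by blast
  qed
  show ?thesis using y st mo inter split by (simp add: reps_iff)
qed

lemma orbit_refl: "x \<in> shape \<Longrightarrow> x \<in> orbit grp act x"
  using orbit_iff phom_one by blast

lemma orbit_closed: "x \<in> reps \<Longrightarrow> y \<in> orbit grp act x \<Longrightarrow> y \<in> reps"
  using orbit_iff[OF reps_shape] reps_phom by blast

lemma orbit_eq:
  assumes x: "x \<in> shape" and y: "y \<in> orbit grp act x" shows "orbit grp act y = orbit grp act x"
proof -
  obtain g where g: "y \<in> shape" "g \<in> carrier grp" "phom Q l g x y" using y orbit_iff[OF x] by blast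
  obtain k where k: "k \<in> carrier grp" "phom Q l k y x" using phom_inverse[OF x g] by blast
  show ?thesis
  proof (rule Set.set_eqI)
    fix z
    show "z \<in> orbit grp act y \<longleftrightarrow> z \<in> orbit grp act x"
      unfolding orbit_iff[OF x] orbit_iff[OF g(1)]
      using phom_comp[OF x g(1) _ g(2) _ g(3)] phom_comp[OF g(1) x _ k(1) _ k(2)] by blast
  qed
qed

lemma det_wmat_phom:
  assumes x: "x \<in> shape" and y: "y \<in> shape" and g: "\<And>v. v \<in> verts Q \<Longrightarrow> g m v \<in> carrier_mat (ds m v) (ds m v)"
    and h: "qhom Q (g m) (fst x m) (fst y m)" and L: "word_family (ds m) f L" and m: "m \<le> l" and v: "v \<in> verts Q"
  shows "det (wmat (ds m) (fst y m) L v) = det (g m v) * det (wmat (ds m) (fst x m) L v)"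
  using wmat_qhom[OF shape_qreps[OF x m] shape_qreps[OF y m] g h L v]
    det_mult[OF g[OF v] wmat_carrier[of "ds m" "fst x m" L v]] by simp


section \<open>Charts by word bases\<close>

definition word_charts :: "('v \<Rightarrow> nat \<Rightarrow> ('v, 'e) word) set" where
  "word_charts = {L \<in> (\<Pi>\<^sub>E v\<in>verts Q. \<Pi>\<^sub>E c\<in>{..<ds 0 v}. {w. valid f w \<and> size w \<le> (\<Sum>v\<in>verts Q. ds 0 v)}).
     word_family (ds 0) f L}"

lemma finite_word_charts: "finite word_charts"
proof -
  have "finite (\<Pi>\<^sub>E v\<in>verts Q. \<Pi>\<^sub>E c\<in>{..<ds 0 v}. {w. valid f w \<and> size w \<le> (\<Sum>v\<in>verts Q. ds 0 v)})"
    by (intro finite_PiE finite_verts finite_lessThan finite_words)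
  then show ?thesis unfolding word_charts_def by (rule rev_finite_subset) blast
qed

definition chart_dom :: "('v \<Rightarrow> nat \<Rightarrow> ('v, 'e) word) \<Rightarrow> ('v, 'e) parabolic_rep set" where
  "chart_dom L = {x\<in>reps. \<forall>m\<le>l. \<forall>v\<in>verts Q. det (wmat (ds m) (fst x m) L v) \<noteq> 0}"

text \<open>
  Descending induction on \<open>m\<close>: a basis of words of step \<open>m + 1\<close> lifts to
  independent words of step \<open>m\<close>, which stability extends to a basis. The lifting is
  also the reason why the dimensions decrease.
\<close>

lemma chart_exists:
  assumes x: "x \<in> reps"
  shows "\<exists>L\<in>word_charts. x \<in> chart_dom L" and "m < l \<Longrightarrow> v \<in> verts Q \<Longrightarrow> ds (Suc m) v \<le> ds m v"
proof -
  note q = shape_qreps[OF reps_shape[OF x]]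
  \<comment> \<open>\<open>W\<close> is a basis of words at step \<open>m\<close>, and initial segments of it are bases at the later steps.\<close>
  let ?P = "\<lambda>m W. word_lists (ds m) f (fst x m) W \<and> (\<forall>v\<in>verts Q. length (W v) = ds m v) \<and>
    (\<forall>m'\<in>{m..l}. \<forall>v\<in>verts Q. ds m' v \<le> ds m v \<and> det (wmat (ds m') (fst x m') (\<lambda>v c. W v ! c) v) \<noteq> 0) \<and>
    (\<forall>m'\<in>{m..<l}. \<forall>v\<in>verts Q. ds (Suc m') v \<le> ds m' v)"
  have st: "stable Q (ds m) f (fst x m)" if "m \<le> l" for m using x that by (simp add: reps_iff)
  have "\<exists>W. ?P 0 W"
  proof (rule inc_induct[of 0 l "\<lambda>m. \<exists>W. ?P m W"])
    obtain W where "word_lists (ds l) f (fst x l) W" "\<forall>v\<in>verts Q. length (W v) = ds l v"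
      using word_lists_extend[OF q[OF order_refl] st[OF order_refl] word_lists_Nil] by blast
    then show "\<exists>W. ?P l W" using word_lists_det[OF q[OF order_refl]] by (intro exI[of _ W]) auto
  next
    fix m assume m: "m < l" and "\<exists>W. ?P (Suc m) W"
    then obtain W where W: "?P (Suc m) W" by blast
    have S: "Suc m \<le> l" "m \<le> l" using m by auto
    have lift: "word_lists (ds m) f (fst x m) W"
      by (rule word_lists_lift[OF q[OF S(2)] q[OF S(1)] shape_pi[OF reps_shape[OF x] m]])
        (use x m W in \<open>auto simp: reps_iff\<close>)
    then obtain W' where W': "word_lists (ds m) f (fst x m) W'"
      "\<forall>v\<in>verts Q. length (W' v) = ds m v \<and> (\<exists>ys. W' v = W v @ ys)"
      using word_lists_extend[OF q[OF S(2)] st[OF S(2)] lift] by blast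
    have le: "ds (Suc m) v \<le> ds m v" if "v \<in> verts Q" for v
      using word_lists_length[OF lift that] W that by auto
    have "?P m W'"
    proof (intro conjI ballI)
      fix m' v assume m': "m' \<in> {m..l}" and v: "v \<in> verts Q"
      show "ds m' v \<le> ds m v"
      proof (cases "m' = m")
        case False
        then have "m' \<in> {Suc m..l}" using m' by auto
        then have "ds m' v \<le> ds (Suc m) v" using W v by blast
        then show ?thesis using le[OF v] by simp
      qed simp
      show "det (wmat (ds m') (fst x m') (\<lambda>v c. W' v ! c) v) \<noteq> 0"
      proof (cases "m' = m")
        case True
        then show ?thesis using word_lists_det[OF q[OF S(2)] W'(1) v] W'(2) v by auto
      next
        case False
        then have m'': "m' \<in> {Suc m..l}" using m' by auto
        have "W' v ! c = W v ! c" if "c < ds m' v" for c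
        proof -
          have "c < length (W v)" using that W m'' v by (auto intro: less_le_trans)
          then show ?thesis using W'(2) v by (auto simp: nth_append)
        qed
        then have "wmat (ds m') (fst x m') (\<lambda>v c. W' v ! c) v = wmat (ds m') (fst x m') (\<lambda>v c. W v ! c) v"
          by (auto simp: wmat_def)
        then show ?thesis using W m'' v by auto
      qed
    next
      fix m' v assume "m' \<in> {m..<l}" and v: "v \<in> verts Q"
      then show "ds (Suc m') v \<le> ds m' v" using W le[OF v] v by (cases "m' = m") auto
    qed (use W' in auto)
    then show "\<exists>W. ?P m W" by blast
  qed simp
  then obtain W where W: "?P 0 W" by blast
  show "m < l \<Longrightarrow> v \<in> verts Q \<Longrightarrow> ds (Suc m) v \<le> ds m v" using W by auto
  define L where "L = (\<lambda>v\<in>verts Q. \<lambda>c\<in>{..<ds 0 v}. W v ! c)"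
  have LW: "L v c = W v ! c" if "v \<in> verts Q" "c < ds 0 v" for v c using that by (simp add: L_def)
  have T: "(\<Sum>v\<in>verts Q. length (W v)) = (\<Sum>v\<in>verts Q. ds 0 v)" using W by (intro sum.cong) auto
  have Wv: "valid f w" "target w = v" "size w \<le> (\<Sum>v\<in>verts Q. ds 0 v)" if "v \<in> verts Q" "w \<in> set (W v)" for v w
    using W that unfolding word_lists_def T by auto
  have Wn: "W v ! c \<in> set (W v)" if "v \<in> verts Q" "c < ds 0 v" for v c using W that by auto
  have "word_family (ds 0) f L" unfolding word_family_def using Wv Wn by (auto simp: LW)
  moreover have "L \<in> (\<Pi>\<^sub>E v\<in>verts Q. \<Pi>\<^sub>E c\<in>{..<ds 0 v}. {w. valid f w \<and> size w \<le> (\<Sum>v\<in>verts Q. ds 0 v)})"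
    using Wv Wn by (auto simp: L_def)
  ultimately have "L \<in> word_charts" by (simp add: word_charts_def)
  moreover have "x \<in> chart_dom L"
    unfolding chart_dom_def
  proof (intro CollectI conjI x allI impI ballI)
    fix m v assume m: "m \<le> l" and v: "v \<in> verts Q"
    have "ds m v \<le> ds 0 v" using W m v by auto
    then have "wmat (ds m) (fst x m) L v = wmat (ds m) (fst x m) (\<lambda>v c. W v ! c) v"
      using LW[OF v] by (auto simp: wmat_def)
    then show "det (wmat (ds m) (fst x m) L v) \<noteq> 0" using W m v by auto
  qed
  ultimately show "\<exists>L\<in>word_charts. x \<in> chart_dom L" by blast
qed

end


section \<open>The slice of normalised representations\<close>

text \<open>
  The inclusion of the span of the first \<open>k\<close> basis vectors, which is a section of
  every projection of the form \<open>(1 | *)\<close>.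
\<close>

definition inc :: "nat \<Rightarrow> nat \<Rightarrow> complex mat" where
  "inc n k = mat n k (\<lambda>(r, c). if r = c then 1 else 0)"

lemma inc_carrier [simp]: "inc n k \<in> carrier_mat n k" and inc_dim [simp]: "dim_row (inc n k) = n" "dim_col (inc n k) = k"
  by (simp_all add: inc_def)

lemma inc_self [simp]: "inc n n = 1\<^sub>m n"
  by (auto simp: inc_def)

lemma mult_inc_index:
  "A \<in> carrier_mat r n \<Longrightarrow> k \<le> n \<Longrightarrow> i < r \<Longrightarrow> j < k \<Longrightarrow> (A * inc n k) $$ (i, j) = A $$ (i, j)"
proof -
  assume A: "A \<in> carrier_mat r n" "k \<le> n" "i < r" "j < k"
  have "(A * inc n k) $$ (i, j) = (\<Sum>l<n. A $$ (i, l) * inc n k $$ (l, j))"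
    by (rule mult_mat_index[OF A(1) inc_carrier A(3,4)])
  also have "\<dots> = (\<Sum>l<n. if l = j then A $$ (i, l) else 0)"
    using A by (intro sum.cong) (auto simp: inc_def)
  also have "\<dots> = A $$ (i, j)" using A by simp
  finally show ?thesis .
qed

lemma inc_comp: "j \<le> k \<Longrightarrow> k \<le> n \<Longrightarrow> inc n k * inc k j = inc n j"
  by (intro eq_matI) (auto simp: mult_inc_index[OF inc_carrier] simp del: index_mult_mat(1), auto simp: inc_def)

text \<open>
  The columns of \<open>1 - J * P\<close> lie in the kernel of \<open>P\<close>.
\<close>

lemma vanish_on_kernel:
  fixes A P J :: "complex mat"
  assumes A: "A \<in> carrier_mat r n" and P: "P \<in> carrier_mat k n" and J: "J \<in> carrier_mat n k"
    and PJ: "P * J = 1\<^sub>m k" and van: "\<And>u. u \<in> mat_kernel P \<Longrightarrow> A *\<^sub>v u = 0\<^sub>v r"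
  shows "A * (J * P) = A"
proof -
  let ?D = "1\<^sub>m n - J * P"
  note dims = carrier_matD[OF A] carrier_matD[OF P] carrier_matD[OF J]
  have D: "?D \<in> carrier_mat n n" using J P by auto
  have "P * (J * P) = P" using PJ P by (simp flip: mat_assoc add: dims)
  then have PD: "P * ?D = 0\<^sub>m k n" using P by (simp add: mat_distrib dims)
  have "A * ?D = 0\<^sub>m r n"
  proof (rule mat_col_eqI)
    fix c assume "c < dim_col (0\<^sub>m r n :: complex mat)"
    then have c: "c < n" by simp
    have "P *\<^sub>v col ?D c = col (P * ?D) c" using col_mult2[OF P D c] by simp
    also have "\<dots> = 0\<^sub>v k" unfolding PD using c by (intro eq_vecI) auto
    finally have "col ?D c \<in> mat_kernel P" using D c by (intro mat_kernelI[OF P]) auto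
    then have "col (A * ?D) c = 0\<^sub>v r" using col_mult2[OF A D c] van by simp
    then show "col (A * ?D) c = col (0\<^sub>m r n) c" using c by (intro eq_vecI) auto
  qed (use A J P in auto)
  then have "A - A * (J * P) = 0\<^sub>m r n" using A by (simp add: mat_distrib dims)
  then have e: "(A - A * (J * P)) $$ (i, j) = 0" if "i < r" "j < n" for i j using that by simp
  show ?thesis
    using e by (intro eq_matI) (auto simp: dims simp del: index_mult_mat(1))
qed

text \<open>
  Positions of matrix entries: of \<open>A\<close>, \<open>B\<close>, \<open>i\<close>,
  \<open>j\<close> of the first representation, and of the maps \<open>\<pi>\<close>.
\<close>

datatype ('v, 'e) coord = CA 'e nat nat | CB 'e nat nat | CI 'v nat nat | CJ 'v nat nat | CP nat 'v nat nat

locale parabolic_chain = parabolic_data Q f l ds for Q :: "('v, 'e) pre_digraph" and f l ds +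
  assumes dec: "m < l \<Longrightarrow> v \<in> verts Q \<Longrightarrow> ds (Suc m) v \<le> ds m v"
begin

lemma dec': "m \<le> k \<Longrightarrow> k \<le> l \<Longrightarrow> v \<in> verts Q \<Longrightarrow> ds k v \<le> ds m v"
proof (induction k rule: dec_induct)
  case (step k)
  then show ?case using dec[of k v] by simp
qed simp

text \<open>The maps \<open>\<pi>\<close> have the form \<open>(1 | *)\<close>.\<close>

definition unitri :: "(nat \<Rightarrow> 'v \<Rightarrow> complex mat) \<Rightarrow> bool" where
  "unitri \<pi> \<longleftrightarrow> (\<forall>m<l. \<forall>v\<in>verts Q. \<pi> m v \<in> carrier_mat (ds (Suc m) v) (ds m v) \<and>
     \<pi> m v * inc (ds m v) (ds (Suc m) v) = 1\<^sub>m (ds (Suc m) v))"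

abbreviation PI :: "(nat \<Rightarrow> 'v \<Rightarrow> complex mat) \<Rightarrow> 'v \<Rightarrow> nat \<Rightarrow> complex mat" where
  "PI \<pi> v m \<equiv> pi_comp (ds 0 v) \<pi> v m"

abbreviation I0 :: "'v \<Rightarrow> nat \<Rightarrow> complex mat" where
  "I0 v m \<equiv> inc (ds 0 v) (ds m v)"

context
  fixes \<pi> assumes u: "unitri \<pi>"
begin

lemma pi_carrier: "m < l \<Longrightarrow> v \<in> verts Q \<Longrightarrow> \<pi> m v \<in> carrier_mat (ds (Suc m) v) (ds m v)"
  using u by (simp add: unitri_def)

lemma PI_carrier: "m \<le> l \<Longrightarrow> v \<in> verts Q \<Longrightarrow> PI \<pi> v m \<in> carrier_mat (ds m v) (ds 0 v)"
  by (rule pi_comp_carrier) (rule pi_carrier)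

lemma PI_dim: "m \<le> l \<Longrightarrow> v \<in> verts Q \<Longrightarrow> dim_row (PI \<pi> v m) = ds m v" "m \<le> l \<Longrightarrow> v \<in> verts Q \<Longrightarrow> dim_col (PI \<pi> v m) = ds 0 v"
  using PI_carrier by blast+

lemma PI_I0: "m \<le> l \<Longrightarrow> v \<in> verts Q \<Longrightarrow> PI \<pi> v m * I0 v m = 1\<^sub>m (ds m v)"
proof (induction m)
  case (Suc m)
  then have m: "m < l" "m \<le> l" by auto
  have i: "I0 v (Suc m) = I0 v m * inc (ds m v) (ds (Suc m) v)"
    using dec[OF m(1) Suc(3)] dec'[OF le0 m(2) Suc(3)] by (simp add: inc_comp)
  note dims = PI_dim[OF m(2) Suc(3)] carrier_matD[OF pi_carrier[OF m(1) Suc(3)]]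
  have "PI \<pi> v (Suc m) * I0 v (Suc m) = \<pi> m v * (PI \<pi> v m * I0 v m) * inc (ds m v) (ds (Suc m) v)"
    unfolding i by (simp add: mat_assoc dims)
  also have "\<dots> = 1\<^sub>m (ds (Suc m) v)"
    using Suc.IH[OF m(2) Suc(3)] u m Suc(3) by (simp add: unitri_def dims)
  finally show ?case .
qed simp

text \<open>
  The projection to step \<open>k\<close> factors through the projection to step \<open>m\<close>,
  of which \<open>I0 v m\<close> is a section.
\<close>

lemma PI_absorb: "m \<le> k \<Longrightarrow> k \<le> l \<Longrightarrow> v \<in> verts Q \<Longrightarrow> PI \<pi> v k * (I0 v m * PI \<pi> v m) = PI \<pi> v k"
proof (induction k rule: dec_induct)
  case base
  note dims = PI_dim[OF base]
  have "PI \<pi> v m * (I0 v m * PI \<pi> v m) = (PI \<pi> v m * I0 v m) * PI \<pi> v m" by (simp add: mat_assoc dims)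
  then show ?case using PI_I0[OF base] PI_carrier[OF base] by simp
next
  case (step k)
  then have k: "k < l" "k \<le> l" "m \<le> l" by auto
  note dims = PI_dim[OF k(2) step(5)] PI_dim[OF k(3) step(5)] carrier_matD[OF pi_carrier[OF k(1) step(5)]]
  have "PI \<pi> v (Suc k) * (I0 v m * PI \<pi> v m) = \<pi> k v * (PI \<pi> v k * (I0 v m * PI \<pi> v m))"
    by (simp add: mat_assoc dims)
  then show ?case using step.IH[OF k(2) step(5)] by simp
qed

lemma PI_step:
  assumes "m < k" "k \<le> l" "v \<in> verts Q"
  shows "PI \<pi> v k * I0 v (Suc m) * \<pi> m v = PI \<pi> v k * I0 v m"
proof -
  have m: "m < l" "m \<le> l" "Suc m \<le> l" "Suc m \<le> k" using assms by auto
  note dims = PI_dim[OF m(2) assms(3)] PI_dim[OF assms(2,3)] carrier_matD[OF pi_carrier[OF m(1) assms(3)]]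
  have "PI \<pi> v k * I0 v (Suc m) * \<pi> m v = PI \<pi> v k * I0 v (Suc m) * (\<pi> m v * (PI \<pi> v m * I0 v m))"
    using PI_I0[OF m(2) assms(3)] pi_carrier[OF m(1) assms(3)] by simp
  also have "\<dots> = PI \<pi> v k * (I0 v (Suc m) * PI \<pi> v (Suc m)) * I0 v m" by (simp add: mat_assoc dims)
  also have "\<dots> = PI \<pi> v k * I0 v m" unfolding PI_absorb[OF m(4) assms(2,3)] ..
  finally show ?thesis .
qed

end

text \<open>
  A point of the slice is given by the restrictions of \<open>A\<close>, \<open>B\<close>, \<open>j\<close> to the span of the first
  \<open>ds l v\<close> basis vectors, by \<open>i\<close>, and by the last columns of the maps \<open>\<pi>\<close>.
\<close>

definition tA :: "(('v, 'e) coord \<Rightarrow> complex) \<Rightarrow> 'e \<Rightarrow> complex mat" where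
  "tA y e = mat (ds 0 (head Q e)) (ds l (tail Q e)) (\<lambda>(r, c). y (CA e r c))"
definition tB :: "(('v, 'e) coord \<Rightarrow> complex) \<Rightarrow> 'e \<Rightarrow> complex mat" where
  "tB y e = mat (ds 0 (tail Q e)) (ds l (head Q e)) (\<lambda>(r, c). y (CB e r c))"
definition tI :: "(('v, 'e) coord \<Rightarrow> complex) \<Rightarrow> 'v \<Rightarrow> complex mat" where
  "tI y v = mat (ds 0 v) (f v) (\<lambda>(r, c). y (CI v r c))"
definition tJ :: "(('v, 'e) coord \<Rightarrow> complex) \<Rightarrow> 'v \<Rightarrow> complex mat" where
  "tJ y v = mat (f v) (ds l v) (\<lambda>(r, c). y (CJ v r c))"
definition tp :: "(('v, 'e) coord \<Rightarrow> complex) \<Rightarrow> nat \<Rightarrow> 'v \<Rightarrow> complex mat" where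
  "tp y m v = mat (ds (Suc m) v) (ds m v)
     (\<lambda>(r, c). if c < ds (Suc m) v then (if r = c then 1 else 0) else y (CP m v r c))"

lemma t_carrier [simp]:
  "tA y e \<in> carrier_mat (ds 0 (head Q e)) (ds l (tail Q e))" "tB y e \<in> carrier_mat (ds 0 (tail Q e)) (ds l (head Q e))"
  "tI y v \<in> carrier_mat (ds 0 v) (f v)" "tJ y v \<in> carrier_mat (f v) (ds l v)"
  "tp y m v \<in> carrier_mat (ds (Suc m) v) (ds m v)"
  by (simp_all add: tA_def tB_def tI_def tJ_def tp_def)

lemmas t_dim [simp] = t_carrier[THEN carrier_matD(1)] t_carrier[THEN carrier_matD(2)]

lemma unitri_tp: "unitri (tp y)"
  unfolding unitri_def
proof (intro allI impI ballI conjI t_carrier)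
  fix m v assume m: "m < l" "v \<in> verts Q"
  show "tp y m v * inc (ds m v) (ds (Suc m) v) = 1\<^sub>m (ds (Suc m) v)"
    using dec[OF m] by (intro eq_matI) (auto simp: mult_inc_index[OF t_carrier(5)] simp del: index_mult_mat(1), auto simp: tp_def)
qed

text \<open>
  By the split condition \<open>A\<close>, \<open>B\<close> and \<open>j\<close> factor through
  the projection to the last step, and are thus determined by their restrictions to the image of
  \<open>I0 v l\<close>.
\<close>

definition rep0 :: "(('v, 'e) coord \<Rightarrow> complex) \<Rightarrow> ('v, 'e) qrep" where
  "rep0 y = \<lparr> Amap = (\<lambda>e\<in>arcs Q. tA y e * PI (tp y) (tail Q e) l), Bmap = (\<lambda>e\<in>arcs Q. tB y e * PI (tp y) (head Q e) l),
     imap = (\<lambda>v\<in>verts Q. tI y v), jmap = (\<lambda>v\<in>verts Q. tJ y v * PI (tp y) v l) \<rparr>"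

text \<open>
  The quotient of the first representation at step \<open>m\<close>, written with the section
  \<open>I0 v m\<close>.
\<close>

definition qr :: "(('v, 'e) coord \<Rightarrow> complex) \<Rightarrow> nat \<Rightarrow> ('v, 'e) qrep" where
  "qr y m = \<lparr> Amap = (\<lambda>e\<in>arcs Q. PI (tp y) (head Q e) m * Amap (rep0 y) e * I0 (tail Q e) m),
     Bmap = (\<lambda>e\<in>arcs Q. PI (tp y) (tail Q e) m * Bmap (rep0 y) e * I0 (head Q e) m),
     imap = (\<lambda>v\<in>verts Q. PI (tp y) v m * imap (rep0 y) v), jmap = (\<lambda>v\<in>verts Q. jmap (rep0 y) v * I0 v m) \<rparr>"

definition pt :: "(('v, 'e) coord \<Rightarrow> complex) \<Rightarrow> ('v, 'e) parabolic_rep" where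
  "pt y = (\<lambda>m\<in>{..l}. qr y m, \<lambda>m\<in>{..<l}. \<lambda>v\<in>verts Q. tp y m v)"

lemma rep0_qreps: "rep0 y \<in> qreps Q (ds 0) f"
  using PI_carrier[OF unitri_tp] unfolding qreps_def rep0_def
  by (auto intro!: mult_carrier_mat[of _ _ "ds l _"])

lemma qr_qreps: "m \<le> l \<Longrightarrow> qr y m \<in> qreps Q (ds m) f"
proof -
  assume m: "m \<le> l"
  note q = qreps_carrier[OF rep0_qreps[of y]] and p = PI_carrier[OF unitri_tp m]
  show ?thesis
    unfolding qreps_def qr_def
    using mult_carrier_mat[OF mult_carrier_mat[OF p[OF head_in] q(1)] inc_carrier]
      mult_carrier_mat[OF mult_carrier_mat[OF p[OF tail_in] q(2)] inc_carrier]
      mult_carrier_mat[OF p q(3)] mult_carrier_mat[OF q(4) inc_carrier]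
    by auto
qed

lemma qr_0: "qr y 0 = rep0 y"
  by (rule qreps_eqI[OF qr_qreps[OF le0] rep0_qreps])
    (auto simp: qr_def qreps_dim[OF rep0_qreps])

lemma pt_shape: "pt y \<in> shape"
  unfolding pt_def pshape_def using qr_qreps by auto

lemma rep0_absorb:
  assumes m: "m \<le> l"
  shows "e \<in> arcs Q \<Longrightarrow> Amap (rep0 y) e * (I0 (tail Q e) m * PI (tp y) (tail Q e) m) = Amap (rep0 y) e"
    and "e \<in> arcs Q \<Longrightarrow> Bmap (rep0 y) e * (I0 (head Q e) m * PI (tp y) (head Q e) m) = Bmap (rep0 y) e"
    and "v \<in> verts Q \<Longrightarrow> jmap (rep0 y) v * (I0 v m * PI (tp y) v m) = jmap (rep0 y) v"
proof -
  have *: "(T * PI (tp y) v l) * (I0 v m * PI (tp y) v m) = T * PI (tp y) v l"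
    if v: "v \<in> verts Q" and T: "T \<in> carrier_mat r (ds l v)" for T v r
  proof -
    note dims = PI_dim[OF unitri_tp m v] PI_dim[OF unitri_tp order_refl v] carrier_matD[OF T]
    have "(T * PI (tp y) v l) * (I0 v m * PI (tp y) v m) = T * (PI (tp y) v l * (I0 v m * PI (tp y) v m))"
      by (rule mat_assoc) (simp_all add: dims)
    then show ?thesis using PI_absorb[OF unitri_tp m order_refl v] by simp
  qed
  show "e \<in> arcs Q \<Longrightarrow> Amap (rep0 y) e * (I0 (tail Q e) m * PI (tp y) (tail Q e) m) = Amap (rep0 y) e"
    "e \<in> arcs Q \<Longrightarrow> Bmap (rep0 y) e * (I0 (head Q e) m * PI (tp y) (head Q e) m) = Bmap (rep0 y) e"
    "v \<in> verts Q \<Longrightarrow> jmap (rep0 y) v * (I0 v m * PI (tp y) v m) = jmap (rep0 y) v"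
    using *[OF tail_in t_carrier(1)] *[OF head_in t_carrier(2)] *[OF _ t_carrier(4)] by (auto simp: rep0_def)
qed

lemma qhom_rep0:
  assumes m: "m \<le> l" shows "qhom Q (\<lambda>v. PI (tp y) v m) (rep0 y) (qr y m)"
  unfolding qhom_def
proof (intro conjI ballI)
  note q = qreps_dim[OF rep0_qreps[of y]] and p = PI_dim[OF unitri_tp m]
  fix e assume e: "e \<in> arcs Q"
  show "PI (tp y) (head Q e) m * Amap (rep0 y) e = Amap (qr y m) e * PI (tp y) (tail Q e) m"
    using e rep0_absorb(1)[OF m e, of y] by (simp add: qr_def mat_assoc q p)
  show "PI (tp y) (tail Q e) m * Bmap (rep0 y) e = Bmap (qr y m) e * PI (tp y) (head Q e) m"
    using e rep0_absorb(2)[OF m e, of y] by (simp add: qr_def mat_assoc q p)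
next
  note q = qreps_dim[OF rep0_qreps[of y]] and p = PI_dim[OF unitri_tp m]
  fix v assume v: "v \<in> verts Q"
  show "PI (tp y) v m * imap (rep0 y) v = imap (qr y m) v" using v by (simp add: qr_def)
  show "jmap (qr y m) v * PI (tp y) v m = jmap (rep0 y) v"
    using v rep0_absorb(3)[OF m v, of y] by (simp add: qr_def mat_assoc q p)
qed

lemma rep0_step:
  assumes m: "m < l"
  shows "e \<in> arcs Q \<Longrightarrow> Amap (rep0 y) e * (I0 (tail Q e) (Suc m) * tp y m (tail Q e)) = Amap (rep0 y) e * I0 (tail Q e) m"
    and "e \<in> arcs Q \<Longrightarrow> Bmap (rep0 y) e * (I0 (head Q e) (Suc m) * tp y m (head Q e)) = Bmap (rep0 y) e * I0 (head Q e) m"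
    and "v \<in> verts Q \<Longrightarrow> jmap (rep0 y) v * (I0 v (Suc m) * tp y m v) = jmap (rep0 y) v * I0 v m"
proof -
  have *: "(T * PI (tp y) v l) * (I0 v (Suc m) * tp y m v) = (T * PI (tp y) v l) * I0 v m"
    if v: "v \<in> verts Q" and T: "T \<in> carrier_mat r (ds l v)" for T v r
  proof -
    note dims = PI_dim[OF unitri_tp order_refl v] carrier_matD[OF T]
    show ?thesis using PI_step[OF unitri_tp m order_refl v, of y] by (simp add: mat_assoc dims)
  qed
  show "e \<in> arcs Q \<Longrightarrow> Amap (rep0 y) e * (I0 (tail Q e) (Suc m) * tp y m (tail Q e)) = Amap (rep0 y) e * I0 (tail Q e) m"
    "e \<in> arcs Q \<Longrightarrow> Bmap (rep0 y) e * (I0 (head Q e) (Suc m) * tp y m (head Q e)) = Bmap (rep0 y) e * I0 (head Q e) m"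
    "v \<in> verts Q \<Longrightarrow> jmap (rep0 y) v * (I0 v (Suc m) * tp y m v) = jmap (rep0 y) v * I0 v m"
    using *[OF tail_in t_carrier(1)] *[OF head_in t_carrier(2)] *[OF _ t_carrier(4)] by (auto simp: rep0_def)
qed

lemma qhom_step:
  assumes m: "m < l" shows "qhom Q (tp y m) (qr y m) (qr y (Suc m))"
  unfolding qhom_def
proof (intro conjI ballI)
  have S: "m \<le> l" "Suc m \<le> l" using m by auto
  note q = qreps_dim[OF rep0_qreps[of y]] and p = PI_dim[OF unitri_tp S(1)] PI_dim[OF unitri_tp S(2)]
  {
    fix e assume e: "e \<in> arcs Q"
    have "Amap (qr y (Suc m)) e * tp y m (tail Q e) =
        PI (tp y) (head Q e) (Suc m) * (Amap (rep0 y) e * (I0 (tail Q e) (Suc m) * tp y m (tail Q e)))"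
      using e by (simp add: qr_def mat_assoc q p del: pi_comp.simps)
    also have "\<dots> = tp y m (head Q e) * Amap (qr y m) e"
      unfolding rep0_step(1)[OF m e] using e by (simp add: qr_def mat_assoc q p)
    finally show "tp y m (head Q e) * Amap (qr y m) e = Amap (qr y (Suc m)) e * tp y m (tail Q e)" ..
    have "Bmap (qr y (Suc m)) e * tp y m (head Q e) =
        PI (tp y) (tail Q e) (Suc m) * (Bmap (rep0 y) e * (I0 (head Q e) (Suc m) * tp y m (head Q e)))"
      using e by (simp add: qr_def mat_assoc q p del: pi_comp.simps)
    also have "\<dots> = tp y m (tail Q e) * Bmap (qr y m) e"
      unfolding rep0_step(2)[OF m e] using e by (simp add: qr_def mat_assoc q p)
    finally show "tp y m (tail Q e) * Bmap (qr y m) e = Bmap (qr y (Suc m)) e * tp y m (head Q e)" ..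
  }
  fix v assume v: "v \<in> verts Q"
  show "tp y m v * imap (qr y m) v = imap (qr y (Suc m)) v" using v by (simp add: qr_def mat_assoc q p)
  show "jmap (qr y (Suc m)) v * tp y m v = jmap (qr y m) v"
    using v rep0_step(3)[OF m v, of y] by (simp add: qr_def mat_assoc q p)
qed

text \<open>
  The moment map of \<open>rep0 y\<close> is the composite of \<open>tmom y v\<close> with the
  projection to the last step. The entries of the moment map itself would in general be dependent
  equations.
\<close>

definition tmom :: "(('v, 'e) coord \<Rightarrow> complex) \<Rightarrow> 'v \<Rightarrow> complex mat" where
  "tmom y v = msum (ds 0 v) (ds l v) (\<lambda>e. tA y e * (PI (tp y) (tail Q e) l * tB y e)) {e \<in> arcs Q. head Q e = v}
     - msum (ds 0 v) (ds l v) (\<lambda>e. tB y e * (PI (tp y) (head Q e) l * tA y e)) {e \<in> arcs Q. tail Q e = v}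
     + tI y v * tJ y v"

lemma tmom_carrier [simp]: "tmom y v \<in> carrier_mat (ds 0 v) (ds l v)"
  unfolding tmom_def by (intro add_carrier_mat mult_carrier_mat[of _ _ "f v"] t_carrier)

lemma moment_rep0: "v \<in> verts Q \<Longrightarrow> moment Q (ds 0) (rep0 y) v = tmom y v * PI (tp y) v l"
proof -
  assume v: "v \<in> verts Q"
  note p = PI_dim[OF unitri_tp order_refl] and pc = PI_carrier[OF unitri_tp order_refl]
  have 1: "msum (ds 0 v) (ds 0 v) (\<lambda>e. Amap (rep0 y) e * Bmap (rep0 y) e) {e \<in> arcs Q. head Q e = v} =
      msum (ds 0 v) (ds l v) (\<lambda>e. tA y e * (PI (tp y) (tail Q e) l * tB y e)) {e \<in> arcs Q. head Q e = v} * PI (tp y) v l"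
    by (subst msum_mult[OF pc[OF v]])
      (use pc in \<open>auto intro!: msum_cong mult_carrier_mat[of _ _ "ds l _"] carrier_matI simp: rep0_def mat_assoc p\<close>)
  have 2: "msum (ds 0 v) (ds 0 v) (\<lambda>e. Bmap (rep0 y) e * Amap (rep0 y) e) {e \<in> arcs Q. tail Q e = v} =
      msum (ds 0 v) (ds l v) (\<lambda>e. tB y e * (PI (tp y) (head Q e) l * tA y e)) {e \<in> arcs Q. tail Q e = v} * PI (tp y) v l"
    by (subst msum_mult[OF pc[OF v]])
      (use pc in \<open>auto intro!: msum_cong mult_carrier_mat[of _ _ "ds l _"] carrier_matI simp: rep0_def mat_assoc p\<close>)
  show ?thesis
    unfolding moment_def 1 2 tmom_def using v by (simp add: mat_distrib p rep0_def mat_assoc)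
qed

definition sol :: "('v \<Rightarrow> nat \<Rightarrow> ('v, 'e) word) \<Rightarrow> (('v, 'e) coord \<Rightarrow> complex) \<Rightarrow> bool" where
  "sol L y \<longleftrightarrow> (\<forall>v\<in>verts Q. tmom y v = 0\<^sub>m (ds 0 v) (ds l v) \<and> wmat (ds 0) (rep0 y) L v = 1\<^sub>m (ds 0 v))"

definition normal :: "('v \<Rightarrow> nat \<Rightarrow> ('v, 'e) word) \<Rightarrow> ('v, 'e) parabolic_rep \<Rightarrow> bool" where
  "normal L x \<longleftrightarrow> (\<forall>m\<le>l. \<forall>v\<in>verts Q. wmat (ds m) (fst x m) L v = 1\<^sub>m (ds m v))"

lemma word_family_le: "word_family (ds 0) f L \<Longrightarrow> m \<le> l \<Longrightarrow> word_family (ds m) f L"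
  unfolding word_family_def by (meson dec' le0 less_le_trans)

text \<open>
  The projections are homomorphisms from \<open>rep0 y\<close>, so the values of words, and with
  them stability, and the moment map equation pass to all later steps.
\<close>

lemma sol_reps:
  assumes s: "sol L y" and L: "word_family (ds 0) f L"
  shows "pt y \<in> reps" "normal L (pt y)"
proof -
  note p = PI_carrier[OF unitri_tp]
  have fst: "fst (pt y) m = qr y m" if "m \<le> l" for m using that by (simp add: pt_def)
  have w: "wmat (ds m) (qr y m) L v = 1\<^sub>m (ds m v)" if m: "m \<le> l" and v: "v \<in> verts Q" for m v
  proof (rule mat_col_eqI)
    fix c assume "c < dim_col (1\<^sub>m (ds m v) :: complex mat)"
    then have c: "c < ds m v" by simp
    have c0: "c < ds 0 v" using c dec'[OF le0 m v] by simp
    have lv: "valid f (L v c)" "target (L v c) = v" using L v c0 by (auto simp: word_family_def)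
    have "col (wmat (ds m) (qr y m) L v) c = ev (qr y m) (L v c)"
      by (rule col_wmat[OF qr_qreps[OF m] word_family_le[OF L m] v c])
    also have "\<dots> = PI (tp y) v m *\<^sub>v ev (rep0 y) (L v c)"
      using ev_qhom[OF rep0_qreps qr_qreps[OF m] p[OF m] qhom_rep0[OF m] lv(1)] lv(2) by simp
    also have "ev (rep0 y) (L v c) = col (1\<^sub>m (ds 0 v)) c"
      using s v col_wmat[OF rep0_qreps L v c0, of y] by (simp add: sol_def)
    also have "\<dots> = col (I0 v m) c" using c c0 by (intro eq_vecI) (auto simp: inc_def)
    also have "PI (tp y) v m *\<^sub>v col (I0 v m) c = col (1\<^sub>m (ds m v)) c"
      using col_mult2[OF p[OF m v, of y] inc_carrier c] PI_I0[OF unitri_tp m v, of y] by simp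
    finally show "col (wmat (ds m) (qr y m) L v) c = col (1\<^sub>m (ds m v)) c" .
  qed auto
  then show "normal L (pt y)" by (simp add: normal_def fst)
  have st: "stable Q (ds m) f (qr y m)" if m: "m \<le> l" for m
    by (rule stableI_words[OF qr_qreps[OF m] word_family_le[OF L m]]) (simp add: w[OF m])
  have m0: "moment Q (ds 0) (rep0 y) v = 0\<^sub>m (ds 0 v) (ds 0 v)" if v: "v \<in> verts Q" for v
    using s v by (simp add: moment_rep0 sol_def left_mult_zero_mat[OF p[OF order_refl v]])
  have mo: "moment_map_eqs Q (ds m) (qr y m)" if m: "m \<le> l" for m
    unfolding moment_map_eqs_iff[OF qr_qreps[OF m]]
  proof
    fix v assume v: "v \<in> verts Q"
    note c = moment_carrier[OF qr_qreps[OF m] v, of y]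
    have e: "moment Q (ds m) (qr y m) v * PI (tp y) v m = 0\<^sub>m (ds m v) (ds 0 v)"
      using moment_qhom[OF rep0_qreps qr_qreps[OF m] p[OF m] qhom_rep0[OF m] v] m0[OF v]
      by (simp add: right_mult_zero_mat[OF p[OF m v]])
    have "moment Q (ds m) (qr y m) v = moment Q (ds m) (qr y m) v * (PI (tp y) v m * I0 v m)"
      using PI_I0[OF unitri_tp m v, of y] c by simp
    also have "\<dots> = (moment Q (ds m) (qr y m) v * PI (tp y) v m) * I0 v m"
      using carrier_matD[OF c] PI_dim[OF unitri_tp m v, of y] by (simp add: mat_assoc)
    also have "\<dots> = 0\<^sub>m (ds m v) (ds m v)" unfolding e by simp
    finally show "moment Q (ds m) (qr y m) v = 0\<^sub>m (ds m v) (ds m v)" .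
  qed
  have pic: "pi_comp (ds 0 v) (snd (pt y)) v l = PI (tp y) v l" if "v \<in> verts Q" for v
    by (rule pi_comp_cong) (use that in \<open>simp add: pt_def\<close>)
  have "parabolic_split Q l ds f (pt y)"
    unfolding parabolic_split_def case_prod_unfold
  proof (intro ballI)
    fix v u assume v: "v \<in> verts Q" and "u \<in> mat_kernel (pi_comp (ds 0 v) (snd (pt y)) v l)"
    then have u: "u \<in> carrier_vec (ds 0 v)" "PI (tp y) v l *\<^sub>v u = 0\<^sub>v (ds l v)"
      using mat_kernelD[OF p[OF order_refl v]] pic[OF v] by auto
    have *: "(T * PI (tp y) v l) *\<^sub>v u = 0\<^sub>v r" if T: "T \<in> carrier_mat r (ds l v)" for T r
    proof -
      have "(T * PI (tp y) v l) *\<^sub>v u = T *\<^sub>v 0\<^sub>v (ds l v)"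
        using assoc_mult_mat_vec[OF T p[OF order_refl v] u(1)] u(2) by simp
      then show ?thesis using T by (auto intro!: eq_vecI simp: scalar_prod_def)
    qed
    have f0: "fst (pt y) 0 = rep0 y" using fst[OF le0] by (simp add: qr_0)
    show "(\<forall>e \<in> arcs Q. tail Q e = v \<longrightarrow> Amap (fst (pt y) 0) e *\<^sub>v u = 0\<^sub>v (ds 0 (head Q e))) \<and>
       (\<forall>e \<in> arcs Q. head Q e = v \<longrightarrow> Bmap (fst (pt y) 0) e *\<^sub>v u = 0\<^sub>v (ds 0 (tail Q e))) \<and>
       jmap (fst (pt y) 0) v *\<^sub>v u = 0\<^sub>v (f v)"
      unfolding f0 using v *[OF t_carrier(4)] *[of "tA y _" "ds 0 (head Q _)"] *[of "tB y _" "ds 0 (tail Q _)"]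
        t_carrier(1,2)[of y]
      by (auto simp: rep0_def)
  qed
  moreover have "qhom Q (snd (pt y) m) (fst (pt y) m) (fst (pt y) (Suc m))" if m: "m < l" for m
    using qhom_step[OF m, of y] m by (simp add: pt_def qhom_def)
  ultimately show "pt y \<in> reps"
    using pt_shape st mo by (simp add: reps_iff fst)
qed

definition coords_of :: "('v, 'e) parabolic_rep \<Rightarrow> ('v, 'e) coord \<Rightarrow> complex" where
  "coords_of x k = (case k of CA e r c \<Rightarrow> Amap (fst x 0) e $$ (r, c) | CB e r c \<Rightarrow> Bmap (fst x 0) e $$ (r, c)
     | CI v r c \<Rightarrow> imap (fst x 0) v $$ (r, c) | CJ v r c \<Rightarrow> jmap (fst x 0) v $$ (r, c)
     | CP m v r c \<Rightarrow> snd x m v $$ (r, c))"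

text \<open>
  At a normalised point the words of \<open>L\<close> have unit vectors as values at every step.
  As \<open>\<pi>\<close> maps the values at one step to those at the next, it has the form
  \<open>(1 | *)\<close>. The split condition then recovers the first representation from its
  restrictions, and the others as its quotients.
\<close>

lemma normal_sol:
  assumes x: "x \<in> reps" and n: "normal L x" and L: "word_family (ds 0) f L"
  shows "sol L (coords_of x)" "pt (coords_of x) = x"
proof -
  let ?y = "coords_of x"
  note xs = reps_shape[OF x]
  note q = shape_qreps[OF xs] and xp = shape_pi[OF xs]
  have h: "qhom Q (snd x m) (fst x m) (fst x (Suc m))" if "m < l" for m using x that by (simp add: reps_iff)
  have evx: "ev (fst x m) (L v c) = unit_vec (ds m v) c" if m: "m \<le> l" and v: "v \<in> verts Q" and c: "c < ds m v" for m v c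
    using col_wmat[OF q[OF m] word_family_le[OF L m] v c] n m v c by (simp add: normal_def)
  have uni: "snd x m v $$ (r, c) = (if r = c then 1 else 0)" if m: "m < l" and v: "v \<in> verts Q" and r: "r < ds (Suc m) v" and c: "c < ds (Suc m) v"
    for m v r c
  proof -
    have S: "Suc m \<le> l" "m \<le> l" using m by auto
    have c': "c < ds m v" and c0: "c < ds 0 v" using c dec'[of m "Suc m" v] dec'[of 0 "Suc m" v] S v by auto
    have lv: "valid f (L v c)" "target (L v c) = v" using L v c0 by (auto simp: word_family_def)
    have "unit_vec (ds (Suc m) v) c = snd x m v *\<^sub>v unit_vec (ds m v) c"
      using ev_qhom[OF q[OF S(2)] q[OF S(1)] xp[OF m] h[OF m] lv(1)] lv(2) evx[OF S(1) v c] evx[OF S(2) v c'] by simp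
    then have "unit_vec (ds (Suc m) v) c $ r = (snd x m v *\<^sub>v unit_vec (ds m v) c) $ r" by simp
    also have "\<dots> = snd x m v $$ (r, c)" using xp[OF m v] r c' by auto
    finally show ?thesis using r c by simp
  qed
  have tp: "tp ?y m v = snd x m v" if m: "m < l" and v: "v \<in> verts Q" for m v
    using xp[OF m v] uni[OF m v] by (intro eq_matI) (auto simp: tp_def coords_of_def)
  have PIx: "pi_comp (ds 0 v) (snd x) v m = PI (tp ?y) v m" if "m \<le> l" "v \<in> verts Q" for m v
    by (rule pi_comp_cong) (use that tp in auto)
  note p = PI_carrier[OF unitri_tp] and pi0 = PI_I0[OF unitri_tp]
  have split: "\<And>v u. v \<in> verts Q \<Longrightarrow> u \<in> mat_kernel (PI (tp ?y) v l) \<Longrightarrow>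
       (\<forall>e \<in> arcs Q. tail Q e = v \<longrightarrow> Amap (fst x 0) e *\<^sub>v u = 0\<^sub>v (ds 0 (head Q e))) \<and>
       (\<forall>e \<in> arcs Q. head Q e = v \<longrightarrow> Bmap (fst x 0) e *\<^sub>v u = 0\<^sub>v (ds 0 (tail Q e))) \<and>
       jmap (fst x 0) v *\<^sub>v u = 0\<^sub>v (f v)"
    using x PIx[OF order_refl] unfolding reps_iff parabolic_split_def case_prod_unfold by auto
  have abs: "T * (I0 v l * PI (tp ?y) v l) = T"
    if v: "v \<in> verts Q" and T: "T \<in> carrier_mat r (ds 0 v)" and van: "\<And>u. u \<in> mat_kernel (PI (tp ?y) v l) \<Longrightarrow> T *\<^sub>v u = 0\<^sub>v r"
    for T v r
    by (rule vanish_on_kernel[OF T p[OF order_refl v] inc_carrier pi0[OF order_refl v] van])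
  have c0: "Amap (fst x 0) e \<in> carrier_mat (ds 0 (head Q e)) (ds 0 (tail Q e))"
    "Bmap (fst x 0) e \<in> carrier_mat (ds 0 (tail Q e)) (ds 0 (head Q e))" if "e \<in> arcs Q" for e
    using qreps_carrier(1,2)[OF q[OF le0] that] by auto
  have c0': "imap (fst x 0) v \<in> carrier_mat (ds 0 v) (f v)" "jmap (fst x 0) v \<in> carrier_mat (f v) (ds 0 v)" if "v \<in> verts Q" for v
    using qreps_carrier(3,4)[OF q[OF le0] that] by auto
  have tA: "tA ?y e = Amap (fst x 0) e * I0 (tail Q e) l" "tB ?y e = Bmap (fst x 0) e * I0 (head Q e) l" if e: "e \<in> arcs Q" for e
    using c0[OF e] dec'[of 0 l "tail Q e"] dec'[of 0 l "head Q e"] e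
    by (auto intro!: eq_matI simp: mult_inc_index[OF c0(1)[OF e]] mult_inc_index[OF c0(2)[OF e]] simp del: index_mult_mat(1))
      (auto simp: tA_def tB_def coords_of_def)
  have tJ: "tJ ?y v = jmap (fst x 0) v * I0 v l" if v: "v \<in> verts Q" for v
    using c0'[OF v] dec'[of 0 l v] v
    by (auto intro!: eq_matI simp: mult_inc_index[OF c0'(2)[OF v]] simp del: index_mult_mat(1))
      (auto simp: tJ_def coords_of_def)
  have tI: "tI ?y v = imap (fst x 0) v" if v: "v \<in> verts Q" for v
    using c0'[OF v] by (auto intro!: eq_matI simp: tI_def coords_of_def)
  have r0: "rep0 ?y = fst x 0"
  proof (rule qreps_eqI[OF rep0_qreps q[OF le0]])
    fix e assume e: "e \<in> arcs Q"
    show "Amap (rep0 ?y) e = Amap (fst x 0) e"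
      using abs[OF tail_in[OF e] c0(1)[OF e]] split[OF tail_in[OF e]] e PI_dim[OF unitri_tp order_refl tail_in[OF e]] c0[OF e]
      by (auto simp: rep0_def tA mat_assoc)
    show "Bmap (rep0 ?y) e = Bmap (fst x 0) e"
      using abs[OF head_in[OF e] c0(2)[OF e]] split[OF head_in[OF e]] e PI_dim[OF unitri_tp order_refl head_in[OF e]] c0[OF e]
      by (auto simp: rep0_def tA mat_assoc)
  next
    fix v assume v: "v \<in> verts Q"
    show "imap (rep0 ?y) v = imap (fst x 0) v" using v by (simp add: rep0_def tI)
    show "jmap (rep0 ?y) v = jmap (fst x 0) v"
      using abs[OF v c0'(2)[OF v]] split[OF v] v PI_dim[OF unitri_tp order_refl v] c0'[OF v]
      by (auto simp: rep0_def tJ mat_assoc)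
  qed
  have hP: "qhom Q (\<lambda>v. PI (tp ?y) v m) (fst x 0) (fst x m)" if "m \<le> l" for m
    using that
  proof (induction m)
    case 0
    show ?case using qreps_dim[OF q[OF le0]] by (auto simp: qhom_def)
  next
    case (Suc m)
    then have m: "m < l" "m \<le> l" by auto
    have "qhom Q (\<lambda>v. snd x m v * PI (tp ?y) v m) (fst x 0) (fst x (Suc m))"
      by (rule qhom_comp[OF q[OF le0] q[OF m(2)] q[OF Suc(2)] p[OF m(2)] xp[OF m(1)] Suc.IH[OF m(2)] h[OF m(1)]])
    then show ?case by (simp add: qhom_def tp[OF m(1)])
  qed
  have qrx: "qr ?y m = fst x m" if m: "m \<le> l" for m
  proof (rule qreps_eqI[OF qr_qreps[OF m] q[OF m]])
    note dims = qreps_dim[OF q[OF m]] PI_dim[OF unitri_tp m] qreps_dim[OF q[OF le0]]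
    fix e assume e: "e \<in> arcs Q"
    have "Amap (fst x m) e * (PI (tp ?y) (tail Q e) m * I0 (tail Q e) m) = Amap (fst x m) e"
      using pi0[OF m tail_in[OF e], of ?y] dims(2)[OF e] by simp
    then have "(Amap (fst x m) e * PI (tp ?y) (tail Q e) m) * I0 (tail Q e) m = Amap (fst x m) e"
      using e by (simp add: mat_assoc dims)
    then show "Amap (qr ?y m) e = Amap (fst x m) e" using hP[OF m] e by (simp add: qr_def r0 qhom_def)
    have "Bmap (fst x m) e * (PI (tp ?y) (head Q e) m * I0 (head Q e) m) = Bmap (fst x m) e"
      using pi0[OF m head_in[OF e], of ?y] dims(4)[OF e] by simp
    then have "(Bmap (fst x m) e * PI (tp ?y) (head Q e) m) * I0 (head Q e) m = Bmap (fst x m) e"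
      using e by (simp add: mat_assoc dims)
    then show "Bmap (qr ?y m) e = Bmap (fst x m) e" using hP[OF m] e by (simp add: qr_def r0 qhom_def)
  next
    note dims = qreps_dim[OF q[OF m]] PI_dim[OF unitri_tp m] qreps_dim[OF q[OF le0]]
    fix v assume v: "v \<in> verts Q"
    show "imap (qr ?y m) v = imap (fst x m) v" using hP[OF m] v by (simp add: qr_def r0 qhom_def)
    have "jmap (fst x m) v * (PI (tp ?y) v m * I0 v m) = jmap (fst x m) v"
      using pi0[OF m v, of ?y] dims(8)[OF v] by simp
    then have "(jmap (fst x m) v * PI (tp ?y) v m) * I0 v m = jmap (fst x m) v"
      using v by (simp add: mat_assoc dims)
    then show "jmap (qr ?y m) v = jmap (fst x m) v" using hP[OF m] v by (simp add: qr_def r0 qhom_def)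
  qed
  show "pt ?y = x"
    by (rule shape_eqI[OF pt_shape xs]) (auto simp: pt_def qrx tp)
  show "sol L ?y"
    unfolding sol_def r0
  proof (intro ballI conjI)
    fix v assume v: "v \<in> verts Q"
    show "wmat (ds 0) (fst x 0) L v = 1\<^sub>m (ds 0 v)" using n v by (simp add: normal_def)
    have e: "tmom ?y v * PI (tp ?y) v l = 0\<^sub>m (ds 0 v) (ds 0 v)"
      using moment_rep0[OF v, of ?y] x moment_map_eqs_iff[OF q[OF le0]] v by (auto simp: reps_iff r0)
    have "tmom ?y v = tmom ?y v * (PI (tp ?y) v l * I0 v l)"
      using pi0[OF order_refl v, of ?y] by (simp add: right_mult_one_mat[OF tmom_carrier])
    also have "\<dots> = (tmom ?y v * PI (tp ?y) v l) * I0 v l"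
      using carrier_matD[OF tmom_carrier] PI_dim[OF unitri_tp order_refl v] by (simp add: mat_assoc)
    also have "\<dots> = 0\<^sub>m (ds 0 v) (ds l v)" unfolding e by simp
    finally show "tmom ?y v = 0\<^sub>m (ds 0 v) (ds l v)" .
  qed
qed

end


section \<open>The atlas of a split parabolic quiver variety\<close>

context fun_alg
begin

lemma mfun_add:
  assumes "mfun n m F" "mfun n m G" shows "mfun n m (\<lambda>x. F x + G x)"
proof (rule mfunI)
  show "F x + G x \<in> carrier_mat n m" if "x \<in> U" for x
    using mfun_carrier[OF assms(2) that] by auto
  show "(\<lambda>x. (F x + G x) $$ (r, c)) \<in> R" if "r < n" "c < m" for r c
  proof (rule cong)
    show "(\<lambda>x. F x $$ (r, c) + G x $$ (r, c)) \<in> R"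
      using assms that by (intro add mfun_entry[of n m])
    show "F x $$ (r, c) + G x $$ (r, c) = (F x + G x) $$ (r, c)" if "x \<in> U" for x
      using mfun_carrier[OF assms(2) that] \<open>r < n\<close> \<open>c < m\<close> by auto
  qed
qed

lemma mfun_msum: "(\<And>e. e \<in> E \<Longrightarrow> mfun n m (F e)) \<Longrightarrow> mfun n m (\<lambda>x. msum n m (\<lambda>e. F e x) E)"
  by (rule mfunI) (auto intro!: sum mfun_entry[of n m])

end

definition qfun :: "('v, 'e) pre_digraph \<Rightarrow> 'a set \<Rightarrow> ('a \<Rightarrow> complex) set \<Rightarrow> ('v \<Rightarrow> nat) \<Rightarrow> ('v \<Rightarrow> nat) \<Rightarrow> ('a \<Rightarrow> ('v, 'e) qrep) \<Rightarrow> bool" where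
  "qfun Q U R d f X \<longleftrightarrow> (\<forall>x\<in>U. X x \<in> qreps Q d f) \<and>
     (\<forall>e\<in>arcs Q. fun_alg.mfun U R (d (head Q e)) (d (tail Q e)) (\<lambda>x. Amap (X x) e) \<and>
        fun_alg.mfun U R (d (tail Q e)) (d (head Q e)) (\<lambda>x. Bmap (X x) e)) \<and>
     (\<forall>v\<in>verts Q. fun_alg.mfun U R (d v) (f v) (\<lambda>x. imap (X x) v) \<and> fun_alg.mfun U R (f v) (d v) (\<lambda>x. jmap (X x) v))"

lemma (in quiver) qfunI_coords:
  assumes "fun_alg U R" and X: "\<And>x. x \<in> U \<Longrightarrow> X x \<in> qreps Q d f"
    and R: "\<And>\<phi>. \<phi> \<in> qrep_coords Q d f \<Longrightarrow> (\<lambda>x. \<phi> (X x)) \<in> R"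
  shows "qfun Q U R d f X"
proof -
  interpret fun_alg U R by fact
  note c = qreps_carrier[OF X]
  show ?thesis
    unfolding qfun_def
  proof (intro conjI ballI X)
    fix e assume e: "e \<in> arcs Q"
    show "mfun (d (head Q e)) (d (tail Q e)) (\<lambda>x. Amap (X x) e)"
    proof (rule mfunI)
      fix r c assume "r < d (head Q e)" "c < d (tail Q e)"
      then have "(\<lambda>x. Amap x e $$ (r, c)) \<in> qrep_coords Q d f" using e unfolding qrep_coords_def by blast
      from R[OF this] show "(\<lambda>x. Amap (X x) e $$ (r, c)) \<in> R" .
    qed (rule c(1)[OF _ e])
    show "mfun (d (tail Q e)) (d (head Q e)) (\<lambda>x. Bmap (X x) e)"
    proof (rule mfunI)
      fix r c assume "r < d (tail Q e)" "c < d (head Q e)"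
      then have "(\<lambda>x. Bmap x e $$ (r, c)) \<in> qrep_coords Q d f" using e unfolding qrep_coords_def by blast
      from R[OF this] show "(\<lambda>x. Bmap (X x) e $$ (r, c)) \<in> R" .
    qed (rule c(2)[OF _ e])
  next
    fix v assume v: "v \<in> verts Q"
    show "mfun (d v) (f v) (\<lambda>x. imap (X x) v)"
    proof (rule mfunI)
      fix r c assume "r < d v" "c < f v"
      then have "(\<lambda>x. imap x v $$ (r, c)) \<in> qrep_coords Q d f" using v unfolding qrep_coords_def by blast
      from R[OF this] show "(\<lambda>x. imap (X x) v $$ (r, c)) \<in> R" .
    qed (rule c(3)[OF _ v])
    show "mfun (f v) (d v) (\<lambda>x. jmap (X x) v)"
    proof (rule mfunI)
      fix r c assume "r < f v" "c < d v"
      then have "(\<lambda>x. jmap x v $$ (r, c)) \<in> qrep_coords Q d f" using v unfolding qrep_coords_def by blast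
      from R[OF this] show "(\<lambda>x. jmap (X x) v $$ (r, c)) \<in> R" .
    qed (rule c(4)[OF _ v])
  qed
qed

lemma (in quiver) qfun_coords:
  assumes "fun_alg U R" and q: "qfun Q U R d f X" and \<phi>: "\<phi> \<in> qrep_coords Q d f"
  shows "(\<lambda>x. \<phi> (X x)) \<in> R"
proof -
  interpret fun_alg U R by fact
  show ?thesis
    using \<phi> q unfolding qrep_coords_def qfun_def by (auto intro: mfun_entry)
qed

lemma (in quiver) ev_fun:
  assumes "fun_alg U R" and q: "qfun Q U R d f X"
  shows "valid f w \<Longrightarrow> r < d (target w) \<Longrightarrow> (\<lambda>x. ev (X x) w $ r) \<in> R"
proof -
  interpret fun_alg U R by fact
  have X: "X x \<in> qreps Q d f" if "x \<in> U" for x using q that by (simp add: qfun_def)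
  have step: "(\<lambda>x. (M x *\<^sub>v V x) $ r) \<in> R"
    if "mfun n k M" "\<And>i. i < k \<Longrightarrow> (\<lambda>x. V x $ i) \<in> R" "\<And>x. x \<in> U \<Longrightarrow> V x \<in> carrier_vec k" "r < n" for M V n k r
  proof (rule cong)
    show "(\<lambda>x. \<Sum>i<k. M x $$ (r, i) * V x $ i) \<in> R"
      using that by (intro sum mult mfun_entry[OF that(1)]) auto
    show "(\<Sum>i<k. M x $$ (r, i) * V x $ i) = (M x *\<^sub>v V x) $ r" if x: "x \<in> U" for x
      by (rule mult_mat_vec_index[symmetric]) (use that mfun_carrier[OF \<open>mfun n k M\<close> x] \<open>r < n\<close> \<open>x \<in> U \<Longrightarrow> V x \<in> carrier_vec k\<close> in auto)
  qed
  show "valid f w \<Longrightarrow> r < d (target w) \<Longrightarrow> (\<lambda>x. ev (X x) w $ r) \<in> R"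
  proof (induction w arbitrary: r)
    case (Gen v k)
    then have v: "v \<in> verts Q" "k < f v" "r < d v" by auto
    have m: "mfun (d v) (f v) (\<lambda>x. imap (X x) v)" using q v by (simp add: qfun_def)
    show ?case
      by (rule cong[OF mfun_entry[OF m v(3,2)]]) (use qreps_dim(5,6)[OF X v(1)] v in auto)
  next
    case (StepA e w)
    then have e: "e \<in> arcs Q" "target w = tail Q e" "valid f w" "r < d (head Q e)" by auto
    show ?case
      unfolding ev.simps
      by (rule step[of "d (head Q e)" "d (tail Q e)"])
        (use q e StepA.IH[OF e(3)] ev_carrier[OF X e(3)] in \<open>auto simp: qfun_def\<close>)
  next
    case (StepB e w)
    then have e: "e \<in> arcs Q" "target w = head Q e" "valid f w" "r < d (tail Q e)" by auto
    show ?case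
      unfolding ev.simps
      by (rule step[of "d (tail Q e)" "d (head Q e)"])
        (use q e StepB.IH[OF e(3)] ev_carrier[OF X e(3)] in \<open>auto simp: qfun_def\<close>)
  qed
qed

lemma (in quiver) wmat_fun:
  assumes "fun_alg U R" and q: "qfun Q U R d f X" and L: "word_family d f L" and v: "v \<in> verts Q"
  shows "fun_alg.mfun U R (d v) (d v) (\<lambda>x. wmat d (X x) L v)"
proof -
  interpret fun_alg U R by fact
  show ?thesis
    unfolding wmat_def using L v by (intro mfun_mat) (auto simp: word_family_def intro!: ev_fun[OF assms(1) q])
qed

definition entries :: "nat \<Rightarrow> nat \<Rightarrow> ('a \<Rightarrow> complex mat) \<Rightarrow> ('a \<Rightarrow> complex) set" where
  "entries n m F = {\<lambda>p. F p $$ (r, c) | r c. r < n \<and> c < m}"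

lemma entries_diff_zero_iff:
  assumes "F p \<in> carrier_mat n m" "G p \<in> carrier_mat n m"
  shows "(\<forall>e\<in>entries n m (\<lambda>p. F p - G p). e p = 0) \<longleftrightarrow> F p = G p"
proof
  assume z: "\<forall>e\<in>entries n m (\<lambda>p. F p - G p). e p = 0"
  show "F p = G p"
  proof (rule eq_matI)
    fix r c assume "r < dim_row (G p)" "c < dim_col (G p)"
    then have rc: "r < n" "c < m" using assms by auto
    then have "(\<lambda>p. (F p - G p) $$ (r, c)) \<in> entries n m (\<lambda>p. F p - G p)"
      unfolding entries_def by (intro CollectI exI[of _ r] exI[of _ c] conjI refl)
    from bspec[OF z this] have "(F p - G p) $$ (r, c) = 0" .
    then show "F p $$ (r, c) = G p $$ (r, c)" using rc assms by simp
  qed (use assms in auto)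
qed (use assms in \<open>auto simp: entries_def\<close>)

lemma (in fun_alg) entries_subset: "mfun n m F \<Longrightarrow> entries n m F \<subseteq> R"
  by (auto simp: entries_def intro: mfun_entry)

context parabolic_chain
begin

abbreviation "\<Phi> \<equiv> parabolic_coords Q l ds f"

lemma reps_qfun:
  assumes alg: "fun_alg U R" and X: "\<And>x. x \<in> U \<Longrightarrow> X x \<in> reps" and R: "\<And>\<phi>. \<phi> \<in> \<Phi> \<Longrightarrow> (\<lambda>x. \<phi> (X x)) \<in> R"
  shows "m \<le> l \<Longrightarrow> qfun Q U R (ds m) f (\<lambda>x. fst (X x) m)"
    and "m < l \<Longrightarrow> v \<in> verts Q \<Longrightarrow> fun_alg.mfun U R (ds (Suc m) v) (ds m v) (\<lambda>x. snd (X x) m v)"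
proof -
  interpret fun_alg U R by fact
  show "qfun Q U R (ds m) f (\<lambda>x. fst (X x) m)" if m: "m \<le> l"
  proof (rule qfunI_coords[OF alg shape_qreps[OF reps_shape[OF X] m]])
    fix \<phi> :: "('v, 'e) qrep \<Rightarrow> complex" assume "\<phi> \<in> qrep_coords Q (ds m) f"
    then have "(\<lambda>x. \<phi> (fst x m)) \<in> \<Phi>" using m unfolding parabolic_coords_def by blast
    from R[OF this] show "(\<lambda>x. \<phi> (fst (X x) m)) \<in> R" .
  qed
  show "mfun (ds (Suc m) v) (ds m v) (\<lambda>x. snd (X x) m v)" if m: "m < l" and v: "v \<in> verts Q"
  proof (rule mfunI)
    show "snd (X x) m v \<in> carrier_mat (ds (Suc m) v) (ds m v)" if "x \<in> U" for x
      by (rule shape_pi[OF reps_shape[OF X[OF that]] m v])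
    fix r c assume "r < ds (Suc m) v" "c < ds m v"
    then have "(\<lambda>x. snd x m v $$ (r, c)) \<in> \<Phi>" using m v unfolding parabolic_coords_def by blast
    from R[OF this] show "(\<lambda>x. snd (X x) m v $$ (r, c)) \<in> R" .
  qed
qed

text \<open>
  The entries that are free on the slice. The columns \<open>c < ds (Suc m) v\<close> of
  \<open>\<pi>\<close> are those of an identity matrix.
\<close>

definition Idx :: "('v, 'e) coord set" where
  "Idx = (\<lambda>(e, r, c). CA e r c) ` (SIGMA e:arcs Q. {..<ds 0 (head Q e)} \<times> {..<ds l (tail Q e)}) \<union>
     (\<lambda>(e, r, c). CB e r c) ` (SIGMA e:arcs Q. {..<ds 0 (tail Q e)} \<times> {..<ds l (head Q e)}) \<union>
     (\<lambda>(v, r, c). CI v r c) ` (SIGMA v:verts Q. {..<ds 0 v} \<times> {..<f v}) \<union>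
     (\<lambda>(v, r, c). CJ v r c) ` (SIGMA v:verts Q. {..<f v} \<times> {..<ds l v}) \<union>
     (\<lambda>(m, v, r, c). CP m v r c) ` (SIGMA m:{..<l}. SIGMA v:verts Q. {..<ds (Suc m) v} \<times> {ds (Suc m) v..<ds m v})"

lemma Idx_iff [simp]:
  "CA e r c \<in> Idx \<longleftrightarrow> e \<in> arcs Q \<and> r < ds 0 (head Q e) \<and> c < ds l (tail Q e)"
  "CB e r c \<in> Idx \<longleftrightarrow> e \<in> arcs Q \<and> r < ds 0 (tail Q e) \<and> c < ds l (head Q e)"
  "CI v r c \<in> Idx \<longleftrightarrow> v \<in> verts Q \<and> r < ds 0 v \<and> c < f v"
  "CJ v r c \<in> Idx \<longleftrightarrow> v \<in> verts Q \<and> r < f v \<and> c < ds l v"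
  "CP m v r c \<in> Idx \<longleftrightarrow> m < l \<and> v \<in> verts Q \<and> r < ds (Suc m) v \<and> ds (Suc m) v \<le> c \<and> c < ds m v"
  by (auto simp: Idx_def image_iff)

lemma finite_Idx: "finite Idx"
  unfolding Idx_def by (intro finite_UnI finite_imageI finite_SigmaI) auto

definition N :: nat where "N = card Idx"

text \<open>An arbitrary numbering, as the coordinates of affine space are numbered.\<close>

definition num :: "('v, 'e) coord \<Rightarrow> nat" where
  "num = (SOME h. bij_betw h Idx {..<N})"

lemma num_bij: "bij_betw num Idx {..<N}"
  unfolding num_def
  by (rule someI_ex[of "\<lambda>h. bij_betw h Idx {..<N}"]) (use ex_bij_betw_finite_nat[OF finite_Idx] in \<open>simp add: N_def lessThan_atLeast0\<close>)

lemma num_less: "i \<in> Idx \<Longrightarrow> num i < N"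
  using num_bij by (auto simp: bij_betw_def)

definition val :: "complex vec \<Rightarrow> ('v, 'e) coord \<Rightarrow> complex" where
  "val z i = z $ num i"

definition vecof :: "(('v, 'e) coord \<Rightarrow> complex) \<Rightarrow> complex vec" where
  "vecof y = vec N (\<lambda>n. y (inv_into Idx num n))"

lemma vecof_carrier [simp]: "vecof y \<in> carrier_vec N"
  by (simp add: vecof_def)

lemma val_vecof: "i \<in> Idx \<Longrightarrow> val (vecof y) i = y i"
  using num_bij num_less by (simp add: val_def vecof_def bij_betw_def)

lemma vecof_val: "z \<in> carrier_vec N \<Longrightarrow> vecof (val z) = z"
  using num_bij by (intro eq_vecI) (auto simp: val_def vecof_def bij_betw_def f_inv_into_f)

lemma vecof_cong: "(\<And>i. i \<in> Idx \<Longrightarrow> y i = y' i) \<Longrightarrow> vecof y = vecof y'"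
  using num_bij by (intro eq_vecI) (auto simp: vecof_def bij_betw_def inv_into_into)

lemma t_cong:
  assumes "\<And>i. i \<in> Idx \<Longrightarrow> y i = y' i"
  shows "e \<in> arcs Q \<Longrightarrow> tA y e = tA y' e" "e \<in> arcs Q \<Longrightarrow> tB y e = tB y' e"
    "v \<in> verts Q \<Longrightarrow> tI y v = tI y' v" "v \<in> verts Q \<Longrightarrow> tJ y v = tJ y' v"
    "m < l \<Longrightarrow> v \<in> verts Q \<Longrightarrow> tp y m v = tp y' m v"
    "m \<le> l \<Longrightarrow> v \<in> verts Q \<Longrightarrow> PI (tp y) v m = PI (tp y') v m"
proof -
  show "e \<in> arcs Q \<Longrightarrow> tA y e = tA y' e" "e \<in> arcs Q \<Longrightarrow> tB y e = tB y' e"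
    "v \<in> verts Q \<Longrightarrow> tI y v = tI y' v" "v \<in> verts Q \<Longrightarrow> tJ y v = tJ y' v"
    unfolding tA_def tB_def tI_def tJ_def using assms by (auto intro!: eq_matI)
  show tp: "m < l \<Longrightarrow> v \<in> verts Q \<Longrightarrow> tp y m v = tp y' m v" for m
    unfolding tp_def using assms by (intro eq_matI) auto
  show "m \<le> l \<Longrightarrow> v \<in> verts Q \<Longrightarrow> PI (tp y) v m = PI (tp y') v m"
    by (rule pi_comp_cong) (simp add: tp)
qed

lemma rep0_cong: "(\<And>i. i \<in> Idx \<Longrightarrow> y i = y' i) \<Longrightarrow> rep0 y = rep0 y'"
  by (rule qreps_eqI[OF rep0_qreps rep0_qreps]) (simp_all add: rep0_def t_cong[of y y'])

lemma pt_cong: "(\<And>i. i \<in> Idx \<Longrightarrow> y i = y' i) \<Longrightarrow> pt y = pt y'"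
proof (rule shape_eqI[OF pt_shape pt_shape])
  assume a: "\<And>i. i \<in> Idx \<Longrightarrow> y i = y' i"
  show "fst (pt y) m = fst (pt y') m" if m: "m \<le> l" for m
  proof -
    have "qr y m = qr y' m"
      by (rule qreps_eqI[OF qr_qreps[OF m] qr_qreps[OF m]])
        (simp_all add: qr_def t_cong(6)[OF a m] rep0_cong[OF a])
    then show ?thesis using m by (simp add: pt_def)
  qed
  show "snd (pt y) m v = snd (pt y') m v" if "m < l" "v \<in> verts Q" for m v
    using that t_cong(5)[OF a that] by (simp add: pt_def)
qed

lemma sol_cong: "(\<And>i. i \<in> Idx \<Longrightarrow> y i = y' i) \<Longrightarrow> sol L y \<longleftrightarrow> sol L y'"
proof -
  assume a: "\<And>i. i \<in> Idx \<Longrightarrow> y i = y' i"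
  have "tmom y v = tmom y' v" if v: "v \<in> verts Q" for v
  proof -
    have "msum (ds 0 v) (ds l v) (\<lambda>e. tA y e * (PI (tp y) (tail Q e) l * tB y e)) {e \<in> arcs Q. head Q e = v} =
        msum (ds 0 v) (ds l v) (\<lambda>e. tA y' e * (PI (tp y') (tail Q e) l * tB y' e)) {e \<in> arcs Q. head Q e = v}"
      "msum (ds 0 v) (ds l v) (\<lambda>e. tB y e * (PI (tp y) (head Q e) l * tA y e)) {e \<in> arcs Q. tail Q e = v} =
        msum (ds 0 v) (ds l v) (\<lambda>e. tB y' e * (PI (tp y') (head Q e) l * tA y' e)) {e \<in> arcs Q. tail Q e = v}"
      by (auto intro!: msum_cong simp: t_cong[OF a])
    then show ?thesis using v by (simp add: tmom_def t_cong[OF a])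
  qed
  then show ?thesis by (simp add: sol_def rep0_cong[OF a])
qed

lemma coords_of_pt: "i \<in> Idx \<Longrightarrow> coords_of (pt y) i = y i"
proof -
  assume i: "i \<in> Idx"
  have f0: "fst (pt y) 0 = rep0 y" by (simp add: pt_def qr_0)
  have *: "(T * PI (tp y) v l) $$ (r, c) = T $$ (r, c)"
    if v: "v \<in> verts Q" and T: "T \<in> carrier_mat n (ds l v)" and rc: "r < n" "c < ds l v" for T v n r c
  proof -
    have TP: "T * PI (tp y) v l \<in> carrier_mat n (ds 0 v)" using PI_carrier[OF unitri_tp order_refl v] T by auto
    have "(T * PI (tp y) v l) $$ (r, c) = ((T * PI (tp y) v l) * I0 v l) $$ (r, c)"
      using mult_inc_index[OF TP dec'[OF le0 order_refl v] rc] by simp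
    also have "(T * PI (tp y) v l) * I0 v l = T * (PI (tp y) v l * I0 v l)"
      using carrier_matD[OF T] PI_dim[OF unitri_tp order_refl v] by (simp add: mat_assoc)
    also have "\<dots> = T" unfolding PI_I0[OF unitri_tp order_refl v] using T by simp
    finally show ?thesis .
  qed
  show ?thesis
  proof (cases i)
    case (CA e r c)
    then show ?thesis using i *[OF tail_in t_carrier(1)] by (simp add: coords_of_def f0 rep0_def) (simp add: tA_def)
  next
    case (CB e r c)
    then show ?thesis using i *[OF head_in t_carrier(2)] by (simp add: coords_of_def f0 rep0_def) (simp add: tB_def)
  next
    case (CI v r c)
    then show ?thesis using i by (simp add: coords_of_def f0 rep0_def) (simp add: tI_def)
  next
    case (CJ v r c)
    then show ?thesis using i *[OF _ t_carrier(4)] by (simp add: coords_of_def f0 rep0_def) (simp add: tJ_def)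
  next
    case (CP m v r c)
    then show ?thesis using i by (simp add: coords_of_def pt_def) (simp add: tp_def)
  qed
qed

definition moment_idx :: "('v \<times> nat \<times> nat) set" where
  "moment_idx = (SIGMA v:verts Q. {..<ds 0 v} \<times> {..<ds l v})"
definition frame_idx :: "('v \<times> nat \<times> nat) set" where
  "frame_idx = (SIGMA v:verts Q. {..<ds 0 v} \<times> {..<ds 0 v})"

lemma finite_eqs [simp]: "finite moment_idx" "finite frame_idx"
  unfolding moment_idx_def frame_idx_def by (auto intro!: finite_SigmaI)

definition eq_list :: "('v \<times> nat \<times> nat) set \<Rightarrow> ('v \<times> nat \<times> nat) list" where
  "eq_list E = (SOME xs. set xs = E \<and> distinct xs)"

lemma eq_list: "finite E \<Longrightarrow> set (eq_list E) = E" "finite E \<Longrightarrow> distinct (eq_list E)" "finite E \<Longrightarrow> length (eq_list E) = card E"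
proof -
  assume "finite E"
  then have "set (eq_list E) = E \<and> distinct (eq_list E)"
    unfolding eq_list_def using finite_distinct_list[of E] by (rule_tac someI_ex) auto
  then show "set (eq_list E) = E" "distinct (eq_list E)" "length (eq_list E) = card E"
    using distinct_card[of "eq_list E"] by auto
qed

definition moment_eq :: "('v \<times> nat \<times> nat) \<Rightarrow> complex vec \<Rightarrow> complex" where
  "moment_eq = (\<lambda>(v, r, c) z. tmom (val z) v $$ (r, c))"
definition frame_eq :: "('v \<Rightarrow> nat \<Rightarrow> ('v, 'e) word) \<Rightarrow> ('v \<times> nat \<times> nat) \<Rightarrow> complex vec \<Rightarrow> complex" where
  "frame_eq L = (\<lambda>(v, r, c) z. wmat (ds 0) (rep0 (val z)) L v $$ (r, c) - (if r = c then 1 else 0))"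

text \<open>
  The moment map equations followed by the normalisation of the frame, in an arbitrary but fixed
  order.
\<close>

definition eqns :: "('v \<Rightarrow> nat \<Rightarrow> ('v, 'e) word) \<Rightarrow> (complex vec \<Rightarrow> complex) list" where
  "eqns L = map moment_eq (eq_list moment_idx) @ map (frame_eq L) (eq_list frame_idx)"

lemma length_eqns: "length (eqns L) = card moment_idx + card frame_idx"
  by (simp add: eqns_def eq_list)

lemma set_eqns: "set (eqns L) = moment_eq ` moment_idx \<union> frame_eq L ` frame_idx"
  by (simp add: eqns_def eq_list)

lemma zero_locus_eqns: "z \<in> zero_locus N (set (eqns L)) \<longleftrightarrow> z \<in> carrier_vec N \<and> sol L (val z)"
proof -
  have 1: "tmom (val z) v = 0\<^sub>m (ds 0 v) (ds l v) \<longleftrightarrow> (\<forall>r<ds 0 v. \<forall>c<ds l v. moment_eq (v, r, c) z = 0)" if "v \<in> verts Q" for v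
    using carrier_matD[OF tmom_carrier[of "val z" v]] by (auto simp: moment_eq_def intro!: eq_matI)
  have 2: "wmat (ds 0) (rep0 (val z)) L v = 1\<^sub>m (ds 0 v) \<longleftrightarrow> (\<forall>r<ds 0 v. \<forall>c<ds 0 v. frame_eq L (v, r, c) z = 0)" if "v \<in> verts Q" for v
  proof
    assume "\<forall>r<ds 0 v. \<forall>c<ds 0 v. frame_eq L (v, r, c) z = 0"
    then show "wmat (ds 0) (rep0 (val z)) L v = 1\<^sub>m (ds 0 v)" by (intro eq_matI) (auto simp: frame_eq_def)
  qed (auto simp: frame_eq_def)
  show ?thesis
    unfolding zero_locus_def set_eqns sol_def using 1 2 by (auto simp: moment_idx_def frame_idx_def)
qed

interpretation poly: fun_alg UNIV "poly_funs (vec_coords N)"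
  by (rule fun_alg_poly)

lemma val_poly: "i \<in> Idx \<Longrightarrow> (\<lambda>z. val z i) \<in> poly_funs (vec_coords N)"
  unfolding val_def using num_less by (intro poly_funs.coord) (auto simp: vec_coords_def)

lemma t_poly:
  "e \<in> arcs Q \<Longrightarrow> poly.mfun (ds 0 (head Q e)) (ds l (tail Q e)) (\<lambda>z. tA (val z) e)"
  "e \<in> arcs Q \<Longrightarrow> poly.mfun (ds 0 (tail Q e)) (ds l (head Q e)) (\<lambda>z. tB (val z) e)"
  "v \<in> verts Q \<Longrightarrow> poly.mfun (ds 0 v) (f v) (\<lambda>z. tI (val z) v)"
  "v \<in> verts Q \<Longrightarrow> poly.mfun (f v) (ds l v) (\<lambda>z. tJ (val z) v)"
  "m < l \<Longrightarrow> v \<in> verts Q \<Longrightarrow> poly.mfun (ds (Suc m) v) (ds m v) (\<lambda>z. tp (val z) m v)"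
proof -
  show "m < l \<Longrightarrow> v \<in> verts Q \<Longrightarrow> poly.mfun (ds (Suc m) v) (ds m v) (\<lambda>z. tp (val z) m v)"
    unfolding tp_def
  proof (rule poly.mfun_mat)
    fix r c assume "m < l" "v \<in> verts Q" "r < ds (Suc m) v" "c < ds m v"
    then show "(\<lambda>z. (\<lambda>(r, c). if c < ds (Suc m) v then if r = c then 1 else 0 else val z (CP m v r c)) (r, c))
        \<in> poly_funs (vec_coords N)"
      by (cases "c < ds (Suc m) v") (auto intro: poly_funs.const val_poly)
  qed
qed (auto simp: tA_def tB_def tI_def tJ_def intro!: poly.mfun_mat val_poly)

lemma PI_poly: "m \<le> l \<Longrightarrow> v \<in> verts Q \<Longrightarrow> poly.mfun (ds m v) (ds 0 v) (\<lambda>z. PI (tp (val z)) v m)"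
  by (induction m) (auto intro!: poly.mfun_const poly.mfun_mult t_poly)

lemma rep0_poly: "qfun Q UNIV (poly_funs (vec_coords N)) (ds 0) f (\<lambda>z. rep0 (val z))"
  unfolding qfun_def
proof (intro conjI ballI rep0_qreps)
  fix e assume e: "e \<in> arcs Q"
  show "poly.mfun (ds 0 (head Q e)) (ds 0 (tail Q e)) (\<lambda>z. Amap (rep0 (val z)) e)"
    using poly.mfun_mult[OF t_poly(1)[OF e] PI_poly[OF order_refl tail_in[OF e]]] e by (simp add: rep0_def)
  show "poly.mfun (ds 0 (tail Q e)) (ds 0 (head Q e)) (\<lambda>z. Bmap (rep0 (val z)) e)"
    using poly.mfun_mult[OF t_poly(2)[OF e] PI_poly[OF order_refl head_in[OF e]]] e by (simp add: rep0_def)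
next
  fix v assume v: "v \<in> verts Q"
  show "poly.mfun (ds 0 v) (f v) (\<lambda>z. imap (rep0 (val z)) v)" using t_poly(3)[OF v] v by (simp add: rep0_def)
  show "poly.mfun (f v) (ds 0 v) (\<lambda>z. jmap (rep0 (val z)) v)"
    using poly.mfun_mult[OF t_poly(4)[OF v] PI_poly[OF order_refl v]] v by (simp add: rep0_def)
qed

lemma qr_poly: "m \<le> l \<Longrightarrow> qfun Q UNIV (poly_funs (vec_coords N)) (ds m) f (\<lambda>z. qr (val z) m)"
  unfolding qfun_def
proof (intro conjI ballI qr_qreps)
  assume m: "m \<le> l"
  note r = rep0_poly[unfolded qfun_def]
  note I = poly.mfun_const[OF inc_carrier]
  {
    fix e assume e: "e \<in> arcs Q"
    have A: "poly.mfun (ds 0 (head Q e)) (ds 0 (tail Q e)) (\<lambda>z. Amap (rep0 (val z)) e)"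
      and B: "poly.mfun (ds 0 (tail Q e)) (ds 0 (head Q e)) (\<lambda>z. Bmap (rep0 (val z)) e)" using r e by auto
    show "poly.mfun (ds m (head Q e)) (ds m (tail Q e)) (\<lambda>z. Amap (qr (val z) m) e)"
      using poly.mfun_mult[OF poly.mfun_mult[OF PI_poly[OF m head_in[OF e]] A] I] e by (simp add: qr_def)
    show "poly.mfun (ds m (tail Q e)) (ds m (head Q e)) (\<lambda>z. Bmap (qr (val z) m) e)"
      using poly.mfun_mult[OF poly.mfun_mult[OF PI_poly[OF m tail_in[OF e]] B] I] e by (simp add: qr_def)
  }
  fix v assume v: "v \<in> verts Q"
  have i: "poly.mfun (ds 0 v) (f v) (\<lambda>z. imap (rep0 (val z)) v)" and j: "poly.mfun (f v) (ds 0 v) (\<lambda>z. jmap (rep0 (val z)) v)"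
    using r v by auto
  show "poly.mfun (ds m v) (f v) (\<lambda>z. imap (qr (val z) m) v)"
    using poly.mfun_mult[OF PI_poly[OF m v] i] v by (simp add: qr_def)
  show "poly.mfun (f v) (ds m v) (\<lambda>z. jmap (qr (val z) m) v)"
    using poly.mfun_mult[OF j I] v by (simp add: qr_def)
qed

lemma pt_poly: "\<phi> \<in> \<Phi> \<Longrightarrow> (\<lambda>z. \<phi> (pt (val z))) \<in> poly_funs (vec_coords N)"
  unfolding parabolic_coords_def
proof (elim UnE)
  assume "\<phi> \<in> {\<lambda>x. \<phi> (fst x m) | m \<phi>. m \<le> l \<and> \<phi> \<in> qrep_coords Q (ds m) f}"
  then obtain m \<psi> where m: "m \<le> l" "\<psi> \<in> qrep_coords Q (ds m) f" "\<phi> = (\<lambda>x. \<psi> (fst x m))" by auto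
  show ?thesis using qfun_coords[OF fun_alg_poly qr_poly[OF m(1)] m(2)] m by (simp add: pt_def)
next
  assume "\<phi> \<in> {\<lambda>x. snd x m v $$ (r, c) | m v r c. m < l \<and> v \<in> verts Q \<and> r < ds (Suc m) v \<and> c < ds m v}"
  then obtain m v r c where m: "m < l" "v \<in> verts Q" "r < ds (Suc m) v" "c < ds m v" "\<phi> = (\<lambda>x. snd x m v $$ (r, c))"
    by auto
  show ?thesis using poly.mfun_entry[OF t_poly(5)[OF m(1,2)] m(3,4)] m by (simp add: pt_def)
qed

lemma tmom_poly: "v \<in> verts Q \<Longrightarrow> poly.mfun (ds 0 v) (ds l v) (\<lambda>z. tmom (val z) v)"
  unfolding tmom_def
  by (intro poly.mfun_add poly.mfun_diff poly.mfun_msum poly.mfun_mult[OF t_poly(3) t_poly(4)])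
    (auto intro!: poly.mfun_mult t_poly PI_poly)

lemma eqns_poly:
  assumes L: "word_family (ds 0) f L" shows "set (eqns L) \<subseteq> poly_funs (vec_coords N)"
proof -
  have "moment_eq k \<in> poly_funs (vec_coords N)" if "k \<in> moment_idx" for k
    using that poly.mfun_entry[OF tmom_poly] by (auto simp: moment_idx_def moment_eq_def)
  moreover have "frame_eq L k \<in> poly_funs (vec_coords N)" if "k \<in> frame_idx" for k
    using that by (auto simp: frame_idx_def frame_eq_def
      intro!: poly.diff poly_funs.const poly.mfun_entry[OF wmat_fun[OF fun_alg_poly rep0_poly L]])
  ultimately show ?thesis by (auto simp: set_eqns)
qed

text \<open>
  An isomorphism \<open>g\<close> multiplies the matrices of word values by \<open>g\<close> from
  the left, so the inverses of these matrices bring \<open>x\<close> into the slice.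
\<close>

definition normalise :: "('v \<Rightarrow> nat \<Rightarrow> ('v, 'e) word) \<Rightarrow> ('v, 'e) parabolic_rep \<Rightarrow> ('v, 'e) parabolic_rep" where
  "normalise L x = act (\<lambda>m\<in>{..l}. \<lambda>v\<in>verts Q. minv (wmat (ds m) (fst x m) L v)) x"

lemma GL_minv:
  assumes "M \<in> carrier_mat n n" "det M \<noteq> 0"
  shows "minv M \<in> carrier (GL n)" "inv\<^bsub>GL n\<^esub> (minv M) = M"
proof -
  note m = minv[OF assms]
  have "det (minv M) * det M = 1" using det_mult[OF m(1) assms(1)] m(3) by simp
  then show g: "minv M \<in> carrier (GL n)" using m(1) by (auto simp: GL_iff)
  note i = GL_inv[OF g]
  have "inv\<^bsub>GL n\<^esub> (minv M) = inv\<^bsub>GL n\<^esub> (minv M) * (minv M * M)" using m(3) i(2) by simp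
  also have "\<dots> = (inv\<^bsub>GL n\<^esub> (minv M) * minv M) * M" using i(2) m(1) assms(1) by simp
  also have "\<dots> = M" using i(4) assms(1) by simp
  finally show "inv\<^bsub>GL n\<^esub> (minv M) = M" .
qed

lemma normalise_grp: "x \<in> chart_dom L \<Longrightarrow> (\<lambda>m\<in>{..l}. \<lambda>v\<in>verts Q. minv (wmat (ds m) (fst x m) L v)) \<in> carrier grp"
  by (rule grpI, rule GL_minv) (auto simp: chart_dom_def)

lemma normalise_props:
  assumes x: "x \<in> chart_dom L" and L: "word_family (ds 0) f L"
  shows "normalise L x \<in> orbit grp act x" "normalise L x \<in> reps" "normal L (normalise L x)"
proof -
  have xr: "x \<in> reps" using x by (simp add: chart_dom_def)
  show o: "normalise L x \<in> orbit grp act x" unfolding normalise_def orbit_def using normalise_grp[OF x] by blast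
  then show nr: "normalise L x \<in> reps" by (rule orbit_closed[OF xr])
  show "normal L (normalise L x)"
    unfolding normal_def
  proof (intro allI impI ballI)
    fix m v assume m: "m \<le> l" and v: "v \<in> verts Q"
    let ?g = "\<lambda>m\<in>{..l}. \<lambda>v\<in>verts Q. minv (wmat (ds m) (fst x m) L v)"
    have "qhom Q (?g m) (fst x m) (fst (normalise L x) m)"
      using act_phom(2)[OF reps_shape[OF xr] normalise_grp[OF x]] m by (simp add: phom_def normalise_def)
    then have "wmat (ds m) (fst (normalise L x) m) L v = ?g m v * wmat (ds m) (fst x m) L v"
      by (intro wmat_qhom[OF shape_qreps[OF reps_shape[OF xr] m] shape_qreps[OF reps_shape[OF nr] m], of "?g m"]
            grp_carrier_mat[OF normalise_grp[OF x] m] word_family_le[OF L m] v)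
    also have "\<dots> = 1\<^sub>m (ds m v)"
      using x m v minv(3)[OF wmat_carrier] by (simp add: chart_dom_def)
    finally show "wmat (ds m) (fst (normalise L x) m) L v = 1\<^sub>m (ds m v)" .
  qed
qed

text \<open>
  An isomorphism that starts at a normalised point can be read off from its target. So the action
  is free, and the orbit relation is polynomial.
\<close>

lemma phom_normal:
  assumes x: "x \<in> shape" and y: "y \<in> shape" and g: "g \<in> carrier grp" and h: "phom Q l g x y" and n: "normal L x"
    and L: "word_family (ds 0) f L" and m: "m \<le> l" and v: "v \<in> verts Q"
  shows "g m v = wmat (ds m) (fst y m) L v"
proof -
  have "wmat (ds m) (fst y m) L v = g m v * wmat (ds m) (fst x m) L v"
    by (rule wmat_qhom[OF shape_qreps[OF x m] shape_qreps[OF y m] grp_carrier_mat[OF g m] _ word_family_le[OF L m] v])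
      (use h m in \<open>auto simp: phom_def\<close>)
  then show ?thesis using n m v grp_carrier_mat[OF g m v] by (simp add: normal_def)
qed

lemma normal_unique:
  assumes x: "x \<in> shape" and y: "y \<in> orbit grp act x" and n: "normal L x" "normal L y" and L: "word_family (ds 0) f L"
  shows "y = x"
proof -
  obtain g where g: "y \<in> shape" "g \<in> carrier grp" "phom Q l g x y" using y orbit_iff[OF x] by blast
  have "g m v = 1\<^sub>m (ds m v)" if "m \<le> l" "v \<in> verts Q" for m v
    using phom_normal[OF x g n(1) L that] n(2) that by (simp add: normal_def)
  moreover obtain h where h: "h \<in> carrier grp" "phom Q l h x x" using phom_one[OF x] by blast
  moreover have "h m v = 1\<^sub>m (ds m v)" if "m \<le> l" "v \<in> verts Q" for m v
    using phom_normal[OF x x h n(1) L that] n(1) that by (simp add: normal_def)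
  ultimately have "phom Q l h x y" using phom_cong[of g h x y] g(3) by simp
  then show ?thesis using phom_unique[OF x g(1) x h(1) _ h(2)] by simp
qed

definition rho :: "('v \<Rightarrow> nat \<Rightarrow> ('v, 'e) word) \<Rightarrow> ('v, 'e) parabolic_rep \<Rightarrow> complex vec" where
  "rho L x = vecof (coords_of (normalise L x))"

text \<open>
  By \<open>phom_normal\<close> the word values of \<open>y\<close> form the only candidate for an
  isomorphism from a normalised \<open>x\<close> to \<open>y\<close>; these are the relations that
  it must satisfy.
\<close>

definition orbit_eqs :: "('v \<Rightarrow> nat \<Rightarrow> ('v, 'e) word) \<Rightarrow> (('v, 'e) parabolic_rep \<times> ('v, 'e) parabolic_rep \<Rightarrow> complex) set" where
  "orbit_eqs L = (let g = (\<lambda>m v p. wmat (ds m) (fst (snd p) m) L v) in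
     (\<Union>m\<in>{..l}. \<Union>e\<in>arcs Q.
        entries (ds m (head Q e)) (ds m (tail Q e))
          (\<lambda>p. g m (head Q e) p * Amap (fst (fst p) m) e - Amap (fst (snd p) m) e * g m (tail Q e) p) \<union>
        entries (ds m (tail Q e)) (ds m (head Q e))
          (\<lambda>p. g m (tail Q e) p * Bmap (fst (fst p) m) e - Bmap (fst (snd p) m) e * g m (head Q e) p)) \<union>
     (\<Union>m\<in>{..l}. \<Union>v\<in>verts Q.
        entries (ds m v) (f v) (\<lambda>p. g m v p * imap (fst (fst p) m) v - imap (fst (snd p) m) v) \<union>
        entries (f v) (ds m v) (\<lambda>p. jmap (fst (snd p) m) v * g m v p - jmap (fst (fst p) m) v)) \<union>
     (\<Union>m\<in>{..<l}. \<Union>v\<in>verts Q.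
        entries (ds (Suc m) v) (ds m v) (\<lambda>p. g (Suc m) v p * snd (fst p) m v - snd (snd p) m v * g m v p)))"

lemma orbit_eqs_zero_iff:
  assumes x: "x \<in> shape" and y: "y \<in> shape"
  shows "(\<forall>e\<in>orbit_eqs L. e (x, y) = 0) \<longleftrightarrow> phom Q l (\<lambda>m v. wmat (ds m) (fst y m) L v) x y"
proof -
  note qx = shape_qreps[OF x] and qy = shape_qreps[OF y]
  let ?g = "\<lambda>m v p. wmat (ds m) (fst (snd p) m) L v"
  have A: "(\<forall>k\<in>entries (ds m (head Q e)) (ds m (tail Q e))
      (\<lambda>p. ?g m (head Q e) p * Amap (fst (fst p) m) e - Amap (fst (snd p) m) e * ?g m (tail Q e) p). k (x, y) = 0) \<longleftrightarrow>
      ?g m (head Q e) (x, y) * Amap (fst x m) e = Amap (fst y m) e * ?g m (tail Q e) (x, y)" if "m \<le> l" "e \<in> arcs Q" for m e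
    using qreps_carrier(1)[OF qx[OF that(1)] that(2)] qreps_carrier(1)[OF qy[OF that(1)] that(2)]
    by (subst entries_diff_zero_iff) (auto intro: mult_carrier_mat)
  have B: "(\<forall>k\<in>entries (ds m (tail Q e)) (ds m (head Q e))
      (\<lambda>p. ?g m (tail Q e) p * Bmap (fst (fst p) m) e - Bmap (fst (snd p) m) e * ?g m (head Q e) p). k (x, y) = 0) \<longleftrightarrow>
      ?g m (tail Q e) (x, y) * Bmap (fst x m) e = Bmap (fst y m) e * ?g m (head Q e) (x, y)" if "m \<le> l" "e \<in> arcs Q" for m e
    using qreps_carrier(2)[OF qx[OF that(1)] that(2)] qreps_carrier(2)[OF qy[OF that(1)] that(2)]
    by (subst entries_diff_zero_iff) (auto intro: mult_carrier_mat)
  have I: "(\<forall>k\<in>entries (ds m v) (f v) (\<lambda>p. ?g m v p * imap (fst (fst p) m) v - imap (fst (snd p) m) v). k (x, y) = 0) \<longleftrightarrow>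
      ?g m v (x, y) * imap (fst x m) v = imap (fst y m) v" if "m \<le> l" "v \<in> verts Q" for m v
    using qreps_carrier(3)[OF qx[OF that(1)] that(2)] qreps_carrier(3)[OF qy[OF that(1)] that(2)]
    by (subst entries_diff_zero_iff) (auto intro: mult_carrier_mat)
  have J: "(\<forall>k\<in>entries (f v) (ds m v) (\<lambda>p. jmap (fst (snd p) m) v * ?g m v p - jmap (fst (fst p) m) v). k (x, y) = 0) \<longleftrightarrow>
      jmap (fst y m) v * ?g m v (x, y) = jmap (fst x m) v" if "m \<le> l" "v \<in> verts Q" for m v
    using qreps_carrier(4)[OF qx[OF that(1)] that(2)] qreps_carrier(4)[OF qy[OF that(1)] that(2)]
    by (subst entries_diff_zero_iff) (auto intro: mult_carrier_mat)
  have P: "(\<forall>k\<in>entries (ds (Suc m) v) (ds m v) (\<lambda>p. ?g (Suc m) v p * snd (fst p) m v - snd (snd p) m v * ?g m v p). k (x, y) = 0) \<longleftrightarrow>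
      ?g (Suc m) v (x, y) * snd x m v = snd y m v * ?g m v (x, y)" if "m < l" "v \<in> verts Q" for m v
    using shape_pi[OF x that] shape_pi[OF y that]
    by (subst entries_diff_zero_iff) (auto intro: mult_carrier_mat)
  show ?thesis
    unfolding orbit_eqs_def Let_def phom_def qhom_def ball_Un ball_UN
    using A B I J P by (auto simp: ball_Un)
qed

lemma orbit_eqs_poly:
  assumes L: "word_family (ds 0) f L" and e: "e \<in> orbit_eqs L"
  shows "e \<in> poly_on (reps \<times> reps) (pair_coords \<Phi>)"
proof -
  let ?U = "reps \<times> reps" and ?R = "poly_on (reps \<times> reps) (pair_coords \<Phi>)"
  have alg: "fun_alg ?U ?R" by (rule fun_alg_poly_on)
  interpret pr: fun_alg ?U ?R by (rule alg)
  have co: "(\<lambda>p. \<phi> (fst p)) \<in> ?R" "(\<lambda>p. \<phi> (snd p)) \<in> ?R" if "\<phi> \<in> \<Phi>" for \<phi>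
    using that by (auto intro!: poly_on_coord simp: pair_coords_def)
  have q1: "qfun Q ?U ?R (ds m) f (\<lambda>p. fst (fst p) m)" if "m \<le> l" for m
    by (rule reps_qfun(1)[OF alg _ co(1) that]) auto
  have q2: "qfun Q ?U ?R (ds m) f (\<lambda>p. fst (snd p) m)" if "m \<le> l" for m
    by (rule reps_qfun(1)[OF alg _ co(2) that]) auto
  have p1: "pr.mfun (ds (Suc m) v) (ds m v) (\<lambda>p. snd (fst p) m v)" if "m < l" "v \<in> verts Q" for m v
    by (rule reps_qfun(2)[OF alg _ co(1) that]) auto
  have p2: "pr.mfun (ds (Suc m) v) (ds m v) (\<lambda>p. snd (snd p) m v)" if "m < l" "v \<in> verts Q" for m v
    by (rule reps_qfun(2)[OF alg _ co(2) that]) auto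
  have g: "pr.mfun (ds m v) (ds m v) (\<lambda>p. wmat (ds m) (fst (snd p) m) L v)" if "m \<le> l" "v \<in> verts Q" for m v
    by (rule wmat_fun[OF alg q2[OF that(1)] word_family_le[OF L that(1)] that(2)])
  note q1' = q1[unfolded qfun_def] and q2' = q2[unfolded qfun_def]
  have AB: "pr.mfun (ds m (head Q e)) (ds m (tail Q e)) (\<lambda>p. Amap (fst (fst p) m) e)"
    "pr.mfun (ds m (head Q e)) (ds m (tail Q e)) (\<lambda>p. Amap (fst (snd p) m) e)"
    "pr.mfun (ds m (tail Q e)) (ds m (head Q e)) (\<lambda>p. Bmap (fst (fst p) m) e)"
    "pr.mfun (ds m (tail Q e)) (ds m (head Q e)) (\<lambda>p. Bmap (fst (snd p) m) e)" if "m \<le> l" "e \<in> arcs Q" for m e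
    using q1'[OF that(1)] q2'[OF that(1)] that(2) by auto
  have IJ: "pr.mfun (ds m v) (f v) (\<lambda>p. imap (fst (fst p) m) v)" "pr.mfun (ds m v) (f v) (\<lambda>p. imap (fst (snd p) m) v)"
    "pr.mfun (f v) (ds m v) (\<lambda>p. jmap (fst (fst p) m) v)" "pr.mfun (f v) (ds m v) (\<lambda>p. jmap (fst (snd p) m) v)"
    if "m \<le> l" "v \<in> verts Q" for m v
    using q1'[OF that(1)] q2'[OF that(1)] that(2) by auto
  have "orbit_eqs L \<subseteq> ?R"
    unfolding orbit_eqs_def Let_def
    by (intro Un_least UN_least pr.entries_subset pr.mfun_diff)
      (auto intro!: pr.mfun_mult[OF g AB(1)] pr.mfun_mult[OF AB(2) g] pr.mfun_mult[OF g AB(3)] pr.mfun_mult[OF AB(4) g]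
        pr.mfun_mult[OF g IJ(1)] pr.mfun_mult[OF IJ(4) g] pr.mfun_mult[OF g p1] pr.mfun_mult[OF p2 g] IJ)
  then show ?thesis using e by blast
qed

end

context parabolic_chain
begin

lemma open_reps: "openin (zariski_topology reps \<Phi>) reps"
  using openin_topspace[of "zariski_topology reps \<Phi>"] by (simp add: topspace_zariski)

lemma chart_dom_open:
  assumes L: "word_family (ds 0) f L" shows "openin (zariski_topology reps \<Phi>) (chart_dom L)"
proof -
  let ?R = "reg reps \<Phi> reps"
  have alg: "fun_alg reps ?R" by (rule fun_alg_reg[OF open_reps])
  interpret ra: fun_alg reps ?R by (rule alg)
  let ?h = "\<lambda>x. \<Prod>m\<in>{..l}. \<Prod>v\<in>verts Q. det (wmat (ds m) (fst x m) L v)"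
  have q: "qfun Q reps ?R (ds m) f (\<lambda>x. fst x m)" if "m \<le> l" for m
    by (rule reps_qfun(1)[OF alg _ _ that]) (auto intro: poly_reg[OF open_reps] poly_funs.coord)
  have "?h \<in> ?R"
    by (intro ra.prod ra.mfun_det[OF wmat_fun[OF alg q word_family_le[OF L]]]) auto
  from openin_reg_nonzero[OF open_reps this]
  have "openin (zariski_topology reps \<Phi>) {x\<in>reps. ?h x \<noteq> 0}" .
  also have "{x\<in>reps. ?h x \<noteq> 0} = chart_dom L" by (auto simp: chart_dom_def)
  finally show ?thesis .
qed

text \<open>
  On the chart the matrices of word values have regular inverses. The inverse of the group element
  that normalises is again a matrix of word values, so that no further inverses are needed.
\<close>

lemma rho_reg:
  assumes L: "word_family (ds 0) f L" and i: "i < N"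
  shows "(\<lambda>x. rho L x $ i) \<in> reg reps \<Phi> (chart_dom L)"
proof -
  let ?U = "chart_dom L" and ?R = "reg reps \<Phi> (chart_dom L)"
  have alg: "fun_alg ?U ?R" by (rule fun_alg_reg[OF chart_dom_open[OF L]])
  interpret ra: fun_alg ?U ?R by (rule alg)
  have Ur: "x \<in> ?U \<Longrightarrow> x \<in> reps" for x by (simp add: chart_dom_def)
  have co: "\<phi> \<in> \<Phi> \<Longrightarrow> (\<lambda>x. \<phi> x) \<in> ?R" for \<phi> by (intro poly_reg[OF chart_dom_open[OF L]] poly_funs.coord)
  have q: "qfun Q ?U ?R (ds m) f (\<lambda>x. fst x m)" if "m \<le> l" for m
    by (rule reps_qfun(1)[OF alg Ur co that])
  have p: "ra.mfun (ds (Suc m) v) (ds m v) (\<lambda>x. snd x m v)" if "m < l" "v \<in> verts Q" for m v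
    by (rule reps_qfun(2)[OF alg Ur co that])
  let ?W = "\<lambda>m v x. wmat (ds m) (fst x m) L v"
  have W: "ra.mfun (ds m v) (ds m v) (?W m v)" if "m \<le> l" "v \<in> verts Q" for m v
    by (rule wmat_fun[OF alg q[OF that(1)] word_family_le[OF L that(1)] that(2)])
  have Wi: "ra.mfun (ds m v) (ds m v) (\<lambda>x. minv (?W m v x))" if "m \<le> l" "v \<in> verts Q" for m v
    by (rule ra.mfun_minv[OF W[OF that]], rule reg_inverse[OF ra.mfun_det[OF W[OF that]]])
      (use that in \<open>auto simp: chart_dom_def\<close>)
  have inv: "inv\<^bsub>GL (ds m v)\<^esub> (minv (?W m v x)) = ?W m v x" if "m \<le> l" "v \<in> verts Q" "x \<in> ?U" for m v x
    by (rule GL_minv(2)[OF wmat_carrier]) (use that in \<open>auto simp: chart_dom_def\<close>)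
  have n0: "fst (normalise L x) 0 = gauge_act Q (ds 0) (\<lambda>v\<in>verts Q. minv (?W 0 v x)) (fst x 0)" for x
    by (simp add: normalise_def parabolic_act_def case_prod_unfold)
  have q0: "ra.mfun (ds 0 (head Q e)) (ds 0 (tail Q e)) (\<lambda>x. Amap (fst x 0) e)"
    "ra.mfun (ds 0 (tail Q e)) (ds 0 (head Q e)) (\<lambda>x. Bmap (fst x 0) e)" if "e \<in> arcs Q" for e
    using q[OF le0] that by (auto simp: qfun_def)
  have q0': "ra.mfun (ds 0 v) (f v) (\<lambda>x. imap (fst x 0) v)" "ra.mfun (f v) (ds 0 v) (\<lambda>x. jmap (fst x 0) v)" if "v \<in> verts Q" for v
    using q[OF le0] that by (auto simp: qfun_def)
  have coord: "(\<lambda>x. coords_of (normalise L x) k) \<in> ?R" if k: "k \<in> Idx" for k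
  proof (cases k)
    case (CA e r c)
    then have e: "e \<in> arcs Q" and rc: "r < ds 0 (head Q e)" "c < ds 0 (tail Q e)"
      using k dec'[OF le0 order_refl tail_in, of e] by auto
    have "ra.mfun (ds 0 (head Q e)) (ds 0 (tail Q e)) (\<lambda>x. minv (?W 0 (head Q e) x) * Amap (fst x 0) e * ?W 0 (tail Q e) x)"
      by (intro ra.mfun_mult[OF ra.mfun_mult[OF Wi q0(1)] W] le0 e head_in tail_in)
    from ra.mfun_entry[OF this rc] show ?thesis
      by (rule ra.cong) (use e inv[OF le0 tail_in[OF e]] in \<open>simp add: CA coords_of_def n0 gauge_act_def\<close>)
  next
    case (CB e r c)
    then have e: "e \<in> arcs Q" and rc: "r < ds 0 (tail Q e)" "c < ds 0 (head Q e)"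
      using k dec'[OF le0 order_refl head_in, of e] by auto
    have "ra.mfun (ds 0 (tail Q e)) (ds 0 (head Q e)) (\<lambda>x. minv (?W 0 (tail Q e) x) * Bmap (fst x 0) e * ?W 0 (head Q e) x)"
      by (intro ra.mfun_mult[OF ra.mfun_mult[OF Wi q0(2)] W] le0 e head_in tail_in)
    from ra.mfun_entry[OF this rc] show ?thesis
      by (rule ra.cong) (use e inv[OF le0 head_in[OF e]] in \<open>simp add: CB coords_of_def n0 gauge_act_def\<close>)
  next
    case (CI v r c)
    then have v: "v \<in> verts Q" and rc: "r < ds 0 v" "c < f v" using k by auto
    have "ra.mfun (ds 0 v) (f v) (\<lambda>x. minv (?W 0 v x) * imap (fst x 0) v)"
      by (intro ra.mfun_mult[OF Wi q0'(1)] le0 v)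
    from ra.mfun_entry[OF this rc] show ?thesis
      by (rule ra.cong) (use v in \<open>simp add: CI coords_of_def n0 gauge_act_def\<close>)
  next
    case (CJ v r c)
    then have v: "v \<in> verts Q" and rc: "r < f v" "c < ds 0 v" using k dec'[OF le0 order_refl, of v] by auto
    have "ra.mfun (f v) (ds 0 v) (\<lambda>x. jmap (fst x 0) v * ?W 0 v x)"
      by (intro ra.mfun_mult[OF q0'(2) W] le0 v)
    from ra.mfun_entry[OF this rc] show ?thesis
      by (rule ra.cong) (use v inv[OF le0 v] in \<open>simp add: CJ coords_of_def n0 gauge_act_def\<close>)
  next
    case (CP m v r c)
    then have m: "m < l" and v: "v \<in> verts Q" and rc: "r < ds (Suc m) v" "c < ds m v" using k by auto
    have "ra.mfun (ds (Suc m) v) (ds m v) (\<lambda>x. minv (?W (Suc m) v x) * snd x m v * ?W m v x)"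
      using m by (intro ra.mfun_mult[OF ra.mfun_mult[OF Wi p] W] v) auto
    from ra.mfun_entry[OF this rc] show ?thesis
      by (rule ra.cong)
        (use m v inv[of m v] in \<open>simp add: CP coords_of_def normalise_def parabolic_act_def case_prod_unfold\<close>)
  qed
  have "inv_into Idx num i \<in> Idx" using num_bij i by (auto simp: bij_betw_def intro: inv_into_into)
  from coord[OF this] show ?thesis using i by (simp add: rho_def vecof_def)
qed

lemma word_charts_family: "L \<in> word_charts \<Longrightarrow> word_family (ds 0) f L"
  by (simp add: word_charts_def)

lemma pt_in_chart_dom: "word_family (ds 0) f L \<Longrightarrow> sol L y \<Longrightarrow> pt y \<in> chart_dom L"
  using sol_reps[of L y] by (auto simp: chart_dom_def normal_def)

text \<open>
  The relations imply that the candidate is invertible: by a chart \<open>L'\<close> around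
  \<open>y\<close>, where it is a left factor of an invertible matrix.
\<close>

lemma orbit_iff_eqs:
  assumes L: "word_family (ds 0) f L" and x: "x \<in> reps" "normal L x" and y: "y \<in> reps"
  shows "y \<in> orbit grp act x \<longleftrightarrow> (\<forall>e\<in>orbit_eqs L. e (x, y) = 0)"
proof -
  note xs = reps_shape[OF x(1)] and ys = reps_shape[OF y]
  let ?g = "\<lambda>m v. wmat (ds m) (fst y m) L v"
  have "(\<exists>g\<in>carrier grp. phom Q l g x y) \<longleftrightarrow> phom Q l ?g x y"
  proof
    assume "\<exists>g\<in>carrier grp. phom Q l g x y"
    then obtain g where g: "g \<in> carrier grp" "phom Q l g x y" by blast
    then show "phom Q l ?g x y"
      using phom_cong[of g ?g x y] phom_normal[OF xs ys g x(2) L] by blast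
  next
    assume h: "phom Q l ?g x y"
    obtain L' where L': "L' \<in> word_charts" "y \<in> chart_dom L'" using chart_exists(1)[OF y] by blast
    have "?g m v \<in> carrier (GL (ds m v))" if m: "m \<le> l" and v: "v \<in> verts Q" for m v
    proof -
      have "det (wmat (ds m) (fst y m) L' v) = det (?g m v) * det (wmat (ds m) (fst x m) L' v)"
        by (rule det_wmat_phom[OF xs ys _ _ word_family_le[OF word_charts_family[OF L'(1)] m] m v])
          (use h m in \<open>auto simp: phom_def\<close>)
      moreover have "det (wmat (ds m) (fst y m) L' v) \<noteq> 0" using L'(2) m v by (simp add: chart_dom_def)
      ultimately show ?thesis by (auto simp: GL_iff)
    qed
    then have "(\<lambda>m\<in>{..l}. \<lambda>v\<in>verts Q. ?g m v) \<in> carrier grp" by (rule grpI)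
    moreover have "phom Q l (\<lambda>m\<in>{..l}. \<lambda>v\<in>verts Q. ?g m v) x y"
      using h phom_cong[of "\<lambda>m\<in>{..l}. \<lambda>v\<in>verts Q. ?g m v" ?g x y] by simp
    ultimately show "\<exists>g\<in>carrier grp. phom Q l g x y" by blast
  qed
  then show ?thesis using orbit_iff[OF xs] ys orbit_eqs_zero_iff[OF xs ys] by simp
qed

theorem atlas:
  "quotient_atlas reps \<Phi> grp act word_charts chart_dom N (\<lambda>L. set (eqns L)) (\<lambda>L z. pt (val z)) rho orbit_eqs"
proof
  show "finite word_charts" by (rule finite_word_charts)
  show "reps = (\<Union>L\<in>word_charts. chart_dom L)"
    using chart_exists(1) by (auto simp: chart_dom_def)
  fix x y assume x: "x \<in> reps"
  show "x \<in> orbit grp act x" by (rule orbit_refl[OF reps_shape[OF x]])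
  assume y: "y \<in> orbit grp act x"
  show "y \<in> reps" by (rule orbit_closed[OF x y])
  show "orbit grp act y = orbit grp act x" by (rule orbit_eq[OF reps_shape[OF x] y])
next
  fix L assume L: "L \<in> word_charts"
  note Lf = word_charts_family[OF L]
  show "openin (zariski_topology reps \<Phi>) (chart_dom L)" by (rule chart_dom_open[OF Lf])
  show "set (eqns L) \<subseteq> poly_funs (vec_coords N)" by (rule eqns_poly[OF Lf])
  show "i < N \<Longrightarrow> (\<lambda>x. rho L x $ i) \<in> reg reps \<Phi> (chart_dom L)" for i by (rule rho_reg[OF Lf])
  show "e \<in> orbit_eqs L \<Longrightarrow> e \<in> poly_on (reps \<times> reps) (pair_coords \<Phi>)" for e by (rule orbit_eqs_poly[OF Lf])
  show "\<phi> \<in> \<Phi> \<Longrightarrow> (\<lambda>z. \<phi> (pt (val z))) \<in> poly_on (zero_locus N (set (eqns L))) (vec_coords N)" for \<phi>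
    unfolding poly_on_def using pt_poly[of \<phi>] by (intro CollectI bexI[of _ "\<lambda>z. \<phi> (pt (val z))"]) auto
  {
    fix x assume x: "x \<in> chart_dom L"
    note n = normalise_props[OF x Lf] and xr = x[unfolded chart_dom_def, THEN CollectD, THEN conjunct1]
    have s: "sol L (coords_of (normalise L x))" "pt (coords_of (normalise L x)) = normalise L x"
      by (rule normal_sol[OF n(2,3) Lf])+
    have "sol L (val (rho L x))"
      unfolding rho_def using sol_cong[of "val (vecof (coords_of (normalise L x)))" "coords_of (normalise L x)" L] s(1) val_vecof by blast
    then show "rho L x \<in> zero_locus N (set (eqns L))" by (simp add: zero_locus_eqns) (simp add: rho_def)
    have "pt (val (rho L x)) = normalise L x"
      unfolding rho_def using pt_cong[of "val (vecof (coords_of (normalise L x)))" "coords_of (normalise L x)"] s(2) val_vecof by metis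
    then show "pt (val (rho L x)) \<in> orbit grp act x" using n(1) by simp
    fix y assume y: "y \<in> orbit grp act x"
    obtain g where g: "y \<in> shape" "g \<in> carrier grp" "phom Q l g x y" using y orbit_iff[OF reps_shape[OF xr]] by blast
    have yr: "y \<in> reps" by (rule orbit_closed[OF xr y])
    show yU: "y \<in> chart_dom L"
      unfolding chart_dom_def
    proof (intro CollectI conjI yr allI impI ballI)
      fix m v assume m: "m \<le> l" and v: "v \<in> verts Q"
      have "det (wmat (ds m) (fst y m) L v) = det (g m v) * det (wmat (ds m) (fst x m) L v)"
        by (rule det_wmat_phom[where g = g, OF reps_shape[OF xr] g(1) grp_carrier_mat[OF g(2) m] _ word_family_le[OF Lf m] m v])
          (use g(3) m in \<open>auto simp: phom_def\<close>)
      then show "det (wmat (ds m) (fst y m) L v) \<noteq> 0"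
        using x m v grp_GL[OF g(2) m v] by (simp add: chart_dom_def GL_iff)
    qed
    note n' = normalise_props[OF yU Lf]
    have "orbit grp act y = orbit grp act x" by (rule orbit_eq[OF reps_shape[OF xr] y])
    moreover have "orbit grp act (normalise L x) = orbit grp act x" by (rule orbit_eq[OF reps_shape[OF xr] n(1)])
    ultimately have "normalise L y \<in> orbit grp act (normalise L x)" using n'(1) by simp
    then have "normalise L y = normalise L x" by (rule normal_unique[OF reps_shape[OF n(2)] _ n(3) n'(3) Lf])
    then show "rho L y = rho L x" by (simp add: rho_def)
  }
  fix z assume "z \<in> zero_locus N (set (eqns L))"
  then have z: "z \<in> carrier_vec N" "sol L (val z)" by (simp_all add: zero_locus_eqns)
  note s = sol_reps[OF z(2) Lf]
  show pU: "pt (val z) \<in> chart_dom L" by (rule pt_in_chart_dom[OF Lf z(2)])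
  note n = normalise_props[OF pU Lf]
  have "normalise L (pt (val z)) = pt (val z)" by (rule normal_unique[OF reps_shape[OF s(1)] n(1) s(2) n(3) Lf])
  then have "rho L (pt (val z)) = vecof (coords_of (pt (val z)))" by (simp add: rho_def)
  also have "\<dots> = vecof (val z)" by (rule vecof_cong) (rule coords_of_pt)
  also have "\<dots> = z" by (rule vecof_val[OF z(1)])
  finally show "rho L (pt (val z)) = z" .
  show "y \<in> reps \<Longrightarrow> y \<in> orbit grp act (pt (val z)) \<longleftrightarrow> (\<forall>e\<in>orbit_eqs L. e (pt (val z), y) = 0)" for y
    by (rule orbit_iff_eqs[OF Lf s])
qed

end


section \<open>Smoothness of the slice\<close>

text \<open>Entrywise, because the type of all matrices carries no topology.\<close>

definition mder :: "nat \<Rightarrow> nat \<Rightarrow> (complex \<Rightarrow> complex mat) \<Rightarrow> complex mat \<Rightarrow> bool" where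
  "mder n m F D \<longleftrightarrow> (\<forall>t. F t \<in> carrier_mat n m) \<and> D \<in> carrier_mat n m \<and>
     (\<forall>r<n. \<forall>c<m. ((\<lambda>t. F t $$ (r, c)) has_field_derivative D $$ (r, c)) (at 0))"

lemma mder_carrier: "mder n m F D \<Longrightarrow> F t \<in> carrier_mat n m" "mder n m F D \<Longrightarrow> D \<in> carrier_mat n m"
  by (simp_all add: mder_def)

lemma mder_entry: "mder n m F D \<Longrightarrow> r < n \<Longrightarrow> c < m \<Longrightarrow> ((\<lambda>t. F t $$ (r, c)) has_field_derivative D $$ (r, c)) (at 0)"
  by (simp add: mder_def)

lemma mder_const: "A \<in> carrier_mat n m \<Longrightarrow> mder n m (\<lambda>_. A) (0\<^sub>m n m)"
  by (auto simp: mder_def)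

lemma mder_add: "mder n m F D \<Longrightarrow> mder n m F' D' \<Longrightarrow> mder n m (\<lambda>t. F t + F' t) (D + D')"
  unfolding mder_def
proof (intro conjI allI impI; (elim conjE)?)
  fix r c
  assume a: "\<forall>t. F t \<in> carrier_mat n m" "D \<in> carrier_mat n m" "\<forall>t. F' t \<in> carrier_mat n m" "D' \<in> carrier_mat n m" "r < n" "c < m"
    and d: "\<forall>r<n. \<forall>c<m. ((\<lambda>t. F t $$ (r, c)) has_field_derivative D $$ (r, c)) (at 0)"
      "\<forall>r<n. \<forall>c<m. ((\<lambda>t. F' t $$ (r, c)) has_field_derivative D' $$ (r, c)) (at 0)"
  have "((\<lambda>t. F t $$ (r, c) + F' t $$ (r, c)) has_field_derivative D $$ (r, c) + D' $$ (r, c)) (at 0)"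
    using a d by (intro DERIV_add) auto
  moreover have "(F t + F' t) $$ (r, c) = F t $$ (r, c) + F' t $$ (r, c)" for t
    using a carrier_matD[of "F' t" n m] by (intro index_add_mat(1)) auto
  moreover have "(D + D') $$ (r, c) = D $$ (r, c) + D' $$ (r, c)"
    using a carrier_matD[of D' n m] by (intro index_add_mat(1)) auto
  ultimately show "((\<lambda>t. (F t + F' t) $$ (r, c)) has_field_derivative (D + D') $$ (r, c)) (at 0)" by simp
qed auto

lemma mder_diff: "mder n m F D \<Longrightarrow> mder n m F' D' \<Longrightarrow> mder n m (\<lambda>t. F t - F' t) (D - D')"
  unfolding mder_def
proof (intro conjI allI impI; (elim conjE)?)
  fix r c
  assume a: "\<forall>t. F t \<in> carrier_mat n m" "D \<in> carrier_mat n m" "\<forall>t. F' t \<in> carrier_mat n m" "D' \<in> carrier_mat n m" "r < n" "c < m"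
    and d: "\<forall>r<n. \<forall>c<m. ((\<lambda>t. F t $$ (r, c)) has_field_derivative D $$ (r, c)) (at 0)"
      "\<forall>r<n. \<forall>c<m. ((\<lambda>t. F' t $$ (r, c)) has_field_derivative D' $$ (r, c)) (at 0)"
  have "((\<lambda>t. F t $$ (r, c) - F' t $$ (r, c)) has_field_derivative D $$ (r, c) - D' $$ (r, c)) (at 0)"
    using a d by (intro DERIV_diff) auto
  moreover have "(F t - F' t) $$ (r, c) = F t $$ (r, c) - F' t $$ (r, c)" for t
    using a carrier_matD[of "F' t" n m] by (intro index_minus_mat(1)) auto
  moreover have "(D - D') $$ (r, c) = D $$ (r, c) - D' $$ (r, c)"
    using a carrier_matD[of D' n m] by (intro index_minus_mat(1)) auto
  ultimately show "((\<lambda>t. (F t - F' t) $$ (r, c)) has_field_derivative (D - D') $$ (r, c)) (at 0)" by simp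
qed (auto intro!: minus_carrier_mat)

lemma mder_mult:
  assumes F: "mder n k F D" and G: "mder k m G E"
  shows "mder n m (\<lambda>t. F t * G t) (D * G 0 + F 0 * E)"
  unfolding mder_def
proof (intro conjI allI impI)
  note cF = mder_carrier[OF F] and cG = mder_carrier[OF G]
  show "F t * G t \<in> carrier_mat n m" for t using cF(1) cG(1) by (rule mult_carrier_mat)
  show "D * G 0 + F 0 * E \<in> carrier_mat n m"
    using mult_carrier_mat[OF cF(2) cG(1)] mult_carrier_mat[OF cF(1) cG(2)] by simp
  fix r c assume rc: "r < n" "c < m"
  have "((\<lambda>t. \<Sum>i<k. F t $$ (r, i) * G t $$ (i, c)) has_field_derivative
      (\<Sum>i<k. D $$ (r, i) * G 0 $$ (i, c) + E $$ (i, c) * F 0 $$ (r, i))) (at 0)"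
    using rc by (intro DERIV_sum DERIV_mult mder_entry[OF F] mder_entry[OF G]) auto
  moreover have "(D * G 0 + F 0 * E) $$ (r, c) = (\<Sum>i<k. D $$ (r, i) * G 0 $$ (i, c) + E $$ (i, c) * F 0 $$ (r, i))"
  proof -
    have "(D * G 0 + F 0 * E) $$ (r, c) = (D * G 0) $$ (r, c) + (F 0 * E) $$ (r, c)"
      using rc carrier_matD[OF cF(1)] carrier_matD[OF cG(2)] by (intro index_add_mat(1)) auto
    then show ?thesis
      by (simp only: mult_mat_index[OF cF(2) cG(1) rc] mult_mat_index[OF cF(1) cG(2) rc] sum.distrib mult.commute)
  qed
  ultimately show "((\<lambda>t. (F t * G t) $$ (r, c)) has_field_derivative (D * G 0 + F 0 * E) $$ (r, c)) (at 0)"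
    by (simp only: mult_mat_index[OF cF(1) cG(1) rc])
qed

lemma mder_msum:
  assumes "\<And>e. e \<in> E \<Longrightarrow> mder n m (F e) (D e)"
  shows "mder n m (\<lambda>t. msum n m (\<lambda>e. F e t) E) (msum n m D E)"
  unfolding mder_def
proof (intro conjI allI impI msum_carrier)
  fix r c assume rc: "r < n" "c < m"
  have "((\<lambda>t. \<Sum>e\<in>E. F e t $$ (r, c)) has_field_derivative (\<Sum>e\<in>E. D e $$ (r, c))) (at 0)"
    using assms rc by (intro DERIV_sum mder_entry) auto
  then show "((\<lambda>t. msum n m (\<lambda>e. F e t) E $$ (r, c)) has_field_derivative msum n m D E $$ (r, c)) (at 0)"
    using rc by simp
qed

lemma mder_unique:
  assumes F: "mder n m F D" and F': "mder n m F D'" shows "D = D'"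
proof (rule eq_matI)
  fix r c assume "r < dim_row D'" "c < dim_col D'"
  then have rc: "r < n" "c < m" using mder_carrier(2)[OF F'] by auto
  show "D $$ (r, c) = D' $$ (r, c)" by (rule DERIV_unique[OF mder_entry[OF F rc] mder_entry[OF F' rc]])
qed (use mder_carrier(2)[OF F] mder_carrier(2)[OF F'] in auto)

lemma mder_linear:
  assumes "\<And>t r c. r < n \<Longrightarrow> c < m \<Longrightarrow> F t $$ (r, c) = a (r, c) + t * D $$ (r, c)" "\<And>t. F t \<in> carrier_mat n m" "D \<in> carrier_mat n m"
  shows "mder n m F D"
  unfolding mder_def
proof (intro conjI allI impI assms)
  fix r c assume rc: "r < n" "c < m"
  have "((\<lambda>t. a (r, c) + t * D $$ (r, c)) has_field_derivative D $$ (r, c)) (at 0)"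
    by (auto intro!: derivative_eq_intros)
  then show "((\<lambda>t. F t $$ (r, c)) has_field_derivative D $$ (r, c)) (at 0)" using assms(1)[OF rc] by simp
qed

lemma sum_list_enum:
  assumes "distinct xs"
  shows "(\<Sum>r<length xs. y r * D (xs ! r)) = (\<Sum>k\<in>set xs. y (inv_into {..<length xs} ((!) xs) k) * (D k :: complex))"
proof -
  have b: "bij_betw ((!) xs) {..<length xs} (set xs)" by (rule bij_betw_nth[OF assms]) auto
  have "(\<Sum>k\<in>set xs. y (inv_into {..<length xs} ((!) xs) k) * D k) =
      (\<Sum>r<length xs. y (inv_into {..<length xs} ((!) xs) (xs ! r)) * D (xs ! r))"
    by (rule sum.reindex_bij_betw[OF b, symmetric])
  also have "\<dots> = (\<Sum>r<length xs. y r * D (xs ! r))"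
    using b by (intro sum.cong refl) (simp add: bij_betw_def)
  finally show ?thesis ..
qed

definition elem :: "nat \<Rightarrow> nat \<Rightarrow> nat \<Rightarrow> nat \<Rightarrow> complex mat" where
  "elem n m r0 c0 = mat n m (\<lambda>(r, c). if r = r0 \<and> c = c0 then 1 else 0)"

lemma elem_carrier [simp]: "elem n m r c \<in> carrier_mat n m" by (simp add: elem_def)

text \<open>
  The trace of \<open>X * M\<close>, which identifies linear functionals on matrices
  \<open>M\<close> with matrices \<open>X\<close>.
\<close>

definition pair :: "complex mat \<Rightarrow> complex mat \<Rightarrow> complex" where
  "pair X M = (\<Sum>r<dim_row M. \<Sum>c<dim_col M. X $$ (c, r) * M $$ (r, c))"

lemma pair_elem_left:
  assumes X: "X \<in> carrier_mat m n" and Y: "Y \<in> carrier_mat k m" and rc: "r0 < n" "c0 < k"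
  shows "pair X (elem n k r0 c0 * Y) = (Y * X) $$ (c0, r0)"
proof -
  have "(elem n k r0 c0 * Y) $$ (r, c) = (if r = r0 then Y $$ (c0, c) else 0)" if "r < n" "c < m" for r c
  proof -
    have "(elem n k r0 c0 * Y) $$ (r, c) = (\<Sum>i<k. if i = c0 then (if r = r0 then Y $$ (i, c) else 0) else 0)"
      unfolding mult_mat_index[OF elem_carrier Y that] using that by (intro sum.cong) (auto simp: elem_def)
    then show ?thesis using rc by simp
  qed
  note e = this
  have "pair X (elem n k r0 c0 * Y) = (\<Sum>r<n. \<Sum>c<m. X $$ (c, r) * (elem n k r0 c0 * Y) $$ (r, c))"
    using carrier_matD[OF Y] carrier_matD[OF elem_carrier[of n k r0 c0]] by (simp add: pair_def del: index_mult_mat(1))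
  also have "\<dots> = (\<Sum>r<n. \<Sum>c<m. if r = r0 then X $$ (c, r0) * Y $$ (c0, c) else 0)"
    by (intro sum.cong refl) (simp add: e del: index_mult_mat(1))
  also have "\<dots> = (\<Sum>r<n. if r = r0 then (\<Sum>c<m. X $$ (c, r0) * Y $$ (c0, c)) else 0)"
    by (intro sum.cong) auto
  also have "\<dots> = (\<Sum>c<m. Y $$ (c0, c) * X $$ (c, r0))" using rc by (simp add: mult.commute)
  also have "\<dots> = (Y * X) $$ (c0, r0)" by (rule mult_mat_index[OF Y X rc(2,1), symmetric])
  finally show ?thesis .
qed

lemma pair_elem_right:
  assumes X: "X \<in> carrier_mat m n" and Y: "Y \<in> carrier_mat n k" and rc: "r0 < k" "c0 < m"
  shows "pair X (Y * elem k m r0 c0) = (X * Y) $$ (c0, r0)"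
proof -
  have "(Y * elem k m r0 c0) $$ (r, c) = (if c = c0 then Y $$ (r, r0) else 0)" if "r < n" "c < m" for r c
  proof -
    have "(Y * elem k m r0 c0) $$ (r, c) = (\<Sum>i<k. if i = r0 then (if c = c0 then Y $$ (r, i) else 0) else 0)"
      unfolding mult_mat_index[OF Y elem_carrier that] using that by (intro sum.cong) (auto simp: elem_def)
    then show ?thesis using rc by simp
  qed
  note e = this
  have "pair X (Y * elem k m r0 c0) = (\<Sum>r<n. \<Sum>c<m. X $$ (c, r) * (Y * elem k m r0 c0) $$ (r, c))"
    using carrier_matD[OF Y] carrier_matD[OF elem_carrier[of k m r0 c0]] by (simp add: pair_def del: index_mult_mat(1))
  also have "\<dots> = (\<Sum>r<n. \<Sum>c<m. if c = c0 then X $$ (c0, r) * Y $$ (r, r0) else 0)"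
    by (intro sum.cong refl) (simp add: e del: index_mult_mat(1))
  also have "\<dots> = (\<Sum>r<n. X $$ (c0, r) * Y $$ (r, r0))" using rc by simp
  also have "\<dots> = (X * Y) $$ (c0, r0)" by (rule mult_mat_index[OF X Y rc(2,1), symmetric])
  finally show ?thesis .
qed

lemma pair_zero: "pair X (0\<^sub>m n m) = 0"
  by (simp add: pair_def)

lemma pair_add: "M \<in> carrier_mat n m \<Longrightarrow> M' \<in> carrier_mat n m \<Longrightarrow> pair X (M + M') = pair X M + pair X M'"
  by (simp add: pair_def sum.distrib distrib_left)

lemma pair_diff: "M \<in> carrier_mat n m \<Longrightarrow> M' \<in> carrier_mat n m \<Longrightarrow> pair X (M - M') = pair X M - pair X M'"
  by (simp add: pair_def sum_subtractf right_diff_distrib)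

lemma pair_msum:
  assumes "\<And>e. e \<in> E \<Longrightarrow> F e \<in> carrier_mat n m"
  shows "pair X (msum n m F E) = (\<Sum>e\<in>E. pair X (F e))"
proof -
  have "pair X (msum n m F E) = (\<Sum>r<n. \<Sum>c<m. \<Sum>e\<in>E. X $$ (c, r) * F e $$ (r, c))"
    by (simp add: pair_def sum_distrib_left)
  also have "\<dots> = (\<Sum>r<n. \<Sum>e\<in>E. \<Sum>c<m. X $$ (c, r) * F e $$ (r, c))"
    by (intro sum.cong refl) (rule sum.swap)
  also have "\<dots> = (\<Sum>e\<in>E. \<Sum>r<n. \<Sum>c<m. X $$ (c, r) * F e $$ (r, c))" by (rule sum.swap)
  also have "\<dots> = (\<Sum>e\<in>E. pair X (F e))"
    using assms by (intro sum.cong refl) (auto simp: pair_def)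
  finally show ?thesis .
qed

context parabolic_chain
begin

lemma val_line: "z \<in> carrier_vec N \<Longrightarrow> h \<in> carrier_vec N \<Longrightarrow> i \<in> Idx \<Longrightarrow> val (z + t \<cdot>\<^sub>v h) i = val z i + t * val h i"
  using num_less[of i] by (simp add: val_def)

text \<open>
  The linear part of \<open>tp\<close>, which is only affine in the coordinates.
\<close>

definition tp_dir :: "(('v, 'e) coord \<Rightarrow> complex) \<Rightarrow> nat \<Rightarrow> 'v \<Rightarrow> complex mat" where
  "tp_dir y m v = mat (ds (Suc m) v) (ds m v) (\<lambda>(r, c). if c < ds (Suc m) v then 0 else y (CP m v r c))"

lemma t_mder:
  assumes z: "z \<in> carrier_vec N" and h: "h \<in> carrier_vec N"
  shows "e \<in> arcs Q \<Longrightarrow> mder (ds 0 (head Q e)) (ds l (tail Q e)) (\<lambda>t. tA (val (z + t \<cdot>\<^sub>v h)) e) (tA (val h) e)"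
    "e \<in> arcs Q \<Longrightarrow> mder (ds 0 (tail Q e)) (ds l (head Q e)) (\<lambda>t. tB (val (z + t \<cdot>\<^sub>v h)) e) (tB (val h) e)"
    "v \<in> verts Q \<Longrightarrow> mder (ds 0 v) (f v) (\<lambda>t. tI (val (z + t \<cdot>\<^sub>v h)) v) (tI (val h) v)"
    "v \<in> verts Q \<Longrightarrow> mder (f v) (ds l v) (\<lambda>t. tJ (val (z + t \<cdot>\<^sub>v h)) v) (tJ (val h) v)"
    "m < l \<Longrightarrow> v \<in> verts Q \<Longrightarrow> mder (ds (Suc m) v) (ds m v) (\<lambda>t. tp (val (z + t \<cdot>\<^sub>v h)) m v) (tp_dir (val h) m v)"
proof -
  note vl = val_line[OF z h]
  show "e \<in> arcs Q \<Longrightarrow> mder (ds 0 (head Q e)) (ds l (tail Q e)) (\<lambda>t. tA (val (z + t \<cdot>\<^sub>v h)) e) (tA (val h) e)"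
    by (rule mder_linear[where a = "\<lambda>(r, c). val z (CA e r c)"]) (auto simp: tA_def vl)
  show "e \<in> arcs Q \<Longrightarrow> mder (ds 0 (tail Q e)) (ds l (head Q e)) (\<lambda>t. tB (val (z + t \<cdot>\<^sub>v h)) e) (tB (val h) e)"
    by (rule mder_linear[where a = "\<lambda>(r, c). val z (CB e r c)"]) (auto simp: tB_def vl)
  show "v \<in> verts Q \<Longrightarrow> mder (ds 0 v) (f v) (\<lambda>t. tI (val (z + t \<cdot>\<^sub>v h)) v) (tI (val h) v)"
    by (rule mder_linear[where a = "\<lambda>(r, c). val z (CI v r c)"]) (auto simp: tI_def vl)
  show "v \<in> verts Q \<Longrightarrow> mder (f v) (ds l v) (\<lambda>t. tJ (val (z + t \<cdot>\<^sub>v h)) v) (tJ (val h) v)"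
    by (rule mder_linear[where a = "\<lambda>(r, c). val z (CJ v r c)"]) (auto simp: tJ_def vl)
  show "m < l \<Longrightarrow> v \<in> verts Q \<Longrightarrow> mder (ds (Suc m) v) (ds m v) (\<lambda>t. tp (val (z + t \<cdot>\<^sub>v h)) m v) (tp_dir (val h) m v)"
    by (rule mder_linear[where a = "\<lambda>(r, c). tp (val z) m v $$ (r, c)"]) (auto simp: tp_def tp_dir_def vl)
qed

text \<open>
  A vector in the left kernel of the Jacobian assigns a number to every equation. Arranged as
  matrices \<open>X\<close> and \<open>Y\<close>, these numbers annihilate the derivatives of the
  two kinds of equations in every direction \<open>h\<close>.
\<close>

lemma jacobian_pairing:
  assumes L: "word_family (ds 0) f L" and z: "z \<in> carrier_vec N"
    and ker: "\<And>i. i < N \<Longrightarrow> (\<Sum>r<length (eqns L). y r * jacobian N (eqns L) z $$ (r, i)) = 0"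
  obtains X Y where "\<And>v. X v \<in> carrier_mat (ds l v) (ds 0 v)" "\<And>v. Y v \<in> carrier_mat (ds 0 v) (ds 0 v)"
    "\<And>h D E. h \<in> carrier_vec N \<Longrightarrow> (\<And>v. v \<in> verts Q \<Longrightarrow> mder (ds 0 v) (ds l v) (\<lambda>t. tmom (val (z + t \<cdot>\<^sub>v h)) v) (D v)) \<Longrightarrow>
      (\<And>v. v \<in> verts Q \<Longrightarrow> mder (ds 0 v) (ds 0 v) (\<lambda>t. wmat (ds 0) (rep0 (val (z + t \<cdot>\<^sub>v h))) L v) (E v)) \<Longrightarrow>
      (\<Sum>v\<in>verts Q. pair (X v) (D v)) + (\<Sum>v\<in>verts Q. pair (Y v) (E v)) = 0"
    "(\<And>v. v \<in> verts Q \<Longrightarrow> X v = 0\<^sub>m (ds l v) (ds 0 v)) \<Longrightarrow> (\<And>v. v \<in> verts Q \<Longrightarrow> Y v = 0\<^sub>m (ds 0 v) (ds 0 v)) \<Longrightarrow>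
      \<forall>r<length (eqns L). y r = 0"
proof -
  let ?xs = "eq_list moment_idx" and ?ys = "eq_list frame_idx"
  let ?n = "length ?xs" and ?n' = "length ?ys"
  define a where "a k = y (inv_into {..<?n} ((!) ?xs) k)" for k
  define b where "b k = y (?n + inv_into {..<?n'} ((!) ?ys) k)" for k
  define X where "X v = mat (ds l v) (ds 0 v) (\<lambda>(c, r). a (v, r, c))" for v
  define Y where "Y v = mat (ds 0 v) (ds 0 v) (\<lambda>(c, r). b (v, r, c))" for v
  have len: "length (eqns L) = ?n + ?n'" by (simp add: eqns_def)
  have split: "(\<Sum>r<p + q. g r) = (\<Sum>r<p. g r) + (\<Sum>r<q. g (p + r))" for p q and g :: "nat \<Rightarrow> complex"
    by (induction q) (auto simp: add.assoc)
  show thesis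
  proof (rule that)
    show "X v \<in> carrier_mat (ds l v) (ds 0 v)" "Y v \<in> carrier_mat (ds 0 v) (ds 0 v)" for v
      by (simp_all add: X_def Y_def)
  next
    fix h D E
    assume h: "h \<in> carrier_vec N"
      and D: "\<And>v. v \<in> verts Q \<Longrightarrow> mder (ds 0 v) (ds l v) (\<lambda>t. tmom (val (z + t \<cdot>\<^sub>v h)) v) (D v)"
      and E: "\<And>v. v \<in> verts Q \<Longrightarrow> mder (ds 0 v) (ds 0 v) (\<lambda>t. wmat (ds 0) (rep0 (val (z + t \<cdot>\<^sub>v h))) L v) (E v)"
    let ?d = "\<lambda>r. \<Sum>i<N. jacobian N (eqns L) z $$ (r, i) * h $ i"
    have dr: "((\<lambda>t. (eqns L ! r) (z + t \<cdot>\<^sub>v h)) has_field_derivative ?d r) (at 0)" if "r < ?n + ?n'" for r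
      by (rule jacobian_directional[OF eqns_poly[OF L] z h]) (simp add: len that)
    have "(\<Sum>r<?n + ?n'. y r * ?d r) = (\<Sum>i<N. (\<Sum>r<?n + ?n'. y r * jacobian N (eqns L) z $$ (r, i)) * h $ i)"
      by (simp add: sum_distrib_left sum_distrib_right mult.assoc) (rule sum.swap)
    also have "\<dots> = 0" using ker by (simp add: len)
    finally have tot: "(\<Sum>r<?n. y r * ?d r) + (\<Sum>r<?n'. y (?n + r) * ?d (?n + r)) = 0" unfolding split .
    have d1: "?d r = (\<lambda>(v, r, c). D v $$ (r, c)) (?xs ! r)" if r: "r < ?n" for r
    proof -
      obtain v i c where k: "?xs ! r = (v, i, c)" by (cases "?xs ! r") auto
      have "(v, i, c) \<in> moment_idx" using nth_mem[OF r] k eq_list(1)[of moment_idx] by simp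
      then have v: "v \<in> verts Q" "i < ds 0 v" "c < ds l v" by (auto simp: moment_idx_def)
      have "((\<lambda>t. (eqns L ! r) (z + t \<cdot>\<^sub>v h)) has_field_derivative D v $$ (i, c)) (at 0)"
        using mder_entry[OF D[OF v(1)] v(2,3)] r k by (simp add: eqns_def nth_append moment_eq_def)
      then show ?thesis using DERIV_unique[OF dr[of r]] r k by auto
    qed
    have d2: "?d (?n + r) = (\<lambda>(v, r, c). E v $$ (r, c)) (?ys ! r)" if r: "r < ?n'" for r
    proof -
      obtain v i c where k: "?ys ! r = (v, i, c)" by (cases "?ys ! r") auto
      have "(v, i, c) \<in> frame_idx" using nth_mem[OF r] k eq_list(1)[of frame_idx] by simp
      then have v: "v \<in> verts Q" "i < ds 0 v" "c < ds 0 v" by (auto simp: frame_idx_def)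
      have "((\<lambda>t. wmat (ds 0) (rep0 (val (z + t \<cdot>\<^sub>v h))) L v $$ (i, c) - (if i = c then 1 else 0)) has_field_derivative E v $$ (i, c) - 0) (at 0)"
        by (intro DERIV_diff mder_entry[OF E[OF v(1)] v(2,3)] DERIV_const)
      then have "((\<lambda>t. (eqns L ! (?n + r)) (z + t \<cdot>\<^sub>v h)) has_field_derivative E v $$ (i, c)) (at 0)"
        using r k by (simp add: eqns_def nth_append frame_eq_def)
      then show ?thesis using DERIV_unique[OF dr[of "?n + r"]] r k by auto
    qed
    have "(\<Sum>r<?n. y r * ?d r) = (\<Sum>r<?n. y r * (\<lambda>(v, r, c). D v $$ (r, c)) (?xs ! r))"
      by (intro sum.cong refl) (simp only: d1 lessThan_iff)
    also have "\<dots> = (\<Sum>k\<in>moment_idx. a k * (\<lambda>(v, r, c). D v $$ (r, c)) k)"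
      unfolding a_def by (subst sum_list_enum) (simp_all add: eq_list)
    also have "\<dots> = (\<Sum>v\<in>verts Q. \<Sum>(r, c)\<in>{..<ds 0 v} \<times> {..<ds l v}. a (v, r, c) * D v $$ (r, c))"
      unfolding moment_idx_def by (subst sum.Sigma) (auto simp: case_prod_unfold)
    also have "\<dots> = (\<Sum>v\<in>verts Q. pair (X v) (D v))"
    proof (intro sum.cong refl)
      fix v assume v: "v \<in> verts Q"
      show "(\<Sum>(r, c)\<in>{..<ds 0 v} \<times> {..<ds l v}. a (v, r, c) * D v $$ (r, c)) = pair (X v) (D v)"
        using carrier_matD[OF mder_carrier(2)[OF D[OF v]]]
        by (subst sum.cartesian_product[symmetric]) (simp add: pair_def X_def)
    qed
    finally have s1: "(\<Sum>r<?n. y r * ?d r) = (\<Sum>v\<in>verts Q. pair (X v) (D v))" .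
    have "(\<Sum>r<?n'. y (?n + r) * ?d (?n + r)) = (\<Sum>r<?n'. y (?n + r) * (\<lambda>(v, r, c). E v $$ (r, c)) (?ys ! r))"
      by (intro sum.cong refl) (simp only: d2 lessThan_iff)
    also have "\<dots> = (\<Sum>k\<in>frame_idx. b k * (\<lambda>(v, r, c). E v $$ (r, c)) k)"
      unfolding b_def using sum_list_enum[of ?ys "\<lambda>r. y (?n + r)"] by (simp add: eq_list)
    also have "\<dots> = (\<Sum>v\<in>verts Q. \<Sum>(r, c)\<in>{..<ds 0 v} \<times> {..<ds 0 v}. b (v, r, c) * E v $$ (r, c))"
      unfolding frame_idx_def by (subst sum.Sigma) (auto simp: case_prod_unfold)
    also have "\<dots> = (\<Sum>v\<in>verts Q. pair (Y v) (E v))"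
    proof (intro sum.cong refl)
      fix v assume v: "v \<in> verts Q"
      show "(\<Sum>(r, c)\<in>{..<ds 0 v} \<times> {..<ds 0 v}. b (v, r, c) * E v $$ (r, c)) = pair (Y v) (E v)"
        using carrier_matD[OF mder_carrier(2)[OF E[OF v]]]
        by (subst sum.cartesian_product[symmetric]) (simp add: pair_def Y_def)
    qed
    finally show "(\<Sum>v\<in>verts Q. pair (X v) (D v)) + (\<Sum>v\<in>verts Q. pair (Y v) (E v)) = 0" using tot s1 by simp
  next
    assume X0: "\<And>v. v \<in> verts Q \<Longrightarrow> X v = 0\<^sub>m (ds l v) (ds 0 v)" and Y0: "\<And>v. v \<in> verts Q \<Longrightarrow> Y v = 0\<^sub>m (ds 0 v) (ds 0 v)"
    have a0: "a k = 0" if kE: "k \<in> moment_idx" for k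
    proof -
      obtain v r c where k: "k = (v, r, c)" "v \<in> verts Q" "r < ds 0 v" "c < ds l v" using kE by (cases k) (auto simp: moment_idx_def)
      have "X v $$ (c, r) = 0" using X0[OF k(2)] k by simp
      then show ?thesis using k by (simp add: X_def)
    qed
    have b0: "b k = 0" if kE: "k \<in> frame_idx" for k
    proof -
      obtain v r c where k: "k = (v, r, c)" "v \<in> verts Q" "r < ds 0 v" "c < ds 0 v" using kE by (cases k) (auto simp: frame_idx_def)
      have "Y v $$ (c, r) = 0" using Y0[OF k(2)] k by simp
      then show ?thesis using k by (simp add: Y_def)
    qed
    have inj: "inj_on ((!) ?xs) {..<?n}" "inj_on ((!) ?ys) {..<?n'}"
      by (auto intro!: inj_on_nth simp: eq_list)
    show "\<forall>r<length (eqns L). y r = 0"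
    proof (intro allI impI)
      fix r assume "r < length (eqns L)"
      then consider "r < ?n" | r' where "r = ?n + r'" "r' < ?n'" unfolding len
        by (metis add_diff_inverse_nat nat_add_left_cancel_less)
      then show "y r = 0"
      proof cases
        case 1
        have "?xs ! r \<in> moment_idx" using nth_mem[OF 1] eq_list(1)[of moment_idx] by simp
        from a0[OF this] show ?thesis using 1 inj(1) by (simp add: a_def)
      next
        case 2
        have "?ys ! r' \<in> frame_idx" using nth_mem[OF 2(2)] eq_list(1)[of frame_idx] by simp
        from b0[OF this] show ?thesis using 2 inj(2) by (simp add: b_def)
      qed
    qed
  qed
qed

end

lemma mat_telescope:
  assumes "X \<in> carrier_mat n m" "Y \<in> carrier_mat n m" "(Z :: complex mat) \<in> carrier_mat n m"
  shows "(X - Y) + (Y - Z) = X - Z"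
  using assms by (intro eq_matI) auto

lemma mat_cancel:
  assumes "X \<in> carrier_mat n m" "(Y :: complex mat) \<in> carrier_mat n m"
  shows "(X - Y) + Y = X"
  using assms by (intro eq_matI) auto

lemma mat_regroup:
  assumes "P1 \<in> carrier_mat n m" "R1 \<in> carrier_mat n m" "P2 \<in> carrier_mat n m" "R2 \<in> carrier_mat n m"
    "P3 \<in> carrier_mat n m" "(R3 :: complex mat) \<in> carrier_mat n m"
  shows "(P1 - R1) - (P2 - R2) + (P3 + (0\<^sub>m n m - R3)) = (P1 - P2 + P3) - (R1 - R2 + R3)"
  using assms by (intro eq_matI) auto

lemma mder_cong: "mder n m F D \<Longrightarrow> D = D' \<Longrightarrow> mder n m F D'"
  by simp

lemma msum_minus:
  "(\<And>e. e \<in> E \<Longrightarrow> G e \<in> carrier_mat n m) \<Longrightarrow> msum n m (\<lambda>e. F e - G e) E = msum n m F E - msum n m G E"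
proof (rule eq_matI)
  fix r c assume G: "\<And>e. e \<in> E \<Longrightarrow> G e \<in> carrier_mat n m"
    and "r < dim_row (msum n m F E - msum n m G E)" "c < dim_col (msum n m F E - msum n m G E)"
  then have rc: "r < n" "c < m" by auto
  have "(\<Sum>e\<in>E. (F e - G e) $$ (r, c)) = (\<Sum>e\<in>E. F e $$ (r, c) - G e $$ (r, c))"
    using rc carrier_matD[OF G] by (intro sum.cong refl index_minus_mat(1)) auto
  then show "msum n m (\<lambda>e. F e - G e) E $$ (r, c) = (msum n m F E - msum n m G E) $$ (r, c)"
    using rc by (simp add: sum_subtractf)
qed auto

definition vmat :: "nat \<Rightarrow> complex vec \<Rightarrow> complex mat" where
  "vmat n u = mat n 1 (\<lambda>(i, _). u $ i)"

lemma vmat_carrier [simp]: "vmat n u \<in> carrier_mat n 1"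
  by (simp add: vmat_def)

lemma mult_vmat: "A \<in> carrier_mat n m \<Longrightarrow> u \<in> carrier_vec m \<Longrightarrow> A * vmat m u = vmat n (A *\<^sub>v u)"
proof (rule eq_matI)
  fix r c assume A: "A \<in> carrier_mat n m" "u \<in> carrier_vec m"
    and "r < dim_row (vmat n (A *\<^sub>v u))" "c < dim_col (vmat n (A *\<^sub>v u))"
  then have r: "r < n" "c = 0" by (auto simp: vmat_def)
  show "(A * vmat m u) $$ (r, c) = vmat n (A *\<^sub>v u) $$ (r, c)"
    using r mult_mat_index[OF A(1) vmat_carrier[of m u] r(1), of 0] mult_mat_vec_index[OF A r(1)]
    by (simp add: vmat_def del: index_mult_mat(1) index_mult_mat_vec)
qed (auto simp: vmat_def)

context parabolic_chain
begin

interpretation poly: fun_alg UNIV "poly_funs (vec_coords N)"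
  by (rule fun_alg_poly)

lemma poly_mder:
  assumes F: "poly.mfun n m F" and z: "z \<in> carrier_vec N" and h: "h \<in> carrier_vec N"
  shows "\<exists>D. mder n m (\<lambda>t. F (z + t \<cdot>\<^sub>v h)) D"
proof -
  have "\<exists>d. ((\<lambda>t. F (z + t \<cdot>\<^sub>v h) $$ (r, c)) has_field_derivative d) (at 0)" if "r < n" "c < m" for r c
    using poly_slope[OF poly.mfun_entry[OF F that]] slope_deriv[OF _ z h] by blast
  then obtain d where "\<And>r c. r < n \<Longrightarrow> c < m \<Longrightarrow> ((\<lambda>t. F (z + t \<cdot>\<^sub>v h) $$ (r, c)) has_field_derivative d r c) (at 0)"
    by metis
  then have "mder n m (\<lambda>t. F (z + t \<cdot>\<^sub>v h)) (mat n m (\<lambda>(r, c). d r c))"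
    using poly.mfun_carrier[OF F] by (auto simp: mder_def)
  then show ?thesis by blast
qed

context
  fixes L and z and b :: "'v \<Rightarrow> complex mat"
  assumes L: "word_family (ds 0) f L" and z: "z \<in> carrier_vec N" and s: "sol L (val z)"
    and b: "\<And>v. v \<in> verts Q \<Longrightarrow> b v \<in> carrier_mat (ds 0 v) (ds 0 v)"
begin

abbreviation "y \<equiv> val z"
abbreviation "P v m \<equiv> PI (tp y) v m"
abbreviation "A0 e \<equiv> Amap (rep0 y) e"
abbreviation "B0 e \<equiv> Bmap (rep0 y) e"
abbreviation "J0 v \<equiv> jmap (rep0 y) v"
abbreviation "bm v m \<equiv> P v m * (b v * I0 v m)"

lemma b_dim: "v \<in> verts Q \<Longrightarrow> dim_row (b v) = ds 0 v" "v \<in> verts Q \<Longrightarrow> dim_col (b v) = ds 0 v"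
  using b by blast+

lemma P_dim: "m \<le> l \<Longrightarrow> v \<in> verts Q \<Longrightarrow> dim_row (P v m) = ds m v" "m \<le> l \<Longrightarrow> v \<in> verts Q \<Longrightarrow> dim_col (P v m) = ds 0 v"
  by (rule PI_dim[OF unitri_tp], assumption+)+

text \<open>
  The tangent direction of the gauge transformation \<open>1 + t b\<close> at step
  \<open>0\<close>. At the later steps the gauge transformation must keep the form \<open>(1 |
  *)\<close> of the projections, which forces it to be \<open>1 + t bm v m\<close>.
\<close>

definition gdir :: "('v, 'e) coord \<Rightarrow> complex" where
  "gdir k = (case k of
      CA e r c \<Rightarrow> (b (head Q e) * tA y e - A0 e * (b (tail Q e) * I0 (tail Q e) l)) $$ (r, c)
    | CB e r c \<Rightarrow> (b (tail Q e) * tB y e - B0 e * (b (head Q e) * I0 (head Q e) l)) $$ (r, c)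
    | CI v r c \<Rightarrow> (b v * tI y v) $$ (r, c)
    | CJ v r c \<Rightarrow> (0\<^sub>m (f v) (ds l v) - J0 v * (b v * I0 v l)) $$ (r, c)
    | CP m v r c \<Rightarrow> (bm v (Suc m) * tp y m v - tp y m v * bm v m) $$ (r, c))"

abbreviation "h \<equiv> vecof gdir"
abbreviation "yt t \<equiv> val (z + t \<cdot>\<^sub>v h)"

lemma line0: "z + 0 \<cdot>\<^sub>v h = z"
proof -
  have "0 \<cdot>\<^sub>v h = 0\<^sub>v N" by (intro eq_vecI) (auto simp: vecof_def)
  then show ?thesis using z by simp
qed

lemma rep0_dims:
  "e \<in> arcs Q \<Longrightarrow> dim_row (A0 e) = ds 0 (head Q e)" "e \<in> arcs Q \<Longrightarrow> dim_col (A0 e) = ds 0 (tail Q e)"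
  "e \<in> arcs Q \<Longrightarrow> dim_row (B0 e) = ds 0 (tail Q e)" "e \<in> arcs Q \<Longrightarrow> dim_col (B0 e) = ds 0 (head Q e)"
  "v \<in> verts Q \<Longrightarrow> dim_row (J0 v) = f v" "v \<in> verts Q \<Longrightarrow> dim_col (J0 v) = ds 0 v"
  using qreps_dim[OF rep0_qreps[of y]] by auto

lemma rep0_eq:
  "e \<in> arcs Q \<Longrightarrow> A0 e = tA y e * P (tail Q e) l" "e \<in> arcs Q \<Longrightarrow> B0 e = tB y e * P (head Q e) l"
  "v \<in> verts Q \<Longrightarrow> J0 v = tJ y v * P v l" "v \<in> verts Q \<Longrightarrow> imap (rep0 y) v = tI y v"
  by (simp_all add: rep0_def)

lemma dir_t:
  "e \<in> arcs Q \<Longrightarrow> tA (val h) e = b (head Q e) * tA y e - A0 e * (b (tail Q e) * I0 (tail Q e) l)"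
  "e \<in> arcs Q \<Longrightarrow> tB (val h) e = b (tail Q e) * tB y e - B0 e * (b (head Q e) * I0 (head Q e) l)"
  "v \<in> verts Q \<Longrightarrow> tI (val h) v = b v * tI y v"
  "v \<in> verts Q \<Longrightarrow> tJ (val h) v = 0\<^sub>m (f v) (ds l v) - J0 v * (b v * I0 v l)"
  by (rule eq_matI; simp add: tA_def[of "val h"] tB_def[of "val h"] tI_def[of "val h"] tJ_def[of "val h"]
      val_vecof gdir_def b_dim rep0_dims del: index_mult_mat(1) index_minus_mat(1))+

lemma dir_tp:
  assumes m: "m < l" and v: "v \<in> verts Q"
  shows "tp_dir (val h) m v = bm v (Suc m) * tp y m v - tp y m v * bm v m"
proof (rule eq_matI)
  let ?M = "bm v (Suc m) * tp y m v - tp y m v * bm v m"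
  have S: "m \<le> l" "Suc m \<le> l" using m by auto
  note dims = P_dim[OF S(1) v] P_dim[OF S(2) v] b_dim[OF v]
  have M: "?M \<in> carrier_mat (ds (Suc m) v) (ds m v)"
    by (auto intro!: carrier_matI simp: dims)
  have i: "inc (ds m v) (ds (Suc m) v) \<in> carrier_mat (ds m v) (ds (Suc m) v)" by simp
  have ii: "I0 v m * inc (ds m v) (ds (Suc m) v) = I0 v (Suc m)"
    using dec[OF m v] dec'[OF le0 S(1) v] by (simp add: inc_comp)
  have ti: "tp y m v * inc (ds m v) (ds (Suc m) v) = 1\<^sub>m (ds (Suc m) v)"
    using unitri_tp m v by (simp add: unitri_def)
  have "?M * inc (ds m v) (ds (Suc m) v) =
      bm v (Suc m) * (tp y m v * inc (ds m v) (ds (Suc m) v)) - tp y m v * (P v m * (b v * (I0 v m * inc (ds m v) (ds (Suc m) v))))"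
    by (simp add: mat_distrib mat_assoc dims del: pi_comp.simps)
  also have "\<dots> = bm v (Suc m) - bm v (Suc m)"
    unfolding ti ii by (simp add: mat_assoc dims)
  also have "\<dots> = 0\<^sub>m (ds (Suc m) v) (ds (Suc m) v)"
    by (rule minus_r_inv_mat) (auto intro!: carrier_matI simp: dims)
  finally have z0: "?M * inc (ds m v) (ds (Suc m) v) = 0\<^sub>m (ds (Suc m) v) (ds (Suc m) v)" .
  fix r c assume "r < dim_row ?M" "c < dim_col ?M"
  then have rc: "r < ds (Suc m) v" "c < ds m v" using M by auto
  show "tp_dir (val h) m v $$ (r, c) = ?M $$ (r, c)"
  proof (cases "c < ds (Suc m) v")
    case True
    have "?M $$ (r, c) = (?M * inc (ds m v) (ds (Suc m) v)) $$ (r, c)"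
      by (rule mult_inc_index[OF M dec[OF m v] rc(1) True, symmetric])
    then show ?thesis using rc True unfolding z0 by (simp add: tp_dir_def)
  next
    case False
    then show ?thesis using rc m v by (simp add: tp_dir_def val_vecof gdir_def del: pi_comp.simps)
  qed
qed (use m v in \<open>auto simp: tp_dir_def P_dim b_dim\<close>)

lemma P_mder:
  assumes v: "v \<in> verts Q"
  shows "m \<le> l \<Longrightarrow> mder (ds m v) (ds 0 v) (\<lambda>t. PI (tp (yt t)) v m) (bm v m * P v m - P v m * b v)"
proof (induction m)
  case 0
  have "b v - b v = 0\<^sub>m (ds 0 v) (ds 0 v)" by (rule minus_r_inv_mat[OF b[OF v]])
  then show ?case using mder_const[of "1\<^sub>m (ds 0 v)" "ds 0 v" "ds 0 v"] b[OF v] by simp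
next
  case (Suc m)
  then have m: "m < l" "m \<le> l" by auto
  note dims = P_dim[OF m(2) v] P_dim[OF Suc(2) v] b_dim[OF v]
  have "mder (ds (Suc m) v) (ds 0 v) (\<lambda>t. PI (tp (yt t)) v (Suc m))
     (tp_dir (val h) m v * PI (tp (yt 0)) v m + tp (yt 0) m v * (bm v m * P v m - P v m * b v))"
    unfolding pi_comp.simps
    by (rule mder_mult[OF t_mder(5)[OF z vecof_carrier m(1) v] Suc.IH[OF m(2)]])
  moreover have "tp_dir (val h) m v * PI (tp (yt 0)) v m + tp (yt 0) m v * (bm v m * P v m - P v m * b v)
      = bm v (Suc m) * P v (Suc m) - P v (Suc m) * b v"
  proof -
    have "tp_dir (val h) m v * P v m + tp y m v * (bm v m * P v m - P v m * b v) =
        (bm v (Suc m) * (tp y m v * P v m) - tp y m v * (bm v m * P v m)) + (tp y m v * (bm v m * P v m) - tp y m v * (P v m * b v))"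
      unfolding dir_tp[OF m(1) v] by (simp add: mat_distrib mat_assoc dims del: pi_comp.simps)
    also have "\<dots> = bm v (Suc m) * (tp y m v * P v m) - tp y m v * (P v m * b v)"
      by (rule mat_telescope[of _ "ds (Suc m) v" "ds 0 v"]) (auto intro!: carrier_matI simp: dims simp del: pi_comp.simps)
    finally show ?thesis unfolding line0 by (simp add: mat_assoc dims)
  qed
  ultimately show ?case by simp
qed

text \<open>
  In the direction \<open>gdir\<close> the first representation moves by the infinitesimal action
  of \<open>b\<close>.
\<close>

lemma rep0_mder:
  "e \<in> arcs Q \<Longrightarrow> mder (ds 0 (head Q e)) (ds 0 (tail Q e)) (\<lambda>t. Amap (rep0 (yt t)) e) (b (head Q e) * A0 e - A0 e * b (tail Q e))"
  "e \<in> arcs Q \<Longrightarrow> mder (ds 0 (tail Q e)) (ds 0 (head Q e)) (\<lambda>t. Bmap (rep0 (yt t)) e) (b (tail Q e) * B0 e - B0 e * b (head Q e))"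
  "v \<in> verts Q \<Longrightarrow> mder (ds 0 v) (f v) (\<lambda>t. imap (rep0 (yt t)) v) (b v * imap (rep0 y) v)"
  "v \<in> verts Q \<Longrightarrow> mder (f v) (ds 0 v) (\<lambda>t. jmap (rep0 (yt t)) v) (0\<^sub>m (f v) (ds 0 v) - J0 v * b v)"
proof -
  note zh = z vecof_carrier[of gdir]
  have key: "(X - T * P u l * (b u * I0 u l)) * P u l + T * (bm u l * P u l - P u l * b u) = X * P u l - T * P u l * b u"
    if u: "u \<in> verts Q" and T: "T \<in> carrier_mat n (ds l u)" and X: "X \<in> carrier_mat n (ds l u)" for X T u n
  proof -
    note dims = P_dim[OF order_refl u] b_dim[OF u] carrier_matD[OF T] carrier_matD[OF X]
    have "(X - T * P u l * (b u * I0 u l)) * P u l + T * (bm u l * P u l - P u l * b u)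
      = (X * P u l - T * (P u l * (b u * (I0 u l * P u l)))) + (T * (P u l * (b u * (I0 u l * P u l))) - T * (P u l * b u))"
      by (simp add: mat_distrib mat_assoc dims)
    also have "\<dots> = X * P u l - T * (P u l * b u)"
      by (rule mat_telescope[of _ n "ds 0 u"]) (auto intro!: carrier_matI simp: dims)
    finally show ?thesis by (simp add: mat_assoc dims)
  qed
  show "mder (ds 0 (head Q e)) (ds 0 (tail Q e)) (\<lambda>t. Amap (rep0 (yt t)) e) (b (head Q e) * A0 e - A0 e * b (tail Q e))"
    if e: "e \<in> arcs Q"
  proof -
    note dims = P_dim[OF order_refl tail_in[OF e]] b_dim[OF head_in[OF e]] b_dim[OF tail_in[OF e]]
    have "mder (ds 0 (head Q e)) (ds 0 (tail Q e)) (\<lambda>t. tA (yt t) e * PI (tp (yt t)) (tail Q e) l)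
       (tA (val h) e * PI (tp (yt 0)) (tail Q e) l + tA (yt 0) e * (bm (tail Q e) l * P (tail Q e) l - P (tail Q e) l * b (tail Q e)))"
      by (rule mder_mult[OF t_mder(1)[OF zh e] P_mder[OF tail_in[OF e] order_refl]])
    moreover have "tA (val h) e * P (tail Q e) l + tA y e * (bm (tail Q e) l * P (tail Q e) l - P (tail Q e) l * b (tail Q e))
       = b (head Q e) * tA y e * P (tail Q e) l - tA y e * P (tail Q e) l * b (tail Q e)"
      unfolding dir_t(1)[OF e] rep0_eq(1)[OF e]
      by (rule key[OF tail_in[OF e] t_carrier(1)]) (auto intro!: carrier_matI simp: dims)
    ultimately show ?thesis
      using e unfolding line0 by (simp add: rep0_def mat_assoc dims)
  qed
  show "mder (ds 0 (tail Q e)) (ds 0 (head Q e)) (\<lambda>t. Bmap (rep0 (yt t)) e) (b (tail Q e) * B0 e - B0 e * b (head Q e))"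
    if e: "e \<in> arcs Q"
  proof -
    note dims = P_dim[OF order_refl head_in[OF e]] b_dim[OF head_in[OF e]] b_dim[OF tail_in[OF e]]
    have "mder (ds 0 (tail Q e)) (ds 0 (head Q e)) (\<lambda>t. tB (yt t) e * PI (tp (yt t)) (head Q e) l)
       (tB (val h) e * PI (tp (yt 0)) (head Q e) l + tB (yt 0) e * (bm (head Q e) l * P (head Q e) l - P (head Q e) l * b (head Q e)))"
      by (rule mder_mult[OF t_mder(2)[OF zh e] P_mder[OF head_in[OF e] order_refl]])
    moreover have "tB (val h) e * P (head Q e) l + tB y e * (bm (head Q e) l * P (head Q e) l - P (head Q e) l * b (head Q e))
       = b (tail Q e) * tB y e * P (head Q e) l - tB y e * P (head Q e) l * b (head Q e)"
      unfolding dir_t(2)[OF e] rep0_eq(2)[OF e]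
      by (rule key[OF head_in[OF e] t_carrier(2)]) (auto intro!: carrier_matI simp: dims)
    ultimately show ?thesis
      using e unfolding line0 by (simp add: rep0_def mat_assoc dims)
  qed
  show "v \<in> verts Q \<Longrightarrow> mder (ds 0 v) (f v) (\<lambda>t. imap (rep0 (yt t)) v) (b v * imap (rep0 y) v)"
    using t_mder(3)[OF zh, of v] by (simp add: rep0_def dir_t)
  show "mder (f v) (ds 0 v) (\<lambda>t. jmap (rep0 (yt t)) v) (0\<^sub>m (f v) (ds 0 v) - J0 v * b v)" if v: "v \<in> verts Q"
  proof -
    note dims = P_dim[OF order_refl v] b_dim[OF v]
    have "mder (f v) (ds 0 v) (\<lambda>t. tJ (yt t) v * PI (tp (yt t)) v l)
       (tJ (val h) v * PI (tp (yt 0)) v l + tJ (yt 0) v * (bm v l * P v l - P v l * b v))"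
      by (rule mder_mult[OF t_mder(4)[OF zh v] P_mder[OF v order_refl]])
    moreover have "tJ (val h) v * P v l + tJ y v * (bm v l * P v l - P v l * b v) = 0\<^sub>m (f v) (ds l v) * P v l - tJ y v * P v l * b v"
      unfolding dir_t(4)[OF v] rep0_eq(3)[OF v] by (rule key[OF v t_carrier(4)]) simp
    ultimately show ?thesis
      using v unfolding line0 by (simp add: rep0_def dims left_mult_zero_mat[OF PI_carrier[OF unitri_tp order_refl v]])
  qed
qed

lemma ev_mder:
  "valid f w \<Longrightarrow> mder (ds 0 (target w)) 1 (\<lambda>t. vmat (ds 0 (target w)) (ev (rep0 (yt t)) w)) (b (target w) * vmat (ds 0 (target w)) (ev (rep0 y) w))"
proof (induction w)
  case (Gen v k)
  then have v: "v \<in> verts Q" "k < f v" by auto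
  note d = rep0_mder(3)[OF v(1)]
  have c: "imap (rep0 y') v \<in> carrier_mat (ds 0 v) (f v)" for y' using qreps_carrier(3)[OF rep0_qreps v(1)] .
  have bi: "b v * imap (rep0 y) v \<in> carrier_mat (ds 0 v) (f v)" using mult_carrier_mat[OF b[OF v(1)] c] .
  have "(b v * vmat (ds 0 v) (col (imap (rep0 y) v) k)) $$ (r, 0) = (b v * imap (rep0 y) v) $$ (r, k)" if r: "r < ds 0 v" for r
    using r v c[of y] mult_mat_index[OF b[OF v(1)] vmat_carrier r, of 0] mult_mat_index[OF b[OF v(1)] c r v(2)]
    by (simp add: vmat_def del: index_mult_mat(1))
  moreover have "vmat (ds 0 v) (col (imap (rep0 (yt t)) v) k) $$ (r, 0) = imap (rep0 (yt t)) v $$ (r, k)" if "r < ds 0 v" for r t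
    using that v c[of "yt t"] by (simp add: vmat_def)
  ultimately show ?case
    using mder_entry[OF d _ v(2)] mult_carrier_mat[OF b[OF v(1)] vmat_carrier]
    by (auto simp: mder_def simp del: index_mult_mat(1) One_nat_def)
next
  case (StepA e w)
  then have e: "e \<in> arcs Q" "target w = tail Q e" "valid f w" by auto
  have u: "ev (rep0 y') w \<in> carrier_vec (ds 0 (tail Q e))" for y' using ev_carrier[OF rep0_qreps e(3)] e(2) by simp
  let ?u = "vmat (ds 0 (tail Q e)) (ev (rep0 y) w)"
  note A = qreps_carrier(1)[OF rep0_qreps e(1)]
  note dims = carrier_matD[OF A[of y]] b_dim[OF head_in[OF e(1)]] b_dim[OF tail_in[OF e(1)]] carrier_matD[OF vmat_carrier]
  have "mder (ds 0 (head Q e)) 1 (\<lambda>t. Amap (rep0 (yt t)) e * vmat (ds 0 (tail Q e)) (ev (rep0 (yt t)) w))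
    ((b (head Q e) * A0 e - A0 e * b (tail Q e)) * vmat (ds 0 (tail Q e)) (ev (rep0 (yt 0)) w) + Amap (rep0 (yt 0)) e * (b (tail Q e) * ?u))"
    using mder_mult[OF rep0_mder(1)[OF e(1)]] StepA.IH[OF e(3)] e(2) by simp
  moreover have "(b (head Q e) * A0 e - A0 e * b (tail Q e)) * ?u + A0 e * (b (tail Q e) * ?u) = b (head Q e) * (A0 e * ?u)"
  proof -
    have "(b (head Q e) * A0 e - A0 e * b (tail Q e)) * ?u + A0 e * (b (tail Q e) * ?u) =
       (b (head Q e) * (A0 e * ?u) - A0 e * (b (tail Q e) * ?u)) + A0 e * (b (tail Q e) * ?u)"
      by (simp add: mat_distrib mat_assoc dims)
    also have "\<dots> = b (head Q e) * (A0 e * ?u)"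
      by (rule mat_cancel[of _ "ds 0 (head Q e)" 1]) (auto intro!: carrier_matI simp: dims)
    finally show ?thesis .
  qed
  ultimately show ?case unfolding line0 by (simp add: mult_vmat[OF A u])
next
  case (StepB e w)
  then have e: "e \<in> arcs Q" "target w = head Q e" "valid f w" by auto
  have u: "ev (rep0 y') w \<in> carrier_vec (ds 0 (head Q e))" for y' using ev_carrier[OF rep0_qreps e(3)] e(2) by simp
  let ?u = "vmat (ds 0 (head Q e)) (ev (rep0 y) w)"
  note B = qreps_carrier(2)[OF rep0_qreps e(1)]
  note dims = carrier_matD[OF B[of y]] b_dim[OF head_in[OF e(1)]] b_dim[OF tail_in[OF e(1)]] carrier_matD[OF vmat_carrier]
  have "mder (ds 0 (tail Q e)) 1 (\<lambda>t. Bmap (rep0 (yt t)) e * vmat (ds 0 (head Q e)) (ev (rep0 (yt t)) w))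
    ((b (tail Q e) * B0 e - B0 e * b (head Q e)) * vmat (ds 0 (head Q e)) (ev (rep0 (yt 0)) w) + Bmap (rep0 (yt 0)) e * (b (head Q e) * ?u))"
    using mder_mult[OF rep0_mder(2)[OF e(1)]] StepB.IH[OF e(3)] e(2) by simp
  moreover have "(b (tail Q e) * B0 e - B0 e * b (head Q e)) * ?u + B0 e * (b (head Q e) * ?u) = b (tail Q e) * (B0 e * ?u)"
  proof -
    have "(b (tail Q e) * B0 e - B0 e * b (head Q e)) * ?u + B0 e * (b (head Q e) * ?u) =
       (b (tail Q e) * (B0 e * ?u) - B0 e * (b (head Q e) * ?u)) + B0 e * (b (head Q e) * ?u)"
      by (simp add: mat_distrib mat_assoc dims)
    also have "\<dots> = b (tail Q e) * (B0 e * ?u)"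
      by (rule mat_cancel[of _ "ds 0 (tail Q e)" 1]) (auto intro!: carrier_matI simp: dims)
    finally show ?thesis .
  qed
  ultimately show ?case unfolding line0 by (simp add: mult_vmat[OF B u])
qed

text \<open>
  The values of words move by \<open>b\<close> as vectors do, and at \<open>z\<close> they are the
  unit vectors.
\<close>

lemma wmat_mder:
  assumes v: "v \<in> verts Q"
  shows "mder (ds 0 v) (ds 0 v) (\<lambda>t. wmat (ds 0) (rep0 (yt t)) L v) (b v)"
  unfolding mder_def
proof (intro conjI allI impI wmat_carrier b[OF v])
  fix r c assume rc: "r < ds 0 v" "c < ds 0 v"
  have lv: "valid f (L v c)" "target (L v c) = v" using L v rc by (auto simp: word_family_def)
  have u: "ev (rep0 y) (L v c) = unit_vec (ds 0 v) c"
    using col_wmat[OF rep0_qreps L v rc(2), of y] s v rc(2) by (simp add: sol_def)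
  have "((\<lambda>t. vmat (ds 0 v) (ev (rep0 (yt t)) (L v c)) $$ (r, 0)) has_field_derivative
      (b v * vmat (ds 0 v) (unit_vec (ds 0 v) c)) $$ (r, 0)) (at 0)"
    using mder_entry[OF ev_mder[OF lv(1)], of r 0] rc unfolding lv(2) u by simp
  moreover have "(b v * vmat (ds 0 v) (unit_vec (ds 0 v) c)) $$ (r, 0) = b v $$ (r, c)"
  proof -
    have "(b v * vmat (ds 0 v) (unit_vec (ds 0 v) c)) $$ (r, 0) = vmat (ds 0 v) (b v *\<^sub>v unit_vec (ds 0 v) c) $$ (r, 0)"
      using mult_vmat[OF b[OF v]] by simp
    also have "\<dots> = b v $$ (r, c)" using rc b[OF v] by (simp add: vmat_def)
    finally show ?thesis .
  qed
  ultimately show "((\<lambda>t. wmat (ds 0) (rep0 (yt t)) L v $$ (r, c)) has_field_derivative b v $$ (r, c)) (at 0)"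
    using rc by (simp add: wmat_def vmat_def)
qed

lemma moment_mder:
  assumes v: "v \<in> verts Q"
  shows "mder (ds 0 v) (ds 0 v) (\<lambda>t. moment Q (ds 0) (rep0 (yt t)) v)
    (b v * moment Q (ds 0) (rep0 y) v - moment Q (ds 0) (rep0 y) v * b v)"
proof -
  let ?H = "{e \<in> arcs Q. head Q e = v}" and ?T = "{e \<in> arcs Q. tail Q e = v}"
  have comm: "(X1 * A - A * X2) * B + A * (X2 * B - B * X1) = X1 * (A * B) - A * B * X1"
    if "A \<in> carrier_mat n m" "B \<in> carrier_mat m n" "X1 \<in> carrier_mat n n" "X2 \<in> carrier_mat m m" for A B X1 X2 :: "complex mat" and n m
  proof -
    note dims = that[THEN carrier_matD(1)] that[THEN carrier_matD(2)]
    have "(X1 * A - A * X2) * B + A * (X2 * B - B * X1) = (X1 * (A * B) - A * (X2 * B)) + (A * (X2 * B) - A * (B * X1))"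
      by (simp add: mat_distrib mat_assoc dims)
    also have "\<dots> = X1 * (A * B) - A * (B * X1)"
      by (rule mat_telescope[of _ n n]) (auto intro!: carrier_matI simp: dims)
    finally show ?thesis by (simp add: mat_assoc dims)
  qed
  note q = qreps_carrier[OF rep0_qreps[of y]]
  let ?S1 = "msum (ds 0 v) (ds 0 v) (\<lambda>e. A0 e * B0 e) ?H" and ?S2 = "msum (ds 0 v) (ds 0 v) (\<lambda>e. B0 e * A0 e) ?T"
  have c1: "A0 e * B0 e \<in> carrier_mat (ds 0 v) (ds 0 v)" if "e \<in> ?H" for e
    using that mult_carrier_mat[OF q(1,2), of e] by auto
  have c2: "B0 e * A0 e \<in> carrier_mat (ds 0 v) (ds 0 v)" if "e \<in> ?T" for e
    using that mult_carrier_mat[OF q(2,1), of e] by auto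
  have 1: "mder (ds 0 v) (ds 0 v) (\<lambda>t. msum (ds 0 v) (ds 0 v) (\<lambda>e. Amap (rep0 (yt t)) e * Bmap (rep0 (yt t)) e) ?H)
      (b v * ?S1 - ?S1 * b v)"
  proof -
    have M: "mder (ds 0 v) (ds 0 v) (\<lambda>t. Amap (rep0 (yt t)) e * Bmap (rep0 (yt t)) e) (b v * (A0 e * B0 e) - A0 e * B0 e * b v)"
      if "e \<in> ?H" for e
    proof -
      have e: "e \<in> arcs Q" "head Q e = v" using that by auto
      show ?thesis
        using mder_mult[OF rep0_mder(1)[OF e(1)] rep0_mder(2)[OF e(1)], unfolded line0]
          comm[OF q(1,2)[OF e(1)] b[OF head_in[OF e(1)]] b[OF tail_in[OF e(1)]]]
        unfolding e(2) by simp
    qed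
    have m1: "b v * ?S1 = msum (ds 0 v) (ds 0 v) (\<lambda>e. b v * (A0 e * B0 e)) ?H" by (rule mult_msum[OF b[OF v] c1])
    have m2: "?S1 * b v = msum (ds 0 v) (ds 0 v) (\<lambda>e. A0 e * B0 e * b v) ?H" by (rule msum_mult[OF b[OF v] c1])
    from mder_msum[OF M]
    have "mder (ds 0 v) (ds 0 v) (\<lambda>t. msum (ds 0 v) (ds 0 v) (\<lambda>e. Amap (rep0 (yt t)) e * Bmap (rep0 (yt t)) e) ?H)
      (msum (ds 0 v) (ds 0 v) (\<lambda>e. b v * (A0 e * B0 e) - A0 e * B0 e * b v) ?H)" .
    also have "msum (ds 0 v) (ds 0 v) (\<lambda>e. b v * (A0 e * B0 e) - A0 e * B0 e * b v) ?H = b v * ?S1 - ?S1 * b v"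
      unfolding m1 m2 by (rule msum_minus[OF mult_carrier_mat[OF c1 b[OF v]]])
    finally show ?thesis .
  qed
  have 2: "mder (ds 0 v) (ds 0 v) (\<lambda>t. msum (ds 0 v) (ds 0 v) (\<lambda>e. Bmap (rep0 (yt t)) e * Amap (rep0 (yt t)) e) ?T)
      (b v * ?S2 - ?S2 * b v)"
  proof -
    have M: "mder (ds 0 v) (ds 0 v) (\<lambda>t. Bmap (rep0 (yt t)) e * Amap (rep0 (yt t)) e) (b v * (B0 e * A0 e) - B0 e * A0 e * b v)"
      if "e \<in> ?T" for e
    proof -
      have e: "e \<in> arcs Q" "tail Q e = v" using that by auto
      show ?thesis
        using mder_mult[OF rep0_mder(2)[OF e(1)] rep0_mder(1)[OF e(1)], unfolded line0]
          comm[OF q(2,1)[OF e(1)] b[OF tail_in[OF e(1)]] b[OF head_in[OF e(1)]]]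
        unfolding e(2) by simp
    qed
    have m1: "b v * ?S2 = msum (ds 0 v) (ds 0 v) (\<lambda>e. b v * (B0 e * A0 e)) ?T" by (rule mult_msum[OF b[OF v] c2])
    have m2: "?S2 * b v = msum (ds 0 v) (ds 0 v) (\<lambda>e. B0 e * A0 e * b v) ?T" by (rule msum_mult[OF b[OF v] c2])
    from mder_msum[OF M]
    have "mder (ds 0 v) (ds 0 v) (\<lambda>t. msum (ds 0 v) (ds 0 v) (\<lambda>e. Bmap (rep0 (yt t)) e * Amap (rep0 (yt t)) e) ?T)
      (msum (ds 0 v) (ds 0 v) (\<lambda>e. b v * (B0 e * A0 e) - B0 e * A0 e * b v) ?T)" .
    also have "msum (ds 0 v) (ds 0 v) (\<lambda>e. b v * (B0 e * A0 e) - B0 e * A0 e * b v) ?T = b v * ?S2 - ?S2 * b v"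
      unfolding m1 m2 by (rule msum_minus[OF mult_carrier_mat[OF c2 b[OF v]]])
    finally show ?thesis .
  qed
  let ?K = "imap (rep0 y) v * J0 v"
  have K: "?K \<in> carrier_mat (ds 0 v) (ds 0 v)" by (rule mult_carrier_mat[OF q(3,4)[OF v]])
  note dims = carrier_matD[OF q(3)[OF v]] carrier_matD[OF q(4)[OF v]] b_dim[OF v]
  have 3: "mder (ds 0 v) (ds 0 v) (\<lambda>t. imap (rep0 (yt t)) v * jmap (rep0 (yt t)) v) (b v * ?K + (0\<^sub>m (ds 0 v) (ds 0 v) - ?K * b v))"
  proof (rule mder_cong[OF mder_mult[OF rep0_mder(3,4)[OF v], unfolded line0]])
    show "b v * imap (rep0 y) v * J0 v + imap (rep0 y) v * (0\<^sub>m (f v) (ds 0 v) - J0 v * b v) =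
      b v * ?K + (0\<^sub>m (ds 0 v) (ds 0 v) - ?K * b v)"
      using right_mult_zero_mat[OF q(3)[OF v]] by (simp add: mat_distrib mat_assoc dims)
  qed
  have "mder (ds 0 v) (ds 0 v) (\<lambda>t. moment Q (ds 0) (rep0 (yt t)) v)
    ((b v * ?S1 - ?S1 * b v) - (b v * ?S2 - ?S2 * b v) + (b v * ?K + (0\<^sub>m (ds 0 v) (ds 0 v) - ?K * b v)))"
    unfolding moment_def by (rule mder_add[OF mder_diff[OF 1 2] 3])
  also have "(b v * ?S1 - ?S1 * b v) - (b v * ?S2 - ?S2 * b v) + (b v * ?K + (0\<^sub>m (ds 0 v) (ds 0 v) - ?K * b v))
      = (b v * ?S1 - b v * ?S2 + b v * ?K) - (?S1 * b v - ?S2 * b v + ?K * b v)"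
    by (rule mat_regroup) (auto intro!: carrier_matI simp: dims)
  also have "\<dots> = b v * moment Q (ds 0) (rep0 y) v - moment Q (ds 0) (rep0 y) v * b v"
    unfolding moment_def by (simp add: mat_distrib dims)
  finally show ?thesis .
qed

text \<open>
  The moment map moves by its commutator with \<open>b\<close>, which is zero because the moment
  map vanishes at \<open>z\<close>. The projection to the last step is surjective and cancels.
\<close>

lemma tmom_mder:
  assumes v: "v \<in> verts Q"
  shows "mder (ds 0 v) (ds l v) (\<lambda>t. tmom (yt t) v) (0\<^sub>m (ds 0 v) (ds l v))"
proof -
  obtain D where D: "mder (ds 0 v) (ds l v) (\<lambda>t. tmom (yt t) v) D"
    using poly_mder[OF tmom_poly[OF v] z vecof_carrier] by blast
  note Dc = mder_carrier(2)[OF D]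
  have t0: "tmom y v = 0\<^sub>m (ds 0 v) (ds l v)" using s v by (simp add: sol_def)
  have pc: "P v l \<in> carrier_mat (ds l v) (ds 0 v)" by (rule PI_carrier[OF unitri_tp order_refl v])
  note dims = P_dim[OF order_refl v] b_dim[OF v] carrier_matD[OF Dc]
  have m0: "moment Q (ds 0) (rep0 y) v = 0\<^sub>m (ds 0 v) (ds 0 v)"
    unfolding moment_rep0[OF v] t0 by (rule left_mult_zero_mat[OF pc])
  have "mder (ds 0 v) (ds 0 v) (\<lambda>t. moment Q (ds 0) (rep0 (yt t)) v) (D * P v l + tmom y v * (bm v l * P v l - P v l * b v))"
    unfolding moment_rep0[OF v] using mder_mult[OF D P_mder[OF v order_refl], unfolded line0] .
  from mder_unique[OF this moment_mder[OF v]]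
  have "D * P v l + tmom y v * (bm v l * P v l - P v l * b v) = 0\<^sub>m (ds 0 v) (ds 0 v)"
    unfolding m0 using b[OF v] by simp
  moreover have "tmom y v * (bm v l * P v l - P v l * b v) = 0\<^sub>m (ds 0 v) (ds 0 v)"
    unfolding t0 by (rule left_mult_zero_mat) (auto intro!: carrier_matI simp: dims)
  moreover have "D * P v l \<in> carrier_mat (ds 0 v) (ds 0 v)" using Dc pc by (rule mult_carrier_mat)
  ultimately have DP: "D * P v l = 0\<^sub>m (ds 0 v) (ds 0 v)" by simp
  have "D = D * (P v l * I0 v l)" using PI_I0[OF unitri_tp order_refl v, of y] Dc by simp
  also have "\<dots> = (D * P v l) * I0 v l" by (simp add: mat_assoc dims)
  also have "\<dots> = 0\<^sub>m (ds 0 v) (ds l v)" unfolding DP by simp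
  finally show ?thesis using D by simp
qed

end

end

lemma mder_mult_left: "A \<in> carrier_mat n k \<Longrightarrow> mder k m F D \<Longrightarrow> mder n m (\<lambda>t. A * F t) (A * D)"
proof -
  assume A: "A \<in> carrier_mat n k" and F: "mder k m F D"
  have "0\<^sub>m n k * F 0 + A * D = A * D"
    using left_mult_zero_mat[OF mder_carrier(1)[OF F], of n 0] left_add_zero_mat[OF mult_carrier_mat[OF A mder_carrier(2)[OF F]]] by simp
  then show ?thesis using mder_mult[OF mder_const[OF A] F] by simp
qed

lemma sum_three: "(\<Sum>v\<in>S. a v - b v + c v) = sum a S - sum b S + (sum c S :: complex)"
  by (simp add: sum.distrib sum_subtractf)

lemma pair_zero_left: "M \<in> carrier_mat n m \<Longrightarrow> pair (0\<^sub>m m n) M = 0"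
  by (simp add: pair_def)

context parabolic_chain
begin

lemma sum_by_vertex:
  assumes "\<And>e. e \<in> arcs Q \<Longrightarrow> p e \<in> verts Q"
  shows "(\<Sum>v\<in>verts Q. \<Sum>e\<in>{e \<in> arcs Q. p e = v}. g v e) = (\<Sum>e\<in>arcs Q. g (p e) e :: complex)"
proof -
  have "(\<Sum>v\<in>verts Q. \<Sum>e\<in>{e \<in> arcs Q. p e = v}. g v e) = (\<Sum>v\<in>verts Q. \<Sum>e\<in>{e \<in> arcs Q. p e = v}. g (p e) e)"
    by (intro sum.cong refl) auto
  also have "\<dots> = (\<Sum>e\<in>arcs Q. g (p e) e)"
    by (rule sum.group) (use assms in auto)
  finally show ?thesis .
qed

text \<open>
  With fixed projections the moment map is bilinear in the remaining coordinates, and each arrow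
  contributes at its head and at its tail.
\<close>

lemma pairing_fixed_projections:
  fixes X :: "'v \<Rightarrow> complex mat" and z k
  defines "x \<equiv> val z" and "dx \<equiv> val k"
  assumes z: "z \<in> carrier_vec N" and k: "k \<in> carrier_vec N"
    and fixp: "\<And>m v r c. CP m v r c \<in> Idx \<Longrightarrow> val k (CP m v r c) = 0"
  obtains D where "\<And>v. v \<in> verts Q \<Longrightarrow> mder (ds 0 v) (ds l v) (\<lambda>t. tmom (val (z + t \<cdot>\<^sub>v k)) v) (D v)"
    "\<And>X. (\<Sum>v\<in>verts Q. pair (X v) (D v)) =
      (\<Sum>e\<in>arcs Q. (pair (X (head Q e)) (tA dx e * (PI (tp x) (tail Q e) l * tB x e))
          + pair (X (head Q e)) (tA x e * (PI (tp x) (tail Q e) l * tB dx e)))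
          - (pair (X (tail Q e)) (tB dx e * (PI (tp x) (head Q e) l * tA x e))
          + pair (X (tail Q e)) (tB x e * (PI (tp x) (head Q e) l * tA dx e)))) +
      (\<Sum>v\<in>verts Q. pair (X v) (tI dx v * tJ x v) + pair (X v) (tI x v * tJ dx v))"
proof -
  have z0: "z + 0 \<cdot>\<^sub>v k = z"
  proof -
    have "0 \<cdot>\<^sub>v k = 0\<^sub>v N" using k by (intro eq_vecI) auto
    then show ?thesis using z by simp
  qed
  let ?P = "\<lambda>v. PI (tp x) v l"
  have pc: "?P v \<in> carrier_mat (ds l v) (ds 0 v)" if "v \<in> verts Q" for v
    by (rule PI_carrier[OF unitri_tp order_refl that])
  have tpc: "tp (val (z + t \<cdot>\<^sub>v k)) m v = tp x m v" if "m < l" "v \<in> verts Q" for t m v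
    using that by (intro eq_matI) (auto simp: tp_def x_def val_line[OF z k] fixp)
  have Pc: "PI (tp (val (z + t \<cdot>\<^sub>v k))) v l = ?P v" if "v \<in> verts Q" for t v
    by (rule pi_comp_cong) (use tpc that in simp)
  note d = t_mder[OF z k]
  let ?H = "\<lambda>v. {e \<in> arcs Q. head Q e = v}" and ?T = "\<lambda>v. {e \<in> arcs Q. tail Q e = v}"
  let ?F1 = "\<lambda>e. tA dx e * (?P (tail Q e) * tB x e)" and ?F2 = "\<lambda>e. tA x e * (?P (tail Q e) * tB dx e)"
  let ?G1 = "\<lambda>e. tB dx e * (?P (head Q e) * tA x e)" and ?G2 = "\<lambda>e. tB x e * (?P (head Q e) * tA dx e)"
  define D where "D v = msum (ds 0 v) (ds l v) (\<lambda>e. ?F1 e + ?F2 e) (?H v) - msum (ds 0 v) (ds l v) (\<lambda>e. ?G1 e + ?G2 e) (?T v)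
     + (tI dx v * tJ x v + tI x v * tJ dx v)" for v
  have F: "?F1 e \<in> carrier_mat (ds 0 (head Q e)) (ds l (head Q e))" "?F2 e \<in> carrier_mat (ds 0 (head Q e)) (ds l (head Q e))"
    if "e \<in> arcs Q" for e
    by (rule mult_carrier_mat[OF t_carrier(1) mult_carrier_mat[OF pc[OF tail_in[OF that]] t_carrier(2)]])+
  have G: "?G1 e \<in> carrier_mat (ds 0 (tail Q e)) (ds l (tail Q e))" "?G2 e \<in> carrier_mat (ds 0 (tail Q e)) (ds l (tail Q e))"
    if "e \<in> arcs Q" for e
    by (rule mult_carrier_mat[OF t_carrier(2) mult_carrier_mat[OF pc[OF head_in[OF that]] t_carrier(1)]])+
  have K: "tI a v * tJ b v \<in> carrier_mat (ds 0 v) (ds l v)" for a b v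
    by (rule mult_carrier_mat[OF t_carrier(3,4)])
  show thesis
  proof (rule that)
    fix v assume v: "v \<in> verts Q"
    have 1: "mder (ds 0 v) (ds l v) (\<lambda>t. tA (val (z + t \<cdot>\<^sub>v k)) e * (PI (tp (val (z + t \<cdot>\<^sub>v k))) (tail Q e) l * tB (val (z + t \<cdot>\<^sub>v k)) e)) (?F1 e + ?F2 e)"
      if "e \<in> ?H v" for e
    proof -
      have e: "e \<in> arcs Q" "head Q e = v" using that by auto
      show ?thesis
        using mder_mult[OF d(1)[OF e(1)] mder_mult_left[OF pc[OF tail_in[OF e(1)]] d(2)[OF e(1)]]] e(2)
        unfolding Pc[OF tail_in[OF e(1)]] z0 x_def dx_def by simp
    qed
    have 2: "mder (ds 0 v) (ds l v) (\<lambda>t. tB (val (z + t \<cdot>\<^sub>v k)) e * (PI (tp (val (z + t \<cdot>\<^sub>v k))) (head Q e) l * tA (val (z + t \<cdot>\<^sub>v k)) e)) (?G1 e + ?G2 e)"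
      if "e \<in> ?T v" for e
    proof -
      have e: "e \<in> arcs Q" "tail Q e = v" using that by auto
      show ?thesis
        using mder_mult[OF d(2)[OF e(1)] mder_mult_left[OF pc[OF head_in[OF e(1)]] d(1)[OF e(1)]]] e(2)
        unfolding Pc[OF head_in[OF e(1)]] z0 x_def dx_def by simp
    qed
    have 3: "mder (ds 0 v) (ds l v) (\<lambda>t. tI (val (z + t \<cdot>\<^sub>v k)) v * tJ (val (z + t \<cdot>\<^sub>v k)) v) (tI dx v * tJ x v + tI x v * tJ dx v)"
      using mder_mult[OF d(3,4)[OF v]] unfolding z0 x_def dx_def .
    show "mder (ds 0 v) (ds l v) (\<lambda>t. tmom (val (z + t \<cdot>\<^sub>v k)) v) (D v)"
      unfolding tmom_def D_def by (rule mder_add[OF mder_diff[OF mder_msum[OF 1] mder_msum[OF 2]] 3])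
  next
    fix X :: "'v \<Rightarrow> complex mat"
    have pD: "pair (X v) (D v) = (\<Sum>e\<in>?H v. pair (X v) (?F1 e) + pair (X v) (?F2 e)) - (\<Sum>e\<in>?T v. pair (X v) (?G1 e) + pair (X v) (?G2 e))
       + (pair (X v) (tI dx v * tJ x v) + pair (X v) (tI x v * tJ dx v))" if v: "v \<in> verts Q" for v
    proof -
      have h: "pair (X v) (msum (ds 0 v) (ds l v) (\<lambda>e. ?F1 e + ?F2 e) (?H v)) = (\<Sum>e\<in>?H v. pair (X v) (?F1 e) + pair (X v) (?F2 e))"
      proof (subst pair_msum)
        fix e assume "e \<in> ?H v" then show "?F1 e + ?F2 e \<in> carrier_mat (ds 0 v) (ds l v)" using add_carrier_mat[OF F(2)] by auto
      next
        show "(\<Sum>e\<in>?H v. pair (X v) (?F1 e + ?F2 e)) = (\<Sum>e\<in>?H v. pair (X v) (?F1 e) + pair (X v) (?F2 e))"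
          by (rule sum.cong[OF refl], rule pair_add) (use F in auto)
      qed
      have t: "pair (X v) (msum (ds 0 v) (ds l v) (\<lambda>e. ?G1 e + ?G2 e) (?T v)) = (\<Sum>e\<in>?T v. pair (X v) (?G1 e) + pair (X v) (?G2 e))"
      proof (subst pair_msum)
        fix e assume "e \<in> ?T v" then show "?G1 e + ?G2 e \<in> carrier_mat (ds 0 v) (ds l v)" using add_carrier_mat[OF G(2)] by auto
      next
        show "(\<Sum>e\<in>?T v. pair (X v) (?G1 e + ?G2 e)) = (\<Sum>e\<in>?T v. pair (X v) (?G1 e) + pair (X v) (?G2 e))"
          by (rule sum.cong[OF refl], rule pair_add) (use G in auto)
      qed
      show ?thesis
        unfolding D_def
        by (subst pair_add[OF minus_carrier_mat[OF msum_carrier] add_carrier_mat[OF K]], subst pair_diff[OF msum_carrier msum_carrier],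
          subst pair_add[OF K K]) (simp only: h t)
    qed
    have "(\<Sum>v\<in>verts Q. pair (X v) (D v)) =
      (\<Sum>v\<in>verts Q. \<Sum>e\<in>?H v. pair (X v) (?F1 e) + pair (X v) (?F2 e)) - (\<Sum>v\<in>verts Q. \<Sum>e\<in>?T v. pair (X v) (?G1 e) + pair (X v) (?G2 e))
       + (\<Sum>v\<in>verts Q. pair (X v) (tI dx v * tJ x v) + pair (X v) (tI x v * tJ dx v))"
      by (rule trans[OF sum.cong[OF refl pD] sum_three])
    also have "(\<Sum>v\<in>verts Q. \<Sum>e\<in>?H v. pair (X v) (?F1 e) + pair (X v) (?F2 e)) =
        (\<Sum>e\<in>arcs Q. pair (X (head Q e)) (?F1 e) + pair (X (head Q e)) (?F2 e))"
      by (rule sum_by_vertex[OF head_in])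
    also have "(\<Sum>v\<in>verts Q. \<Sum>e\<in>?T v. pair (X v) (?G1 e) + pair (X v) (?G2 e)) =
        (\<Sum>e\<in>arcs Q. pair (X (tail Q e)) (?G1 e) + pair (X (tail Q e)) (?G2 e))"
      by (rule sum_by_vertex[OF tail_in])
    finally show "(\<Sum>v\<in>verts Q. pair (X v) (D v)) =
      (\<Sum>e\<in>arcs Q. (pair (X (head Q e)) (?F1 e) + pair (X (head Q e)) (?F2 e)) - (pair (X (tail Q e)) (?G1 e) + pair (X (tail Q e)) (?G2 e))) +
      (\<Sum>v\<in>verts Q. pair (X v) (tI dx v * tJ x v) + pair (X v) (tI x v * tJ dx v))"
      by (simp only: sum_subtractf)
  qed
qed

definition unit_dir :: "('v, 'e) coord \<Rightarrow> complex vec" where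
  "unit_dir i = vecof (\<lambda>j. if j = i then 1 else 0)"

lemma unit_dir_carrier [simp]: "unit_dir i \<in> carrier_vec N"
  by (simp add: unit_dir_def)

lemma val_unit_dir: "j \<in> Idx \<Longrightarrow> val (unit_dir i) j = (if j = i then 1 else 0)"
  by (simp add: unit_dir_def val_vecof)

lemma t_unit_dir:
  "e \<in> arcs Q \<Longrightarrow> tA (val (unit_dir i)) e = mat (ds 0 (head Q e)) (ds l (tail Q e)) (\<lambda>(r, c). if CA e r c = i then 1 else 0)"
  "e \<in> arcs Q \<Longrightarrow> tB (val (unit_dir i)) e = mat (ds 0 (tail Q e)) (ds l (head Q e)) (\<lambda>(r, c). if CB e r c = i then 1 else 0)"
  "v \<in> verts Q \<Longrightarrow> tI (val (unit_dir i)) v = mat (ds 0 v) (f v) (\<lambda>(r, c). if CI v r c = i then 1 else 0)"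
  "v \<in> verts Q \<Longrightarrow> tJ (val (unit_dir i)) v = mat (f v) (ds l v) (\<lambda>(r, c). if CJ v r c = i then 1 else 0)"
  by (rule eq_matI; simp add: tA_def tB_def tI_def tJ_def val_unit_dir)+

text \<open>
  Gauge directions move the frame by an arbitrary \<open>b\<close> and keep the moment map zero,
  so they detect \<open>Y\<close>. Directions along single entries of \<open>A\<close>,
  \<open>B\<close> and \<open>j\<close> then say that \<open>X\<close> intertwines the
  representation with its last quotient and vanishes on the image of \<open>i\<close>. By
  induction \<open>X\<close> kills the values of all words, among them a basis.
\<close>

lemma eqns_independent:
  assumes L: "word_family (ds 0) f L" and z: "z \<in> carrier_vec N" and s: "sol L (val z)"
    and ker: "\<And>i. i < N \<Longrightarrow> (\<Sum>r<length (eqns L). a r * jacobian N (eqns L) z $$ (r, i)) = 0"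
  shows "\<forall>r<length (eqns L). a r = 0"
proof (rule jacobian_pairing[OF L z ker])
  fix X Y
  assume X: "\<And>v. X v \<in> carrier_mat (ds l v) (ds 0 v)" and Y: "\<And>v. Y v \<in> carrier_mat (ds 0 v) (ds 0 v)"
    and XY: "\<And>k D E. k \<in> carrier_vec N \<Longrightarrow> (\<And>v. v \<in> verts Q \<Longrightarrow> mder (ds 0 v) (ds l v) (\<lambda>t. tmom (val (z + t \<cdot>\<^sub>v k)) v) (D v)) \<Longrightarrow>
      (\<And>v. v \<in> verts Q \<Longrightarrow> mder (ds 0 v) (ds 0 v) (\<lambda>t. wmat (ds 0) (rep0 (val (z + t \<cdot>\<^sub>v k))) L v) (E v)) \<Longrightarrow>
      (\<Sum>v\<in>verts Q. pair (X v) (D v)) + (\<Sum>v\<in>verts Q. pair (Y v) (E v)) = 0"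
    and fin: "(\<And>v. v \<in> verts Q \<Longrightarrow> X v = 0\<^sub>m (ds l v) (ds 0 v)) \<Longrightarrow> (\<And>v. v \<in> verts Q \<Longrightarrow> Y v = 0\<^sub>m (ds 0 v) (ds 0 v)) \<Longrightarrow>
      \<forall>r<length (eqns L). a r = 0"
  \<comment> \<open>The gauge direction of an elementary matrix picks out one entry of \<open>Y\<close>.\<close>
  have Y0: "Y v = 0\<^sub>m (ds 0 v) (ds 0 v)" if v: "v \<in> verts Q" for v
  proof (rule eq_matI)
    fix c0 r0 assume "c0 < dim_row (0\<^sub>m (ds 0 v) (ds 0 v) :: complex mat)" "r0 < dim_col (0\<^sub>m (ds 0 v) (ds 0 v) :: complex mat)"
    then have rc: "r0 < ds 0 v" "c0 < ds 0 v" by auto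
    define b where "b u = (if u = v then elem (ds 0 v) (ds 0 v) r0 c0 else 0\<^sub>m (ds 0 u) (ds 0 u))" for u
    have b: "b u \<in> carrier_mat (ds 0 u) (ds 0 u)" for u by (simp add: b_def)
    have "(\<Sum>u\<in>verts Q. pair (X u) (0\<^sub>m (ds 0 u) (ds l u))) + (\<Sum>u\<in>verts Q. pair (Y u) (b u)) = 0"
      by (rule XY[OF vecof_carrier tmom_mder[OF L z s b] wmat_mder[OF L z s b]])
    moreover have "(\<Sum>u\<in>verts Q. pair (Y u) (b u)) = (\<Sum>u\<in>verts Q. if u = v then pair (Y v) (b v) else 0)"
      by (intro sum.cong refl) (simp add: b_def pair_zero)
    ultimately have "pair (Y v) (b v) = 0" using v by (simp add: pair_zero)
    moreover have "pair (Y v) (b v) = Y v $$ (c0, r0)"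
      using pair_elem_left[OF Y[of v] one_carrier_mat rc]
      by (simp add: b_def right_mult_one_mat[OF elem_carrier] left_mult_one_mat[OF Y])
    ultimately show "Y v $$ (c0, r0) = 0\<^sub>m (ds 0 v) (ds 0 v) $$ (c0, r0)" using rc by simp
  qed (use Y in auto)
  let ?x = "val z"
  let ?P = "\<lambda>v. PI (tp ?x) v l"
  let ?pe = "\<lambda>X k e. (pair (X (head Q e)) (tA (val k) e * (?P (tail Q e) * tB ?x e))
          + pair (X (head Q e)) (tA ?x e * (?P (tail Q e) * tB (val k) e)))
          - (pair (X (tail Q e)) (tB (val k) e * (?P (head Q e) * tA ?x e))
          + pair (X (tail Q e)) (tB ?x e * (?P (head Q e) * tA (val k) e)))"
    and ?pv = "\<lambda>X k v. pair (X v) (tI (val k) v * tJ ?x v) + pair (X v) (tI ?x v * tJ (val k) v)"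
  have P: "?P v \<in> carrier_mat (ds l v) (ds 0 v)" if "v \<in> verts Q" for v
    by (rule PI_carrier[OF unitri_tp order_refl that])
  \<comment> \<open>Along a direction which fixes the projections only the moment map contributes.\<close>
  have XD: "(\<Sum>e\<in>arcs Q. ?pe X k e) +
      (\<Sum>v\<in>verts Q. ?pv X k v) = 0"
    if k: "k \<in> carrier_vec N" and kp: "\<And>m v r c. CP m v r c \<in> Idx \<Longrightarrow> val k (CP m v r c) = 0" for k
  proof (rule pairing_fixed_projections[OF z k kp])
    fix D
    assume D: "\<And>v. v \<in> verts Q \<Longrightarrow> mder (ds 0 v) (ds l v) (\<lambda>t. tmom (val (z + t \<cdot>\<^sub>v k)) v) (D v)"
      and eq: "\<And>X. (\<Sum>v\<in>verts Q. pair (X v) (D v)) = (\<Sum>e\<in>arcs Q. ?pe X k e) +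
      (\<Sum>v\<in>verts Q. ?pv X k v)"
    have "\<exists>E. mder (ds 0 v) (ds 0 v) (\<lambda>t. wmat (ds 0) (rep0 (val (z + t \<cdot>\<^sub>v k))) L v) E" if "v \<in> verts Q" for v
      by (rule poly_mder[OF wmat_fun[OF fun_alg_poly rep0_poly L that] z k])
    then obtain E where E: "\<And>v. v \<in> verts Q \<Longrightarrow> mder (ds 0 v) (ds 0 v) (\<lambda>t. wmat (ds 0) (rep0 (val (z + t \<cdot>\<^sub>v k))) L v) (E v)"
      by metis
    have "(\<Sum>v\<in>verts Q. pair (Y v) (E v)) = 0"
      by (rule sum.neutral) (simp add: Y0 pair_zero_left[OF mder_carrier(2)[OF E]])
    then show ?thesis using XY[OF k D E] eq[of X] by simp
  qed
  \<comment> \<open>Directions along one entry of \<open>A\<close>; \<open>?a\<close> and \<open>?b\<close> are the contributions at the head and at the tail.\<close>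
  have swapA: "?P (tail Q e) * tB ?x e * X (head Q e) = X (tail Q e) * Bmap (rep0 ?x) e" if e: "e \<in> arcs Q" for e
  proof (rule eq_matI)
    note h = head_in[OF e] and t = tail_in[OF e]
    note dims = carrier_matD[OF P[OF h]] carrier_matD[OF P[OF t]] carrier_matD[OF X[of "head Q e"]] carrier_matD[OF X[of "tail Q e"]]
    show "dim_row (?P (tail Q e) * tB ?x e * X (head Q e)) = dim_row (X (tail Q e) * Bmap (rep0 ?x) e)"
      "dim_col (?P (tail Q e) * tB ?x e * X (head Q e)) = dim_col (X (tail Q e) * Bmap (rep0 ?x) e)"
      using dims e by (auto simp: rep0_def)
    fix c0 r0 assume "c0 < dim_row (X (tail Q e) * Bmap (rep0 ?x) e)" "r0 < dim_col (X (tail Q e) * Bmap (rep0 ?x) e)"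
    then have rc: "r0 < ds 0 (head Q e)" "c0 < ds l (tail Q e)" using dims e by (auto simp: rep0_def)
    let ?k = "unit_dir (CA e r0 c0)"
    have dA: "tA (val ?k) e' = (if e' = e then elem (ds 0 (head Q e)) (ds l (tail Q e)) r0 c0 else 0\<^sub>m (ds 0 (head Q e')) (ds l (tail Q e')))"
      if "e' \<in> arcs Q" for e'
      using that by (auto simp: t_unit_dir elem_def intro!: eq_matI)
    have dB: "tB (val ?k) e' = 0\<^sub>m (ds 0 (tail Q e')) (ds l (head Q e'))" if "e' \<in> arcs Q" for e'
      using that by (auto simp: t_unit_dir intro!: eq_matI)
    have dI: "tI (val ?k) v = 0\<^sub>m (ds 0 v) (f v)" "tJ (val ?k) v = 0\<^sub>m (f v) (ds l v)" if "v \<in> verts Q" for v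
      using that by (auto simp: t_unit_dir intro!: eq_matI)
    let ?a = "pair (X (head Q e)) (elem (ds 0 (head Q e)) (ds l (tail Q e)) r0 c0 * (?P (tail Q e) * tB ?x e))"
    let ?b = "pair (X (tail Q e)) (tB ?x e * (?P (head Q e) * elem (ds 0 (head Q e)) (ds l (tail Q e)) r0 c0))"
    have "(\<Sum>e'\<in>arcs Q. if e' = e then ?a - ?b else 0) + (\<Sum>v\<in>verts Q. 0) = 0"
    proof (rule trans[OF _ XD[of ?k]])
      show "val ?k (CP m v r c) = 0" if "CP m v r c \<in> Idx" for m v r c using val_unit_dir[OF that] by simp
      show "(\<Sum>e'\<in>arcs Q. if e' = e then ?a - ?b else 0) + (\<Sum>v\<in>verts Q. 0) =
        (\<Sum>e\<in>arcs Q. ?pe X ?k e) +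
        (\<Sum>v\<in>verts Q. ?pv X ?k v)"
      proof (intro arg_cong2[where f = "(+)"] sum.cong refl)
        fix e' assume e': "e' \<in> arcs Q"
        note P' = P[OF head_in[OF e']] P[OF tail_in[OF e']]
        note z' = left_mult_zero_mat[OF mult_carrier_mat[OF P'(1) t_carrier(1)]] left_mult_zero_mat[OF mult_carrier_mat[OF P'(2) t_carrier(2)]]
          right_mult_zero_mat[OF P'(1)] right_mult_zero_mat[OF P'(2)] right_mult_zero_mat[OF t_carrier(1)] right_mult_zero_mat[OF t_carrier(2)]
        show "(if e' = e then ?a - ?b else 0) = ?pe X ?k e'"
          unfolding dA[OF e'] dB[OF e'] z' by (cases "e' = e") (simp_all add: z' pair_zero)
      next
        fix v assume v: "v \<in> verts Q"
        show "0 = ?pv X ?k v"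
          unfolding dI[OF v] left_mult_zero_mat[OF t_carrier(4)] right_mult_zero_mat[OF t_carrier(3)] by (simp add: pair_zero)
      qed
    qed simp
    then have ab: "?a = ?b" using e by simp
    have "?a = (?P (tail Q e) * tB ?x e * X (head Q e)) $$ (c0, r0)"
      by (rule pair_elem_left[OF X mult_carrier_mat[OF P[OF t] t_carrier(2)] rc])
    moreover have "?b = (X (tail Q e) * Bmap (rep0 ?x) e) $$ (c0, r0)"
    proof -
      have "tB ?x e * (?P (head Q e) * elem (ds 0 (head Q e)) (ds l (tail Q e)) r0 c0) = Bmap (rep0 ?x) e * elem (ds 0 (head Q e)) (ds l (tail Q e)) r0 c0"
        using assoc_mult_mat[OF t_carrier(2) P[OF h] elem_carrier, of ?x "ds l (tail Q e)" r0 c0] e by (simp add: rep0_def)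
      then show ?thesis
        using pair_elem_right[OF X[of "tail Q e"] qreps_carrier(2)[OF rep0_qreps e] rc] by simp
    qed
    ultimately show "(?P (tail Q e) * tB ?x e * X (head Q e)) $$ (c0, r0) = (X (tail Q e) * Bmap (rep0 ?x) e) $$ (c0, r0)"
      using ab by simp
  qed
  \<comment> \<open>Directions along one entry of \<open>B\<close>.\<close>
  have swapB: "?P (head Q e) * tA ?x e * X (tail Q e) = X (head Q e) * Amap (rep0 ?x) e" if e: "e \<in> arcs Q" for e
  proof (rule eq_matI)
    note h = head_in[OF e] and t = tail_in[OF e]
    note dims = carrier_matD[OF P[OF h]] carrier_matD[OF P[OF t]] carrier_matD[OF X[of "head Q e"]] carrier_matD[OF X[of "tail Q e"]]
    show "dim_row (?P (head Q e) * tA ?x e * X (tail Q e)) = dim_row (X (head Q e) * Amap (rep0 ?x) e)"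
      "dim_col (?P (head Q e) * tA ?x e * X (tail Q e)) = dim_col (X (head Q e) * Amap (rep0 ?x) e)"
      using dims e by (auto simp: rep0_def)
    fix c0 r0 assume "c0 < dim_row (X (head Q e) * Amap (rep0 ?x) e)" "r0 < dim_col (X (head Q e) * Amap (rep0 ?x) e)"
    then have rc: "r0 < ds 0 (tail Q e)" "c0 < ds l (head Q e)" using dims e by (auto simp: rep0_def)
    let ?k = "unit_dir (CB e r0 c0)"
    have dB: "tB (val ?k) e' = (if e' = e then elem (ds 0 (tail Q e)) (ds l (head Q e)) r0 c0 else 0\<^sub>m (ds 0 (tail Q e')) (ds l (head Q e')))"
      if "e' \<in> arcs Q" for e'
      using that by (auto simp: t_unit_dir elem_def intro!: eq_matI)
    have dA: "tA (val ?k) e' = 0\<^sub>m (ds 0 (head Q e')) (ds l (tail Q e'))" if "e' \<in> arcs Q" for e'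
      using that by (auto simp: t_unit_dir intro!: eq_matI)
    have dI: "tI (val ?k) v = 0\<^sub>m (ds 0 v) (f v)" "tJ (val ?k) v = 0\<^sub>m (f v) (ds l v)" if "v \<in> verts Q" for v
      using that by (auto simp: t_unit_dir intro!: eq_matI)
    let ?a = "pair (X (head Q e)) (tA ?x e * (?P (tail Q e) * elem (ds 0 (tail Q e)) (ds l (head Q e)) r0 c0))"
    let ?b = "pair (X (tail Q e)) (elem (ds 0 (tail Q e)) (ds l (head Q e)) r0 c0 * (?P (head Q e) * tA ?x e))"
    have "(\<Sum>e'\<in>arcs Q. if e' = e then ?a - ?b else 0) + (\<Sum>v\<in>verts Q. 0) = 0"
    proof (rule trans[OF _ XD[of ?k]])
      show "val ?k (CP m v r c) = 0" if "CP m v r c \<in> Idx" for m v r c using val_unit_dir[OF that] by simp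
      show "(\<Sum>e'\<in>arcs Q. if e' = e then ?a - ?b else 0) + (\<Sum>v\<in>verts Q. 0) =
        (\<Sum>e\<in>arcs Q. ?pe X ?k e) +
        (\<Sum>v\<in>verts Q. ?pv X ?k v)"
      proof (intro arg_cong2[where f = "(+)"] sum.cong refl)
        fix e' assume e': "e' \<in> arcs Q"
        note P' = P[OF head_in[OF e']] P[OF tail_in[OF e']]
        note z' = left_mult_zero_mat[OF mult_carrier_mat[OF P'(1) t_carrier(1)]] left_mult_zero_mat[OF mult_carrier_mat[OF P'(2) t_carrier(2)]]
          right_mult_zero_mat[OF P'(1)] right_mult_zero_mat[OF P'(2)] right_mult_zero_mat[OF t_carrier(1)] right_mult_zero_mat[OF t_carrier(2)]
        show "(if e' = e then ?a - ?b else 0) = ?pe X ?k e'"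
          unfolding dA[OF e'] dB[OF e'] z' by (cases "e' = e") (simp_all add: z' pair_zero)
      next
        fix v assume v: "v \<in> verts Q"
        show "0 = ?pv X ?k v"
          unfolding dI[OF v] left_mult_zero_mat[OF t_carrier(4)] right_mult_zero_mat[OF t_carrier(3)] by (simp add: pair_zero)
      qed
    qed simp
    then have ab: "?a = ?b" using e by simp
    have "?b = (?P (head Q e) * tA ?x e * X (tail Q e)) $$ (c0, r0)"
      by (rule pair_elem_left[OF X mult_carrier_mat[OF P[OF h] t_carrier(1)] rc])
    moreover have "?a = (X (head Q e) * Amap (rep0 ?x) e) $$ (c0, r0)"
    proof -
      have "tA ?x e * (?P (tail Q e) * elem (ds 0 (tail Q e)) (ds l (head Q e)) r0 c0) = Amap (rep0 ?x) e * elem (ds 0 (tail Q e)) (ds l (head Q e)) r0 c0"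
        using assoc_mult_mat[OF t_carrier(1) P[OF t] elem_carrier, of ?x "ds l (head Q e)" r0 c0] e by (simp add: rep0_def)
      then show ?thesis
        using pair_elem_right[OF X[of "head Q e"] qreps_carrier(1)[OF rep0_qreps e] rc] by simp
    qed
    ultimately show "(?P (head Q e) * tA ?x e * X (tail Q e)) $$ (c0, r0) = (X (head Q e) * Amap (rep0 ?x) e) $$ (c0, r0)"
      using ab by simp
  qed
  \<comment> \<open>Directions along one entry of \<open>j\<close>.\<close>
  have XI: "X v * imap (rep0 ?x) v = 0\<^sub>m (ds l v) (f v)" if v: "v \<in> verts Q" for v
  proof (rule eq_matI)
    fix c0 r0 assume "c0 < dim_row (0\<^sub>m (ds l v) (f v) :: complex mat)" "r0 < dim_col (0\<^sub>m (ds l v) (f v) :: complex mat)"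
    then have rc: "r0 < f v" "c0 < ds l v" by auto
    let ?k = "unit_dir (CJ v r0 c0)"
    have dJ: "tJ (val ?k) u = (if u = v then elem (f v) (ds l v) r0 c0 else 0\<^sub>m (f u) (ds l u))" if "u \<in> verts Q" for u
      using that by (auto simp: t_unit_dir elem_def intro!: eq_matI)
    have dI: "tI (val ?k) u = 0\<^sub>m (ds 0 u) (f u)" if "u \<in> verts Q" for u
      using that by (auto simp: t_unit_dir intro!: eq_matI)
    have dA: "tA (val ?k) e' = 0\<^sub>m (ds 0 (head Q e')) (ds l (tail Q e'))" "tB (val ?k) e' = 0\<^sub>m (ds 0 (tail Q e')) (ds l (head Q e'))"
      if "e' \<in> arcs Q" for e'
      using that by (auto simp: t_unit_dir intro!: eq_matI)
    let ?a = "pair (X v) (tI ?x v * elem (f v) (ds l v) r0 c0)"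
    have "(\<Sum>e'\<in>arcs Q. 0) + (\<Sum>u\<in>verts Q. if u = v then ?a else 0) = 0"
    proof (rule trans[OF _ XD[of ?k]])
      show "val ?k (CP m v r c) = 0" if "CP m v r c \<in> Idx" for m v r c using val_unit_dir[OF that] by simp
      show "(\<Sum>e'\<in>arcs Q. 0) + (\<Sum>u\<in>verts Q. if u = v then ?a else 0) =
        (\<Sum>e\<in>arcs Q. ?pe X ?k e) +
        (\<Sum>v\<in>verts Q. ?pv X ?k v)"
      proof (intro arg_cong2[where f = "(+)"] sum.cong refl)
        fix e' assume e': "e' \<in> arcs Q"
        note P' = P[OF head_in[OF e']] P[OF tail_in[OF e']]
        note z' = left_mult_zero_mat[OF mult_carrier_mat[OF P'(1) t_carrier(1)]] left_mult_zero_mat[OF mult_carrier_mat[OF P'(2) t_carrier(2)]]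
          right_mult_zero_mat[OF P'(1)] right_mult_zero_mat[OF P'(2)] right_mult_zero_mat[OF t_carrier(1)] right_mult_zero_mat[OF t_carrier(2)]
        show "0 = ?pe X ?k e'"
          unfolding dA[OF e'] z' by (simp add: z' pair_zero)
      next
        fix u assume u: "u \<in> verts Q"
        show "(if u = v then ?a else 0) = ?pv X ?k u"
          unfolding dI[OF u] dJ[OF u] left_mult_zero_mat[OF t_carrier(4)] by (simp add: pair_zero right_mult_zero_mat[OF t_carrier(3)])
      qed
    qed simp
    then have "?a = 0" using v by simp
    then show "(X v * imap (rep0 ?x) v) $$ (c0, r0) = 0\<^sub>m (ds l v) (f v) $$ (c0, r0)"
      using pair_elem_right[OF X[of v] t_carrier(3) rc, of ?x] rc v by (simp add: rep0_def del: index_mult_mat(1))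
  qed (use X v in \<open>auto simp: rep0_def\<close>)
  have kill: "valid f w \<Longrightarrow> X (target w) *\<^sub>v ev (rep0 ?x) w = 0\<^sub>v (ds l (target w))" for w
  proof (induction w)
    case (Gen v i)
    then have v: "v \<in> verts Q" "i < f v" by auto
    have "X v *\<^sub>v col (imap (rep0 ?x) v) i = col (X v * imap (rep0 ?x) v) i"
      by (rule col_mult2[OF X qreps_carrier(3)[OF rep0_qreps v(1)] v(2), symmetric])
    also have "\<dots> = 0\<^sub>v (ds l v)" unfolding XI[OF v(1)] using v(2) by (intro eq_vecI) auto
    finally show ?case by simp
  next
    case (StepA e w)
    then have e: "e \<in> arcs Q" "target w = tail Q e" "valid f w" by auto
    have u: "ev (rep0 ?x) w \<in> carrier_vec (ds 0 (tail Q e))" using ev_carrier[OF rep0_qreps e(3)] e(2) by simp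
    note PA = mult_carrier_mat[OF P[OF head_in[OF e(1)]] t_carrier(1)]
    have "X (head Q e) *\<^sub>v (Amap (rep0 ?x) e *\<^sub>v ev (rep0 ?x) w) = (X (head Q e) * Amap (rep0 ?x) e) *\<^sub>v ev (rep0 ?x) w"
      by (rule assoc_mult_mat_vec[OF X qreps_carrier(1)[OF rep0_qreps e(1)] u, symmetric])
    also have "\<dots> = (?P (head Q e) * tA ?x e) *\<^sub>v (X (tail Q e) *\<^sub>v ev (rep0 ?x) w)"
      unfolding swapB[OF e(1), symmetric] by (rule assoc_mult_mat_vec[OF PA X u])
    also have "X (tail Q e) *\<^sub>v ev (rep0 ?x) w = 0\<^sub>v (ds l (tail Q e))" using StepA.IH[OF e(3)] e(2) by simp
    also have "(?P (head Q e) * tA ?x e) *\<^sub>v 0\<^sub>v (ds l (tail Q e)) = 0\<^sub>v (ds l (head Q e))"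
      using carrier_matD[OF PA] by (intro eq_vecI) (auto simp: scalar_prod_def)
    finally show ?case by simp
  next
    case (StepB e w)
    then have e: "e \<in> arcs Q" "target w = head Q e" "valid f w" by auto
    have u: "ev (rep0 ?x) w \<in> carrier_vec (ds 0 (head Q e))" using ev_carrier[OF rep0_qreps e(3)] e(2) by simp
    note PB = mult_carrier_mat[OF P[OF tail_in[OF e(1)]] t_carrier(2)]
    have "X (tail Q e) *\<^sub>v (Bmap (rep0 ?x) e *\<^sub>v ev (rep0 ?x) w) = (X (tail Q e) * Bmap (rep0 ?x) e) *\<^sub>v ev (rep0 ?x) w"
      by (rule assoc_mult_mat_vec[OF X qreps_carrier(2)[OF rep0_qreps e(1)] u, symmetric])
    also have "\<dots> = (?P (tail Q e) * tB ?x e) *\<^sub>v (X (head Q e) *\<^sub>v ev (rep0 ?x) w)"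
      unfolding swapA[OF e(1), symmetric] by (rule assoc_mult_mat_vec[OF PB X u])
    also have "X (head Q e) *\<^sub>v ev (rep0 ?x) w = 0\<^sub>v (ds l (head Q e))" using StepB.IH[OF e(3)] e(2) by simp
    also have "(?P (tail Q e) * tB ?x e) *\<^sub>v 0\<^sub>v (ds l (head Q e)) = 0\<^sub>v (ds l (tail Q e))"
      using carrier_matD[OF PB] by (intro eq_vecI) (auto simp: scalar_prod_def)
    finally show ?case by simp
  qed
  have X0: "X v = 0\<^sub>m (ds l v) (ds 0 v)" if v: "v \<in> verts Q" for v
  proof (rule mat_col_eqI)
    fix c assume "c < dim_col (0\<^sub>m (ds l v) (ds 0 v) :: complex mat)"
    then have c: "c < ds 0 v" by simp
    have lv: "valid f (L v c)" "target (L v c) = v" using L v c by (auto simp: word_family_def)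
    have "ev (rep0 ?x) (L v c) = unit_vec (ds 0 v) c"
      using col_wmat[OF rep0_qreps L v c, of ?x] s v c by (simp add: sol_def)
    then have "X v *\<^sub>v unit_vec (ds 0 v) c = 0\<^sub>v (ds l v)" using kill[OF lv(1)] lv(2) by simp
    moreover have "X v *\<^sub>v unit_vec (ds 0 v) c = col (X v) c"
      using col_mult2[OF X[of v] one_carrier_mat c] X[of v] c by simp
    ultimately show "col (X v) c = col (0\<^sub>m (ds l v) (ds 0 v)) c" using c by (auto intro!: eq_vecI)
  qed (use X in auto)
  show ?thesis by (rule fin[OF X0 Y0])
qed

lemma eqns_rank:
  assumes L: "word_family (ds 0) f L" and z: "z \<in> carrier_vec N" and s: "sol L (val z)"
  shows "vec_space.rank (length (eqns L)) (jacobian N (eqns L) z) = length (eqns L)" "length (eqns L) \<le> N"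
proof -
  let ?c = "length (eqns L)" and ?J = "jacobian N (eqns L) z"
  have J: "?J \<in> carrier_mat ?c N" by (simp add: jacobian_def)
  obtain R where R: "R \<in> carrier_mat N ?c" "?J * R = 1\<^sub>m ?c"
    using left_kernel_trivial_right_inverse[OF J] eqns_independent[OF L z s] by blast
  then show "vec_space.rank ?c ?J = ?c"
    using vec_space.rank_eq_iff_right_inverse[OF J] by blast
  show "?c \<le> N"
  proof (rule ccontr)
    assume "\<not> ?c \<le> N"
    then obtain a where a: "a \<in> carrier_vec ?c" "a \<noteq> 0\<^sub>v ?c" "R *\<^sub>v a = 0\<^sub>v N"
      using wide_matrix_kernel[OF R(1)] by auto
    have "a = (?J * R) *\<^sub>v a" using R(2) a(1) by simp
    also have "\<dots> = ?J *\<^sub>v 0\<^sub>v N" using assoc_mult_mat_vec[OF J R(1) a(1)] a(3) by simp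
    also have "\<dots> = 0\<^sub>v ?c" using carrier_matD[OF J] by (intro eq_vecI) (auto simp: scalar_prod_def)
    finally show False using a(2) by simp
  qed
qed

end


section \<open>The dimension count\<close>

lemma (in quiver) sum_over_arcs:
  fixes a b :: "'v \<Rightarrow> int"
  shows "(\<Sum>v\<in>verts Q. \<Sum>w\<in>verts Q. a v * int (card {e \<in> arcs Q. tail Q e = v \<and> head Q e = w}) * b w)
    = (\<Sum>e\<in>arcs Q. a (tail Q e) * b (head Q e))"
proof -
  have "(\<Sum>v\<in>verts Q. \<Sum>w\<in>verts Q. a v * int (card {e \<in> arcs Q. tail Q e = v \<and> head Q e = w}) * b w)
      = (\<Sum>v\<in>verts Q. \<Sum>w\<in>verts Q. \<Sum>e\<in>{e \<in> {e \<in> arcs Q. tail Q e = v}. head Q e = w}. a (tail Q e) * b (head Q e))"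
  proof (intro sum.cong refl)
    fix v w
    have "(\<Sum>e\<in>{e \<in> {e \<in> arcs Q. tail Q e = v}. head Q e = w}. a (tail Q e) * b (head Q e))
        = (\<Sum>e\<in>{e \<in> arcs Q. tail Q e = v \<and> head Q e = w}. a v * b w)"
      by (intro sum.cong) auto
    then show "a v * int (card {e \<in> arcs Q. tail Q e = v \<and> head Q e = w}) * b w
        = (\<Sum>e\<in>{e \<in> {e \<in> arcs Q. tail Q e = v}. head Q e = w}. a (tail Q e) * b (head Q e))"
      by simp
  qed
  also have "\<dots> = (\<Sum>v\<in>verts Q. \<Sum>e\<in>{e \<in> arcs Q. tail Q e = v}. a (tail Q e) * b (head Q e))"
    by (intro sum.cong refl sum.group) auto
  also have "\<dots> = (\<Sum>e\<in>arcs Q. a (tail Q e) * b (head Q e))"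
    by (intro sum.group) auto
  finally show ?thesis .
qed

lemma (in quiver) cartan_form:
  fixes a b :: "'v \<Rightarrow> int"
  shows "(\<Sum>v\<in>verts Q. \<Sum>w\<in>verts Q. a v * cartan Q v w * b w)
    = 2 * (\<Sum>v\<in>verts Q. a v * b v) - (\<Sum>e\<in>arcs Q. a (tail Q e) * b (head Q e) + a (head Q e) * b (tail Q e))"
proof -
  have "(\<Sum>v\<in>verts Q. \<Sum>w\<in>verts Q. a v * (if v = w then 2 else 0) * b w) = (\<Sum>v\<in>verts Q. \<Sum>w\<in>verts Q. if v = w then 2 * (a v * b v) else 0)"
    by (intro sum.cong) auto
  also have "\<dots> = 2 * (\<Sum>v\<in>verts Q. a v * b v)" by (simp add: sum_distrib_left)
  finally have 1: "(\<Sum>v\<in>verts Q. \<Sum>w\<in>verts Q. a v * (if v = w then 2 else 0) * b w) = 2 * (\<Sum>v\<in>verts Q. a v * b v)" .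
  have "(\<Sum>v\<in>verts Q. \<Sum>w\<in>verts Q. a v * int (card {e \<in> arcs Q. tail Q e = w \<and> head Q e = v}) * b w)
      = (\<Sum>w\<in>verts Q. \<Sum>v\<in>verts Q. b w * int (card {e \<in> arcs Q. tail Q e = w \<and> head Q e = v}) * a v)"
    by (subst sum.swap) (simp add: mult_ac)
  then have 2: "(\<Sum>v\<in>verts Q. \<Sum>w\<in>verts Q. a v * int (card {e \<in> arcs Q. tail Q e = w \<and> head Q e = v}) * b w)
      = (\<Sum>e\<in>arcs Q. a (head Q e) * b (tail Q e))"
    unfolding sum_over_arcs by (simp add: mult.commute)
  have "(\<Sum>v\<in>verts Q. \<Sum>w\<in>verts Q. a v * cartan Q v w * b w) = (\<Sum>v\<in>verts Q. \<Sum>w\<in>verts Q.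
      a v * (if v = w then 2 else 0) * b w - a v * int (card {e \<in> arcs Q. tail Q e = v \<and> head Q e = w}) * b w
      - a v * int (card {e \<in> arcs Q. tail Q e = w \<and> head Q e = v}) * b w)"
    by (intro sum.cong refl) (simp add: cartan_def algebra_simps)
  then show ?thesis unfolding sum_subtractf 1 2 sum_over_arcs sum.distrib by simp
qed

text \<open>The inner sum telescopes to \<open>x m2 - x 0\<close>.\<close>

lemma sum_steps_telescope:
  fixes x :: "nat \<Rightarrow> int"
  shows "(\<Sum>m<l. x (Suc m) * (x m - x (Suc m)))
    = x 0 * (x 0 - x l) - (\<Sum>m2\<in>{1..l}. \<Sum>m1\<in>{1..m2}. (x m1 - x (m1 - 1)) * (x m2 - x (m2 - 1)))"
proof -
  have t: "(\<Sum>m1\<in>{1..m}. x m1 - x (m1 - 1)) = x m - x 0" for m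
    by (induction m) (auto simp: sum.nat_ivl_Suc')
  show ?thesis
    unfolding sum_distrib_right[symmetric] t
    by (induction l) (auto simp: sum.nat_ivl_Suc' algebra_simps)
qed

lemma card_image_Sigma:
  assumes "finite A" "\<And>a. a \<in> A \<Longrightarrow> finite (B a)" "inj h"
  shows "card (h ` Sigma A B) = (\<Sum>a\<in>A. card (B a))"
  using assms by (subst card_image) (auto intro: inj_on_subset)

context parabolic_chain
begin

lemma card_coords:
  "N = (\<Sum>e\<in>arcs Q. ds 0 (head Q e) * ds l (tail Q e) + ds 0 (tail Q e) * ds l (head Q e))
     + (\<Sum>v\<in>verts Q. ds 0 v * f v + f v * ds l v)
     + (\<Sum>v\<in>verts Q. \<Sum>m<l. ds (Suc m) v * (ds m v - ds (Suc m) v))"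
proof -
  let ?A = "(\<lambda>(e, r, c). CA e r c) ` (SIGMA e:arcs Q. {..<ds 0 (head Q e)} \<times> {..<ds l (tail Q e)}) :: ('v, 'e) coord set"
  let ?B = "(\<lambda>(e, r, c). CB e r c) ` (SIGMA e:arcs Q. {..<ds 0 (tail Q e)} \<times> {..<ds l (head Q e)}) :: ('v, 'e) coord set"
  let ?I = "(\<lambda>(v, r, c). CI v r c) ` (SIGMA v:verts Q. {..<ds 0 v} \<times> {..<f v}) :: ('v, 'e) coord set"
  let ?J = "(\<lambda>(v, r, c). CJ v r c) ` (SIGMA v:verts Q. {..<f v} \<times> {..<ds l v}) :: ('v, 'e) coord set"
  let ?P = "(\<lambda>(m, v, r, c). CP m v r c) ` (SIGMA m:{..<l}. SIGMA v:verts Q. {..<ds (Suc m) v} \<times> {ds (Suc m) v..<ds m v}) :: ('v, 'e) coord set"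
  have fin: "finite ?A" "finite ?B" "finite ?I" "finite ?J" "finite ?P"
    by (intro finite_imageI finite_SigmaI; simp)+
  have inj: "inj (\<lambda>(e, r, c). CA e r c)" "inj (\<lambda>(e, r, c). CB e r c)" "inj (\<lambda>(v, r, c). CI v r c)" "inj (\<lambda>(v, r, c). CJ v r c)"
    "inj (\<lambda>(m, v, r, c). CP m v r c)"
    by (auto simp: inj_def)
  have "N = card ?A + card ?B + card ?I + card ?J + card ?P"
    unfolding N_def Idx_def using fin by (subst card_Un_disjoint; (auto; fail)?)+
  moreover have "card ?A = (\<Sum>e\<in>arcs Q. ds 0 (head Q e) * ds l (tail Q e))"
    by (subst card_image_Sigma[OF _ _ inj(1)]) auto
  moreover have "card ?B = (\<Sum>e\<in>arcs Q. ds 0 (tail Q e) * ds l (head Q e))"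
    by (subst card_image_Sigma[OF _ _ inj(2)]) auto
  moreover have "card ?I = (\<Sum>v\<in>verts Q. ds 0 v * f v)"
    by (subst card_image_Sigma[OF _ _ inj(3)]) auto
  moreover have "card ?J = (\<Sum>v\<in>verts Q. f v * ds l v)"
    by (subst card_image_Sigma[OF _ _ inj(4)]) auto
  moreover have "card ?P = (\<Sum>m<l. \<Sum>v\<in>verts Q. ds (Suc m) v * (ds m v - ds (Suc m) v))"
    by (subst card_image_Sigma[OF _ _ inj(5)]) (auto intro!: finite_SigmaI)
  ultimately show ?thesis
    by (simp add: sum.distrib sum.swap[of _ "verts Q"])
qed

lemma card_eqns: "length (eqns L) = (\<Sum>v\<in>verts Q. ds 0 v * ds l v) + (\<Sum>v\<in>verts Q. ds 0 v * ds 0 v)"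
  unfolding length_eqns moment_idx_def frame_idx_def by simp

text \<open>
  The terms that only involve \<open>f\<close> and \<open>ds 0\<close> are the same count for a
  chain that consists of the first representation alone.
\<close>

lemma dimension_formula:
  assumes c: "length (eqns L) \<le> N"
  shows "int (N - length (eqns L)) =
      2 * (\<Sum>e\<in>arcs Q. int (ds 0 (tail Q e)) * int (ds 0 (head Q e))) + 2 * (\<Sum>v\<in>verts Q. int (f v) * int (ds 0 v))
      - 2 * (\<Sum>v\<in>verts Q. int (ds 0 v) * int (ds 0 v))
      - (\<Sum>v\<in>verts Q. int (f v) * (int (ds 0 v) - int (ds l v)))
      + (\<Sum>v\<in>verts Q. \<Sum>w\<in>verts Q. int (ds 0 v) * cartan Q v w * (int (ds 0 w) - int (ds l w)))
      - (\<Sum>v\<in>verts Q. \<Sum>m2\<in>{1..l}. \<Sum>m1\<in>{1..m2}.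
          (int (ds m1 v) - int (ds (m1 - 1) v)) * (int (ds m2 v) - int (ds (m2 - 1) v)))"
proof -
  let ?S = "\<lambda>v. \<Sum>m2\<in>{1..l}. \<Sum>m1\<in>{1..m2}. (int (ds m1 v) - int (ds (m1 - 1) v)) * (int (ds m2 v) - int (ds (m2 - 1) v))"
  let ?D = "\<lambda>v. int (ds 0 v)" and ?E = "\<lambda>v. int (ds l v)" and ?F = "\<lambda>v. int (f v)"
  have flag: "int (\<Sum>m<l. ds (Suc m) v * (ds m v - ds (Suc m) v)) = ?D v * (?D v - ?E v) - ?S v" if v: "v \<in> verts Q" for v
  proof -
    have "int (\<Sum>m<l. ds (Suc m) v * (ds m v - ds (Suc m) v)) = (\<Sum>m<l. int (ds (Suc m) v) * (int (ds m v) - int (ds (Suc m) v)))"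
      unfolding of_nat_sum using dec v by (intro sum.cong refl) (simp add: of_nat_diff)
    then show ?thesis using sum_steps_telescope[of "\<lambda>m. int (ds m v)" l] by simp
  qed
  have arc: "int (ds 0 (head Q e) * ds l (tail Q e) + ds 0 (tail Q e) * ds l (head Q e)) =
      2 * (?D (tail Q e) * ?D (head Q e)) - (?D (tail Q e) * (?D (head Q e) - ?E (head Q e)) + ?D (head Q e) * (?D (tail Q e) - ?E (tail Q e)))" for e
    by (simp add: algebra_simps)
  have "int (N - length (eqns L)) = int N - int (length (eqns L))" using c by simp
  also have "\<dots> = (\<Sum>e\<in>arcs Q. 2 * (?D (tail Q e) * ?D (head Q e)) - (?D (tail Q e) * (?D (head Q e) - ?E (head Q e)) + ?D (head Q e) * (?D (tail Q e) - ?E (tail Q e))))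
      + (\<Sum>v\<in>verts Q. (?D v * ?F v + ?F v * ?E v) + (?D v * (?D v - ?E v) - ?S v) - (?D v * ?E v + ?D v * ?D v))"
    unfolding card_coords card_eqns of_nat_add of_nat_sum[of _ "arcs Q"] of_nat_sum[of _ "verts Q"] arc[unfolded of_nat_add]
    using flag by (simp add: sum.distrib sum_subtractf)
  also have "(\<Sum>v\<in>verts Q. (?D v * ?F v + ?F v * ?E v) + (?D v * (?D v - ?E v) - ?S v) - (?D v * ?E v + ?D v * ?D v))
      = (\<Sum>v\<in>verts Q. 2 * (?F v * ?D v) - 2 * (?D v * ?D v) - ?F v * (?D v - ?E v) + 2 * (?D v * (?D v - ?E v)) - ?S v)"
    by (intro sum.cong refl) (simp add: algebra_simps)
  finally show ?thesis
    unfolding cartan_form by (simp only: sum_subtractf sum.distrib sum_distrib_left)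
qed

end


section \<open>Nakajima quiver varieties\<close>

text \<open>
  The bijection \<open>\<theta>\<close> matches coordinate functions and orbits, and these are all
  that an atlas refers to.
\<close>

lemma quotient_atlas_transport:
  assumes a: "quotient_atlas X \<Phi> G act I U N P \<sigma> \<rho> E"
    and \<theta>: "\<And>x. x \<in> X' \<Longrightarrow> \<theta> x \<in> X" "\<And>x. x \<in> X' \<Longrightarrow> \<tau> (\<theta> x) = x"
    and \<tau>: "\<And>x. x \<in> X \<Longrightarrow> \<tau> x \<in> X'" "\<And>x. x \<in> X \<Longrightarrow> \<theta> (\<tau> x) = x"
    and c1: "\<And>\<phi>. \<phi> \<in> \<Phi> \<Longrightarrow> (\<lambda>x. \<phi> (\<theta> x)) \<in> \<Phi>'" and c2: "\<And>\<phi>. \<phi> \<in> \<Phi>' \<Longrightarrow> (\<lambda>x. \<phi> (\<tau> x)) \<in> \<Phi>"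
    and orb: "\<And>x y. x \<in> X' \<Longrightarrow> y \<in> orbit G' act' x \<longleftrightarrow> y \<in> X' \<and> \<theta> y \<in> orbit G act (\<theta> x)"
  shows "quotient_atlas X' \<Phi>' G' act' I (\<lambda>L. {x \<in> X'. \<theta> x \<in> U L}) N P (\<lambda>L z. \<tau> (\<sigma> L z)) (\<lambda>L x. \<rho> L (\<theta> x))
    (\<lambda>L. (\<lambda>e p. e (\<theta> (fst p), \<theta> (snd p))) ` E L)"
proof -
  interpret a: quotient_atlas X \<Phi> G act I U N P \<sigma> \<rho> E by (rule a)
  have op: "openin (zariski_topology X' \<Phi>') X'"
    using openin_topspace[of "zariski_topology X' \<Phi>'"] by (simp add: topspace_zariski)
  have \<theta>_reg: "(\<lambda>x. \<phi> (\<theta> x)) \<in> reg X' \<Phi>' X'" if "\<phi> \<in> \<Phi>" for \<phi>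
    by (rule poly_reg[OF op poly_funs.coord[OF c1[OF that]]])
  show ?thesis
  proof
    show "finite I" by (rule a.fin)
    show "X' = (\<Union>L\<in>I. {x \<in> X'. \<theta> x \<in> U L})"
    proof (intro subset_antisym subsetI)
      fix x assume x: "x \<in> X'"
      then have "\<theta> x \<in> (\<Union>L\<in>I. U L)" using \<theta>(1) a.cover by simp
      then show "x \<in> (\<Union>L\<in>I. {x \<in> X'. \<theta> x \<in> U L})" using x by blast
    qed blast
    show "x \<in> orbit G' act' x" if "x \<in> X'" for x using orb[OF that] a.orbit_refl \<theta>(1) that by blast
    show "y \<in> X'" if "x \<in> X'" "y \<in> orbit G' act' x" for x y using orb that by blast
    show "orbit G' act' y = orbit G' act' x" if x: "x \<in> X'" and y: "y \<in> orbit G' act' x" for x y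
    proof -
      have y': "y \<in> X'" "\<theta> y \<in> orbit G act (\<theta> x)" using y orb[OF x] by auto
      show ?thesis
        using orb[OF x] orb[OF y'(1)] a.orbit_eq[OF \<theta>(1)[OF x] y'(2)] by (intro Set.set_eqI) simp
    qed
  next
    fix L assume L: "L \<in> I"
    note sub = a.U_sub[OF L]
    show "openin (zariski_topology X' \<Phi>') {x \<in> X'. \<theta> x \<in> U L}"
      by (rule reg_map_open[where f = \<theta>, OF op \<theta>_reg \<theta>(1) a.U_open[OF L]])
    show "y \<in> {x \<in> X'. \<theta> x \<in> U L}" if "x \<in> {x \<in> X'. \<theta> x \<in> U L}" "y \<in> orbit G' act' x" for x y
      using that orb a.U_inv[OF L] by blast
    show "P L \<subseteq> poly_funs (vec_coords N)" by (rule a.P_poly[OF L])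
    show "(\<lambda>x. \<rho> L (\<theta> x) $ i) \<in> reg X' \<Phi>' {x \<in> X'. \<theta> x \<in> U L}" if "i < N" for i
      by (rule reg_map_pullback[where f = \<theta> and h = "\<lambda>x. \<rho> L x $ i", OF op \<theta>_reg \<theta>(1) a.\<rho>_reg[OF L that]])
    show "\<rho> L (\<theta> x) \<in> zero_locus N (P L)" if "x \<in> {x \<in> X'. \<theta> x \<in> U L}" for x using a.\<rho>_in[OF L] that by blast
    show "\<rho> L (\<theta> y) = \<rho> L (\<theta> x)" if "x \<in> {x \<in> X'. \<theta> x \<in> U L}" "y \<in> orbit G' act' x" for x y
      using that orb a.\<rho>_inv[OF L] by blast
    show "\<tau> (\<sigma> L (\<rho> L (\<theta> x))) \<in> orbit G' act' x" if x: "x \<in> {x \<in> X'. \<theta> x \<in> U L}" for x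
    proof -
      have "\<sigma> L (\<rho> L (\<theta> x)) \<in> orbit G act (\<theta> x)" using a.\<sigma>_\<rho>[OF L] x by blast
      moreover from this have "\<sigma> L (\<rho> L (\<theta> x)) \<in> X" using a.orbit_closed \<theta>(1) x by blast
      ultimately show ?thesis using orb x \<tau> by simp
    qed
    show "(\<lambda>z. \<phi> (\<tau> (\<sigma> L z))) \<in> poly_on (zero_locus N (P L)) (vec_coords N)" if "\<phi> \<in> \<Phi>'" for \<phi>
      using a.\<sigma>_poly[OF L c2[OF that]] .
    show "e \<in> poly_on (X' \<times> X') (pair_coords \<Phi>')" if e: "e \<in> (\<lambda>e p. e (\<theta> (fst p), \<theta> (snd p))) ` E L" for e
    proof -
      obtain e' where e': "e' \<in> E L" "e = (\<lambda>p. e' (\<theta> (fst p), \<theta> (snd p)))" using e by blast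
      obtain p where p: "p \<in> poly_funs (pair_coords \<Phi>)" "\<forall>q\<in>X \<times> X. e' q = p q"
        using a.E_poly[OF L e'(1)] by (auto simp: poly_on_def)
      have "(\<lambda>q. p (\<theta> (fst q), \<theta> (snd q))) \<in> poly_funs (pair_coords \<Phi>')"
      proof (rule fun_alg.poly_comp[OF fun_alg_poly p(1)])
        fix \<psi> assume "\<psi> \<in> pair_coords \<Phi>"
        then show "(\<lambda>q. \<psi> (\<theta> (fst q), \<theta> (snd q))) \<in> poly_funs (pair_coords \<Phi>')"
          using c1 by (auto simp: pair_coords_def intro!: poly_funs.coord)
      qed
      then show ?thesis unfolding poly_on_def e'(2) using p(2) \<theta>(1)
        by (intro CollectI bexI[of _ "\<lambda>q. p (\<theta> (fst q), \<theta> (snd q))"]) auto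
    qed
    fix z assume z: "z \<in> zero_locus N (P L)"
    have s: "\<sigma> L z \<in> X" "\<sigma> L z \<in> U L" using a.\<sigma>_in[OF L z] sub by auto
    show "\<tau> (\<sigma> L z) \<in> {x \<in> X'. \<theta> x \<in> U L}" using s \<tau> by simp
    show "\<rho> L (\<theta> (\<tau> (\<sigma> L z))) = z" using a.\<rho>_\<sigma>[OF L z] \<tau>(2)[OF s(1)] by simp
    show "y \<in> orbit G' act' (\<tau> (\<sigma> L z)) \<longleftrightarrow> (\<forall>e\<in>(\<lambda>e p. e (\<theta> (fst p), \<theta> (snd p))) ` E L. e (\<tau> (\<sigma> L z), y) = 0)"
      if y: "y \<in> X'" for y
      using orb[OF \<tau>(1)[OF s(1)], of y] a.E_orbit[OF L z \<theta>(1)[OF y]] y \<tau>(2)[OF s(1)] by simp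
  qed
qed

context parabolic_chain
begin

text \<open>
  Independent rows of length \<open>N\<close> number at most \<open>N\<close>. Their independence
  is known at points of the slice only, hence the nonemptiness.
\<close>

lemma eqns_le_coords:
  assumes "reps \<noteq> {}" shows "length (eqns L') \<le> N"
proof -
  interpret quotient_atlas reps \<Phi> grp act word_charts chart_dom N "\<lambda>L. set (eqns L)" "\<lambda>L z. pt (val z)" rho orbit_eqs
    by (rule atlas)
  obtain x where "x \<in> reps" using assms by blast
  then obtain L where L: "L \<in> word_charts" "x \<in> chart_dom L" using chart_exists(1) by blast
  have "rho L x \<in> carrier_vec N" "sol L (val (rho L x))" using \<rho>_in[OF L] by (simp_all add: zero_locus_eqns)
  then show ?thesis using eqns_rank(2)[OF word_charts_family[OF L(1)]] by (simp add: length_eqns)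
qed

lemma atlas_rank:
  "L \<in> word_charts \<Longrightarrow> z \<in> zero_locus N (set (eqns L)) \<Longrightarrow>
    vec_space.rank (length (eqns L)) (jacobian N (eqns L) z) = length (eqns L)"
  using eqns_rank(1)[OF word_charts_family] by (simp add: zero_locus_eqns)

theorem split_parabolic_smooth:
  assumes "reps \<noteq> {}"
  shows "smooth_variety_of_dim (N - length (eqns L')) (split_parabolic_variety Q l ds f)"
proof -
  interpret quotient_atlas reps \<Phi> grp act word_charts chart_dom N "\<lambda>L. set (eqns L)" "\<lambda>L z. pt (val z)" rho orbit_eqs
    by (rule atlas)
  have "smooth_of_dim (N - length (eqns L')) M"
    by (rule smooth_M[where ps = eqns]) (use eqns_le_coords[OF assms] atlas_rank in \<open>auto simp: length_eqns\<close>)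
  then show ?thesis
    using variety_M by (simp add: smooth_variety_of_dim_def split_parabolic_variety_def)
qed

end

context quiver
begin

text \<open>A representation regarded as a chain without maps.\<close>

definition single :: "('v, 'e) qrep \<Rightarrow> ('v, 'e) parabolic_rep" where
  "single x = (\<lambda>m\<in>{..0}. x, \<lambda>m\<in>{..<0}. undefined)"

lemma fst_single [simp]: "fst (single x) 0 = x"
  by (simp add: single_def)

text \<open>
  The split condition is void, since the empty composite of projections is the identity.
\<close>

lemma single_reps:
  assumes x: "x \<in> stable_qreps Q d f" shows "single x \<in> split_parabolic_reps Q 0 (\<lambda>_. d) f"
proof -
  interpret parabolic_data Q f 0 "\<lambda>_. d" by unfold_locales
  have q: "x \<in> qreps Q d f" "stable Q d f x" "moment_map_eqs Q d x" using x by (auto simp: stable_qreps_def)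
  have "parabolic_split Q 0 (\<lambda>_. d) f (single x)"
    unfolding parabolic_split_def case_prod_unfold
  proof (intro ballI)
    fix v u assume v: "v \<in> verts Q" and "u \<in> mat_kernel (pi_comp (d v) (snd (single x)) v 0)"
    then have u: "u \<in> carrier_vec (d v)" "1\<^sub>m (d v) *\<^sub>v u = 0\<^sub>v (d v)"
      using mat_kernelD[OF one_carrier_mat] by auto
    then have u0: "u = 0\<^sub>v (d v)" by simp
    have *: "T *\<^sub>v 0\<^sub>v n = 0\<^sub>v r" if "T \<in> carrier_mat r n" for T :: "complex mat" and r n
      using that by (intro eq_vecI) (auto simp: scalar_prod_def)
    show "(\<forall>e\<in>arcs Q. tail Q e = v \<longrightarrow> Amap (fst (single x) 0) e *\<^sub>v u = 0\<^sub>v (d (head Q e))) \<and>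
         (\<forall>e\<in>arcs Q. head Q e = v \<longrightarrow> Bmap (fst (single x) 0) e *\<^sub>v u = 0\<^sub>v (d (tail Q e))) \<and>
         jmap (fst (single x) 0) v *\<^sub>v u = 0\<^sub>v (f v)"
      unfolding u0 fst_single using *[OF qreps_carrier(1)[OF q(1)]] *[OF qreps_carrier(2)[OF q(1)]] *[OF qreps_carrier(4)[OF q(1) v]]
      by auto
  qed
  then show ?thesis using q by (auto simp: reps_iff pshape_def single_def)
qed

lemma single_fst:
  assumes x: "x \<in> split_parabolic_reps Q 0 (\<lambda>_. d) f"
  shows "fst x 0 \<in> stable_qreps Q d f" "single (fst x 0) = x"
proof -
  have p: "fst x \<in> (\<Pi>\<^sub>E m\<in>{..0}. stable_qreps Q d f)" "snd x \<in> (\<Pi>\<^sub>E m\<in>{..<0}. \<Pi>\<^sub>E v\<in>verts Q. carrier_mat (d v) (d v))"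
    using x by (simp_all add: split_parabolic_reps_def mem_Times_iff)
  show "fst x 0 \<in> stable_qreps Q d f" by (rule PiE_mem[OF p(1)]) simp
  have 1: "fst (single (fst x 0)) m = fst x m" for m
  proof (cases "m = 0")
    case False
    then have "fst x m = undefined" by (intro PiE_arb[OF p(1)]) simp
    then show ?thesis using False by (simp add: single_def)
  qed simp
  have 2: "snd (single (fst x 0)) m = snd x m" for m
  proof -
    have "snd x m = undefined" by (rule PiE_arb[OF p(2)]) simp
    then show ?thesis by (simp add: single_def)
  qed
  show "single (fst x 0) = x" by (rule prod_eqI; rule ext) (rule 1, rule 2)
qed

lemma act_single: "parabolic_act Q 0 (\<lambda>_. d) g (single x) = single (gauge_act Q d (g 0) x)"
  by (simp add: parabolic_act_def single_def restrict_def fun_eq_iff)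

text \<open>
  The atlas for \<open>l = 0\<close> gives a smooth variety of the dimension counted by
  \<open>dimension_formula\<close>, and \<open>smooth_dim_unique\<close> identifies it with
  \<open>smooth_variety_dim\<close>.
\<close>

lemma nakajima_dim:
  assumes ne: "stable_qreps Q d f \<noteq> {}"
  shows "int (smooth_variety_dim (nakajima_variety Q d f)) = 2 * (\<Sum>e\<in>arcs Q. int (d (tail Q e)) * int (d (head Q e)))
      + 2 * (\<Sum>v\<in>verts Q. int (f v) * int (d v)) - 2 * (\<Sum>v\<in>verts Q. int (d v) * int (d v))"
proof -
  interpret c: parabolic_chain Q f 0 "\<lambda>_. d" by unfold_locales simp
  have orb: "y \<in> orbit (gauge_group Q d) (gauge_act Q d) x \<longleftrightarrow>
      y \<in> stable_qreps Q d f \<and> single y \<in> orbit c.grp c.act (single x)" if x: "x \<in> stable_qreps Q d f" for x y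
  proof
    assume "y \<in> orbit (gauge_group Q d) (gauge_act Q d) x"
    then obtain g where g: "g \<in> carrier (gauge_group Q d)" "y = gauge_act Q d g x" by (auto simp: orbit_def)
    have "(\<lambda>m\<in>{..0}. g) \<in> carrier c.grp" using g(1) by (auto simp: parabolic_group_def)
    moreover have "single y = c.act (\<lambda>m\<in>{..0}. g) (single x)" using g(2) by (simp add: act_single)
    ultimately have o: "single y \<in> orbit c.grp c.act (single x)" unfolding orbit_def by blast
    have "single y \<in> c.reps" by (rule c.orbit_closed[OF single_reps[OF x] o])
    then show "y \<in> stable_qreps Q d f \<and> single y \<in> orbit c.grp c.act (single x)"
      using o single_fst(1)[of "single y"] by simp
  next
    assume "y \<in> stable_qreps Q d f \<and> single y \<in> orbit c.grp c.act (single x)"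
    then obtain g where g: "g \<in> carrier c.grp" "single y = c.act g (single x)" by (auto simp: orbit_def)
    have "fst (single y) 0 = gauge_act Q d (g 0) x" unfolding g(2) act_single by simp
    moreover have "g 0 \<in> carrier (gauge_group Q d)" using g(1) by (auto simp: parabolic_group_def)
    ultimately show "y \<in> orbit (gauge_group Q d) (gauge_act Q d) x" unfolding orbit_def by auto
  qed
  interpret q: quotient_atlas "stable_qreps Q d f" "qrep_coords Q d f" "gauge_group Q d" "gauge_act Q d" c.word_charts
    "\<lambda>L. {x \<in> stable_qreps Q d f. single x \<in> c.chart_dom L}" c.N "\<lambda>L. set (c.eqns L)" "\<lambda>L z. fst (c.pt (c.val z)) 0"
    "\<lambda>L x. c.rho L (single x)" "\<lambda>L. (\<lambda>e p. e (single (fst p), single (snd p))) ` c.orbit_eqs L"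
  proof (rule quotient_atlas_transport[OF c.atlas single_reps fst_single single_fst _ _ orb])
    show "(\<lambda>x. \<phi> (single x)) \<in> qrep_coords Q d f" if "\<phi> \<in> c.\<Phi>" for \<phi>
      using that by (auto simp: parabolic_coords_def)
    show "(\<lambda>x. \<phi> (fst x 0)) \<in> c.\<Phi>" if "\<phi> \<in> qrep_coords Q d f" for \<phi>
      using that unfolding parabolic_coords_def by blast
  qed
  have ne': "c.reps \<noteq> {}" using ne single_reps by blast
  define n where "n = c.N - length (c.eqns undefined)"
  have "smooth_of_dim n q.M"
    by (rule q.smooth_M[where ps = c.eqns]) (use c.eqns_le_coords[OF ne'] c.atlas_rank in \<open>auto simp: c.length_eqns n_def\<close>)
  then have s: "smooth_variety_of_dim n (nakajima_variety Q d f)"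
    using q.variety_M by (simp add: smooth_variety_of_dim_def nakajima_variety_def)
  have t: "topspace (fs_top (nakajima_variety Q d f)) \<noteq> {}"
    using q.topspace_M ne by (simp add: nakajima_variety_def)
  have n: "smooth_variety_dim (nakajima_variety Q d f) = n"
    unfolding smooth_variety_dim_def
    by (rule the_equality[where P = "\<lambda>n. smooth_variety_of_dim n (nakajima_variety Q d f)", OF s]) (use s t smooth_dim_unique in \<open>auto simp: smooth_variety_of_dim_def\<close>)
  show ?thesis
    unfolding n n_def using c.dimension_formula[OF c.eqns_le_coords[OF ne']] by simp
qed

lemma stable_qreps_cong:
  assumes "\<And>v. v \<in> verts Q \<Longrightarrow> d v = d' v" shows "stable_qreps Q d f = stable_qreps Q d' f"
proof -
  have "qreps Q d f = qreps Q d' f"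
    unfolding qreps_def using assms head_in tail_in by (simp cong: PiE_cong)
  moreover have "stable Q d f x = stable Q d' f x" for x
    unfolding stable_def using assms by (simp cong: ball_cong)
  moreover have "moment_map_eqs Q d x = moment_map_eqs Q d' x" for x
    unfolding moment_map_eqs_def using assms by simp
  ultimately show ?thesis by (simp add: stable_qreps_def)
qed

end


section \<open>Dimension of split parabolic quiver varieties\<close>

theorem corollary2p26:
  fixes Q :: "('v, 'e) pre_digraph"
    and f d :: "'v \<Rightarrow> nat" and k :: "'v \<Rightarrow> int"
    and l :: nat and ds :: "nat \<Rightarrow> 'v \<Rightarrow> nat"
  assumes quiver: "fin_digraph Q"
    and ds_0: "\<forall>v \<in> verts Q. ds 0 v = d v"
    and k: "\<forall>v \<in> verts Q. int (ds 0 v) - int (ds l v) = k v"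
  shows "topspace (fs_top (split_parabolic_variety Q l ds f)) = {} \<or>
    (\<exists>n. smooth_variety_of_dim n (split_parabolic_variety Q l ds f) \<and>
       int n = int (smooth_variety_dim (nakajima_variety Q d f))
         - (\<Sum>v \<in> verts Q. int (f v) * k v)
         + (\<Sum>v \<in> verts Q. \<Sum>w \<in> verts Q. int (d v) * cartan Q v w * k w)
         - (\<Sum>v \<in> verts Q. \<Sum>m2 \<in> {1..l}. \<Sum>m1 \<in> {1..m2}.
              (int (ds m1 v) - int (ds (m1 - 1) v)) * (int (ds m2 v) - int (ds (m2 - 1) v))))"
proof (cases "split_parabolic_reps Q l ds f = {}")
  case True
  then show ?thesis
    by (simp add: split_parabolic_variety_def quotient_space_def topspace_quotient_topology topspace_zariski_space orbits_def)
next
  case False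
  interpret p: parabolic_data Q f l ds
    by (intro parabolic_data.intro quiver.intro quiver)
  obtain x where x: "x \<in> p.reps" using False by blast
  interpret c: parabolic_chain Q f l ds
    by unfold_locales (rule p.chart_exists(2)[OF x])
  have "fst x 0 \<in> stable_qreps Q (ds 0) f" using x by (auto simp: split_parabolic_reps_def)
  then have "stable_qreps Q d f \<noteq> {}" using p.stable_qreps_cong[of "ds 0" d f] ds_0 by auto
  note nak = p.nakajima_dim[OF this]
  have "int (smooth_variety_dim (nakajima_variety Q d f)) = 2 * (\<Sum>e\<in>arcs Q. int (ds 0 (tail Q e)) * int (ds 0 (head Q e)))
      + 2 * (\<Sum>v\<in>verts Q. int (f v) * int (ds 0 v)) - 2 * (\<Sum>v\<in>verts Q. int (ds 0 v) * int (ds 0 v))"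
    unfolding nak using ds_0 p.head_in p.tail_in by simp
  moreover have "(\<Sum>v\<in>verts Q. int (f v) * (int (ds 0 v) - int (ds l v))) = (\<Sum>v\<in>verts Q. int (f v) * k v)"
    using k by simp
  moreover have "(\<Sum>v\<in>verts Q. \<Sum>w\<in>verts Q. int (ds 0 v) * cartan Q v w * (int (ds 0 w) - int (ds l w))) =
      (\<Sum>v\<in>verts Q. \<Sum>w\<in>verts Q. int (d v) * cartan Q v w * k w)"
    using ds_0 k by (intro sum.cong refl) auto
  ultimately show ?thesis
    using c.split_parabolic_smooth[OF False, of undefined] c.dimension_formula[OF c.eqns_le_coords[OF False], of undefined]
    by (intro disjI2 exI[of _ "c.N - length (c.eqns undefined)"] conjI) simp_all
qed

end
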